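(* Let $p$ be a prime. As $j$ gets arbitrarily large, i.e. in the colimit over $j\to\infty$ along the suspension maps $\mathcal{P}^{j+d}_j[v]\to\mathcal{P}^{j+1+d}_{j+1}[v]$ (for fixed degree shift $d$ and weight index $v$), with the composition induced from the power ring $\mathcal{P}$, the algebra of unary operations on a degree $j$ homotopy class of a spectral partition Lie algebra over $\mathbb{F}_p$, or equivalently on a degree $-j$ class in mod $p$ TAQ cohomology, is the Koszul dual algebra $\mathrm{Ext}^{*,*}_{\mathcal{R}}(\mathbb{F}_p,\mathbb{F}_p)$ of the mod $p$ Dyer-Lashof algebra $\mathcal{R}$.
   Context: Dyer-Lashof algebra. $\mathcal{R}$ is the $\mathbb{F}_p$-algebra generated by $Q^i$, $i\in\mathbb{Z}$, of degree $i$ and weight $2$ if $p=2$, and by $\beta^\epsilon Q^i$, $\epsilon\in\{0,1\}$, $i\in\mathbb{Z}$, of degree $2(p-1)i-\epsilon$ and weight $p$ if $p>2$, subject to the usual (quadratic) Adem relations for Dyer-Lashof operations (no instability relations); it has basis the monomials $Q^{i_1}\cdots Q^{i_n}$ with $i_l\le2i_{l+1}$, resp. $\beta^{\epsilon_1}Q^{i_1}\cdots\beta^{\epsilon_n}Q^{i_n}$ with $i_l\le pi_{l+1}-\epsilon_{l+1}$. It is a homogeneous Koszul algebra; its Koszul dual is the Ext algebra with Yoneda product, generated by the classes $(Q^i)^*$, resp. $(\beta^\epsilon Q^i)^*$, dual to the generators. The ringoid $\mathcal{R}_u^!$. This is the $\mathbb{F}_p$-linear category with objects $(s,j)\in\mathbb{Z}_{\le0}\times\mathbb{Z}$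 and the following presentation (for all $s\le 0$). For $p=2$: generators $(Q^i)^*\colon(s,j)\to(s-1,j-i)$ for $i\ge-j$; relations, on an object $(s,j)$, $(Q^a)^*(Q^b)^*=\sum_{a+b-c>2c,\ c\ge a-b}\binom{b-c-1}{a-2c-1}(Q^{a+b-c})^*(Q^c)^*$ for $a\le2b$, $b\ge-j$, $a\ge b-j$. For $p>2$: generators $(\beta^\epsilon Q^i)^*\colon(s,j)\to(s-1,j-2(p-1)i+\epsilon)$ for $\epsilon\in\{0,1\}$, $2i>-j$; relations on $(s,j)$: $(Q^a)^*(Q^b)^*=-\sum_{a+b-c>pc,\,2c>-j}(-1)^{a-c}\binom{(p-1)(b-c)-1}{a-pc-1}(Q^{a+b-c})^*(Q^c)^*$ for $a\le pb$, $2b>-j$, $2a>2(p-1)b-j$; $(\beta Q^a)^*(Q^b)^*=\sum_{a+b-c\ge pc,\,2c>-j}(-1)^{a-c}\binom{(p-1)(b-c)}{a-pc}(Q^{a+b-c})^*(\beta Q^c)^*-\sum_{a+b-c>pc,\,2c>-j}(-1)^{a-c}\binom{(p-1)(b-c)-1}{a-pc-1}(\beta Q^{a+b-c})^*(Q^c)^*$ for the same $a,b$; $(\beta^\epsilon Q^a)^*(\beta Q^b)^*=\sum_{a+b-c\ge pc,\,2c>-j}(-1)^{a-c}\binom{(p-1)(b-c)-1}{a-pc}(\beta^\epsilon Q^{a+b-c})^*(\beta Q^c)^*$ for $a<pb$, $2b>-j$, $2a>2(p-1)b-j-1$. The power ring $\mathcal{P}$ (unary operations of weight powers of $p$ on homotopy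 groups of spectral partition Lie algebras over $\mathbb{F}_p$). $\mathcal{P}^j_k[w]=\mathcal{R}_u^!((0,k),(-w,j+w))$ for $w>0$ (operations of weight $p^w$ from degree $k$ to degree $j$), $\mathcal{P}^i_i[0]=\mathbb{F}_p\{\iota_i\}$ with $\iota_i$ a two-sided unit, $\mathcal{P}^j_i[0]=\emptyset$ for $i\ne j$. Composition $\mathcal{P}^i_j[v]\times\mathcal{P}^j_k[w]\to\mathcal{P}^i_k[v+w]$: view the first factor in $\mathcal{R}_u^!((-w,j+w),(-v-w,i+v+w))$ (same word in the generators) and juxtapose. Elements of $\mathcal{P}^i_j[w]$ are natural operations $\pi_j\to\pi_i$ on spectral partition Lie algebras, i.e. elements of $\pi_i(\mathrm{Lie}^\pi_{\mathbb{F}_p,\mathbb{E}_\infty}(\Sigma^j\mathbb{F}_p))$. Suspension. The suspension map is the injection $\mathcal{R}_u^!((0,j),(-v,i+v))\hookrightarrow\mathcal{R}_u^!((0,j+1),(-v,i+1+v))$ given by the same word in the generators (an operation defined on degree $j$ is defined on degree $j+1$); it is induced by the canonical map $\Sigma\mathrm{Lie}^\pi_{\mathbb{F}_p,\mathbb{E}_\infty}(\Sigma^j\mathbb{F}_p)\to\mathrm{Lie}^\pi_{\mathbb{F}_p,\mathbb{E}_\infty}(\Sigma^{j+1}\mathbb{F}_p)$.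
   Formalization: Ext_R(F_p,F_p) is replaced by its subalgebra generated by the classes dual to the generators, shown dense in the full Ext: R is not of finite type, so the full Ext^{2,t} is uncountable while the colimit is countable. *)

theory Defs
  imports Complex_Main
    "HOL-Algebra.QuotRing"
    "HOL-Library.Poly_Mapping"
    "HOL-Library.Cardinality"
    "HOL-Computational_Algebra.Primes"
begin

text \<open>
  Throughout, the type variable \<open>'k\<close> is a field type; it plays the role of the prime field
  with \<open>p\<close> elements as soon as \<open>CARD('k) = p\<close> and \<open>p\<close> is prime.
\<close>


section \<open>Bigraded algebras\<close>

text \<open>
  A bigraded algebra is a family of vector spaces indexed by \<open>nat \<times> int\<close> with bilinear products;
  the first two (four) arguments of the operations are the bidegrees of their inputs.
\<close>

record ('k, 'a) bigraded_alg =
  bcomp :: "nat \<Rightarrow> int \<Rightarrow> 'a set"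
  bzero :: "nat \<Rightarrow> int \<Rightarrow> 'a"
  badd :: "nat \<Rightarrow> int \<Rightarrow> 'a \<Rightarrow> 'a \<Rightarrow> 'a"
  bscale :: "nat \<Rightarrow> int \<Rightarrow> 'k \<Rightarrow> 'a \<Rightarrow> 'a"
  bone :: "'a"
  bmult :: "nat \<Rightarrow> int \<Rightarrow> nat \<Rightarrow> int \<Rightarrow> 'a \<Rightarrow> 'a \<Rightarrow> 'a"

locale bigraded_algebra =
  fixes A :: "('k::field, 'a) bigraded_alg"
  assumes zero_closed: "bzero A s t \<in> bcomp A s t"
    and add_closed: "\<lbrakk>x \<in> bcomp A s t; y \<in> bcomp A s t\<rbrakk> \<Longrightarrow> badd A s t x y \<in> bcomp A s t"
    and scale_closed: "x \<in> bcomp A s t \<Longrightarrow> bscale A s t c x \<in> bcomp A s t"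
    and one_closed: "bone A \<in> bcomp A 0 0"
    and mult_closed: "\<lbrakk>x \<in> bcomp A s t; y \<in> bcomp A s' t'\<rbrakk>
        \<Longrightarrow> bmult A s t s' t' x y \<in> bcomp A (s + s') (t + t')"
    and add_assoc: "\<lbrakk>x \<in> bcomp A s t; y \<in> bcomp A s t; z \<in> bcomp A s t\<rbrakk>
        \<Longrightarrow> badd A s t (badd A s t x y) z = badd A s t x (badd A s t y z)"
    and add_commute: "\<lbrakk>x \<in> bcomp A s t; y \<in> bcomp A s t\<rbrakk> \<Longrightarrow> badd A s t x y = badd A s t y x"
    and add_zero: "x \<in> bcomp A s t \<Longrightarrow> badd A s t x (bzero A s t) = x"
    and add_inverse: "x \<in> bcomp A s t \<Longrightarrow> badd A s t x (bscale A s t (- 1) x) = bzero A s t"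
    and scale_one: "x \<in> bcomp A s t \<Longrightarrow> bscale A s t 1 x = x"
    and scale_scale: "x \<in> bcomp A s t \<Longrightarrow> bscale A s t c (bscale A s t d x) = bscale A s t (c * d) x"
    and scale_add_left: "x \<in> bcomp A s t
        \<Longrightarrow> bscale A s t (c + d) x = badd A s t (bscale A s t c x) (bscale A s t d x)"
    and scale_add_right: "\<lbrakk>x \<in> bcomp A s t; y \<in> bcomp A s t\<rbrakk>
        \<Longrightarrow> bscale A s t c (badd A s t x y) = badd A s t (bscale A s t c x) (bscale A s t c y)"
    and mult_assoc: "\<lbrakk>x \<in> bcomp A s t; y \<in> bcomp A s' t'; z \<in> bcomp A s'' t''\<rbrakk>
        \<Longrightarrow> bmult A (s + s') (t + t') s'' t'' (bmult A s t s' t' x y) z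
          = bmult A s t (s' + s'') (t' + t'') x (bmult A s' t' s'' t'' y z)"
    and one_mult: "x \<in> bcomp A s t \<Longrightarrow> bmult A 0 0 s t (bone A) x = x"
    and mult_one: "x \<in> bcomp A s t \<Longrightarrow> bmult A s t 0 0 x (bone A) = x"
    and mult_add_left: "\<lbrakk>x \<in> bcomp A s t; y \<in> bcomp A s t; z \<in> bcomp A s' t'\<rbrakk>
        \<Longrightarrow> bmult A s t s' t' (badd A s t x y) z
          = badd A (s + s') (t + t') (bmult A s t s' t' x z) (bmult A s t s' t' y z)"
    and mult_add_right: "\<lbrakk>x \<in> bcomp A s t; y \<in> bcomp A s' t'; z \<in> bcomp A s' t'\<rbrakk>
        \<Longrightarrow> bmult A s t s' t' x (badd A s' t' y z)
          = badd A (s + s') (t + t') (bmult A s t s' t' x y) (bmult A s t s' t' x z)"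
    and mult_scale_left: "\<lbrakk>x \<in> bcomp A s t; y \<in> bcomp A s' t'\<rbrakk>
        \<Longrightarrow> bmult A s t s' t' (bscale A s t c x) y
          = bscale A (s + s') (t + t') c (bmult A s t s' t' x y)"
    and mult_scale_right: "\<lbrakk>x \<in> bcomp A s t; y \<in> bcomp A s' t'\<rbrakk>
        \<Longrightarrow> bmult A s t s' t' x (bscale A s' t' c y)
          = bscale A (s + s') (t + t') c (bmult A s t s' t' x y)"

text \<open>
  Isomorphisms may change the second degree: the component of bidegree \<open>(s, t)\<close> goes to the one of
  bidegree \<open>(s, \<tau> s t)\<close>.
\<close>

definition bigraded_algebra_iso ::
  "(nat \<Rightarrow> int \<Rightarrow> int) \<Rightarrow> ('k::field, 'a) bigraded_alg \<Rightarrow> ('k, 'b) bigraded_alg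
    \<Rightarrow> (nat \<Rightarrow> int \<Rightarrow> 'a \<Rightarrow> 'b) \<Rightarrow> bool"
  where "bigraded_algebra_iso \<tau> A B \<Phi> \<longleftrightarrow>
    bigraded_algebra A \<and> bigraded_algebra B \<and>
    (\<forall>s. bij (\<tau> s)) \<and>
    \<tau> 0 0 = 0 \<and> (\<forall>s t s' t'. \<tau> (s + s') (t + t') = \<tau> s t + \<tau> s' t') \<and>
    (\<forall>s t. bij_betw (\<Phi> s t) (bcomp A s t) (bcomp B s (\<tau> s t))) \<and>
    (\<forall>s t. \<forall>x\<in>bcomp A s t. \<forall>y\<in>bcomp A s t.
       \<Phi> s t (badd A s t x y) = badd B s (\<tau> s t) (\<Phi> s t x) (\<Phi> s t y)) \<and>
    (\<forall>s t c. \<forall>x\<in>bcomp A s t. \<Phi> s t (bscale A s t c x) = bscale B s (\<tau> s t) c (\<Phi> s t x)) \<and>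
    \<Phi> 0 0 (bone A) = bone B \<and>
    (\<forall>s t s' t'. \<forall>x\<in>bcomp A s t. \<forall>y\<in>bcomp A s' t'.
       \<Phi> (s + s') (t + t') (bmult A s t s' t' x y)
         = bmult B s (\<tau> s t) s' (\<tau> s' t') (\<Phi> s t x) (\<Phi> s' t' y))"

inductive generated_by ::
  "('k::field, 'a) bigraded_alg \<Rightarrow> (nat \<Rightarrow> int \<Rightarrow> 'a set) \<Rightarrow> nat \<Rightarrow> int \<Rightarrow> 'a \<Rightarrow> bool"
  for A :: "('k::field, 'a) bigraded_alg" and S :: "nat \<Rightarrow> int \<Rightarrow> 'a set"
  where
    gen_base: "x \<in> S s t \<Longrightarrow> generated_by A S s t x"
  | gen_zero: "generated_by A S s t (bzero A s t)"
  | gen_one: "generated_by A S 0 0 (bone A)"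
  | gen_add: "\<lbrakk>generated_by A S s t x; generated_by A S s t y\<rbrakk>
      \<Longrightarrow> generated_by A S s t (badd A s t x y)"
  | gen_scale: "generated_by A S s t x \<Longrightarrow> generated_by A S s t (bscale A s t c x)"
  | gen_mult: "\<lbrakk>generated_by A S s t x; generated_by A S s' t' y\<rbrakk>
      \<Longrightarrow> generated_by A S (s + s') (t + t') (bmult A s t s' t' x y)"

definition generated_subalgebra ::
  "('k::field, 'a) bigraded_alg \<Rightarrow> (nat \<Rightarrow> int \<Rightarrow> 'a set) \<Rightarrow> ('k, 'a) bigraded_alg"
  where "generated_subalgebra A S = A\<lparr>bcomp := \<lambda>s t. {x. generated_by A S s t x}\<rparr>"


section \<open>Ext of a graded augmented algebra over a prime field\<close>

text \<open>
  A graded augmented algebra is a ring with its augmentation ideal and its homogeneous components.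
\<close>

record 'a aug_graded_ring = "'a ring" +
  aug_ideal :: "'a set"
  homog :: "int \<Rightarrow> 'a set"

text \<open>
  \<open>Ext\<close> of the ground field by itself is computed by the normalised bar resolution, as the
  cohomology of the graded dual of the reduced bar construction: a cochain of bidegree \<open>(s, t)\<close> is
  a linear form on the \<open>s\<close>-th tensor power of the augmentation ideal that vanishes in all internal
  degrees except \<open>t\<close>, i.e. a multilinear form on \<open>s\<close>-tuples. Over a prime field a map is linear as
  soon as it is additive. A tuple is a list, and cochains are zero outside their domain.
\<close>

definition bar_tuples :: "('a, 'm) aug_graded_ring_scheme \<Rightarrow> nat \<Rightarrow> 'a list set"
  where "bar_tuples A s = {xs. length xs = s \<and> set xs \<subseteq> aug_ideal A}"

definition bar_homogeneous ::
  "('a, 'm) aug_graded_ring_scheme \<Rightarrow> nat \<Rightarrow> 'a list \<Rightarrow> int list \<Rightarrow> bool"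
  where "bar_homogeneous A s xs ds \<longleftrightarrow>
    length xs = s \<and> list_all2 (\<lambda>x d. x \<in> aug_ideal A \<inter> homog A d) xs ds"

definition ext_cochains ::
  "('a, 'm) aug_graded_ring_scheme \<Rightarrow> nat \<Rightarrow> int \<Rightarrow> ('a list \<Rightarrow> 'k::field) set"
  where "ext_cochains A s t = {f.
    (\<forall>xs. xs \<notin> bar_tuples A s \<longrightarrow> f xs = 0) \<and>
    (\<forall>us x y vs. us @ x # vs \<in> bar_tuples A s \<and> us @ y # vs \<in> bar_tuples A s \<longrightarrow>
       f (us @ (x \<oplus>\<^bsub>A\<^esub> y) # vs) = f (us @ x # vs) + f (us @ y # vs)) \<and>
    (\<forall>xs ds. bar_homogeneous A s xs ds \<and> sum_list ds \<noteq> t \<longrightarrow> f xs = 0)}"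

definition bar_merge :: "('a, 'm) aug_graded_ring_scheme \<Rightarrow> nat \<Rightarrow> 'a list \<Rightarrow> 'a list"
  where "bar_merge A i xs = take i xs @ (xs ! i \<otimes>\<^bsub>A\<^esub> xs ! Suc i) # drop (i + 2) xs"

text \<open>
  The pullback of a cochain along the bar differential
  \<open>d[x\<^sub>1|\<dots>|x\<^sub>s] = \<Sum>\<^sub>i (-1)\<^sup>e\<^sub>i [x\<^sub>1|\<dots>|x\<^sub>i x\<^sub>i\<^sub>+\<^sub>1|\<dots>|x\<^sub>s]\<close>, where \<open>e\<^sub>i\<close> is the total (homological plus
  internal) degree of \<open>[x\<^sub>1|\<dots>|x\<^sub>i]\<close>; the list \<open>ds\<close> contains the internal degrees of the entries.
  These signs, used by Priddy, are the ones for which the quadratic dual relations of the odd primary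
  Dyer-Lashof algebra get the signs of the presentation below.
\<close>

definition bar_codiff ::
  "('a, 'm) aug_graded_ring_scheme \<Rightarrow> ('a list \<Rightarrow> 'k::field) \<Rightarrow> 'a list \<Rightarrow> int list \<Rightarrow> 'k"
  where "bar_codiff A f xs ds =
    (\<Sum>i<length xs - 1. (- 1) powi (int (Suc i) + sum_list (take (Suc i) ds)) * f (bar_merge A i xs))"

definition ext_cocycles ::
  "('a, 'm) aug_graded_ring_scheme \<Rightarrow> nat \<Rightarrow> int \<Rightarrow> ('a list \<Rightarrow> 'k::field) set"
  where "ext_cocycles A s t = {f \<in> ext_cochains A s t.
    \<forall>xs ds. bar_homogeneous A (Suc s) xs ds \<longrightarrow> bar_codiff A f xs ds = 0}"

text \<open>For \<open>s = 0\<close> the sum defining \<^const>\<open>bar_codiff\<close> is empty, so the only coboundary is zero.\<close>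

definition ext_coboundaries ::
  "('a, 'm) aug_graded_ring_scheme \<Rightarrow> nat \<Rightarrow> int \<Rightarrow> ('a list \<Rightarrow> 'k::field) set"
  where "ext_coboundaries A s t = {f \<in> ext_cochains A s t.
    \<exists>h\<in>ext_cochains A (s - 1) t.
      \<forall>xs ds. bar_homogeneous A s xs ds \<longrightarrow> f xs = bar_codiff A h xs ds}"

definition ext_class ::
  "('a, 'm) aug_graded_ring_scheme \<Rightarrow> nat \<Rightarrow> int \<Rightarrow> ('a list \<Rightarrow> 'k::field) \<Rightarrow> ('a list \<Rightarrow> 'k) set"
  where "ext_class A s t f =
    {g \<in> ext_cocycles A s t. (\<lambda>xs. g xs - f xs) \<in> ext_coboundaries A s t}"

text \<open>
  On bar cochains the Yoneda product is the cup product, with the Koszul sign for moving the second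
  cochain past the bar elements on which the first is evaluated.
\<close>

definition cup ::
  "nat \<Rightarrow> int \<Rightarrow> nat \<Rightarrow> int \<Rightarrow> ('a list \<Rightarrow> 'k::field) \<Rightarrow> ('a list \<Rightarrow> 'k) \<Rightarrow> 'a list \<Rightarrow> 'k"
  where "cup s t s' t' f g xs =
    (- 1) powi ((int s + t) * (int s' + t')) * (f (take s xs) * g (drop s xs))"

definition ext_algebra ::
  "('a, 'm) aug_graded_ring_scheme \<Rightarrow> ('k::field, ('a list \<Rightarrow> 'k) set) bigraded_alg"
  where "ext_algebra A = \<lparr>
    bcomp = \<lambda>s t. ext_class A s t ` ext_cocycles A s t,
    bzero = \<lambda>s t. ext_class A s t (\<lambda>_. 0),
    badd = \<lambda>s t X Y. \<Union>f\<in>X. \<Union>g\<in>Y. ext_class A s t (\<lambda>xs. f xs + g xs),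
    bscale = \<lambda>s t c X. \<Union>f\<in>X. ext_class A s t (\<lambda>xs. c * f xs),
    bone = ext_class A 0 0 (\<lambda>xs. if xs = [] then 1 else 0),
    bmult = \<lambda>s t s' t' X Y. \<Union>f\<in>X. \<Union>g\<in>Y. ext_class A (s + s') (t + t') (cup s t s' t' f g)\<rparr>"


section \<open>The Dyer-Lashof algebra\<close>

text \<open>
  The pair \<open>(e, i)\<close> stands for \<open>\<beta>\<^sup>\<epsilon> Q\<^sup>i\<close>, where \<open>\<epsilon> = 1\<close> iff \<open>e\<close> is true, and for the dual class
  in the context of the ringoid below.
\<close>

type_synonym dl_gen = "bool \<times> int"

type_synonym 'k dl_free = "dl_gen list \<Rightarrow>\<^sub>0 'k"

definition dl_gens :: "nat \<Rightarrow> dl_gen set"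
  where "dl_gens p = {(e, i). p = 2 \<longrightarrow> \<not> e}"

definition dl_deg :: "nat \<Rightarrow> dl_gen \<Rightarrow> int"
  where "dl_deg p g = (if p = 2 then snd g else 2 * (int p - 1) * snd g - of_bool (fst g))"

definition word_deg :: "nat \<Rightarrow> dl_gen list \<Rightarrow> int"
  where "word_deg p w = (\<Sum>g\<leftarrow>w. dl_deg p g)"

definition pm_scale :: "'k::field \<Rightarrow> ('b \<Rightarrow>\<^sub>0 'k) \<Rightarrow> ('b \<Rightarrow>\<^sub>0 'k)"
  where "pm_scale c f = Poly_Mapping.map ((*) c) f"

definition word_mult :: "('g list \<Rightarrow>\<^sub>0 'k::field) \<Rightarrow> ('g list \<Rightarrow>\<^sub>0 'k) \<Rightarrow> ('g list \<Rightarrow>\<^sub>0 'k)"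
  where "word_mult f g =
    (\<Sum>u\<in>Poly_Mapping.keys f. \<Sum>v\<in>Poly_Mapping.keys g. Poly_Mapping.single (u @ v) (Poly_Mapping.lookup f u * Poly_Mapping.lookup g v))"

definition free_algebra :: "'g set \<Rightarrow> ('g list \<Rightarrow>\<^sub>0 'k::field) ring"
  where "free_algebra G = \<lparr>
    carrier = {f. Poly_Mapping.keys f \<subseteq> lists G},
    monoid.mult = word_mult,
    one = Poly_Mapping.single [] 1,
    zero = 0,
    add = (+)\<rparr>"

text \<open>Binomial coefficients with integer arguments, zero if an argument is negative.\<close>

definition ibinom :: "int \<Rightarrow> int \<Rightarrow> nat"
  where "ibinom n k = (if 0 \<le> n \<and> 0 \<le> k then nat n choose nat k else 0)"

abbreviation quad :: "bool \<Rightarrow> int \<Rightarrow> bool \<Rightarrow> int \<Rightarrow> 'k::field \<Rightarrow> 'k dl_free"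
  where "quad e a e' b c \<equiv> Poly_Mapping.single [(e, a), (e', b)] c"

text \<open>
  The Adem relations, written as differences of their two sides. The ranges of summation contain all
  indices for which the binomial coefficients do not vanish.
\<close>

definition adem_2 :: "int \<Rightarrow> int \<Rightarrow> 'k::field dl_free"
  where "adem_2 r s = quad False r False s 1
    - (\<Sum>i | r \<le> 2 * i \<and> i < r - s.
        quad False (r + s - i) False i (of_nat (ibinom (i - s - 1) (2 * i - r))))"

definition adem_odd_Q :: "nat \<Rightarrow> bool \<Rightarrow> int \<Rightarrow> int \<Rightarrow> 'k::field dl_free"
  where "adem_odd_Q p e r s = quad e r False s 1
    - (\<Sum>i | r \<le> int p * i \<and> i \<le> r - (int p - 1) * s.
        quad e (r + s - i) False i
          ((- 1) powi (r + i) * of_nat (ibinom ((int p - 1) * (i - s) - 1) (int p * i - r))))"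

definition adem_odd_QbQ :: "nat \<Rightarrow> int \<Rightarrow> int \<Rightarrow> 'k::field dl_free"
  where "adem_odd_QbQ p r s = quad False r True s 1
    - (\<Sum>i | r \<le> int p * i \<and> i \<le> r - (int p - 1) * s.
        quad True (r + s - i) False i
          ((- 1) powi (r + i) * of_nat (ibinom ((int p - 1) * (i - s)) (int p * i - r))))
    + (\<Sum>i | r \<le> int p * i \<and> i \<le> r - (int p - 1) * s.
        quad False (r + s - i) True i
          ((- 1) powi (r + i) * of_nat (ibinom ((int p - 1) * (i - s) - 1) (int p * i - r - 1))))"

definition adem_odd_bQbQ :: "nat \<Rightarrow> int \<Rightarrow> int \<Rightarrow> 'k::field dl_free"
  where "adem_odd_bQbQ p r s = quad True r True s 1
    + (\<Sum>i | r \<le> int p * i \<and> i \<le> r - (int p - 1) * s.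
        quad True (r + s - i) True i
          ((- 1) powi (r + i) * of_nat (ibinom ((int p - 1) * (i - s) - 1) (int p * i - r - 1))))"

definition adem_relations :: "nat \<Rightarrow> ('k::field dl_free) set"
  where "adem_relations p =
    (if p = 2 then {adem_2 r s | r s. r > 2 * s}
     else {adem_odd_Q p e r s | e r s. r > int p * s}
       \<union> {adem_odd_QbQ p r s | r s. r \<ge> int p * s}
       \<union> {adem_odd_bQbQ p r s | r s. r \<ge> int p * s})"

definition dl_ideal :: "nat \<Rightarrow> ('k::field dl_free) set"
  where "dl_ideal p = Idl\<^bsub>free_algebra (dl_gens p)\<^esub> (adem_relations p)"

abbreviation dl_coset :: "nat \<Rightarrow> 'k::field dl_free \<Rightarrow> ('k dl_free) set"
  where "dl_coset p f \<equiv> dl_ideal p +>\<^bsub>free_algebra (dl_gens p)\<^esub> f"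

definition dyer_lashof :: "nat \<Rightarrow> ('k::field dl_free) set aug_graded_ring"
  where "dyer_lashof p = ring.extend (free_algebra (dl_gens p) Quot dl_ideal p)
    (aug_graded_ring.fields
      {dl_coset p f | f. f \<in> carrier (free_algebra (dl_gens p)) \<and> Poly_Mapping.lookup f [] = 0}
      (\<lambda>t. {dl_coset p f | f. f \<in> carrier (free_algebra (dl_gens p)) \<and>
                             (\<forall>w\<in>Poly_Mapping.keys f. word_deg p w = t)}))"

text \<open>
  The cochain dual to a generator. The relations are quadratic, so the coefficient of a one-letter
  word does not depend on the representative of a coset.
\<close>

definition dl_dual :: "nat \<Rightarrow> dl_gen \<Rightarrow> ('k::field dl_free) set list \<Rightarrow> 'k"
  where "dl_dual p g xs =
    (if xs \<in> bar_tuples (dyer_lashof p) 1 then Poly_Mapping.lookup (SOME f. f \<in> hd xs) [g] else 0)"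

definition dl_dual_class :: "nat \<Rightarrow> dl_gen \<Rightarrow> (('k::field dl_free) set list \<Rightarrow> 'k) set"
  where "dl_dual_class p g = ext_class (dyer_lashof p) 1 (dl_deg p g) (dl_dual p g)"

text \<open>
  The Dyer-Lashof algebra has infinitely many generators \<open>Q\<^sup>i\<close>, \<open>i\<close> in \<open>\<int>\<close>, and is not of finite
  type: from length two on its homogeneous components have infinite dimension, so the groups
  \<open>Ext\<^sup>s\<^sup>,\<^sup>t\<close> with \<open>s \<ge> 2\<close> are full duals of spaces of infinite dimension. The Koszul dual is the
  \<open>Ext\<close> algebra generated by the classes dual to the generators.
\<close>

definition koszul_dual :: "nat \<Rightarrow> ('k::field, (('k dl_free) set list \<Rightarrow> 'k) set) bigraded_alg"
  where "koszul_dual p = generated_subalgebra (ext_algebra (dyer_lashof p))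
    (\<lambda>s t. {dl_dual_class p g | g. g \<in> dl_gens p \<and> s = 1 \<and> dl_deg p g = t})"


section \<open>The ringoid\<close>

text \<open>
  Objects are pairs \<open>(s, j)\<close> with \<open>s \<le> 0\<close>. A word is a composite of generators in the usual order:
  its last letter is applied first.
\<close>

type_synonym ru_obj = "int \<times> int"

definition ru_gen :: "nat \<Rightarrow> ru_obj \<Rightarrow> dl_gen \<Rightarrow> bool"
  where "ru_gen p x g \<longleftrightarrow> fst x \<le> 0 \<and> g \<in> dl_gens p \<and>
    (if p = 2 then snd g \<ge> - snd x else 2 * snd g > - snd x)"

definition ru_target :: "nat \<Rightarrow> ru_obj \<Rightarrow> dl_gen \<Rightarrow> ru_obj"
  where "ru_target p x g = (fst x - 1, snd x - dl_deg p g)"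

fun ru_path :: "nat \<Rightarrow> ru_obj \<Rightarrow> dl_gen list \<Rightarrow> ru_obj \<Rightarrow> bool"
  where
    "ru_path p x [] y \<longleftrightarrow> fst x \<le> 0 \<and> x = y"
  | "ru_path p x (g # w) y \<longleftrightarrow> (\<exists>z. ru_path p x w z \<and> ru_gen p z g \<and> y = ru_target p z g)"

definition ru_free :: "nat \<Rightarrow> ru_obj \<Rightarrow> ru_obj \<Rightarrow> ('k::field dl_free) set"
  where "ru_free p x y = {f. \<forall>w\<in>Poly_Mapping.keys f. ru_path p x w y}"

definition ru_rel_2 :: "int \<Rightarrow> int \<Rightarrow> 'k::field dl_free"
  where "ru_rel_2 a b = quad False a False b 1
    - (\<Sum>c | a + b - c > 2 * c \<and> c \<ge> a - b.
        quad False (a + b - c) False c (of_nat (ibinom (b - c - 1) (a - 2 * c - 1))))"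

definition ru_rel_odd_QQ :: "nat \<Rightarrow> int \<Rightarrow> int \<Rightarrow> int \<Rightarrow> 'k::field dl_free"
  where "ru_rel_odd_QQ p j a b = quad False a False b 1
    + (\<Sum>c | a + b - c > int p * c \<and> 2 * c > - j.
        quad False (a + b - c) False c
          ((- 1) powi (a - c) * of_nat (ibinom ((int p - 1) * (b - c) - 1) (a - int p * c - 1))))"

definition ru_rel_odd_bQQ :: "nat \<Rightarrow> int \<Rightarrow> int \<Rightarrow> int \<Rightarrow> 'k::field dl_free"
  where "ru_rel_odd_bQQ p j a b = quad True a False b 1
    - (\<Sum>c | a + b - c \<ge> int p * c \<and> 2 * c > - j.
        quad False (a + b - c) True c
          ((- 1) powi (a - c) * of_nat (ibinom ((int p - 1) * (b - c)) (a - int p * c))))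
    + (\<Sum>c | a + b - c > int p * c \<and> 2 * c > - j.
        quad True (a + b - c) False c
          ((- 1) powi (a - c) * of_nat (ibinom ((int p - 1) * (b - c) - 1) (a - int p * c - 1))))"

definition ru_rel_odd_QbQ :: "nat \<Rightarrow> int \<Rightarrow> bool \<Rightarrow> int \<Rightarrow> int \<Rightarrow> 'k::field dl_free"
  where "ru_rel_odd_QbQ p j e a b = quad e a True b 1
    - (\<Sum>c | a + b - c \<ge> int p * c \<and> 2 * c > - j.
        quad e (a + b - c) True c
          ((- 1) powi (a - c) * of_nat (ibinom ((int p - 1) * (b - c) - 1) (a - int p * c))))"

text \<open>The relations on an object \<open>(s, j)\<close>, written as differences of their two sides.\<close>

definition ru_relations :: "nat \<Rightarrow> int \<Rightarrow> ('k::field dl_free) set"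
  where "ru_relations p j =
    (if p = 2 then {ru_rel_2 a b | a b. a \<le> 2 * b \<and> b \<ge> - j \<and> a \<ge> b - j}
     else {ru_rel_odd_QQ p j a b | a b.
             a \<le> int p * b \<and> 2 * b > - j \<and> 2 * a > 2 * (int p - 1) * b - j}
       \<union> {ru_rel_odd_bQQ p j a b | a b.
             a \<le> int p * b \<and> 2 * b > - j \<and> 2 * a > 2 * (int p - 1) * b - j}
       \<union> {ru_rel_odd_QbQ p j e a b | e a b.
             a < int p * b \<and> 2 * b > - j \<and> 2 * a > 2 * (int p - 1) * b - j - 1})"

text \<open>The component from \<open>x\<close> to \<open>y\<close> of the categorical ideal generated by the relations.\<close>

definition ru_ideal :: "nat \<Rightarrow> ru_obj \<Rightarrow> ru_obj \<Rightarrow> ('k::field dl_free) set"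
  where "ru_ideal p x y = module.span pm_scale
    {word_mult (word_mult (Poly_Mapping.single u 1) r) (Poly_Mapping.single v 1) | u r v z z'.
       ru_path p x v z \<and> r \<in> ru_relations p (snd z) \<inter> ru_free p z z' \<and> ru_path p z' u y}"

definition ru_class :: "nat \<Rightarrow> ru_obj \<Rightarrow> ru_obj \<Rightarrow> 'k::field dl_free \<Rightarrow> ('k dl_free) set"
  where "ru_class p x y f = {g. g - f \<in> ru_ideal p x y}"

definition ru_hom :: "nat \<Rightarrow> ru_obj \<Rightarrow> ru_obj \<Rightarrow> ('k::field dl_free) set set"
  where "ru_hom p x y = ru_class p x y ` ru_free p x y"

definition ru_add ::
  "nat \<Rightarrow> ru_obj \<Rightarrow> ru_obj \<Rightarrow> ('k::field dl_free) set \<Rightarrow> ('k dl_free) set \<Rightarrow> ('k dl_free) set"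
  where "ru_add p x y X Y = (\<Union>f\<in>X. \<Union>g\<in>Y. ru_class p x y (f + g))"

definition ru_scale ::
  "nat \<Rightarrow> ru_obj \<Rightarrow> ru_obj \<Rightarrow> 'k::field \<Rightarrow> ('k dl_free) set \<Rightarrow> ('k dl_free) set"
  where "ru_scale p x y c X = (\<Union>f\<in>X. ru_class p x y (pm_scale c f))"

text \<open>The composite of \<open>Y\<close> followed by \<open>X\<close>, as a morphism from \<open>x\<close> to \<open>y\<close>.\<close>

definition ru_comp ::
  "nat \<Rightarrow> ru_obj \<Rightarrow> ru_obj \<Rightarrow> ('k::field dl_free) set \<Rightarrow> ('k dl_free) set \<Rightarrow> ('k dl_free) set"
  where "ru_comp p x y X Y = (\<Union>f\<in>X. \<Union>g\<in>Y. ru_class p x y (word_mult f g))"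

text \<open>The morphism from \<open>x\<close> to \<open>y\<close> given by the same linear combinations of words.\<close>

definition same_word ::
  "nat \<Rightarrow> ru_obj \<Rightarrow> ru_obj \<Rightarrow> ('k::field dl_free) set \<Rightarrow> ('k dl_free) set"
  where "same_word p x y X = (\<Union>f\<in>X. ru_class p x y f)"


section \<open>The power ring and its stabilisation\<close>

text \<open>
  \<open>power_ring p i j v\<close> is the space of operations of weight \<open>p\<^sup>v\<close> from degree \<open>j\<close> to degree \<open>i\<close>.
  For \<open>v = 0\<close> the only word is the empty one: the space is spanned by the unit if \<open>i = j\<close>, and there
  are no operations, i.e. it is zero, if \<open>i \<noteq> j\<close>.
\<close>

abbreviation pow_target :: "int \<Rightarrow> nat \<Rightarrow> ru_obj"
  where "pow_target i v \<equiv> (- int v, i + int v)"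

definition power_ring :: "nat \<Rightarrow> int \<Rightarrow> int \<Rightarrow> nat \<Rightarrow> ('k::field dl_free) set set"
  where "power_ring p i j v = ru_hom p (0, j) (pow_target i v)"

text \<open>
  \<open>power_comp p i v j w k X Y\<close> is the composite of \<open>X\<close>, from degree \<open>j\<close> to degree \<open>i\<close>, and \<open>Y\<close>,
  from degree \<open>k\<close> to degree \<open>j\<close>.
\<close>

definition power_comp ::
  "nat \<Rightarrow> int \<Rightarrow> nat \<Rightarrow> int \<Rightarrow> nat \<Rightarrow> int \<Rightarrow>
    ('k::field dl_free) set \<Rightarrow> ('k dl_free) set \<Rightarrow> ('k dl_free) set"
  where "power_comp p i v j w k X Y =
    ru_comp p (0, k) (pow_target i (v + w))
      (same_word p (pow_target j w) (- int v - int w, i + int v + int w) X) Y"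

definition suspension ::
  "nat \<Rightarrow> nat \<Rightarrow> int \<Rightarrow> int \<Rightarrow> ('k::field dl_free) set \<Rightarrow> ('k dl_free) set"
  where "suspension p v d j X = same_word p (0, j + 1) (pow_target (j + 1 + d) v) X"

fun suspension_iter ::
  "nat \<Rightarrow> nat \<Rightarrow> int \<Rightarrow> int \<Rightarrow> nat \<Rightarrow> ('k::field dl_free) set \<Rightarrow> ('k dl_free) set"
  where
    "suspension_iter p v d j 0 X = X"
  | "suspension_iter p v d j (Suc n) X = suspension p v d (j + int n) (suspension_iter p v d j n X)"

text \<open>
  Elements of the colimit over \<open>j\<close> for weight index \<open>v\<close> and degree shift \<open>d\<close> are classes of pairs
  \<open>(j, X)\<close> with \<open>X\<close> an operation from degree \<open>j\<close> to degree \<open>j + d\<close>; two pairs are identified if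
  they agree after finitely many suspensions.
\<close>

type_synonym 'k stable_op = "(int \<times> ('k dl_free) set) set"

definition stable_class :: "nat \<Rightarrow> nat \<Rightarrow> int \<Rightarrow> int \<Rightarrow> ('k::field dl_free) set \<Rightarrow> 'k stable_op"
  where "stable_class p v d j X =
    {(k, Y). Y \<in> power_ring p (k + d) k v \<and>
       (\<exists>m n. j + int m = k + int n \<and> suspension_iter p v d j m X = suspension_iter p v d k n Y)}"

text \<open>
  In the product, the left factor is represented on the target degree \<open>k + e\<close> of the representative
  of the right factor.
\<close>

definition stable_power_algebra :: "nat \<Rightarrow> ('k::field, 'k stable_op) bigraded_alg"
  where "stable_power_algebra p = \<lparr>
    bcomp = \<lambda>v d. {stable_class p v d j X | j X. X \<in> power_ring p (j + d) j v},
    bzero = \<lambda>v d. stable_class p v d 0 (ru_class p (0, 0) (pow_target d v) 0),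
    badd = \<lambda>v d A B. \<Union>{stable_class p v d j (ru_add p (0, j) (pow_target (j + d) v) X Y) | j X Y.
              (j, X) \<in> A \<and> (j, Y) \<in> B},
    bscale = \<lambda>v d c A. \<Union>{stable_class p v d j (ru_scale p (0, j) (pow_target (j + d) v) c X) | j X.
              (j, X) \<in> A},
    bone = stable_class p 0 0 0 (ru_class p (0, 0) (0, 0) (Poly_Mapping.single [] 1)),
    bmult = \<lambda>v d w e A B. \<Union>{stable_class p (v + w) (d + e) k
                (power_comp p (k + e + d) v (k + e) w k X Y) | k X Y.
              (k + e, X) \<in> A \<and> (k, Y) \<in> B}\<rparr>"

text \<open>
  The stable operation given by a generator, which has degree shift \<open>- dl_deg p g - 1\<close>; it is
  defined on classes of degree \<open>2 * \<bar>snd g\<bar> + 1\<close>.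
\<close>

definition stable_gen :: "nat \<Rightarrow> dl_gen \<Rightarrow> 'k::field stable_op"
  where "stable_gen p g = (let j = 2 * \<bar>snd g\<bar> + 1; d = - dl_deg p g - 1 in
    stable_class p 1 d j
      (ru_class p (0, j) (pow_target (j + d) 1) (Poly_Mapping.single [g] 1)))"

end

theory Submission
  imports Defs "HOL-Computational_Algebra.Formal_Power_Series"
begin

text \<open>
  The Dyer-Lashof algebra acts from the right on functions on monomials, by transposes of the Steenrod
  operations on \<open>\<Lambda>[u\<^sub>1, \<dots>] \<otimes> \<F>\<^sub>p[x\<^sub>1, \<dots>]\<close>. That the Adem relations act by zero is an identity for the
  coefficients of monomials in the Dickson invariants, and admissible words act by linearly independent
  operators. As rewriting with the Adem relations terminates, the admissible words form a basis, and
  with such a basis the reduced bar complex can be contracted onto the tensors of generators all of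
  whose neighbouring pairs are inadmissible: the algebra is Koszul. Hence the quadratic dual relations
  present the algebra generated by the dual classes in \<open>Ext\<close>.

  These relations are those of the ringoid, as the binomial coefficients exclude every term that is not
  defined on the object \<open>(s, j)\<close>. A linear combination of words lies in the ideal of the quadratic
  dual relations iff it lies in the ideal of the relations on \<open>(s, j)\<close> for all large \<open>j\<close>, since each
  word and each relation is defined once \<open>j\<close> is large. So the colimit over \<open>j\<close> is the quadratic dual
  algebra.
\<close>

section \<open>Linear combinations of words\<close>

text \<open>The obstacle is size. With generators indexed by all integers and no instability
  relations, the homogeneous parts of a fixed length at least two have infinite dimension, so
  neither dimension counts nor double duals are available. They are replaced by a finiteness of
  rewriting in both directions: along the Adem relations certain exponents stay bounded above,
  against them they stay bounded below, and a score changes strictly. So the rewriting of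
  inadmissible pairs terminates, and so does the rewriting of admissible pairs by the dual
  relations. The first gives normal forms and a contraction defined by well-founded recursion; the
  second shows that the inadmissible words span the dual algebra. Uniqueness of normal forms is
  detected by the module, in place of a confluence check: each admissible word is the extremal word
  for some matrix coefficient. The same size is the reason why the Koszul dual is related to all of
  Ext by density.\<close>

abbreviation supp :: "('b \<Rightarrow>\<^sub>0 'k::zero) \<Rightarrow> 'b set" where "supp \<equiv> Poly_Mapping.keys"
abbreviation coef :: "('b \<Rightarrow>\<^sub>0 'k::zero) \<Rightarrow> 'b \<Rightarrow> 'k" where "coef \<equiv> Poly_Mapping.lookup"
abbreviation sing :: "'b \<Rightarrow> 'k::zero \<Rightarrow> ('b \<Rightarrow>\<^sub>0 'k)" where "sing \<equiv> Poly_Mapping.single"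

text \<open>The linear extension of a function on words. Identities in the free algebra are proved
  by applying all such functionals, as in \<open>ev_eqI\<close>, which turns them into identities of
  scalars.\<close>

definition ev :: "('b \<Rightarrow> 'k::field) \<Rightarrow> ('b \<Rightarrow>\<^sub>0 'k) \<Rightarrow> 'k"
  where "ev \<phi> f = (\<Sum>w\<in>supp f. coef f w * \<phi> w)"

lemma ev_superset: "\<lbrakk>finite S; supp f \<subseteq> S\<rbrakk> \<Longrightarrow> ev \<phi> f = (\<Sum>w\<in>S. coef f w * \<phi> w)"
  unfolding ev_def by (rule sum.mono_neutral_left) (auto simp: in_keys_iff)

lemma ev_zero [simp]: "ev \<phi> 0 = 0"
  by (simp add: ev_def)

lemma ev_single [simp]: "ev \<phi> (sing w c) = c * \<phi> w"
  by (simp add: ev_def)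

lemma ev_add: "ev \<phi> (f + g) = ev \<phi> f + ev \<phi> g"
  using ev_superset[of "supp f \<union> supp g" "f + g" \<phi>] ev_superset[of "supp f \<union> supp g" f \<phi>]
    ev_superset[of "supp f \<union> supp g" g \<phi>] keys_add[of f g]
  by (simp add: lookup_add distrib_right sum.distrib)

lemma coef_pm_scale [simp]: "coef (pm_scale c f) w = c * coef f w"
  unfolding pm_scale_def by (simp add: Poly_Mapping.map.rep_eq when_def)

lemma supp_pm_scale: "supp (pm_scale c f) \<subseteq> supp f"
  by (auto simp: in_keys_iff)

lemma ev_scale: "ev \<phi> (pm_scale c f) = c * ev \<phi> f"
  using ev_superset[of "supp f" "pm_scale c f" \<phi>] supp_pm_scale[of c f]
  by (simp add: ev_def sum_distrib_left mult.assoc)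

lemma ev_uminus: "ev \<phi> (- f) = - ev \<phi> f"
  using ev_add[of \<phi> f "- f"] by (simp add: eq_neg_iff_add_eq_0 add.commute)

lemma ev_diff: "ev \<phi> (f - g) = ev \<phi> f - ev \<phi> g"
  using ev_add[of \<phi> f "- g"] by (simp add: ev_uminus)

lemma ev_sum: "ev \<phi> (\<Sum>i\<in>I. f i) = (\<Sum>i\<in>I. ev \<phi> (f i))"
  by (induction I rule: infinite_finite_induct) (auto simp: ev_add)

lemma ev_fun_add: "ev (\<lambda>w. \<phi> w + \<psi> w) f = ev \<phi> f + ev \<psi> f"
  by (simp add: ev_def distrib_left sum.distrib)

lemma ev_fun_scale: "ev (\<lambda>w. c * \<phi> w) f = c * ev \<phi> f"
  by (simp add: ev_def sum_distrib_left mult.left_commute)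

lemma ev_fun_diff: "ev (\<lambda>w. \<phi> w - \<psi> w) f = ev \<phi> f - ev \<psi> f"
  by (simp add: ev_def right_diff_distrib sum_subtractf)

lemma ev_cong: "(\<And>w. w \<in> supp f \<Longrightarrow> \<phi> w = \<psi> w) \<Longrightarrow> ev \<phi> f = ev \<psi> f"
  by (simp add: ev_def)

lemma ev_eq_0: "(\<And>w. w \<in> supp f \<Longrightarrow> \<phi> w = 0) \<Longrightarrow> ev \<phi> f = 0"
  by (simp add: ev_def)

lemma ev_indicator: "ev (\<lambda>w. if w = u then 1 else 0) f = coef f u"
proof -
  have "ev (\<lambda>w. if w = u then 1 else 0) f = (\<Sum>w\<in>supp f. if w = u then coef f w else 0)"
    unfolding ev_def by (rule sum.cong) auto
  then show ?thesis by (simp add: sum.delta in_keys_iff)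
qed

lemma ev_eqI: "(\<And>\<phi>. ev \<phi> f = ev \<phi> g) \<Longrightarrow> f = g"
  by (rule poly_mapping_eqI) (metis ev_indicator)

text \<open>Iterating functionals over the factors makes associativity and distributivity of the
  product identities of iterated sums.\<close>

lemma ev_word_mult: "ev \<phi> (word_mult f g) = ev (\<lambda>u. ev (\<lambda>v. \<phi> (u @ v)) g) f"
  unfolding word_mult_def ev_sum ev_single by (simp add: ev_def sum_distrib_left mult.assoc)

lemma supp_word_mult: "supp (word_mult f g) \<subseteq> {u @ v | u v. u \<in> supp f \<and> v \<in> supp g}"
proof
  fix w assume "w \<in> supp (word_mult f g)"
  then have "(\<Sum>u\<in>supp f. \<Sum>v\<in>supp g. coef (sing (u @ v) (coef f u * coef g v)) w) \<noteq> 0"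
    by (simp add: in_keys_iff word_mult_def lookup_sum)
  then obtain u where u: "u \<in> supp f" "(\<Sum>v\<in>supp g. coef (sing (u @ v) (coef f u * coef g v)) w) \<noteq> 0"
    by (meson sum.neutral)
  then obtain v where v: "v \<in> supp g" "coef (sing (u @ v) (coef f u * coef g v)) w \<noteq> 0"
    by (meson sum.neutral)
  then have "w = u @ v" by (simp add: lookup_single when_def split: if_splits)
  then show "w \<in> {u @ v | u v. u \<in> supp f \<and> v \<in> supp g}" using u v by blast
qed

lemma sing_eq_scale: "sing w c = pm_scale c (sing w 1)"
  by (rule ev_eqI) (simp add: ev_scale)

lemma word_mult_sing [simp]: "word_mult (sing u a) (sing v b) = sing (u @ v) (a * b)"
  by (rule ev_eqI) (simp add: ev_word_mult mult.assoc)

lemma word_mult_assoc: "word_mult (word_mult f g) h = word_mult f (word_mult g h)"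
  by (rule ev_eqI) (simp add: ev_word_mult)

lemma word_mult_one [simp]: "word_mult (sing [] 1) f = f" "word_mult f (sing [] 1) = f"
  by (rule ev_eqI, simp add: ev_word_mult)+

lemma word_mult_zero [simp]: "word_mult 0 f = 0" "word_mult f 0 = 0"
  by (rule ev_eqI, simp add: ev_word_mult ev_eq_0)+

lemma word_mult_add_left: "word_mult (f + g) h = word_mult f h + word_mult g h"
  by (rule ev_eqI) (simp add: ev_word_mult ev_add)

lemma word_mult_add_right: "word_mult h (f + g) = word_mult h f + word_mult h g"
  by (rule ev_eqI) (simp add: ev_word_mult ev_add ev_fun_add)

lemma word_mult_diff_left: "word_mult (f - g) h = word_mult f h - word_mult g h"
  by (rule ev_eqI) (simp add: ev_word_mult ev_diff)

lemma word_mult_diff_right: "word_mult h (f - g) = word_mult h f - word_mult h g"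
  by (rule ev_eqI) (simp add: ev_word_mult ev_diff ev_fun_diff)

lemma word_mult_scale_left: "word_mult (pm_scale c f) h = pm_scale c (word_mult f h)"
  by (rule ev_eqI) (simp add: ev_word_mult ev_scale)

lemma word_mult_scale_right: "word_mult h (pm_scale c f) = pm_scale c (word_mult h f)"
  by (rule ev_eqI) (simp add: ev_word_mult ev_scale ev_fun_scale)

lemma word_mult_const: "word_mult (sing [] c) f = pm_scale c f"
  by (rule ev_eqI) (simp add: ev_word_mult ev_scale)

lemma pm_scale_simps [simp]:
  "pm_scale c 0 = 0" "pm_scale 0 f = 0" "pm_scale 1 f = f" "pm_scale (- 1) f = - f"
  "pm_scale c (pm_scale d f) = pm_scale (c * d) f"
  by (rule ev_eqI, simp add: ev_scale ev_uminus mult.assoc)+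

lemma pm_scale_add: "pm_scale c (f + g) = pm_scale c f + pm_scale c g"
  by (rule ev_eqI) (simp add: ev_scale ev_add distrib_left)

lemma pm_scale_add_left: "pm_scale (c + d) f = pm_scale c f + pm_scale d f"
  by (rule ev_eqI) (simp add: ev_scale ev_add distrib_right)

lemma pm_scale_diff: "pm_scale c (f - g) = pm_scale c f - pm_scale c g"
  by (rule ev_eqI) (simp add: ev_scale ev_diff right_diff_distrib)

lemma supp_diff: "supp (f - g) \<subseteq> supp f \<union> supp (g :: 'b \<Rightarrow>\<^sub>0 'k::field)"
  by (auto simp: in_keys_iff lookup_minus)

lemma supp_sum: "supp (\<Sum>i\<in>I. f i) \<subseteq> (\<Union>i\<in>I. supp (f i :: 'b \<Rightarrow>\<^sub>0 'k::field))"
proof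
  fix w assume "w \<in> supp (sum f I)"
  then have "(\<Sum>i\<in>I. coef (f i) w) \<noteq> 0" by (simp add: in_keys_iff lookup_sum)
  then obtain i where "i \<in> I" "coef (f i) w \<noteq> 0" by (meson sum.neutral)
  then show "w \<in> (\<Union>i\<in>I. supp (f i))" by (auto simp: in_keys_iff)
qed

lemma pm_expand: "f = (\<Sum>w\<in>supp f. sing w (coef f w :: 'k::field))"
  by (rule ev_eqI) (simp only: ev_sum ev_single, simp add: ev_def)

lemma pm_induct [consumes 1, case_names zero add]:
  assumes "supp f \<subseteq> S"
    and "P 0" and "\<And>w c g. \<lbrakk>w \<in> S; supp g \<subseteq> S; P g\<rbrakk> \<Longrightarrow> P (sing w c + g)"
  shows "P (f :: 'b \<Rightarrow>\<^sub>0 'k::field)"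
proof -
  have "P (\<Sum>w\<in>T. sing w (coef f w)) \<and> supp (\<Sum>w\<in>T. sing w (coef f w)) \<subseteq> S"
    if "finite T" "T \<subseteq> S" for T
    using that
  proof (induction T rule: finite_induct)
    case (insert x T)
    then have "P (sing x (coef f x) + (\<Sum>w\<in>T. sing w (coef f w)))" by (intro assms(3)) auto
    moreover have "supp (sing x (coef f x) + (\<Sum>w\<in>T. sing w (coef f w))) \<subseteq> S"
      using insert by (intro order.trans[OF keys_add]) auto
    ultimately show ?case using insert by simp
  qed (use assms(2) in auto)
  from this[of "supp f"] show ?thesis using assms(1) pm_expand[of f] by simp
qed

global_interpretation pm: module pm_scale
  by unfold_locales (simp_all add: pm_scale_add pm_scale_add_left)

section \<open>Binomial coefficients modulo a prime\<close>

locale prime_field =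
  fixes p :: nat and K :: "'k::field itself"
  assumes prime: "prime p" and card: "CARD('k) = p"
begin

lemma p_ge_2: "p \<ge> 2" and p_pos [simp]: "p > 0" "p \<noteq> 0"
  using prime by (auto dest: prime_ge_2_nat prime_gt_0_nat)

lemma le_p_mult: "m \<le> p * m"
  using mult_le_mono1[of 1 p m] p_ge_2 by simp

lemma finite_field: "finite (UNIV :: 'k set)"
  using card p_pos by (metis card_ge_0_finite)

text \<open>Translation by 1 permutes the field, so the sum of all elements equals itself plus
  \<open>p\<close> times 1.\<close>

lemma of_nat_p [simp]: "of_nat p = (0::'k)"
proof -
  have "(\<Sum>x\<in>(UNIV::'k set). x) = (\<Sum>x\<in>(UNIV::'k set). x + 1)"
    by (rule sum.reindex_bij_witness[of _ "\<lambda>x. x + 1" "\<lambda>x. x - 1"]) auto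
  also have "\<dots> = (\<Sum>x\<in>(UNIV::'k set). x) + of_nat p"
    by (simp add: sum.distrib card)
  finally show ?thesis by simp
qed

lemma CHAR_k: "CHAR('k) = p"
proof -
  have "CHAR('k) dvd p" by (metis of_nat_eq_0_iff_char_dvd of_nat_p)
  moreover have "CHAR('k) \<noteq> 1" by (metis of_nat_1 of_nat_CHAR zero_neq_one)
  ultimately show ?thesis using prime by (metis prime_nat_iff)
qed

text \<open>The multiples of 1 by 0, ..., p - 1 are distinct because p is the characteristic, and
  hence exhaust a field with p elements. This is what makes additive maps linear later on.\<close>

lemma of_nat_surj: "\<exists>n. x = (of_nat n :: 'k)"
proof -
  have "inj_on (of_nat :: nat \<Rightarrow> 'k) {..<p}"
  proof (rule linorder_inj_onI)
    fix a b :: nat assume ab: "a < b" "a \<in> {..<p}" "b \<in> {..<p}"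
    then have "\<not> p dvd b - a" by (auto dest: dvd_imp_le)
    then have "of_nat (b - a) \<noteq> (0::'k)" by (simp add: of_nat_eq_0_iff_char_dvd CHAR_k)
    then show "of_nat a \<noteq> (of_nat b :: 'k)" using ab by (simp add: of_nat_diff)
  qed auto
  then have "card ((of_nat :: nat \<Rightarrow> 'k) ` {..<p}) = p" by (simp add: card_image)
  then have "(of_nat :: nat \<Rightarrow> 'k) ` {..<p} = UNIV"
    using finite_field card by (metis card_subset_eq subset_UNIV)
  then show ?thesis by (metis UNIV_I imageE)
qed

lemma minus_one_p: "p = 2 \<Longrightarrow> (- 1 :: 'k) = 1"
  using of_nat_p by (metis minus_equation_iff neg_eq_iff_add_eq_0 of_nat_numeral one_add_one)

abbreviation B :: "int \<Rightarrow> int \<Rightarrow> 'k" where "B n k \<equiv> of_nat (ibinom n k)"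

section \<open>Power series in characteristic p and the binomial identity behind the Adem
  relations\<close>

lemma fps_frobenius: "(1 + fps_X :: 'k fps) ^ (p ^ t) = 1 + fps_X ^ (p ^ t)"
  using freshmans_dream'[of "p ^ t" t 1 "fps_X :: 'k fps"] CHAR_k prime by simp

lemma fps_nth_one_plus_X_power: "fps_nth ((1 + fps_X :: 'k fps) ^ n) i = of_nat (n choose i)"
proof (induction n arbitrary: i)
  case (Suc n)
  then show ?case by (cases i) (simp_all add: distrib_right)
qed (auto simp: binomial_eq_0)

text \<open>The powers of \<open>(1 + X)\<^sup>-\<^sup>1\<close>; generalised binomial coefficients are not available in positive
  characteristic.\<close>

definition inv_power :: "nat \<Rightarrow> 'k fps"
  where "inv_power M = Abs_fps (\<lambda>n. (- 1) ^ n * of_nat ((M + n) choose n))"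

lemma inv_power_Suc: "(1 + fps_X) * inv_power (Suc M) = inv_power M"
proof (rule fps_ext)
  fix n show "fps_nth ((1 + fps_X) * inv_power (Suc M)) n = fps_nth (inv_power M) n"
    by (cases n) (simp_all add: inv_power_def distrib_right algebra_simps)
qed

lemma inv_power_0: "(1 + fps_X) * inv_power 0 = 1"
proof (rule fps_ext)
  fix n show "fps_nth ((1 + fps_X) * inv_power 0) n = fps_nth 1 n"
    by (cases n) (simp_all add: inv_power_def distrib_right)
qed

lemma inv_power_add: "(1 + fps_X) ^ j * inv_power (M + j) = inv_power M"
proof (induction j)
  case (Suc j)
  have "(1 + fps_X) ^ Suc j * inv_power (M + Suc j) = (1 + fps_X) ^ j * ((1 + fps_X) * inv_power (Suc (M + j)))"
    by (simp add: ac_simps)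
  then show ?case by (simp only: inv_power_Suc Suc.IH)
qed simp

text \<open>Note the shift of the index: \<open>inv_power M\<close> is the inverse of the power M +
  1 of 1 + X.\<close>

lemma inv_power_cancel: "(1 + fps_X) ^ (N + M + 1) * inv_power M = (1 + fps_X) ^ N"
proof -
  have "(1 + fps_X) ^ (N + M + 1) * inv_power M
      = (1 + fps_X) ^ N * ((1 + fps_X) * ((1 + fps_X) ^ M * inv_power (0 + M)))"
    by (simp add: power_add ac_simps)
  then show ?thesis by (simp only: inv_power_add inv_power_0 mult_1_right)
qed

text \<open>By absorption, n times the binomial coefficient is n times a multiple of p. The factor n
  is cancelled among natural numbers, as it may vanish in the field.\<close>

lemma binomial_p_mult: "n > 0 \<Longrightarrow> of_nat ((p * n) choose n) = (0::'k)"
proof -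
  assume "n > 0"
  then obtain l where n: "n = Suc l" by (cases n) auto
  have "n * ((p * n) choose n) = p * n * ((p * n - 1) choose l)"
    unfolding n by (metis One_nat_def binomial_absorption times_binomial_minus1_eq n diff_Suc_1 \<open>n > 0\<close>)
  then have "(p * n) choose n = p * ((p * n - 1) choose l)" using \<open>n > 0\<close> by simp
  then show ?thesis by simp
qed

text \<open>
  With \<open>U = X (1 + X)\<^sup>p\<^sup>-\<^sup>1\<close> one has \<open>(1 + X)\<^sup>p\<^sup>-\<^sup>1 - X\<^sup>p = 1 - U\<close>. The identity compares the coefficients of
  \<open>X\<^sup>y\<close> in the \<open>(x + y)\<close>-th powers of both sides, divided by \<open>(1 + X)\<close> to the power \<open>(p - 1) y + 1\<close>.
\<close>

lemma adem_binomial_nat: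
  assumes "y < p * x"
  shows "(- 1) ^ y * of_nat ((x + y) choose y)
    = (\<Sum>m | p * m \<le> y. (- 1) ^ m * of_nat ((x + y) choose m)
         * of_nat (((p - 1) * (x - m) - 1) choose (y - p * m)) :: 'k)"
proof -
  define A where "A = x + y"
  define M where "M = (p - 1) * y"
  define Y where "Y = (1 + fps_X :: 'k fps)"
  have "Y * Y ^ (p - 1) = 1 + fps_X ^ p"
    using fps_frobenius[of 1] p_pos by (simp add: Y_def power_Suc[symmetric] del: power_Suc)
  then have U: "- (fps_X ^ p) + Y ^ (p - 1) = - (fps_X * Y ^ (p - 1)) + 1"
    by (simp add: Y_def algebra_simps)
  have "(\<Sum>m\<le>A. of_nat (A choose m) * (- (fps_X ^ p)) ^ m * (Y ^ (p - 1)) ^ (A - m))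
      = (\<Sum>k\<le>A. of_nat (A choose k) * (- (fps_X * Y ^ (p - 1))) ^ k * 1 ^ (A - k))"
    using arg_cong[OF U, of "\<lambda>z. z ^ A"] by (simp only: binomial_ring)
  then have "(\<Sum>m\<le>A. of_nat (A choose m) * (- (fps_X ^ p)) ^ m * (Y ^ (p - 1)) ^ (A - m)) * inv_power M
      = (\<Sum>k\<le>A. of_nat (A choose k) * (- (fps_X * Y ^ (p - 1))) ^ k * 1 ^ (A - k)) * inv_power M"
    by simp
  then have E: "(\<Sum>m\<le>A. fps_nth (of_nat (A choose m) * (- (fps_X ^ p)) ^ m * (Y ^ (p - 1)) ^ (A - m) * inv_power M) y)
      = (\<Sum>k\<le>A. fps_nth (of_nat (A choose k) * (- (fps_X * Y ^ (p - 1))) ^ k * inv_power M) y)"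
    by (simp add: sum_distrib_right fps_sum_nth[symmetric])
  have L: "fps_nth (of_nat (A choose m) * (- (fps_X ^ p)) ^ m * (Y ^ (p - 1)) ^ (A - m) * inv_power M) y
      = (if p * m \<le> y then (- 1) ^ m * of_nat (A choose m)
           * of_nat (((p - 1) * (x - m) - 1) choose (y - p * m)) else 0)" for m
  proof -
    have *: "of_nat (A choose m) * (- (fps_X ^ p)) ^ m * (Y ^ (p - 1)) ^ (A - m) * inv_power M
      = fps_const ((- 1) ^ m * of_nat (A choose m)) * (fps_X ^ (p * m) * (Y ^ ((p - 1) * (A - m)) * inv_power M))"
      unfolding power_minus[of "fps_X ^ p"]
      by (simp add: fps_of_nat[symmetric] power_mult[symmetric] fps_const_power[symmetric]
          fps_const_mult[symmetric] fps_const_neg[symmetric] ac_simps del: fps_const_power fps_const_mult fps_const_neg)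
    have **: "fps_nth (of_nat (A choose m) * (- (fps_X ^ p)) ^ m * (Y ^ (p - 1)) ^ (A - m) * inv_power M) y
      = (- 1) ^ m * of_nat (A choose m) * (if y < p * m then 0 else
          fps_nth (Y ^ ((p - 1) * (A - m)) * inv_power M) (y - p * m))"
      unfolding * by (simp only: fps_mult_left_const_nth fps_X_power_mult_nth)
    show ?thesis
    proof (cases "p * m \<le> y")
      case True
      then have "p * m < p * x" using assms by linarith
      then have "m < x" by (simp only: mult_less_cancel1)
      then have "(p - 1) * (x - m) \<ge> 1" using p_ge_2 by (simp add: Suc_le_eq)
      \<comment> \<open>Division by the power M + 1 of 1 + X leaves the exponent (p - 1)(x - m) - 1,
        which is not negative because y < p x forces m < x.\<close>
      then have e: "(p - 1) * (A - m) = ((p - 1) * (x - m) - 1) + M + 1"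
      proof -
        have "A - m = (x - m) + y" using \<open>m < x\<close> by (simp add: A_def)
        then have "(p - 1) * (A - m) = (p - 1) * (x - m) + M" by (simp only: M_def distrib_left)
        then show ?thesis using \<open>(p - 1) * (x - m) \<ge> 1\<close> by linarith
      qed
      then show ?thesis
        unfolding ** e unfolding Y_def inv_power_cancel fps_nth_one_plus_X_power using True by simp
    qed (simp only: **, simp)
  qed
  have R: "fps_nth (of_nat (A choose k) * (- (fps_X * Y ^ (p - 1))) ^ k * inv_power M) y
      = (if k = y then (- 1) ^ y * of_nat (A choose y) else 0)" for k
  proof -
    have *: "of_nat (A choose k) * (- (fps_X * Y ^ (p - 1))) ^ k * inv_power M
      = fps_const ((- 1) ^ k * of_nat (A choose k)) * (fps_X ^ k * (Y ^ ((p - 1) * k) * inv_power M))"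
      unfolding power_minus[of "fps_X * Y ^ (p - 1)"] power_mult_distrib
      by (simp add: fps_of_nat[symmetric] power_mult[symmetric] fps_const_power[symmetric]
          fps_const_mult[symmetric] fps_const_neg[symmetric] ac_simps del: fps_const_power fps_const_mult fps_const_neg)
    have **: "fps_nth (of_nat (A choose k) * (- (fps_X * Y ^ (p - 1))) ^ k * inv_power M) y
      = (- 1) ^ k * of_nat (A choose k) * (if y < k then 0 else
          fps_nth (Y ^ ((p - 1) * k) * inv_power M) (y - k))"
      unfolding * by (simp only: fps_mult_left_const_nth fps_X_power_mult_nth)
    show ?thesis
    proof (cases "k \<le> y")
      case True
      then have "M = (p - 1) * (y - k) + (p - 1) * k" by (simp add: M_def distrib_left[symmetric])
      then have "Y ^ ((p - 1) * k) * inv_power M = inv_power ((p - 1) * (y - k))"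
        by (simp only: Y_def inv_power_add)
      \<comment> \<open>For n = y - k > 0 this coefficient is, up to sign, the binomial coefficient
        of pn over n, which vanishes modulo p. Only the summand k = y survives.\<close>
      moreover have "fps_nth (inv_power ((p - 1) * (y - k))) (y - k) = (if k = y then 1 else 0)"
      proof (cases "k = y")
        case False
        have "(p - 1) * n + n = p * n" for n
          using p_pos by (cases p) auto
        then show ?thesis using binomial_p_mult[of "y - k"] False True by (simp add: inv_power_def)
      qed (simp add: inv_power_def)
      ultimately show ?thesis using True by (simp only: **) auto
    qed (simp only: **, simp)
  qed
  have sub: "{m. p * m \<le> y} \<subseteq> {..A}"
  proof
    fix m assume "m \<in> {m. p * m \<le> y}"
    then show "m \<in> {..A}" using le_p_mult[of m] unfolding A_def atMost_iff mem_Collect_eq by linarith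
  qed
  have "(\<Sum>m\<le>A. if p * m \<le> y then (- 1) ^ m * of_nat (A choose m)
           * of_nat (((p - 1) * (x - m) - 1) choose (y - p * m)) else 0)
      = ((- 1) ^ y * of_nat (A choose y) :: 'k)"
    using E unfolding L R by (simp add: A_def)
  moreover have "(\<Sum>m\<le>A. if p * m \<le> y then (- 1) ^ m * of_nat (A choose m)
           * of_nat (((p - 1) * (x - m) - 1) choose (y - p * m)) else 0)
     = (\<Sum>m | p * m \<le> y. (- 1) ^ m * of_nat (A choose m)
         * of_nat (((p - 1) * (x - m) - 1) choose (y - p * m)) :: 'k)"
    using sub by (simp add: sum.If_cases Int_absorb1)
  ultimately show ?thesis by (simp add: A_def)
qed

section \<open>Signs and binomial coefficients with integer arguments\<close>

definition sgn_k :: "int \<Rightarrow> 'k" where "sgn_k n = (- 1) powi n"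

lemma sgn_k_add: "sgn_k (m + n) = sgn_k m * sgn_k n"
  by (simp add: sgn_k_def power_int_add)

lemma sgn_k_even [simp]: "even n \<Longrightarrow> sgn_k n = 1"
  by (simp add: sgn_k_def power_int_minus_left)

lemma sgn_k_odd [simp]: "odd n \<Longrightarrow> sgn_k n = - 1"
  by (simp add: sgn_k_def power_int_minus_left)

lemma sgn_k_p2: "p = 2 \<Longrightarrow> sgn_k n = 1"
  by (cases "even n") (simp_all add: minus_one_p)

lemma sgn_k_cong: "even (m - n) \<or> p = 2 \<Longrightarrow> sgn_k m = sgn_k n"
  by (cases "p = 2") (simp add: sgn_k_p2, auto simp: sgn_k_def power_int_minus_left)

lemma odd_p: "p \<noteq> 2 \<Longrightarrow> odd (int p)"
  using prime prime_odd_nat p_ge_2 by auto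

lemma ibinom_sym: "ibinom n k = ibinom n (n - k)"
proof -
  consider "n < 0 \<or> k < 0" | "0 \<le> n" "0 \<le> k" "k \<le> n" | "0 \<le> n" "n < k" by linarith
  then show ?thesis
  proof cases
    case 2
    then show ?thesis using binomial_symmetric[of "nat k" "nat n"] by (simp add: ibinom_def nat_diff_distrib)
  qed (auto simp: ibinom_def binomial_eq_0)
qed

lemma ibinom_eq_0: "n < k \<or> k < 0 \<or> n < 0 \<Longrightarrow> ibinom n k = 0"
  by (auto simp: ibinom_def binomial_eq_0)

lemma ibinom_nz: "ibinom n k \<noteq> 0 \<Longrightarrow> 0 \<le> k \<and> k \<le> n"
  using ibinom_eq_0 by (metis linorder_not_less)

text \<open>By Frobenius the power p^t of 1 + X is 1 + X^(p^t); multiply by (1 + X)^A and compare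
  coefficients.\<close>

lemma B_shift:
  assumes "A \<ge> 0"
  shows "B A (n - int (p ^ t)) + B A n = B (A + int (p ^ t)) n"
proof (cases "n < 0")
  case False
  define a m where "a = nat A" and "m = nat n"
  have *: "A = int a" "n = int m" using assms False by (auto simp: a_def m_def)
  have "(1 + fps_X) ^ (a + p ^ t) = (1 + fps_X :: 'k fps) ^ a + fps_X ^ (p ^ t) * (1 + fps_X) ^ a"
    by (simp add: power_add fps_frobenius distrib_left mult.commute)
  then have "fps_nth ((1 + fps_X) ^ (a + p ^ t)) m
      = fps_nth ((1 + fps_X :: 'k fps) ^ a + fps_X ^ (p ^ t) * (1 + fps_X) ^ a) m" by simp
  then have "of_nat ((a + p ^ t) choose m) = of_nat (a choose m) +
      (if m < p ^ t then 0 else of_nat (a choose (m - p ^ t)) :: 'k)"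
    by (simp only: fps_add_nth fps_X_power_mult_nth fps_nth_one_plus_X_power)
  then show ?thesis
    unfolding * by (auto simp: ibinom_def nat_diff_distrib' nat_add_distrib of_nat_diff[symmetric] simp del: of_nat_diff of_nat_power)
next
  case True
  then have "n - int (p ^ t) < 0" by (meson diff_less_0_iff_less of_nat_0_le_iff order.strict_trans2)
  then have "ibinom A (n - int (p ^ t)) = 0" "ibinom A n = 0" "ibinom (A + int (p ^ t)) n = 0"
    using True by (blast intro: ibinom_eq_0)+
  then show ?thesis by (simp only: of_nat_0 add_0)
qed

text \<open>The passage from natural to integer arguments. Any finite index set is allowed outside
  of which each summand has a vanishing factor; this accommodates the summation ranges of the Adem
  relations, which move when the indices are shifted.\<close>

lemma adem_binomial:
  assumes A: "A \<ge> 0" and y: "x + y = A" "y < int p * x" and S: "finite S"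
    and S_sup: "\<And>m. \<lbrakk>m \<notin> S; ibinom ((int p - 1) * (x - m) - 1) (y - int p * m) \<noteq> 0\<rbrakk> \<Longrightarrow> ibinom A m = 0"
  shows "B A x = (\<Sum>m\<in>S. sgn_k (y + m) * B ((int p - 1) * (x - m) - 1) (y - int p * m) * B A m)"
    (is "_ = sum ?f S")
proof -
  have x: "x > 0"
  proof (rule ccontr)
    assume "\<not> x > 0"
    then have "int p * x \<le> 1 * x" using p_ge_2 by (intro mult_right_mono_neg) auto
    then show False using A y \<open>\<not> x > 0\<close> by linarith
  qed
  have f0: "?f m = 0" if "m < 0 \<or> y < int p * m" for m
    using that by (auto simp: ibinom_eq_0)
  show ?thesis
  proof (cases "y < 0")
    case True
    have "?f m = 0" for m
    proof (rule f0)
      show "m < 0 \<or> y < int p * m"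
        using True by (cases "m < 0") (auto simp: not_less intro: order.strict_trans2[of y 0])
    qed
    then have "sum ?f S = 0" by (intro sum.neutral) blast
    moreover have "ibinom A x = 0" using True y by (intro ibinom_eq_0) auto
    ultimately show ?thesis by simp
  next
    case False
    define X Y where "X = nat x" and "Y = nat y"
    have XY: "x = int X" "y = int Y" "A = int (X + Y)" using x False y by (auto simp: X_def Y_def)
    have lt: "Y < p * X" using y(2) unfolding XY by (metis of_nat_less_iff of_nat_mult)
    define T where "T = {m. p * m \<le> Y}"
    have finT: "finite T"
    proof (rule finite_subset)
      show "T \<subseteq> {..Y}" using le_p_mult order.trans unfolding T_def by blast
    qed simp
    have "sum ?f S = sum ?f (S \<union> int ` T)"
    proof (rule sum.mono_neutral_left)
      show "\<forall>m\<in>S \<union> int ` T - S. ?f m = 0"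
      proof
        fix m assume "m \<in> S \<union> int ` T - S"
        then show "?f m = 0"
          using S_sup[of m] by (cases "ibinom ((int p - 1) * (x - m) - 1) (y - int p * m) = 0") auto
      qed
    qed (use S finT in auto)
    also have "\<dots> = sum ?f (int ` T)"
    proof (rule sum.mono_neutral_right)
      show "\<forall>m\<in>S \<union> int ` T - int ` T. ?f m = 0"
      proof
        fix m assume m: "m \<in> S \<union> int ` T - int ` T"
        have "m < 0 \<or> y < int p * m"
        proof (rule ccontr)
          assume "\<not> ?thesis"
          then obtain n where n: "m = int n" "int p * m \<le> y" by (metis nonneg_int_cases not_less)
          then have "n \<in> T" unfolding T_def XY by (metis mem_Collect_eq of_nat_le_iff of_nat_mult)
          then show False using m n by auto
        qed
        then show "?f m = 0" by (rule f0)
      qed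
    qed (use S finT in auto)
    also have "\<dots> = (\<Sum>m\<in>T. ?f (int m))"
      by (simp add: sum.reindex inj_on_def)
    also have "\<dots> = (\<Sum>m\<in>T. sgn_k y * ((- 1) ^ m * of_nat ((X + Y) choose m)
         * of_nat (((p - 1) * (X - m) - 1) choose (Y - p * m))))"
    proof (rule sum.cong)
      fix m assume "m \<in> T"
      then have m: "p * m \<le> Y" by (simp add: T_def)
      then have "p * m < p * X" using lt by linarith
      then have mX: "m < X" by (simp only: mult_less_cancel1)
      then have ge: "(p - 1) * (X - m) \<ge> 1" using p_ge_2 by (simp add: Suc_le_eq)
      have 1: "(int p - 1) * (x - int m) - 1 = int ((p - 1) * (X - m) - 1)"
        using ge mX p_ge_2 by (simp add: XY of_nat_diff)
      have 2: "y - int p * int m = int (Y - p * m)" using m by (simp add: XY of_nat_diff)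
      have 3: "sgn_k (y + int m) = sgn_k y * (- 1) ^ m"
        by (simp add: sgn_k_add) (simp add: sgn_k_def)
      show "?f (int m) = sgn_k y * ((- 1) ^ m * of_nat ((X + Y) choose m)
         * of_nat (((p - 1) * (X - m) - 1) choose (Y - p * m)))"
        unfolding 1 2 3 XY(3) by (simp add: ibinom_def ac_simps nat_int_add del: of_nat_diff of_nat_mult)
    qed simp
    also have "\<dots> = sgn_k y * ((- 1) ^ Y * of_nat ((X + Y) choose Y))"
      unfolding adem_binomial_nat[OF lt] T_def by (simp add: sum_distrib_left)
    also have "\<dots> = of_nat ((X + Y) choose Y)"
      unfolding XY sgn_k_def by (simp add: power_mult_distrib[symmetric] mult.assoc[symmetric])
    also have "\<dots> = B A x"
      using binomial_symmetric[of Y "X + Y"] by (simp add: XY ibinom_def nat_int_add)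
    finally show ?thesis by simp
  qed
qed

section \<open>Functions satisfying the Adem relations\<close>

text \<open>
  Span of the functions \<open>(a, b) \<mapsto>\<close> coefficient of \<open>w\<^sub>1\<^sup>\<beta> w\<^sub>2\<^sup>\<alpha>\<close> in a monomial in the Dickson invariants
  \<open>w\<^sub>1\<^sup>p + w\<^sub>2\<close> and \<open>w\<^sub>1 w\<^sub>2\<close>, where \<open>a\<close> and \<open>b\<close> are affine functions of the exponents.
\<close>

inductive dickson :: "(int \<Rightarrow> int \<Rightarrow> 'k) \<Rightarrow> bool"
  where
    base: "A \<ge> 0 \<Longrightarrow> dickson (\<lambda>a b. if a + b = A + (int p + 1) * C then B A (b - C) else 0)"
  | zero: "dickson (\<lambda>_ _. 0)"
  | add: "\<lbrakk>dickson f; dickson g\<rbrakk> \<Longrightarrow> dickson (\<lambda>a b. f a b + g a b)"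
  | minus: "dickson f \<Longrightarrow> dickson (\<lambda>a b. - f a b)"
  | scale: "dickson f \<Longrightarrow> dickson (\<lambda>a b. c * f a b)"

text \<open>Multiplication by a power of the invariant w1 w2: the exponent C grows by d.\<close>

lemma dickson_shift: "dickson f \<Longrightarrow> dickson (\<lambda>a b. f (a - int p * d) (b - d))"
proof (induction f rule: dickson.induct)
  case (base A C)
  have "(\<lambda>a b. if (a - int p * d) + (b - d) = A + (int p + 1) * C then B A ((b - d) - C) else 0)
      = (\<lambda>a b. if a + b = A + (int p + 1) * (C + d) then B A (b - (C + d)) else 0)"
    by (intro ext if_cong) (auto simp: algebra_simps)
  then show ?case using dickson.base[OF base, of "C + d"] by simp
qed (auto intro: dickson.intros)

text \<open>Multiplication by the power p^t of the invariant w1^p + w2, which has two terms by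
  Frobenius: the exponent A grows by p^t.\<close>

lemma dickson_split:
  "dickson f \<Longrightarrow> dickson (\<lambda>a b. f a (b - int (p ^ t)) + f (a - int (p ^ t)) b)"
proof (induction f rule: dickson.induct)
  case (base A C)
  have "(\<lambda>a b. (if a + (b - int (p ^ t)) = A + (int p + 1) * C then B A (b - int (p ^ t) - C) else 0)
        + (if a - int (p ^ t) + b = A + (int p + 1) * C then B A (b - C) else 0))
      = (\<lambda>a b. if a + b = (A + int (p ^ t)) + (int p + 1) * C then B (A + int (p ^ t)) (b - C) else 0)"
    (is "?l = ?r")
  proof (intro ext)
    fix a b
    show "?l a b = ?r a b"
    proof (cases "a + b = (A + int (p ^ t)) + (int p + 1) * C")
      case True
      have "b - int (p ^ t) - C = (b - C) - int (p ^ t)" by simp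
      then show ?thesis
        using B_shift[OF base, of "b - C" t] True by (simp only: algebra_simps, simp)
    qed auto
  qed
  moreover have "A + int (p ^ t) \<ge> 0" using base by simp
  ultimately show ?case using dickson.base[of "A + int (p ^ t)" C] by simp
next
  case (add f g)
  have "(\<lambda>a b. (f a (b - int (p ^ t)) + g a (b - int (p ^ t))) + (f (a - int (p ^ t)) b + g (a - int (p ^ t)) b))
     = (\<lambda>a b. (f a (b - int (p ^ t)) + f (a - int (p ^ t)) b) + (g a (b - int (p ^ t)) + g (a - int (p ^ t)) b))"
    by (intro ext) (simp only: ac_simps)
  then show ?case using dickson.add[OF add.IH] by (simp only:)
next
  case (minus f)
  then show ?case using dickson.minus[OF minus.IH] by simp
next
  case (scale f c)
  then show ?case using dickson.scale[OF scale.IH] by (simp add: distrib_left)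
qed (auto intro: dickson.intros)

abbreviation adem_range :: "int \<Rightarrow> int \<Rightarrow> int set"
  where "adem_range a b \<equiv> {b'. int p * b' \<le> a \<and> a - (int p - 1) * b \<le> b'}"

lemma finite_adem_range [simp]: "finite (adem_range a b)"
proof (rule finite_subset)
  show "adem_range a b \<subseteq> {- \<bar>a - (int p - 1) * b\<bar>..\<bar>a\<bar>}"
  proof
    fix x assume x: "x \<in> adem_range a b"
    have "x \<le> \<bar>a\<bar>"
    proof (cases "x \<le> 0")
      case False
      then have "1 * x \<le> int p * x" using p_ge_2 by (intro mult_right_mono) auto
      then show ?thesis using x by auto
    qed auto
    then show "x \<in> {- \<bar>a - (int p - 1) * b\<bar>..\<bar>a\<bar>}" using x by auto
  qed
qed simp

text \<open>By linearity it suffices to treat one Dickson monomial, where this is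
  \<open>adem_binomial\<close> with x = b - C and m = b' - C.\<close>

lemma dickson_adem:
  assumes "dickson f" "a < int p * b"
  shows "f a b = (\<Sum>b'\<in>adem_range a b. sgn_k (a + b') *
    B ((int p - 1) * (b - b') - 1) (a - int p * b') * f (a + b - b') b')"
  using assms(1)
proof (induction f rule: dickson.induct)
  case (base A C)
  show ?case
  proof (cases "a + b = A + (int p + 1) * C")
    case True
    define x where "x = b - C"
    define y where "y = A - x"
    have ay: "a = y + int p * C" using True by (simp add: x_def y_def algebra_simps)
    have bx: "b = x + C" by (simp add: x_def)
    have lt: "y < int p * x" using assms(2) by (simp add: ay bx algebra_simps)
    have bij: "bij_betw (\<lambda>m. m + C) {m. m + C \<in> adem_range a b} (adem_range a b)"
      by (rule bij_betwI[of _ _ _ "\<lambda>m. m - C"]) auto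
    then have fin: "finite {m. m + C \<in> adem_range a b}"
      using bij_betw_finite finite_adem_range by blast
    have N: "(int p - 1) * (x - m) - 1 = (int p - 1) * (b - (m + C)) - 1"
      "y - int p * m = a - int p * (m + C)" for m
      by (simp_all add: ay bx algebra_simps)
    have "B A x = (\<Sum>m\<in>{m. m + C \<in> adem_range a b}. sgn_k (y + m)
        * B ((int p - 1) * (x - m) - 1) (y - int p * m) * B A m)"
    proof (rule adem_binomial[OF base _ lt fin])
      fix m assume m: "m \<notin> {m. m + C \<in> adem_range a b}"
        "ibinom ((int p - 1) * (x - m) - 1) (y - int p * m) \<noteq> 0"
      then have "0 \<le> a - int p * (m + C) \<and> a - int p * (m + C) \<le> (int p - 1) * (b - (m + C)) - 1"
        unfolding N using ibinom_nz by blast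
      then show "ibinom A m = 0" using m(1) by (simp add: algebra_simps)
    qed (simp add: y_def)
    also have "\<dots> = (\<Sum>b'\<in>adem_range a b. sgn_k (y + (b' - C))
        * B ((int p - 1) * (x - (b' - C)) - 1) (y - int p * (b' - C)) * B A (b' - C))"
      by (subst sum.reindex_bij_betw[OF bij, symmetric]) simp
    also have "\<dots> = (\<Sum>b'\<in>adem_range a b. sgn_k (a + b') *
        B ((int p - 1) * (b - b') - 1) (a - int p * b') * B A (b' - C))"
    proof (rule sum.cong)
      fix b'
      \<comment> \<open>The exponents differ by a multiple of p + 1, which is even for odd p; for p
        = 2 all signs are 1.\<close>
      have "sgn_k (y + (b' - C)) = sgn_k (a + b')"
      proof (rule sgn_k_cong)
        have "y + (b' - C) - (a + b') = - ((int p + 1) * C)" by (simp add: ay algebra_simps)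
        then show "even (y + (b' - C) - (a + b')) \<or> p = 2"
          using odd_p by (cases "p = 2") auto
      qed
      then show "sgn_k (y + (b' - C)) * B ((int p - 1) * (x - (b' - C)) - 1) (y - int p * (b' - C)) * B A (b' - C)
        = sgn_k (a + b') * B ((int p - 1) * (b - b') - 1) (a - int p * b') * B A (b' - C)"
        unfolding N by simp
    qed simp
    finally show ?thesis using True by (simp add: x_def)
  qed simp
next
  case (add f g)
  then show ?case by (simp add: distrib_left sum.distrib)
next
  case (minus f)
  then show ?case by (simp add: sum_negf)
next
  case (scale f c)
  then show ?case by (simp add: sum_distrib_left mult.left_commute)
qed simp

text \<open>The case \<open>N = k = 0\<close> is exceptional because \<^const>\<open>ibinom\<close> vanishes at negative arguments.\<close>

lemma B_pascal: "B N k - B (N - 1) (k - 1) = (if N = 0 \<and> k = 0 then 1 else B (N - 1) k)"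
proof -
  consider "N < 0" | "N = 0" | "N > 0" "k \<le> 0" | "N > 0" "k > 0" by linarith
  then show ?thesis
  proof cases
    case 2
    then show ?thesis by (cases "k = 0") (auto simp: ibinom_def binomial_eq_0)
  next
    case 3
    then show ?thesis by (cases "k = 0") (auto simp: ibinom_def)
  next
    case 4
    define n j where "n = nat (N - 1)" and "j = nat (k - 1)"
    have "nat N = Suc n" "nat k = Suc j" using 4 by (auto simp: n_def j_def)
    then show ?thesis using 4 by (simp add: ibinom_def n_def[symmetric] j_def[symmetric])
  qed (auto simp: ibinom_def)
qed

text \<open>By Pascal's rule the difference is the coefficient in \<open>dickson_adem\<close>; its
  two terms belong to the two sums in the Adem relation for a Bockstein between two operations. On
  the boundary a = p b the range is the single index b, and the exceptional value of
  \<open>B_pascal\<close> gives the coefficient 1.\<close>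

lemma dickson_adem':
  assumes "dickson f" "a \<le> int p * b"
  shows "f a b = (\<Sum>b'\<in>adem_range a b. sgn_k (a + b') *
    (B ((int p - 1) * (b - b')) (a - int p * b') - B ((int p - 1) * (b - b') - 1) (a - int p * b' - 1))
      * f (a + b - b') b')"
proof (cases "a = int p * b")
  case False
  have "B ((int p - 1) * (b - b')) (a - int p * b') - B ((int p - 1) * (b - b') - 1) (a - int p * b' - 1)
      = B ((int p - 1) * (b - b') - 1) (a - int p * b')" for b'
    unfolding B_pascal using False p_ge_2 by auto
  then show ?thesis using dickson_adem[OF assms(1), of a b] False assms(2) by simp
next
  case True
  have "adem_range a b = {b}"
    using p_ge_2 by (auto simp: True algebra_simps)
  moreover have "sgn_k (a + b) = 1"
    using odd_p by (cases "p = 2") (auto simp: True sgn_k_p2)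
  ultimately show ?thesis by (simp add: B_pascal True ibinom_def)
qed

section \<open>A module over the Dyer-Lashof algebra\<close>

text \<open>
  A list \<open>J\<close> stands for a monomial in \<open>\<Lambda>[u\<^sub>1, \<dots>] \<otimes> \<F>\<^sub>p[x\<^sub>1, \<dots>]\<close>, where an entry \<open>0\<close> is a factor \<open>u\<close>
  and an entry \<open>t + 1\<close> is a factor \<open>x\<^sup>p\<^sup>^\<^sup>t\<close> in a separate variable for each position. The
  operations below are the transposes of the Steenrod operations \<open>P\<^sup>a\<close> and \<open>\<beta>\<close> on this algebra, where
  \<open>P\<^sup>0\<close> is not the unit, and of the Milnor primitive \<open>Q\<^sub>1\<close>: they act on functions of \<open>J\<close>.
\<close>

fun steenrod :: "int \<Rightarrow> (nat list \<Rightarrow> 'k) \<Rightarrow> nat list \<Rightarrow> 'k"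
  where
    "steenrod a \<xi> [] = (if a = 0 then \<xi> [] else 0)"
  | "steenrod a \<xi> (t # J) = steenrod a (\<lambda>K. \<xi> (t # K)) J +
      (case t of 0 \<Rightarrow> 0 | Suc i \<Rightarrow> steenrod (a - int (p ^ i)) (\<lambda>K. \<xi> (Suc t # K)) J)"

fun milnor :: "nat \<Rightarrow> (nat list \<Rightarrow> 'k) \<Rightarrow> nat list \<Rightarrow> 'k"
  where
    "milnor n \<xi> [] = 0"
  | "milnor n \<xi> (t # J) = (if t = 0 then \<xi> (Suc n # J) - milnor n (\<lambda>K. \<xi> (0 # K)) J
      else milnor n (\<lambda>K. \<xi> (t # K)) J)"

abbreviation bockstein where "bockstein \<equiv> milnor 0"

lemma steenrod_add: "steenrod a (\<lambda>K. \<xi> K + \<eta> K) J = steenrod a \<xi> J + steenrod a \<eta> J"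
  by (induction J arbitrary: a \<xi> \<eta>) (auto split: nat.splits)

lemma steenrod_scale: "steenrod a (\<lambda>K. c * \<xi> K) J = c * steenrod a \<xi> J"
  by (induction J arbitrary: a \<xi>) (auto split: nat.splits simp: distrib_left)

lemma steenrod_minus: "steenrod a (\<lambda>K. - \<xi> K) J = - steenrod a \<xi> J"
  using steenrod_scale[of a "- 1" \<xi> J] by simp

lemma steenrod_diff: "steenrod a (\<lambda>K. \<xi> K - \<eta> K) J = steenrod a \<xi> J - steenrod a \<eta> J"
  using steenrod_add[of a \<xi> "\<lambda>K. - \<eta> K" J] by (simp add: steenrod_minus)

lemma steenrod_zero [simp]: "steenrod a (\<lambda>K. 0) J = 0"
  using steenrod_scale[of a 0 "\<lambda>_. 0" J] by simp

lemma steenrod_sum: "steenrod a (\<lambda>K. \<Sum>i\<in>I. \<xi> i K) J = (\<Sum>i\<in>I. steenrod a (\<xi> i) J)"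
  by (induction I rule: infinite_finite_induct) (auto simp: steenrod_add)

lemma milnor_add: "milnor n (\<lambda>K. \<xi> K + \<eta> K) J = milnor n \<xi> J + milnor n \<eta> J"
  by (induction J arbitrary: \<xi> \<eta>) auto

lemma milnor_scale: "milnor n (\<lambda>K. c * \<xi> K) J = c * milnor n \<xi> J"
  by (induction J arbitrary: \<xi>) (auto simp: right_diff_distrib)

lemma milnor_minus: "milnor n (\<lambda>K. - \<xi> K) J = - milnor n \<xi> J"
  using milnor_scale[of n "- 1" \<xi> J] by simp

lemma milnor_diff: "milnor n (\<lambda>K. \<xi> K - \<eta> K) J = milnor n \<xi> J - milnor n \<eta> J"
  using milnor_add[of n \<xi> "\<lambda>K. - \<eta> K" J] by (simp add: milnor_minus)

lemma milnor_zero [simp]: "milnor n (\<lambda>K. 0) J = 0"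
  using milnor_scale[of n 0 "\<lambda>_. 0" J] by simp

lemma milnor_sum: "milnor n (\<lambda>K. \<Sum>i\<in>I. \<xi> i K) J = (\<Sum>i\<in>I. milnor n (\<xi> i) J)"
  by (induction I rule: infinite_finite_induct) (auto simp: milnor_add)

lemma bockstein_bockstein [simp]: "bockstein (\<lambda>J. bockstein \<xi> J) J = 0"
  by (induction J arbitrary: \<xi>) (auto simp: milnor_diff)

text \<open>As functions are pulled back, the Bockstein on the left acts on \<open>J\<close> first.
  It turns a factor u into x, which the Steenrod operation then leaves alone or raises to x^p at the
  cost of one degree. The second possibility is the Milnor primitive.\<close>

lemma bockstein_steenrod:
  "bockstein (\<lambda>J. steenrod a \<xi> J) J = steenrod a (\<lambda>J. bockstein \<xi> J) J + steenrod (a - 1) (\<lambda>J. milnor 1 \<xi> J) J"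
proof (induction J arbitrary: a \<xi>)
  case (Cons t J)
  show ?case
  proof (cases t)
    case 0
    then show ?thesis
      by (simp add: Cons.IH steenrod_diff milnor_diff milnor_add)
  next
    case (Suc i)
    then show ?thesis
      by (simp add: Cons.IH milnor_add algebra_simps)
  qed
qed simp

text \<open>Induction on the factors. A factor x^(p^i) is raised by neither operation, by exactly
  one of them, or by both, and then the second raise costs p times as much as the first. The cases
  are the induction hypothesis, \<open>dickson_split\<close> and
  \<open>dickson_shift\<close>.\<close>

lemma dickson_steenrod: "dickson (\<lambda>a b. steenrod b (\<lambda>J. steenrod a \<xi> J) J)"
proof (induction J arbitrary: \<xi>)
  case Nil
  have "(\<lambda>a b. steenrod b (\<lambda>J. steenrod a \<xi> J) []) = (\<lambda>a b. \<xi> [] * (if a + b = 0 + (int p + 1) * 0 then B 0 (b - 0) else 0))"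
    by (intro ext) (auto simp: ibinom_def binomial_eq_0)
  then show ?case by (simp only: dickson.scale dickson.base)
next
  case (Cons t J)
  show ?case
  proof (cases t)
    case 0
    then show ?thesis using Cons.IH[of "\<lambda>K. \<xi> (0 # K)"] by simp
  next
    case (Suc i)
    let ?f = "\<lambda>t a b. steenrod b (\<lambda>J. steenrod a (\<lambda>K. \<xi> (t # K)) J) J"
    have "dickson (\<lambda>a b. ?f t a b + ((?f (Suc t) a (b - int (p ^ i)) + ?f (Suc t) (a - int (p ^ i)) b)
        + ?f (Suc (Suc t)) (a - int p * int (p ^ i)) (b - int (p ^ i))))"
      by (intro dickson.add dickson_split dickson_shift Cons.IH)
    moreover have "(\<lambda>a b. steenrod b (\<lambda>J. steenrod a \<xi> J) (t # J))
        = (\<lambda>a b. ?f t a b + ((?f (Suc t) a (b - int (p ^ i)) + ?f (Suc t) (a - int (p ^ i)) b)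
        + ?f (Suc (Suc t)) (a - int p * int (p ^ i)) (b - int (p ^ i))))"
      by (intro ext) (simp add: Suc steenrod_add)
    ultimately show ?thesis by simp
  qed
qed

end

section \<open>Admissible words are linearly independent\<close>

text \<open>At the first difference the first word has at least as large an index and no Bockstein
  that the second one lacks. The relation is applied to reversed words, because the last letter of a
  word acts first on a list.\<close>

fun late_dom :: "dl_gen list \<Rightarrow> dl_gen list \<Rightarrow> bool"
  where
    "late_dom (x # w) (x' # w') \<longleftrightarrow> (fst x \<longrightarrow> fst x') \<and> snd x' \<le> snd x \<and> (x = x' \<longrightarrow> late_dom w w')"
  | "late_dom _ _ \<longleftrightarrow> True"

lemma late_dom_maximal:
  assumes "finite W" "W \<noteq> {}" "\<And>w. w \<in> W \<Longrightarrow> length w = n"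
  shows "\<exists>w\<in>W. \<forall>w'\<in>W. late_dom w w' \<longrightarrow> w' = w"
  using assms
proof (induction n arbitrary: W)
  case 0
  then show ?case by auto
next
  case (Suc n)
  \<comment> \<open>A dominated letter has at least the key of the dominating one, with equality
    only for equal letters. So a first letter of maximal key dominates only itself within the
    set.\<close>
  define key where "key x = (of_bool (fst x) - snd x :: int)" for x :: dl_gen
  have "Max ((\<lambda>w. key (hd w)) ` W) \<in> (\<lambda>w. key (hd w)) ` W"
    using Suc.prems(1,2) by (intro Max_in) auto
  then obtain w0 where w0: "w0 \<in> W" "key (hd w0) = Max ((\<lambda>w. key (hd w)) ` W)" by auto
  have w0_max: "key (hd w) \<le> key (hd w0)" if "w \<in> W" for w
    unfolding w0(2) using Suc.prems(1) that by (intro Max_ge) auto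
  define x where "x = hd w0"
  define V where "V = {v. x # v \<in> W}"
  have "V \<subseteq> tl ` W" by (force simp: V_def)
  then have "finite V" using Suc.prems(1) finite_subset by blast
  moreover have "w0 = x # tl w0" using Suc.prems(3)[OF w0(1)] by (cases w0) (auto simp: x_def)
  then have "tl w0 \<in> V" using w0(1) by (metis V_def mem_Collect_eq)
  then have "V \<noteq> {}" by blast
  moreover have "length v = n" if "v \<in> V" for v using Suc.prems(3)[of "x # v"] that by (simp add: V_def)
  ultimately obtain v where v: "v \<in> V" "\<And>v'. \<lbrakk>v' \<in> V; late_dom v v'\<rbrakk> \<Longrightarrow> v' = v"
    using Suc.IH[of V] by blast
  have "w' = x # v" if w': "w' \<in> W" "late_dom (x # v) w'" for w'
  proof -
    obtain y u where yu: "w' = y # u" using Suc.prems(3)[OF w'(1)] by (cases w') auto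
    have "key y \<le> key x" using w0_max[OF w'(1)] by (simp add: yu x_def)
    moreover have d: "fst x \<longrightarrow> fst y" "snd y \<le> snd x" using w'(2) by (auto simp: yu)
    ultimately have "snd y = snd x" "fst y = fst x"
      unfolding key_def by (cases "fst x"; cases "fst y"; auto)+
    then have "x = y" by (simp add: prod_eq_iff)
    then show ?thesis using w' v(2)[of u] yu by (auto simp: V_def)
  qed
  then show ?case using v(1) unfolding V_def by blast
qed

text \<open>
  A pair \<open>(t, T)\<close> is an entry \<open>t\<close> of a list that has to become \<open>T\<close>. When \<open>m\<close> letters remain, the
  entries with \<open>T = t + m\<close> have to be raised by each of them. The word \<open>just_in_time m c Z\<close> raises
  every entry at the last possible moment.
\<close>

type_synonym goals = "(nat \<times> nat) list"

definition must_raise :: "nat \<Rightarrow> goals \<Rightarrow> goals"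
  where "must_raise m Z = map (\<lambda>(t, T). (if T = t + m then Suc t else t, T)) Z"

text \<open>A Bockstein turns a single u into x. Two entries 0 with the same positive goal would
  have to be raised by the same letter, so each such goal may occur only once.\<close>

definition feasible :: "nat \<Rightarrow> goals \<Rightarrow> bool"
  where "feasible m Z \<longleftrightarrow> (\<forall>(t, T)\<in>set Z. t \<le> T \<and> T \<le> t + m) \<and>
    (\<forall>M. length (filter ((=) (0, Suc M)) Z) \<le> 1)"

lemma feasible_must_raise:
  assumes "feasible (Suc m) Z" shows "feasible m (must_raise (Suc m) Z)"
proof -
  have "length (filter ((=) (0, Suc M)) (must_raise (Suc m) Z)) \<le> length (filter ((=) (0, Suc M)) Z)" for M
    unfolding must_raise_def by (induction Z) (auto split: if_splits)
  then have "length (filter ((=) (0, Suc M)) (must_raise (Suc m) Z)) \<le> 1" for M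
    using assms unfolding feasible_def by (meson order.trans)
  then show ?thesis using assms unfolding feasible_def by (auto simp: must_raise_def split: if_splits)
qed

lemma snd_must_raise [simp]: "map snd (must_raise m Z) = map snd Z"
  by (auto simp: must_raise_def)

context prime_field
begin

text \<open>The letter to the left is evaluated at p c because the Adem relations are invariant
  under adding d to the right index and p d to the left one.\<close>

fun gen_op :: "dl_gen \<Rightarrow> (int \<Rightarrow> nat list \<Rightarrow> 'k) \<Rightarrow> int \<Rightarrow> nat list \<Rightarrow> 'k"
  where "gen_op (e, i) \<xi> c = steenrod (c - i) (if e then bockstein (\<xi> (int p * c)) else \<xi> (int p * c))"

text \<open>
  The left module structure is transposed to a right one. The integer \<open>c\<close> implements the symmetry of
  the Adem relations under shifts of the indices, which is needed to cover all integer indices.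
\<close>

fun word_op :: "(int \<Rightarrow> nat list \<Rightarrow> 'k) \<Rightarrow> dl_gen list \<Rightarrow> int \<Rightarrow> nat list \<Rightarrow> 'k"
  where
    "word_op \<xi> [] = \<xi>"
  | "word_op \<xi> (x # w) = word_op (gen_op x \<xi>) w"

lemma word_op_append: "word_op \<xi> (u @ v) = word_op (word_op \<xi> u) v"
  by (induction u arbitrary: \<xi>) auto

text \<open>The degree consumed by the raises that cannot wait: raising x^(p^(t-1)) to its p-th
  power costs p^(t-1). Entries 0 are raised by the Bockstein at no cost.\<close>

definition goal_weight :: "nat \<Rightarrow> goals \<Rightarrow> int"
  where "goal_weight m Z = (\<Sum>(t, T)\<leftarrow>Z. if T = t + m \<and> t \<noteq> 0 then int (p ^ (t - 1)) else 0)"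

fun just_in_time :: "nat \<Rightarrow> int \<Rightarrow> goals \<Rightarrow> dl_gen list"
  where
    "just_in_time 0 c Z = []"
  | "just_in_time (Suc m) c Z = just_in_time m (int p * c) (must_raise (Suc m) Z)
       @ [((0, Suc m) \<in> set Z, c - goal_weight (Suc m) Z)]"

lemma length_just_in_time [simp]: "length (just_in_time m c Z) = m"
  by (induction m arbitrary: c Z) auto

definition goal_fun :: "nat list \<Rightarrow> int \<Rightarrow> nat list \<Rightarrow> 'k"
  where "goal_fun T c J = (if J = T then 1 else 0)"

lemma steenrod_nz:
  "steenrod a \<xi> J \<noteq> 0 \<Longrightarrow> \<exists>K. \<xi> K \<noteq> 0 \<and> list_all2 (\<lambda>t k. k = t \<or> k = Suc t \<and> t \<noteq> 0) J K"
proof (induction J arbitrary: a \<xi>)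
  case Nil
  then show ?case by (auto split: if_splits)
next
  case (Cons t J)
  consider "steenrod a (\<lambda>K. \<xi> (t # K)) J \<noteq> 0"
    | i where "t = Suc i" "steenrod (a - int (p ^ i)) (\<lambda>K. \<xi> (Suc t # K)) J \<noteq> 0"
  proof (cases t)
    case 0
    then show ?thesis using Cons.prems that(1) by simp
  next
    case (Suc i)
    then show ?thesis
      using Cons.prems that(1) that(2)[OF Suc] by (cases "steenrod a (\<lambda>K. \<xi> (t # K)) J = 0") auto
  qed
  then show ?case
  proof cases
    case 1
    from Cons.IH[OF this] obtain K where "\<xi> (t # K) \<noteq> 0"
      "list_all2 (\<lambda>t k. k = t \<or> k = Suc t \<and> t \<noteq> 0) J K" by blast
    then show ?thesis by (intro exI[of _ "t # K"]) simp
  next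
    case 2
    from Cons.IH[OF this(2)] obtain K where "\<xi> (Suc t # K) \<noteq> 0"
      "list_all2 (\<lambda>t k. k = t \<or> k = Suc t \<and> t \<noteq> 0) J K" by blast
    then show ?thesis using 2(1) by (intro exI[of _ "Suc t # K"]) simp
  qed
qed

lemma bockstein_nz:
  "bockstein \<xi> J \<noteq> 0 \<Longrightarrow> \<exists>l<length J. J ! l = 0 \<and> \<xi> (J[l := 1]) \<noteq> 0"
proof (induction J arbitrary: \<xi>)
  case (Cons t J)
  consider "t = 0" "\<xi> (1 # J) \<noteq> 0" | "bockstein (\<lambda>K. \<xi> (t # K)) J \<noteq> 0"
    using Cons.prems by (cases "t = 0"; cases "\<xi> (1 # J) = 0") auto
  then show ?case
  proof cases
    case 1
    then show ?thesis by (intro exI[of _ 0]) auto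
  next
    case 2
    from Cons.IH[OF this] obtain l where "l < length J" "J ! l = 0" "\<xi> (t # J[l := 1]) \<noteq> 0" by blast
    then show ?thesis by (intro exI[of _ "Suc l"]) auto
  qed
qed simp

text \<open>One letter raises an entry by at most one: the Steenrod operation acts on
  \<open>J\<close> before the Bockstein and fixes the entries 0, so no entry is raised by
  both.\<close>

lemma gen_op_nz:
  assumes "gen_op x \<xi> c J \<noteq> 0"
  shows "\<exists>K. \<xi> (int p * c) K \<noteq> 0 \<and> list_all2 (\<lambda>t k. k = t \<or> k = Suc t) J K"
proof (cases x)
  case (Pair e i)
  then have "steenrod (c - i) (if e then bockstein (\<xi> (int p * c)) else \<xi> (int p * c)) J \<noteq> 0"
    using assms by (simp only: gen_op.simps not_False_eq_True)
  from steenrod_nz[OF this]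
  obtain K where K: "(if e then bockstein (\<xi> (int p * c)) else \<xi> (int p * c)) K \<noteq> 0"
    "list_all2 (\<lambda>t k. k = t \<or> k = Suc t \<and> t \<noteq> 0) J K" by blast
  show ?thesis
  proof (cases e)
    case True
    then obtain l where l: "l < length K" "K ! l = 0" "\<xi> (int p * c) (K[l := 1]) \<noteq> 0"
      using K(1) bockstein_nz[of "\<xi> (int p * c)" K] by auto
    have "list_all2 (\<lambda>t k. k = t \<or> k = Suc t) J (K[l := 1])"
      using K(2) l(1,2) unfolding list_all2_conv_all_nth by (auto simp: nth_list_update)
    then show ?thesis using l(3) by blast
  next
    case False
    have "list_all2 (\<lambda>t k. k = t \<or> k = Suc t) J K" using K(2) by (rule list_all2_mono) auto
    then show ?thesis using K(1) False by auto
  qed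
qed

definition reachable :: "nat \<Rightarrow> nat list \<Rightarrow> nat list \<Rightarrow> bool"
  where "reachable m T J \<longleftrightarrow> list_all2 (\<lambda>t T. t \<le> T \<and> T \<le> t + m) J T"

lemma word_op_goal_nz: "word_op (goal_fun T) w c J \<noteq> 0 \<Longrightarrow> reachable (length w) T J"
proof (induction w arbitrary: c J rule: rev_induct)
  case Nil
  then show ?case by (auto simp: goal_fun_def reachable_def list_all2_same split: if_splits)
next
  case (snoc x w)
  then have "gen_op x (word_op (goal_fun T) w) c J \<noteq> 0" by (simp add: word_op_append)
  from gen_op_nz[OF this] obtain K where K: "word_op (goal_fun T) w (int p * c) K \<noteq> 0"
    "list_all2 (\<lambda>t k. k = t \<or> k = Suc t) J K" by blast
  have "list_all2 (\<lambda>t T. t \<le> T \<and> T \<le> t + length w) K T"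
    using snoc.IH[OF K(1)] by (simp add: reachable_def)
  then show ?case
    unfolding reachable_def by (rule list_all2_trans[rotated, OF K(2)]) auto
qed

definition raise_pos :: "nat \<Rightarrow> goals \<Rightarrow> nat list"
  where "raise_pos m Z = map (\<lambda>(t, T). if T = t + m \<and> t \<noteq> 0 then Suc t else t) Z"

text \<open>Each raise costs a positive degree. The forced raises consume
  \<open>goal_weight m Z\<close>, so nothing is possible in smaller degrees, and in this degree no
  other entry moves.\<close>

lemma steenrod_must_raise:
  assumes "\<And>K. \<zeta> K \<noteq> 0 \<Longrightarrow> list_all2 (\<lambda>(t, T) k. T = t + m \<and> t \<noteq> 0 \<longrightarrow> t < k) Z K"
  shows "(a < goal_weight m Z \<longrightarrow> steenrod a \<zeta> (map fst Z) = 0) \<and>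
    steenrod (goal_weight m Z) \<zeta> (map fst Z) = \<zeta> (raise_pos m Z)"
  using assms
proof (induction Z arbitrary: a \<zeta>)
  case Nil
  then show ?case by (simp add: goal_weight_def raise_pos_def)
next
  case (Cons z Z)
  obtain t T where z: "z = (t, T)" by (cases z)
  have hyp: "list_all2 (\<lambda>(t, T) k. T = t + m \<and> t \<noteq> 0 \<longrightarrow> t < k) Z K" if "\<zeta> (k # K) \<noteq> 0" for k K
    using Cons.prems[OF that] by auto
  have IH: "b < goal_weight m Z \<Longrightarrow> steenrod b (\<lambda>K. \<zeta> (k # K)) (map fst Z) = 0"
    "steenrod (goal_weight m Z) (\<lambda>K. \<zeta> (k # K)) (map fst Z) = \<zeta> (k # raise_pos m Z)" for b k
    using Cons.IH[of "\<lambda>K. \<zeta> (k # K)" b] hyp by blast+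
  show ?case
  proof (cases "T = t + m \<and> t \<noteq> 0")
    case True
    then obtain i where i: "t = Suc i" by (cases t) auto
    have z0: "\<zeta> (t # K) = 0" for K using Cons.prems[of "t # K"] True by (auto simp: z)
    have "goal_weight m (z # Z) = int (p ^ i) + goal_weight m Z" "raise_pos m (z # Z) = Suc t # raise_pos m Z"
      using True by (simp_all add: z i goal_weight_def raise_pos_def)
    note w = this
    show ?thesis unfolding w using IH z0 by (simp add: z i)
  next
    case False
    then have *: "goal_weight m (z # Z) = goal_weight m Z" "raise_pos m (z # Z) = t # raise_pos m Z"
      by (simp_all add: z goal_weight_def raise_pos_def)
    show ?thesis
    proof (cases t)
      case (Suc i)
      have "int (p ^ i) > 0" by simp
      then have "a \<le> goal_weight m Z \<Longrightarrow> steenrod (a - int (p ^ i)) (\<lambda>K. \<zeta> (Suc t # K)) (map fst Z) = 0" for a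
        by (intro IH) linarith
      then show ?thesis unfolding * using IH by (simp add: z Suc del: of_nat_power)
    next
      case 0
      show ?thesis unfolding * using IH by (simp add: z 0)
    qed
  qed
qed

lemma raise_pos_eq: "(0, m) \<notin> set Z \<Longrightarrow> raise_pos m Z = map fst (must_raise m Z)"
  by (auto simp: raise_pos_def must_raise_def)

text \<open>The Bockstein has to choose the entry \<open>(0, m)\<close>, since any other choice
  leaves it at 0, where \<eta> vanishes. The sign comes from the factors u in front of it.\<close>

lemma bockstein_must_raise:
  assumes "\<And>K. \<eta> K \<noteq> 0 \<Longrightarrow> list_all2 (\<lambda>(t, T) k. (t, T) = (0, m) \<longrightarrow> 0 < k) Z K"
    and "length (filter ((=) (0, m)) Z) = 1"
  shows "bockstein \<eta> (raise_pos m Z) \<in> {\<eta> (map fst (must_raise m Z)), - \<eta> (map fst (must_raise m Z))}"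
  using assms
proof (induction Z arbitrary: \<eta>)
  case (Cons z Z)
  obtain t T where z: "z = (t, T)" by (cases z)
  have hyp: "list_all2 (\<lambda>(t, T) k. (t, T) = (0, m) \<longrightarrow> 0 < k) Z K" if "\<eta> (k # K) \<noteq> 0" for k K
    using Cons.prems(1)[OF that] by auto
  have rp: "raise_pos m (z # Z) = (if T = t + m \<and> t \<noteq> 0 then Suc t else t) # raise_pos m Z"
    "map fst (must_raise m (z # Z)) = (if T = t + m then Suc t else t) # map fst (must_raise m Z)"
    by (simp_all add: z raise_pos_def must_raise_def)
  show ?case
  proof (cases "z = (0, m)")
    case True
    then have "filter ((=) (0, m)) Z = []" using Cons.prems(2) by simp
    then have "(0, m) \<notin> set Z" by (metis filter_empty_conv)
    moreover have "\<eta> (0 # K) = 0" for K using Cons.prems(1)[of "0 # K"] True by (auto simp: z)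
    ultimately show ?thesis unfolding rp using True z by (simp add: raise_pos_eq)
  next
    case False
    then have one: "length (filter ((=) (0, m)) Z) = 1" using Cons.prems(2) by auto
    have IH: "bockstein (\<lambda>K. \<eta> (k # K)) (raise_pos m Z)
        \<in> {\<eta> (k # map fst (must_raise m Z)), - \<eta> (k # map fst (must_raise m Z))}" for k
      by (rule Cons.IH[OF hyp one])
    show ?thesis
    proof (cases "t = 0")
      case True
      obtain l where l: "l < length Z" "Z ! l = (0, m)"
      proof -
        have "filter ((=) (0, m)) Z \<noteq> []" using one by force
        then have "(0, m) \<in> set Z" by (simp add: filter_empty_conv)
        then show ?thesis using that by (metis in_set_conv_nth)
      qed
      have "\<eta> (1 # raise_pos m Z) = 0"
      proof (rule ccontr)
        assume "\<eta> (1 # raise_pos m Z) \<noteq> 0"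
        from list_all2_nthD[OF hyp[OF this] l(1)] show False using l by (simp add: raise_pos_def)
      qed
      then show ?thesis unfolding rp using IH[of 0] True False by (auto simp: z)
    next
      case f: False
      then show ?thesis unfolding rp using IH by auto
    qed
  qed
qed simp

text \<open>The remaining m letters raise each entry at most m times, so an entry at distance m + 1
  from its goal moves now or never. This bounds the index of the letter and forces its Bockstein; at
  the extremal letter only the forced raises happen.\<close>

lemma gen_op_just_in_time:
  assumes feas: "feasible (Suc m) Z" and \<eta>: "\<And>K. \<eta> (int p * c) K \<noteq> 0 \<Longrightarrow> reachable m (map snd Z) K"
  shows "gen_op (e, i) \<eta> c (map fst Z) \<noteq> 0 \<Longrightarrow> i \<le> c - goal_weight (Suc m) Z \<and> ((0, Suc m) \<in> set Z \<longrightarrow> e)"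
    and "gen_op ((0, Suc m) \<in> set Z, c - goal_weight (Suc m) Z) \<eta> c (map fst Z)
      \<in> {\<eta> (int p * c) (map fst (must_raise (Suc m) Z)), - \<eta> (int p * c) (map fst (must_raise (Suc m) Z))}"
proof -
  let ?\<eta> = "\<eta> (int p * c)"
  have hyp: "list_all2 (\<lambda>(t, T) k. T = t + Suc m \<longrightarrow> t < k) Z K" if "?\<eta> K \<noteq> 0" for K
  proof (rule list_all2_all_nthI)
    have r: "list_all2 (\<lambda>t T. t \<le> T \<and> T \<le> t + m) K (map snd Z)" using \<eta>[OF that] by (simp add: reachable_def)
    show "length Z = length K" using list_all2_lengthD[OF r] by simp
    fix n assume "n < length Z"
    then show "(case Z ! n of (t, T) \<Rightarrow> \<lambda>k. T = t + Suc m \<longrightarrow> t < k) (K ! n)"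
      using list_all2_nthD[OF r, of n] \<open>length Z = length K\<close> by (cases "Z ! n") auto
  qed
  have c1: "list_all2 (\<lambda>(t, T) k. T = t + Suc m \<and> t \<noteq> 0 \<longrightarrow> t < k) Z K" if "?\<eta> K \<noteq> 0" for K
    using hyp[OF that] by (rule list_all2_mono) auto
  have c2: "list_all2 (\<lambda>(t, T) k. T = t + Suc m \<and> t \<noteq> 0 \<longrightarrow> t < k) Z K" if bK: "bockstein ?\<eta> K \<noteq> 0" for K
  proof -
    obtain l where l: "l < length K" "K ! l = 0" "?\<eta> (K[l := 1]) \<noteq> 0" using bockstein_nz[OF bK] by blast
    have h: "list_all2 (\<lambda>(t, T) k. T = t + Suc m \<longrightarrow> t < k) Z (K[l := 1])" by (rule hyp[OF l(3)])
    show ?thesis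
    proof (rule list_all2_all_nthI)
      show "length Z = length K" using list_all2_lengthD[OF h] by simp
      fix n assume n: "n < length Z"
      then have "case Z ! n of (t, T) \<Rightarrow> T = t + Suc m \<longrightarrow> t < K[l := 1] ! n" using list_all2_nthD[OF h] by fastforce
      then show "(case Z ! n of (t, T) \<Rightarrow> \<lambda>k. T = t + Suc m \<and> t \<noteq> 0 \<longrightarrow> t < k) (K ! n)"
        using l by (cases "n = l") (auto split: prod.splits)
    qed
  qed
  let ?\<zeta> = "\<lambda>e. if e then bockstein ?\<eta> else ?\<eta>"
  have c: "list_all2 (\<lambda>(t, T) k. T = t + Suc m \<and> t \<noteq> 0 \<longrightarrow> t < k) Z K" if "?\<zeta> e K \<noteq> 0" for K e
    using that c1 c2 by (auto split: if_splits)
  have st: "(a < goal_weight (Suc m) Z \<longrightarrow> steenrod a (?\<zeta> e) (map fst Z) = 0) \<and>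
      steenrod (goal_weight (Suc m) Z) (?\<zeta> e) (map fst Z) = ?\<zeta> e (raise_pos (Suc m) Z)" for a e
    by (rule steenrod_must_raise[OF c])
  show "i \<le> c - goal_weight (Suc m) Z \<and> ((0, Suc m) \<in> set Z \<longrightarrow> e)" if nz: "gen_op (e, i) \<eta> c (map fst Z) \<noteq> 0"
  proof
    show "i \<le> c - goal_weight (Suc m) Z" using st[of "c - i" e] nz by auto
    show "(0, Suc m) \<in> set Z \<longrightarrow> e"
    proof (rule impI, rule ccontr)
      assume "(0, Suc m) \<in> set Z" "\<not> e"
      then obtain l where l: "l < length Z" "Z ! l = (0, Suc m)" by (meson in_set_conv_nth)
      from \<open>\<not> e\<close> nz have "steenrod (c - i) ?\<eta> (map fst Z) \<noteq> 0" by simp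
      from steenrod_nz[OF this] obtain K where K: "?\<eta> K \<noteq> 0"
        "list_all2 (\<lambda>t k. k = t \<or> k = Suc t \<and> t \<noteq> 0) (map fst Z) K" by blast
      have "K ! l = 0" using list_all2_nthD[OF K(2), of l] l by simp
      then show False using list_all2_nthD[OF hyp[OF K(1)] l(1)] l by simp
    qed
  qed
  show "gen_op ((0, Suc m) \<in> set Z, c - goal_weight (Suc m) Z) \<eta> c (map fst Z)
      \<in> {?\<eta> (map fst (must_raise (Suc m) Z)), - ?\<eta> (map fst (must_raise (Suc m) Z))}"
  proof (cases "(0, Suc m) \<in> set Z")
    case True
    then have "length (filter ((=) (0, Suc m)) Z) \<noteq> 0" by (auto simp: filter_empty_conv)
    moreover have "length (filter ((=) (0, Suc m)) Z) \<le> 1" using feas by (simp add: feasible_def)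
    ultimately have "length (filter ((=) (0, Suc m)) Z) = 1" by linarith
    moreover have "list_all2 (\<lambda>(t, T) k. (t, T) = (0, Suc m) \<longrightarrow> 0 < k) Z K" if "?\<eta> K \<noteq> 0" for K
      using hyp[OF that] by (rule list_all2_mono) auto
    ultimately show ?thesis using bockstein_must_raise[of ?\<eta> "Suc m" Z] st[of _ True] True by simp
  next
    case False
    then show ?thesis using st[of _ False] by (simp add: raise_pos_eq)
  qed
qed

lemma word_op_just_in_time:
  "feasible m Z \<Longrightarrow> word_op (goal_fun (map snd Z)) (just_in_time m c Z) c (map fst Z) \<noteq> 0"
proof (induction m arbitrary: c Z)
  case 0
  then have "map fst Z = map snd Z" by (auto simp: feasible_def)
  then show ?case by (simp add: goal_fun_def)
next
  case (Suc m)
  let ?\<eta> = "word_op (goal_fun (map snd Z)) (just_in_time m (int p * c) (must_raise (Suc m) Z))"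
  have "?\<eta> (int p * c) (map fst (must_raise (Suc m) Z)) \<noteq> 0"
    using Suc.IH[OF feasible_must_raise[OF Suc.prems]] by simp
  moreover have "reachable m (map snd Z) K" if "?\<eta> (int p * c) K \<noteq> 0" for K
    using word_op_goal_nz[OF that] by simp
  ultimately show ?case
    using gen_op_just_in_time(2)[OF Suc.prems, of ?\<eta> c] by (auto simp: word_op_append)
qed

text \<open>Together with \<open>word_op_just_in_time\<close> this makes the matrix of coefficients
  triangular with respect to \<open>late_dom\<close>.\<close>

lemma word_op_late_dom:
  "\<lbrakk>feasible m Z; length w = m; word_op (goal_fun (map snd Z)) w c (map fst Z) \<noteq> 0\<rbrakk>
    \<Longrightarrow> late_dom (rev (just_in_time m c Z)) (rev w)"
proof (induction m arbitrary: c Z w)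
  case (Suc m)
  obtain v e i where w: "w = v @ [(e, i)]" "length v = m"
    using Suc.prems(2) by (metis length_Suc_conv_rev surj_pair)
  let ?\<eta> = "word_op (goal_fun (map snd Z)) v"
  have r: "reachable m (map snd Z) K" if "?\<eta> (int p * c) K \<noteq> 0" for K
    using word_op_goal_nz[OF that] w by simp
  have nz: "gen_op (e, i) ?\<eta> c (map fst Z) \<noteq> 0" using Suc.prems(3) by (simp add: w word_op_append)
  have "late_dom (rev (just_in_time m (int p * c) (must_raise (Suc m) Z))) (rev v)"
    if "((0, Suc m) \<in> set Z, c - goal_weight (Suc m) Z) = (e, i)"
  proof (rule Suc.IH)
    show "feasible m (must_raise (Suc m) Z)" by (rule feasible_must_raise[OF Suc.prems(1)])
    have "?\<eta> (int p * c) (map fst (must_raise (Suc m) Z)) \<noteq> 0"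
      using gen_op_just_in_time(2)[OF Suc.prems(1), of ?\<eta> c] r nz unfolding that by fastforce
    then show "word_op (goal_fun (map snd (must_raise (Suc m) Z))) v (int p * c) (map fst (must_raise (Suc m) Z)) \<noteq> 0"
      by simp
  qed (fact w)
  then show ?case
    using gen_op_just_in_time(1)[OF Suc.prems(1) r nz] by (auto simp: w)
qed simp

section \<open>Admissible words as just-in-time words\<close>

definition adm :: "dl_gen \<Rightarrow> dl_gen \<Rightarrow> bool"
  where "adm x y \<longleftrightarrow> snd x \<le> int p * snd y - of_bool (fst y)"

text \<open>Goals for a word with one more letter in front, which acts last: it has to raise all old
  entries once more, turn \<open>a\<close> new factors x into x^p and, if it carries a Bockstein, a
  new u into x.\<close>

definition lift_goals :: "nat \<Rightarrow> bool \<Rightarrow> goals \<Rightarrow> goals"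
  where "lift_goals a e Z = map (\<lambda>(t, T). (t, Suc T)) Z @ replicate a (1, 2) @ (if e then [(0, 1)] else [])"

text \<open>Old entries are forced at the same letters as before, since goal and remaining number of
  letters grow together. When the new letter acts, each of them stands at its old goal T and costs
  p^(T-1), and each of the \<open>a\<close> new factors costs 1. A goal T = 0 would turn into a
  further task for the Bockstein.\<close>

lemma just_in_time_lift:
  assumes "feasible m Z" "\<forall>(t, T)\<in>set Z. T \<noteq> 0"
  shows "just_in_time (Suc m) c (lift_goals a e Z)
    = (e, int (p ^ m) * c - (\<Sum>(t, T)\<leftarrow>Z. int (p ^ (T - 1))) - int a) # just_in_time m c Z"
  using assms
proof (induction m arbitrary: c Z)
  case 0
  have "goal_weight (Suc 0) (map (\<lambda>(t, T). (t, Suc T)) Z) = (\<Sum>(t, T)\<leftarrow>Z. int (p ^ (T - 1)))"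
    using 0 unfolding goal_weight_def feasible_def by (induction Z) auto
  moreover have "goal_weight (Suc 0) (replicate a (1, 2)) = int a"
    unfolding goal_weight_def by (induction a) auto
  ultimately have "goal_weight (Suc 0) (lift_goals a e Z) = (\<Sum>(t, T)\<leftarrow>Z. int (p ^ (T - 1))) + int a"
    by (simp add: lift_goals_def goal_weight_def)
  moreover have "(0, Suc 0) \<in> set (lift_goals a e Z) \<longleftrightarrow> e"
    using 0 by (fastforce simp: lift_goals_def)
  ultimately show ?case by simp
next
  case (Suc m)
  have 1: "must_raise (Suc (Suc m)) (lift_goals a e Z) = lift_goals a e (must_raise (Suc m) Z)"
    by (auto simp: must_raise_def lift_goals_def)
  have 2: "goal_weight (Suc (Suc m)) (lift_goals a e Z) = goal_weight (Suc m) Z"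
  proof -
    have "goal_weight (Suc (Suc m)) (map (\<lambda>(t, T). (t, Suc T)) Z) = goal_weight (Suc m) Z"
      unfolding goal_weight_def by (induction Z) auto
    moreover have "goal_weight (Suc (Suc m)) (replicate a (1, 2)) = 0"
      unfolding goal_weight_def by (induction a) auto
    ultimately show ?thesis by (simp add: lift_goals_def goal_weight_def)
  qed
  have 3: "(0, Suc (Suc m)) \<in> set (lift_goals a e Z) \<longleftrightarrow> (0, Suc m) \<in> set Z"
    by (force simp: lift_goals_def)
  have 4: "(\<Sum>(t, T)\<leftarrow>must_raise (Suc m) Z. int (p ^ (T - 1))) = (\<Sum>(t, T)\<leftarrow>Z. int (p ^ (T - 1)))"
  proof -
    have "map (\<lambda>(t, T). int (p ^ (T - 1))) (must_raise (Suc m) Z) = map (\<lambda>(t, T). int (p ^ (T - 1))) Z"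
      by (auto simp: must_raise_def)
    then show ?thesis by (simp only:)
  qed
  have 5: "\<forall>(t, T)\<in>set (must_raise (Suc m) Z). T \<noteq> 0"
    using Suc.prems(2) by (auto simp: must_raise_def)
  show ?case
    unfolding just_in_time.simps(2)[of "Suc m"] 1 2 3
      Suc.IH[OF feasible_must_raise[OF Suc.prems(1)] 5] 4
    by (simp add: ac_simps)
qed

lemma feasible_lift:
  assumes "feasible m Z" "\<forall>(t, T)\<in>set Z. T \<noteq> 0"
  shows "feasible (Suc m) (lift_goals a e Z)"
proof -
  have f: "filter ((=) (0, Suc M)) (map (\<lambda>(t, T). (t, Suc T)) Z)
      = map (\<lambda>(t, T). (t, Suc T)) (filter ((=) (0, M)) Z)" for M
    by (induction Z) auto
  have "length (filter ((=) (0, Suc M)) (lift_goals a e Z)) \<le> 1" for M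
  proof (cases M)
    case 0
    have "filter ((=) (0, 0)) Z = []" using assms(2) by (auto simp: filter_empty_conv)
    then show ?thesis by (simp add: lift_goals_def f 0)
  next
    case (Suc n)
    then show ?thesis using assms(1) by (simp add: lift_goals_def f feasible_def)
  qed
  moreover have "\<forall>(t, T)\<in>set (lift_goals a e Z). t \<le> T \<and> T \<le> t + Suc m"
    using assms(1) by (auto simp: lift_goals_def feasible_def split: if_splits)
  ultimately show ?thesis by (simp add: feasible_def)
qed

text \<open>The last conjunct drives the induction: its left side is the largest index that
  \<open>just_in_time_lift\<close> can give to a further first letter, and lower indices arise by
  increasing \<open>a\<close>. Its right side is the bound in \<open>adm\<close>, so exactly the
  admissible first letters occur.\<close>

lemma admissible_just_in_time:
  assumes "successively adm w" "w \<noteq> []"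
  shows "\<exists>c Z. feasible (length w) Z \<and> just_in_time (length w) c Z = w \<and> (\<forall>(t, T)\<in>set Z. T \<noteq> 0) \<and>
    int (p ^ length w) * c - (\<Sum>(t, T)\<leftarrow>Z. int (p ^ (T - 1))) = int p * snd (hd w) - of_bool (fst (hd w))"
  using assms
proof (induction w)
  case (Cons x w)
  obtain e i where x: "x = (e, i)" by (cases x)
  have "\<exists>c Z. feasible (length w) Z \<and> just_in_time (length w) c Z = w \<and> (\<forall>(t, T)\<in>set Z. T \<noteq> 0) \<and>
    i \<le> int (p ^ length w) * c - (\<Sum>(t, T)\<leftarrow>Z. int (p ^ (T - 1)))"
  proof (cases "w = []")
    case True
    then show ?thesis by (intro exI[of _ i] exI[of _ "[]"]) (simp add: feasible_def)
  next
    case False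
    then have "adm x (hd w)" "successively adm w" using Cons.prems(1) by (auto simp: successively_Cons)
    then show ?thesis using Cons.IH False by (fastforce simp: adm_def x)
  qed
  then obtain c Z where Z: "feasible (length w) Z" "just_in_time (length w) c Z = w" "\<forall>(t, T)\<in>set Z. T \<noteq> 0"
    "i \<le> int (p ^ length w) * c - (\<Sum>(t, T)\<leftarrow>Z. int (p ^ (T - 1)))" by blast
  define S where "S = (\<Sum>(t, T)\<leftarrow>Z. int (p ^ (T - 1)))"
  define a where "a = nat (int (p ^ length w) * c - S - i)"
  have i: "i = int (p ^ length w) * c - S - int a" using Z(4) by (simp add: a_def S_def)
  have "just_in_time (Suc (length w)) c (lift_goals a e Z) = x # w"
    unfolding just_in_time_lift[OF Z(1,3)] Z(2) using i by (simp add: x S_def)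
  moreover have "feasible (Suc (length w)) (lift_goals a e Z)" by (rule feasible_lift[OF Z(1,3)])
  moreover have "\<forall>(t, T)\<in>set (lift_goals a e Z). T \<noteq> 0" by (auto simp: lift_goals_def split: if_splits)
  moreover have "(\<Sum>(t, T)\<leftarrow>lift_goals a e Z. int (p ^ (T - 1))) = int p * S + int p * int a + of_bool e"
  proof -
    have "(\<Sum>(t, T)\<leftarrow>map (\<lambda>(t, T). (t, Suc T)) Z. int (p ^ (T - 1))) = int p * S"
      using Z(3) unfolding S_def
    proof (induction Z)
      case (Cons z Z)
      then show ?case by (cases z; cases "snd z") (auto simp: distrib_left)
    qed simp
    moreover have "(\<Sum>(t, T)\<leftarrow>replicate a (1::nat, 2). int (p ^ (T - 1))) = int p * int a"
      by (induction a) (auto simp: distrib_left)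
    ultimately show ?thesis by (simp add: lift_goals_def)
  qed
  then have "int (p ^ Suc (length w)) * c - (\<Sum>(t, T)\<leftarrow>lift_goals a e Z. int (p ^ (T - 1))) = int p * i - of_bool e"
    by (simp add: i algebra_simps)
  ultimately show ?case by (intro exI[of _ c] exI[of _ "lift_goals a e Z"]) (simp add: x)
qed simp

text \<open>Among the words of \<open>f\<close> take one that, reversed, dominates no other. It is a
  just-in-time word, and by \<open>word_op_late_dom\<close> its matrix coefficient vanishes at all
  other words of \<open>f\<close>.\<close>

theorem admissible_independent:
  assumes "f \<noteq> 0" "\<And>w. w \<in> supp f \<Longrightarrow> length w = n \<and> successively adm w"
  shows "\<exists>T c J. ev (\<lambda>w. word_op (goal_fun T) w c J) f \<noteq> 0"
proof -
  have ne: "rev ` supp f \<noteq> {}" using assms(1) by (auto simp: in_keys_iff intro: poly_mapping_eqI)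
  obtain v where v: "v \<in> rev ` supp f" "\<And>v'. \<lbrakk>v' \<in> rev ` supp f; late_dom v v'\<rbrakk> \<Longrightarrow> v' = v"
    using late_dom_maximal[OF _ ne, of n] assms(2) by (metis (no_types, lifting) finite_imageI finite_keys imageE length_rev)
  define w where "w = rev v"
  have w: "w \<in> supp f" using v(1) by (auto simp: w_def)
  have "\<exists>c Z. feasible n Z \<and> just_in_time n c Z = w"
  proof (cases "w = []")
    case True
    then have "n = 0" using assms(2)[OF w] by simp
    then show ?thesis using True by (intro exI[of _ 0] exI[of _ "[]"]) (simp add: feasible_def)
  next
    case False
    then show ?thesis using admissible_just_in_time[of w] assms(2)[OF w] by auto
  qed
  then obtain c Z where Z: "feasible n Z" "just_in_time n c Z = w" by blast
  let ?\<phi> = "\<lambda>w. word_op (goal_fun (map snd Z)) w c (map fst Z)"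
  have "?\<phi> w \<noteq> 0" using word_op_just_in_time[OF Z(1), of c] Z(2) by simp
  moreover have "?\<phi> u = 0" if u: "u \<in> supp f" "u \<noteq> w" for u
  proof (rule ccontr)
    assume "?\<phi> u \<noteq> 0"
    then have "late_dom v (rev u)" using word_op_late_dom[OF Z(1), of u c] assms(2)[OF u(1)] Z(2) by (simp add: w_def)
    then have "rev u = v" using v(2) u(1) by blast
    then show False using u(2) by (auto simp: w_def)
  qed
  then have "ev ?\<phi> f = coef f w * ?\<phi> w"
    unfolding ev_def using w by (subst sum.remove[OF finite_keys w]) auto
  ultimately show ?thesis using w by (metis in_keys_iff mult_eq_0_iff)
qed

end

section \<open>The Adem relations\<close>

definition pair_val :: "('g \<Rightarrow> 'g \<Rightarrow> 'k::field) \<Rightarrow> 'g list \<Rightarrow> 'k"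
  where "pair_val F w = (case w of [a, b] \<Rightarrow> F a b | _ \<Rightarrow> 0)"

text \<open>Intended for F with finite support; otherwise the sum is 0 by convention, which is why
  finiteness is assumed in \<open>coef_pair_sum\<close>.\<close>

definition pair_sum :: "('g \<Rightarrow> 'g \<Rightarrow> 'k::field) \<Rightarrow> ('g list \<Rightarrow>\<^sub>0 'k)"
  where "pair_sum F = (\<Sum>(a, b) | F a b \<noteq> 0. sing [a, b] (F a b))"

lemma pair_val_simps [simp]: "pair_val F [a, b] = F a b" "length w \<noteq> 2 \<Longrightarrow> pair_val F w = 0"
  by (auto simp: pair_val_def split: list.splits)

lemma ev_pair_sum: "ev \<phi> (pair_sum F) = (\<Sum>(a, b) | F a b \<noteq> 0. F a b * \<phi> [a, b])"
  unfolding pair_sum_def ev_sum by (rule sum.cong) auto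

lemma coef_pair_sum:
  assumes "finite {(a, b). F a b \<noteq> 0}"
  shows "coef (pair_sum F) w = pair_val F w"
proof (cases "length w = 2")
  case True
  then obtain a b where w: "w = [a, b]" by (auto simp: length_Suc_conv numeral_2_eq_2)
  have "ev (\<lambda>v. if v = w then 1 else 0) (pair_sum F) = (\<Sum>z | F (fst z) (snd z) \<noteq> 0. if z = (a, b) then F a b else 0)"
    unfolding ev_pair_sum case_prod_unfold by (rule sum.cong) (auto simp: w)
  also have "\<dots> = F a b"
    using assms by (simp add: case_prod_unfold)
  finally show ?thesis unfolding ev_indicator by (simp add: w)
next
  case False
  have "ev (\<lambda>v. if v = w then 1 else 0) (pair_sum F) = 0"
    unfolding ev_pair_sum using False by (intro sum.neutral) auto
  then show ?thesis unfolding ev_indicator using False by simp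
qed

lemma coef_word: "coef (sing v c) w = (if w = v then c else 0)"
  by (auto simp: lookup_single when_def)

lemma coef_quad_sum:
  assumes "finite S"
  shows "coef (\<Sum>i\<in>S. quad e (n - i) e' i (h i)) w = pair_val (\<lambda>a b.
    if fst a = e \<and> fst b = e' \<and> snd a + snd b = n \<and> snd b \<in> S then h (snd b) else 0) w"
proof (cases "length w = 2")
  case True
  then obtain f u f' i where w: "w = [(f, u), (f', i)]" by (auto simp: length_Suc_conv numeral_2_eq_2)
  have "coef (\<Sum>i\<in>S. quad e (n - i) e' i (h i)) w
      = (\<Sum>l\<in>S. if l = i then (if f = e \<and> f' = e' \<and> u + i = n then h i else 0) else 0)"
    unfolding lookup_sum by (rule sum.cong) (auto simp: w lookup_single when_def)
  then show ?thesis using assms by (simp add: w)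
next
  case False
  then have "coef (\<Sum>i\<in>S. quad e (n - i) e' i (h i)) w = 0"
    unfolding lookup_sum by (intro sum.neutral) (auto simp: lookup_single when_def)
  then show ?thesis using False by simp
qed

context prime_field
begin

lemma mem_dl_gens: "x \<in> dl_gens p \<longleftrightarrow> (p = 2 \<longrightarrow> \<not> fst x)"
  by (cases x) (simp add: dl_gens_def)

text \<open>All Adem relations in one formula: the coefficient of \<open>[a, b]\<close> in the
  rewriting of an inadmissible \<open>[x, y]\<close>. If \<open>y\<close> carries a Bockstein, it
  stays on the right or moves to the left; for p = 2 only the branch without Bocksteins
  occurs.\<close>

definition acoef :: "dl_gen \<Rightarrow> dl_gen \<Rightarrow> dl_gen \<Rightarrow> dl_gen \<Rightarrow> 'k"
  where "acoef x y a b =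
    (if x \<in> dl_gens p \<and> y \<in> dl_gens p \<and> \<not> adm x y \<and> snd a + snd b = snd x + snd y then
      (let n = (int p - 1) * (snd b - snd y); k = int p * snd b - snd x in
       sgn_k (snd x + snd b) *
        (if \<not> fst y then (if \<not> fst b \<and> fst a = fst x then B (n - 1) k else 0)
         else if fst b then (if fst a = fst x then - B (n - 1) (k - 1) else 0)
         else if fst a \<and> \<not> fst x then B n k else 0))
     else 0)"

lemma nested_if_nz:
  "(if \<not> Y then (if \<not> b \<and> e then u else 0) else if b then (if e then - v else 0) else if f then w else 0)
      \<noteq> (0 :: 'a :: group_add) \<Longrightarrow>
    (\<not> Y \<and> \<not> b \<and> e \<and> u \<noteq> 0) \<or> (Y \<and> b \<and> e \<and> v \<noteq> 0) \<or> (Y \<and> \<not> b \<and> f \<and> w \<noteq> 0)"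
  by (auto split: if_splits)

lemma B_nz: "B n k \<noteq> 0 \<Longrightarrow> 0 \<le> k \<and> k \<le> n"
  by (rule ibinom_nz) (metis of_nat_0)

text \<open>Read off from the range in which binomial coefficients do not vanish. The inequalities
  show that rewriting produces admissible words and supply what termination needs.\<close>

lemma acoef_nz:
  assumes "acoef x y a b \<noteq> 0"
  shows "x \<in> dl_gens p" "y \<in> dl_gens p" "a \<in> dl_gens p" "b \<in> dl_gens p" "\<not> adm x y" "adm a b"
    and "snd a + snd b = snd x + snd y"
    and "of_bool (fst a) + of_bool (fst b) = (of_bool (fst x) + of_bool (fst y) :: int)"
    and "snd y + of_bool (fst y = fst b) \<le> snd b"
    and "snd b + (int p - 1) * snd y + 1 \<le> snd x + of_bool (fst y)"
    and "snd x + of_bool (fst b) \<le> int p * snd b"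
    and "fst b \<longrightarrow> fst y"
proof -
  define N k where "N = (int p - 1) * (snd b - snd y)" and "k = int p * snd b - snd x"
  have c: "x \<in> dl_gens p" "y \<in> dl_gens p" "\<not> adm x y" "snd a + snd b = snd x + snd y"
    using assms by (auto simp: acoef_def split: if_splits)
  have "(if \<not> fst y then (if \<not> fst b \<and> fst a = fst x then B (N - 1) k else 0)
      else if fst b then (if fst a = fst x then - B (N - 1) (k - 1) else 0)
      else if fst a \<and> \<not> fst x then B N k else 0) \<noteq> 0" (is "?X \<noteq> 0")
  proof
    assume z: "?X = 0"
    show False using assms unfolding acoef_def Let_def N_def[symmetric] k_def[symmetric] z by (auto split: if_splits)
  qed
  then have "(\<not> fst y \<and> \<not> fst b \<and> fst a = fst x \<and> B (N - 1) k \<noteq> 0)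
      \<or> (fst y \<and> fst b \<and> fst a = fst x \<and> B (N - 1) (k - 1) \<noteq> 0)
      \<or> (fst y \<and> \<not> fst b \<and> (fst a \<and> \<not> fst x) \<and> B N k \<noteq> 0)" by (rule nested_if_nz)
  then consider (QQ) "\<not> fst y" "\<not> fst b" "fst a = fst x" "0 \<le> k" "k \<le> N - 1"
    | (bb) "fst y" "fst b" "fst a = fst x" "0 \<le> k - 1" "k - 1 \<le> N - 1"
    | (bQ) "fst y" "\<not> fst b" "fst a" "\<not> fst x" "0 \<le> k" "k \<le> N"
    using B_nz by blast
  note cases = this
  have p1: "int p - 1 > 0" using p_ge_2 by simp
  have N_pos: "0 < N \<Longrightarrow> snd y < snd b" "0 \<le> N \<Longrightarrow> snd y \<le> snd b"
    using p1 by (auto simp: N_def zero_less_mult_iff zero_le_mult_iff)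
  show "x \<in> dl_gens p" "y \<in> dl_gens p" "\<not> adm x y" "snd a + snd b = snd x + snd y" by (fact c)+
  show "fst b \<longrightarrow> fst y" using cases by cases auto
  show "a \<in> dl_gens p" "b \<in> dl_gens p"
    using cases c(1,2) by (auto simp: mem_dl_gens)
  show "of_bool (fst a) + of_bool (fst b) = (of_bool (fst x) + of_bool (fst y) :: int)"
    using cases by cases auto
  show *: "snd y + of_bool (fst y = fst b) \<le> snd b"
    using cases by cases (use N_pos in auto)
  have N': "N = int p * snd b - int p * snd y - snd b + snd y" by (simp add: N_def algebra_simps)
  show "snd b + (int p - 1) * snd y + 1 \<le> snd x + of_bool (fst y)"
    using cases by cases (simp_all add: N' k_def algebra_simps)
  show **: "snd x + of_bool (fst b) \<le> int p * snd b"
    using cases by cases (simp_all add: k_def)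
  show "adm a b"
  proof -
    have "snd y \<le> snd b" using * by (simp add: of_bool_def split: if_splits)
    then show ?thesis unfolding adm_def using c(4) ** by linarith
  qed
qed

lemma acoef_deg:
  assumes "acoef x y a b \<noteq> 0" shows "dl_deg p a + dl_deg p b = dl_deg p x + dl_deg p y"
proof -
  have "2 * (int p - 1) * snd a + 2 * (int p - 1) * snd b = 2 * (int p - 1) * snd x + 2 * (int p - 1) * snd y"
    using acoef_nz(7)[OF assms] by (simp only: distrib_left[symmetric])
  then show ?thesis using acoef_nz(7,8)[OF assms] by (simp add: dl_deg_def)
qed

lemma finite_adem_indices: "finite {i. r \<le> int p * i \<and> i \<le> m}"
proof (rule finite_subset)
  show "{i. r \<le> int p * i \<and> i \<le> m} \<subseteq> {- \<bar>r\<bar>..m}"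
  proof
    fix i assume i: "i \<in> {i. r \<le> int p * i \<and> i \<le> m}"
    have "- \<bar>r\<bar> \<le> i"
    proof (cases "i \<ge> 0")
      case False
      then have "int p * i \<le> 1 * i" using p_ge_2 by (intro mult_right_mono_neg) auto
      then show ?thesis using i by auto
    qed auto
    then show "i \<in> {- \<bar>r\<bar>..m}" using i by simp
  qed
qed simp

abbreviation adem_indices :: "int \<Rightarrow> int \<Rightarrow> int set"
  where "adem_indices r s \<equiv> {i. r \<le> int p * i \<and> i \<le> r - (int p - 1) * s}"

lemma acoef_index: "acoef x y a b \<noteq> 0 \<Longrightarrow> snd b \<in> adem_indices (snd x) (snd y) \<and> snd a = snd x + snd y - snd b"
  using acoef_nz(7,10,11)[of x y a b] by (auto simp: of_bool_def split: if_splits)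

lemma acoef_supp:
  "{(a, b). acoef x y a b \<noteq> 0} \<subseteq> (\<lambda>(i, e, e'). ((e, snd x + snd y - i), (e', i))) ` (adem_indices (snd x) (snd y) \<times> UNIV \<times> UNIV)"
proof clarify
  fix e u e' i assume "acoef x y (e, u) (e', i) \<noteq> 0"
  from acoef_index[OF this] show "((e, u), (e', i)) \<in> (\<lambda>(i, e, e'). ((e, snd x + snd y - i), (e', i))) `
      (adem_indices (snd x) (snd y) \<times> UNIV \<times> UNIV)"
    by (intro image_eqI[of _ _ "(i, e, e')"]) auto
qed

lemma finite_acoef: "finite {(a, b). acoef x y a b \<noteq> 0}"
  by (rule finite_subset[OF acoef_supp]) (intro finite_imageI finite_cartesian_product finite_adem_indices finite)

lemma sum_acoef:
  "(\<Sum>(a, b) | acoef x y a b \<noteq> 0. acoef x y a b * \<phi> a b) =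
    (\<Sum>i\<in>adem_indices (snd x) (snd y). \<Sum>e\<in>UNIV. \<Sum>e'\<in>UNIV.
      acoef x y (e, snd x + snd y - i) (e', i) * \<phi> (e, snd x + snd y - i) (e', i))"
proof -
  let ?g = "\<lambda>(i, e, e'). ((e, snd x + snd y - i), (e', i)) :: dl_gen \<times> dl_gen"
  let ?X = "adem_indices (snd x) (snd y) \<times> (UNIV :: bool set) \<times> (UNIV :: bool set)"
  have fin: "finite ?X" by (intro finite_cartesian_product finite_adem_indices finite)
  have "(\<Sum>(a, b) | acoef x y a b \<noteq> 0. acoef x y a b * \<phi> a b) = (\<Sum>(a, b)\<in>?g ` ?X. acoef x y a b * \<phi> a b)"
    by (rule sum.mono_neutral_left[OF finite_imageI[OF fin] acoef_supp]) auto
  also have "\<dots> = (\<Sum>z\<in>?X. (\<lambda>(a, b). acoef x y a b * \<phi> a b) (?g z))"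
    by (rule sum.reindex[unfolded comp_def]) (auto simp: inj_on_def)
  finally show ?thesis by (simp add: sum.cartesian_product case_prod_unfold)
qed

definition adem_rel :: "dl_gen \<Rightarrow> dl_gen \<Rightarrow> 'k dl_free"
  where "adem_rel x y = sing [x, y] 1 - pair_sum (acoef x y)"

lemma coef_adem_rel: "coef (adem_rel x y) w = (if w = [x, y] then 1 else 0) - pair_val (acoef x y) w"
  by (simp add: adem_rel_def lookup_minus coef_word coef_pair_sum[OF finite_acoef])

lemma ev_adem_rel: "ev \<phi> (adem_rel x y) = \<phi> [x, y] - (\<Sum>(a, b) | acoef x y a b \<noteq> 0. acoef x y a b * \<phi> [a, b])"
  by (simp add: adem_rel_def ev_diff ev_pair_sum)

lemma pm_eq_pair_diffI:
  assumes "\<And>w. coef f w = (if w = [x, y] then 1 else 0) - pair_val F w"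
    and "\<And>w. coef g w = (if w = [x, y] then 1 else 0) - pair_val H w"
    and "\<And>e u e' i. F (e, u) (e', i) = H (e, u) (e', i)"
  shows "f = (g :: 'k dl_free)"
proof -
  have "F a b = H a b" for a b by (cases a; cases b) (simp add: assms(3))
  then have "F = H" by (intro ext)
  then show ?thesis using assms(1,2) by (intro poly_mapping_eqI) simp
qed

section \<open>Comparison with the presentation: outside its summation ranges the binomial
  coefficients vanish\<close>

lemma adem_2_eq: "\<lbrakk>p = 2; r > 2 * s\<rbrakk> \<Longrightarrow> adem_2 r s = adem_rel (False, r) (False, s)"
proof (rule pm_eq_pair_diffI[OF _ coef_adem_rel])
  assume *: "p = 2" "r > 2 * s"
  have fin: "finite {i. r \<le> 2 * i \<and> i < r - s}"
    by (rule finite_subset[OF _ finite_adem_indices[of r "r - s"]]) (use *(1) in auto)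
  show "coef (adem_2 r s) w = (if w = [(False, r), (False, s)] then 1 else 0) -
      pair_val (\<lambda>a b. if fst a = False \<and> fst b = False \<and> snd a + snd b = r + s \<and> snd b \<in> {i. r \<le> 2 * i \<and> i < r - s}
        then B (snd b - s - 1) (2 * snd b - r) else 0) w" for w
    unfolding adem_2_def lookup_minus coef_quad_sum[OF fin] coef_word by simp
  fix e u e' i
  have "ibinom (i - s - 1) (2 * i - r) = 0" if "i \<notin> {i. r \<le> 2 * i \<and> i < r - s}"
    using that by (intro ibinom_eq_0) auto
  then show "(if fst (e, u) = False \<and> fst (e', i) = False \<and> snd (e, u) + snd (e', i) = r + s \<and> snd (e', i) \<in> {i. r \<le> 2 * i \<and> i < r - s}
        then B (snd (e', i) - s - 1) (2 * snd (e', i) - r) else 0) = acoef (False, r) (False, s) (e, u) (e', i)"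
    unfolding acoef_def sgn_k_p2[OF *(1)] adm_def Let_def using * by (auto simp: dl_gens_def)
qed

lemma adem_odd_Q_eq: "\<lbrakk>p \<noteq> 2; r > int p * s\<rbrakk> \<Longrightarrow> adem_odd_Q p e r s = adem_rel (e, r) (False, s)"
proof (rule pm_eq_pair_diffI[OF _ coef_adem_rel])
  assume *: "p \<noteq> 2" "r > int p * s"
  let ?S = "adem_indices r s"
  show "coef (adem_odd_Q p e r s) w = (if w = [(e, r), (False, s)] then 1 else 0) -
      pair_val (\<lambda>a b. if fst a = e \<and> fst b = False \<and> snd a + snd b = r + s \<and> snd b \<in> ?S
        then (- 1) powi (r + snd b) * B ((int p - 1) * (snd b - s) - 1) (int p * snd b - r) else 0) w" for w
    unfolding adem_odd_Q_def lookup_minus coef_quad_sum[OF finite_adem_indices] coef_word by simp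
  fix f u f' i
  have "ibinom ((int p - 1) * (i - s) - 1) (int p * i - r) = 0" if "i \<notin> ?S"
    using that by (intro ibinom_eq_0) (auto simp: algebra_simps)
  then show "(if fst (f, u) = e \<and> fst (f', i) = False \<and> snd (f, u) + snd (f', i) = r + s \<and> snd (f', i) \<in> ?S
        then (- 1) powi (r + snd (f', i)) * B ((int p - 1) * (snd (f', i) - s) - 1) (int p * snd (f', i) - r) else 0)
     = acoef (e, r) (False, s) (f, u) (f', i)"
    using * by (auto simp: acoef_def adm_def dl_gens_def sgn_k_def[symmetric] Let_def)
qed

lemma adem_odd_QbQ_eq: "\<lbrakk>p \<noteq> 2; r \<ge> int p * s\<rbrakk> \<Longrightarrow> adem_odd_QbQ p r s = adem_rel (False, r) (True, s)"
proof (rule pm_eq_pair_diffI[OF _ coef_adem_rel])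
  assume *: "p \<noteq> 2" "r \<ge> int p * s"
  let ?S = "adem_indices r s"
  let ?F = "\<lambda>a b. if fst a = True \<and> fst b = False \<and> snd a + snd b = r + s \<and> snd b \<in> ?S
        then (- 1) powi (r + snd b) * B ((int p - 1) * (snd b - s)) (int p * snd b - r) else 0"
  let ?H = "\<lambda>a b. if fst a = False \<and> fst b = True \<and> snd a + snd b = r + s \<and> snd b \<in> ?S
        then (- 1) powi (r + snd b) * B ((int p - 1) * (snd b - s) - 1) (int p * snd b - r - 1) else 0"
  have "pair_val (\<lambda>a b. ?F a b - ?H a b) w = pair_val ?F w - pair_val ?H w" for w
    by (auto simp: pair_val_def split: list.splits)
  then show "coef (adem_odd_QbQ p r s) w = (if w = [(False, r), (True, s)] then 1 else 0) -
      pair_val (\<lambda>a b. ?F a b - ?H a b) w" for w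
    unfolding adem_odd_QbQ_def lookup_minus lookup_add coef_quad_sum[OF finite_adem_indices] coef_word
    by simp
  fix f u f' i
  have "ibinom ((int p - 1) * (i - s)) (int p * i - r) = 0" if "i \<notin> ?S"
    using that by (intro ibinom_eq_0) (auto simp: algebra_simps)
  moreover have "ibinom ((int p - 1) * (i - s) - 1) (int p * i - r - 1) = 0" if "i \<notin> ?S"
    using that by (intro ibinom_eq_0) (auto simp: algebra_simps)
  ultimately show "?F (f, u) (f', i) - ?H (f, u) (f', i) = acoef (False, r) (True, s) (f, u) (f', i)"
    using * by (auto simp: acoef_def adm_def dl_gens_def sgn_k_def[symmetric] Let_def)
qed

lemma adem_odd_bQbQ_eq: "\<lbrakk>p \<noteq> 2; r \<ge> int p * s\<rbrakk> \<Longrightarrow> adem_odd_bQbQ p r s = adem_rel (True, r) (True, s)"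
proof (rule pm_eq_pair_diffI[OF _ coef_adem_rel])
  assume *: "p \<noteq> 2" "r \<ge> int p * s"
  let ?S = "adem_indices r s"
  let ?H = "\<lambda>a b. if fst a = True \<and> fst b = True \<and> snd a + snd b = r + s \<and> snd b \<in> ?S
        then (- 1) powi (r + snd b) * B ((int p - 1) * (snd b - s) - 1) (int p * snd b - r - 1) else 0"
  have "pair_val (\<lambda>a b. - ?H a b) w = - pair_val ?H w" for w
    by (auto simp: pair_val_def split: list.splits)
  then show "coef (adem_odd_bQbQ p r s) w = (if w = [(True, r), (True, s)] then 1 else 0) -
      pair_val (\<lambda>a b. - ?H a b) w" for w
    unfolding adem_odd_bQbQ_def lookup_minus lookup_add coef_quad_sum[OF finite_adem_indices] coef_word
    by simp
  fix f u f' i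
  have "ibinom ((int p - 1) * (i - s) - 1) (int p * i - r - 1) = 0" if "i \<notin> ?S"
    using that by (intro ibinom_eq_0) (auto simp: algebra_simps)
  then show "- ?H (f, u) (f', i) = acoef (True, r) (True, s) (f, u) (f', i)"
    using * by (auto simp: acoef_def adm_def dl_gens_def sgn_k_def[symmetric] Let_def)
qed

lemma adem_relations_eq:
  "adem_relations p = {adem_rel x y | x y. x \<in> dl_gens p \<and> y \<in> dl_gens p \<and> \<not> adm x y}"
proof (cases "p = 2")
  case True
  have "adem_relations p = {adem_2 r s | r s. r > 2 * s}" by (simp add: adem_relations_def True)
  also have "\<dots> = {adem_rel (False, r) (False, s) | r s. r > 2 * s}"
    by (intro Collect_cong ex_cong1) (auto simp: adem_2_eq[OF True])
  also have "\<dots> = {adem_rel x y | x y. x \<in> dl_gens p \<and> y \<in> dl_gens p \<and> \<not> adm x y}"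
  proof (intro equalityI subsetI)
    fix z assume "z \<in> {adem_rel x y | x y. x \<in> dl_gens p \<and> y \<in> dl_gens p \<and> \<not> adm x y}"
    then obtain x y where xy: "z = adem_rel x y" "x \<in> dl_gens p" "y \<in> dl_gens p" "\<not> adm x y" by blast
    have f: "\<not> fst x" "\<not> fst y" using True xy(2,3) unfolding mem_dl_gens by blast+
    then have "x = (False, snd x)" "y = (False, snd y)" by (simp_all add: prod_eq_iff)
    then have "z = adem_rel (False, snd x) (False, snd y)" using xy(1) by metis
    moreover have "snd x > 2 * snd y" using xy(4) f True unfolding adm_def by simp
    ultimately show "z \<in> {adem_rel (False, r) (False, s) | r s. r > 2 * s}" by blast
  next
    fix z assume "z \<in> {adem_rel (False, r) (False, s) | r s. r > 2 * s}"
    then obtain r s where "z = adem_rel (False, r) (False, s)" "r > 2 * s" by blast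
    then show "z \<in> {adem_rel x y | x y. x \<in> dl_gens p \<and> y \<in> dl_gens p \<and> \<not> adm x y}"
    proof -
      have "(False, r) \<in> dl_gens p" "(False, s) \<in> dl_gens p" "\<not> adm (False, r) (False, s)"
        using \<open>r > 2 * s\<close> unfolding adm_def dl_gens_def by (auto simp: True)
      then show ?thesis using \<open>z = adem_rel (False, r) (False, s)\<close> by blast
    qed
  qed
  finally show ?thesis .
next
  case False
  have 1: "adem_relations p = {adem_odd_Q p e r s | e r s. r > int p * s} \<union>
      {adem_odd_QbQ p r s | r s. r \<ge> int p * s} \<union> {adem_odd_bQbQ p r s | r s. r \<ge> int p * s}"
    by (simp add: adem_relations_def False)
  have 2: "{adem_odd_Q p e r s | e r s. r > int p * s} = {adem_rel (e, r) (False, s) | e r s. r > int p * s}"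
    by (intro Collect_cong ex_cong1) (auto simp: adem_odd_Q_eq[OF False])
  have 3: "{adem_odd_QbQ p r s | r s. r \<ge> int p * s} = {adem_rel (False, r) (True, s) | r s. r \<ge> int p * s}"
    by (intro Collect_cong ex_cong1) (auto simp: adem_odd_QbQ_eq[OF False])
  have 4: "{adem_odd_bQbQ p r s | r s. r \<ge> int p * s} = {adem_rel (True, r) (True, s) | r s. r \<ge> int p * s}"
    by (intro Collect_cong ex_cong1) (auto simp: adem_odd_bQbQ_eq[OF False])
  show ?thesis
  proof (unfold 1 2 3 4, intro equalityI subsetI)
    fix z assume "z \<in> {adem_rel x y | x y. x \<in> dl_gens p \<and> y \<in> dl_gens p \<and> \<not> adm x y}"
    then obtain e r e' s where z: "z = adem_rel (e, r) (e', s)" "\<not> adm (e, r) (e', s)" by auto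
    have "\<not> e' \<longrightarrow> r > int p * s" "e' \<longrightarrow> r \<ge> int p * s" using z(2) by (auto simp: adm_def)
    then show "z \<in> {adem_rel (e, r) (False, s) | e r s. r > int p * s} \<union>
      {adem_rel (False, r) (True, s) | r s. r \<ge> int p * s} \<union> {adem_rel (True, r) (True, s) | r s. r \<ge> int p * s}"
      unfolding z(1) by (cases e; cases e'; simp only: simp_thms Un_iff mem_Collect_eq; blast)
  qed (fastforce simp: adm_def dl_gens_def False)
qed

text \<open>By \<open>bockstein_steenrod\<close>, the two relations with a Bockstein on the second letter reduce to the
  relation without Bocksteins, for the functions \<open>F1\<close> and \<open>F2\<close>.\<close>

lemma word_op_adem_rel:
  assumes "x \<in> dl_gens p" "y \<in> dl_gens p" "\<not> adm x y"
  shows "ev (\<lambda>w. word_op \<eta> w c J) (adem_rel x y) = 0"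
proof -
  obtain e r e' s where x: "x = (e, r)" and y: "y = (e', s)" by (metis surj_pair)
  define g where "g d = (if d then bockstein (\<eta> (int p * (int p * c))) else \<eta> (int p * (int p * c)))" for d
  define F where "F d = (\<lambda>a b. steenrod b (\<lambda>J. steenrod a (g d) J) J)" for d
  define F1 where "F1 d = (\<lambda>a b. steenrod b (\<lambda>J. steenrod a (\<lambda>J. bockstein (g d) J) J) J)" for d
  define F2 where "F2 d = (\<lambda>a b. steenrod b (\<lambda>J. steenrod a (\<lambda>J. milnor 1 (g d) J) J) J)" for d
  have dickson: "dickson (F d)" "dickson (F1 d)" "dickson (F2 d)" for d
    unfolding F_def F1_def F2_def by (rule dickson_steenrod)+
  \<comment> \<open>The Bockstein squares to zero, so if the first letter carries one, only the
    Milnor terms remain.\<close>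
  have F1: "F1 False = F True" "F1 True = (\<lambda>_ _. 0)"
    by (intro ext, simp add: F1_def F_def g_def)+
  have val: "word_op \<eta> [(d, u), (d', i)] c J =
      (if d' then F1 d (int p * c - u) (c - i) + F2 d (int p * c - u - 1) (c - i) else F d (int p * c - u) (c - i))" for d u d' i
  proof -
    have "bockstein (steenrod a h) = (\<lambda>J. steenrod a (bockstein h) J + steenrod (a - 1) (milnor 1 h) J)" for a h
      by (rule ext) (rule bockstein_steenrod)
    then show ?thesis by (simp add: F_def F1_def F2_def g_def steenrod_add)
  qed
  \<comment> \<open>In these transposed indices the relation becomes that of
    \<open>dickson_adem\<close>, with i replaced by c - i. Inadmissibility becomes a < p b, or a <=
    p b if the second letter has a Bockstein.\<close>
  define a b where "a = int p * c - r" and "b = c - s"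
  have bij: "bij_betw (\<lambda>i. c - i) (adem_indices r s) (adem_range a b)"
    by (rule bij_betwI[of _ _ _ "\<lambda>i. c - i"]) (auto simp: a_def b_def algebra_simps)
  have idx: "b - (c - i) = i - s" "a - int p * (c - i) = int p * i - r"
    "int p * c - (r + s - i) = a + b - (c - i)" for i
    by (simp_all add: a_def b_def algebra_simps)
  have sg: "sgn_k (a + (c - i)) = sgn_k (r + i)" for i
  proof (rule sgn_k_cong)
    have *: "a + (c - i) - (r + i) = (int p + 1) * c - 2 * (r + i)" by (simp add: a_def algebra_simps)
    show "even (a + (c - i) - (r + i)) \<or> p = 2" unfolding * using odd_p by (cases "p = 2") auto
  qed
  have reindex: "(\<Sum>b'\<in>adem_range a b. h b') = (\<Sum>i\<in>adem_indices r s. h (c - i))" for h :: "int \<Rightarrow> 'k"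
    by (rule sum.reindex_bij_betw[OF bij, symmetric])
  have ev: "ev (\<lambda>w. word_op \<eta> w c J) (adem_rel x y) = word_op \<eta> [(e, r), (e', s)] c J -
      (\<Sum>i\<in>adem_indices r s. \<Sum>d\<in>UNIV. \<Sum>d'\<in>UNIV. acoef x y (d, r + s - i) (d', i) * word_op \<eta> [(d, r + s - i), (d', i)] c J)"
    unfolding ev_adem_rel sum_acoef by (simp add: x y)
  have G: "(e, r) \<in> dl_gens p" "(e', s) \<in> dl_gens p" "\<not> adm (e, r) (e', s)" using assms by (simp_all add: x y)
  define \<sigma> where "\<sigma> i = sgn_k (r + i)" for i
  show ?thesis
  proof (cases e')
    case False
    have "a < int p * b" using assms(3) False by (simp add: a_def b_def adm_def x y algebra_simps)
    then have "F e a b = (\<Sum>i\<in>adem_indices r s. \<sigma> i * B ((int p - 1) * (i - s) - 1) (int p * i - r) * F e (int p * c - (r + s - i)) (c - i))"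
      using dickson_adem[OF dickson(1), of a b e] unfolding reindex sg idx \<sigma>_def by simp
    also have "\<dots> = (\<Sum>i\<in>adem_indices r s. \<Sum>d\<in>UNIV. \<Sum>d'\<in>UNIV. acoef x y (d, r + s - i) (d', i) * word_op \<eta> [(d, r + s - i), (d', i)] c J)"
      unfolding val UNIV_bool using False G by (intro sum.cong) (auto simp: acoef_def x y \<sigma>_def Let_def)
    finally show ?thesis unfolding ev val using False by (simp add: a_def b_def)
  next
    case True
    have le: "a \<le> int p * b" using assms(3) True by (simp add: a_def b_def adm_def x y algebra_simps)
    let ?N = "\<lambda>i. (int p - 1) * (i - s)" and ?k = "\<lambda>i. int p * i - r"
    let ?a = "\<lambda>i. int p * c - (r + s - i)"
    have S1: "F1 e a b = (\<Sum>i\<in>adem_indices r s. \<sigma> i * (B (?N i) (?k i) - B (?N i - 1) (?k i - 1)) * F1 e (?a i) (c - i))"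
      using dickson_adem'[OF dickson(2) le, of e] unfolding reindex sg idx \<sigma>_def by simp
    have "F2 e (a - 1) b = (\<Sum>b'\<in>adem_range (a - 1) b. sgn_k (a - 1 + b') * B ((int p - 1) * (b - b') - 1) (a - 1 - int p * b') * F2 e (a - 1 + b - b') b')"
      using dickson_adem[OF dickson(3), of "a - 1" b e] le by simp
    \<comment> \<open>The Milnor terms satisfy the relation for a - 1. Its range differs from the
      one for a only in indices with vanishing binomial coefficients.\<close>
    also have "\<dots> = (\<Sum>b'\<in>adem_range a b. sgn_k (a - 1 + b') * B ((int p - 1) * (b - b') - 1) (a - 1 - int p * b') * F2 e (a - 1 + b - b') b')"
    proof (rule sum.mono_neutral_cong)
      fix b' assume b': "b' \<in> adem_range (a - 1) b - adem_range a b"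
      then have "(int p - 1) * (b - b') - 1 < a - 1 - int p * b'" by (auto simp: algebra_simps)
      then show "sgn_k (a - 1 + b') * B ((int p - 1) * (b - b') - 1) (a - 1 - int p * b') * F2 e (a - 1 + b - b') b' = 0"
        by (simp add: ibinom_eq_0)
    next
      fix b' assume b': "b' \<in> adem_range a b - adem_range (a - 1) b"
      then have "a - 1 - int p * b' < 0" by auto
      then show "sgn_k (a - 1 + b') * B ((int p - 1) * (b - b') - 1) (a - 1 - int p * b') * F2 e (a - 1 + b - b') b' = 0"
        by (simp add: ibinom_eq_0)
    qed (rule finite_adem_range refl)+
    also have "\<dots> = (\<Sum>b'\<in>adem_range a b. - sgn_k (a + b') * B ((int p - 1) * (b - b') - 1) (a - int p * b' - 1) * F2 e (a + b - b' - 1) b')"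
    proof (rule sum.cong)
      fix b'
      have *: "sgn_k (a - 1 + b') = - sgn_k (a + b')"
        using sgn_k_add[of "a + b'" "- 1"] by (simp add: algebra_simps)
      have "a - 1 - int p * b' = a - int p * b' - 1" "a - 1 + b - b' = a + b - b' - 1" by simp_all
      then show "sgn_k (a - 1 + b') * B ((int p - 1) * (b - b') - 1) (a - 1 - int p * b') * F2 e (a - 1 + b - b') b'
        = - sgn_k (a + b') * B ((int p - 1) * (b - b') - 1) (a - int p * b' - 1) * F2 e (a + b - b' - 1) b'"
        unfolding * by (simp only:)
    qed simp
    finally have S2: "F2 e (a - 1) b = (\<Sum>i\<in>adem_indices r s. - \<sigma> i * B (?N i - 1) (?k i - 1) * F2 e (?a i - 1) (c - i))"
      unfolding reindex sg idx \<sigma>_def .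
    have "F1 e a b + F2 e (a - 1) b = (\<Sum>i\<in>adem_indices r s. \<Sum>d\<in>UNIV. \<Sum>d'\<in>UNIV. acoef x y (d, r + s - i) (d', i) * word_op \<eta> [(d, r + s - i), (d', i)] c J)"
      unfolding S1 S2 sum.distrib[symmetric]
    proof (rule sum.cong)
      fix i
      show "\<sigma> i * (B (?N i) (?k i) - B (?N i - 1) (?k i - 1)) * F1 e (?a i) (c - i) + - \<sigma> i * B (?N i - 1) (?k i - 1) * F2 e (?a i - 1) (c - i)
        = (\<Sum>d\<in>UNIV. \<Sum>d'\<in>UNIV. acoef x y (d, r + s - i) (d', i) * word_op \<eta> [(d, r + s - i), (d', i)] c J)"
        unfolding val UNIV_bool using True G F1
        by (cases e) (simp_all add: acoef_def x y \<sigma>_def Let_def algebra_simps)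
    qed simp
    then show ?thesis unfolding ev val using True by (simp add: a_def b_def)
  qed
qed

section \<open>Termination of rewriting\<close>

definition reduces :: "dl_gen list \<Rightarrow> dl_gen list \<Rightarrow> bool"
  where "reduces w w' \<longleftrightarrow> (\<exists>u x y a b v. w = u @ [x, y] @ v \<and> w' = u @ [a, b] @ v \<and> acoef x y a b \<noteq> 0)"

text \<open>
  The first summand of \<open>score (x # w)\<close> is, up to the Bockstein of \<open>x\<close>, the exponent in the Dickson
  invariants that corresponds to the letter \<open>x\<close>. Rewriting makes a larger exponent increase at the
  expense of \<open>p\<close> times a smaller one to its left.
\<close>

definition suffix_shift :: "dl_gen list \<Rightarrow> int"
  where "suffix_shift w = (\<Sum>x\<leftarrow>w. of_bool (fst x) - (int p - 1) * snd x)"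

fun score :: "dl_gen list \<Rightarrow> int"
  where
    "score [] = 0"
  | "score (x # w) = snd x + suffix_shift w - of_bool (fst x) + (int p + 1) * score w"

fun exponents :: "dl_gen list \<Rightarrow> int set"
  where
    "exponents [] = {}"
  | "exponents (x # w) = insert (snd x + suffix_shift w) (exponents w)"

lemma finite_exponents: "finite (exponents w)"
  by (induction w) auto

lemma suffix_shift_append [simp]: "suffix_shift (u @ v) = suffix_shift u + suffix_shift v"
  by (simp add: suffix_shift_def)

lemma acoef_suffix_shift:
  assumes "acoef x y a b \<noteq> 0" shows "suffix_shift [a, b] = suffix_shift [x, y]"
proof -
  have "(int p - 1) * snd a + (int p - 1) * snd b = (int p - 1) * snd x + (int p - 1) * snd y"
    using acoef_nz(7)[OF assms] by (simp only: distrib_left[symmetric])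
  then show ?thesis using acoef_nz(8)[OF assms] by (simp add: suffix_shift_def)
qed

text \<open>If the right exponent grows by n, the left one falls by p n, up to a Bockstein; as
  \<open>score\<close> counts the right one p + 1 times, it grows. If n = 0, a Bockstein has moved
  to the left, which contributes p - 1.\<close>

lemma acoef_exponents:
  assumes "acoef x y a b \<noteq> 0"
  shows "snd b < snd x + suffix_shift [y]" "snd a + suffix_shift [b] \<le> snd b"
    "snd a + suffix_shift [b] \<le> snd y"
    "score [x, y] < score [a, b]"
proof -
  note nz = acoef_nz[OF assms]
  have yb: "snd y \<le> snd b" using nz(9) by (simp add: of_bool_def split: if_splits)
  show "snd b < snd x + suffix_shift [y]" using nz(10) by (simp add: suffix_shift_def)
  have "snd a + suffix_shift [b] = snd x + snd y + of_bool (fst b) - int p * snd b"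
    using nz(7) by (simp add: suffix_shift_def algebra_simps)
  then show "snd a + suffix_shift [b] \<le> snd y" using nz(11) by simp
  then show "snd a + suffix_shift [b] \<le> snd b" using yb by simp
  have "score [a, b] - score [x, y] = snd b - snd y + (int p - 1) * (of_bool (fst y) - of_bool (fst b))"
    using nz(7,8) by (simp add: suffix_shift_def algebra_simps)
  then show "score [x, y] < score [a, b]"
    using nz(9,12) p_ge_2 yb by (cases "fst y"; cases "fst b"; cases "fst a"; cases "fst x") simp_all
qed

lemma exponents_context:
  assumes "suffix_shift v = suffix_shift v'" "\<forall>z\<in>exponents v'. \<exists>y\<in>exponents v. R z y" "\<And>z. R z z"
  shows "\<forall>z\<in>exponents (u @ v'). \<exists>y\<in>exponents (u @ v). R z y"
proof (induction u)
  case (Cons x u)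
  show ?case using Cons.IH assms(1,3) by auto
qed (use assms(2) in simp)

text \<open>The first two claims say that an upper bound for the exponents persists under rewriting
  and a lower bound under its inverse.\<close>

lemma reduces_exponents:
  assumes "reduces w w'"
  shows "\<forall>z\<in>exponents w'. \<exists>y\<in>exponents w. z \<le> y" "\<forall>z\<in>exponents w. \<exists>y\<in>exponents w'. y \<le> z"
    "score w < score w'" "length w = length w'" "suffix_shift w = suffix_shift w'"
proof -
  obtain u x y a b v where w: "w = u @ [x, y] @ v" "w' = u @ [a, b] @ v" "acoef x y a b \<noteq> 0"
    using assms by (auto simp: reduces_def)
  note e = acoef_exponents[OF w(3)]
  have sh: "suffix_shift ([x, y] @ v) = suffix_shift ([a, b] @ v)"
    using acoef_suffix_shift[OF w(3)] by (simp only: suffix_shift_append)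
  have c: "suffix_shift (z # v) = suffix_shift [z] + suffix_shift v" for z
    using suffix_shift_append[of "[z]" v] by simp
  have "\<forall>z\<in>exponents ([a, b] @ v). \<exists>y\<in>exponents ([x, y] @ v). z \<le> y"
    using e(1,2) by (auto simp: c)
  from exponents_context[OF sh this] show "\<forall>z\<in>exponents w'. \<exists>y\<in>exponents w. z \<le> y"
    unfolding w by simp
  have "\<forall>z\<in>exponents ([x, y] @ v). \<exists>y\<in>exponents ([a, b] @ v). z \<ge> y"
    using e by (auto simp: c intro: order.trans[of _ "snd b + _"])
  from exponents_context[OF sh[symmetric] this] show "\<forall>z\<in>exponents w. \<exists>y\<in>exponents w'. y \<le> z"
    unfolding w by simp
  have "score ([x, y] @ v) < score ([a, b] @ v)" using e(4) by (simp add: c algebra_simps)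
  then have "score (u @ [x, y] @ v) < score (u @ [a, b] @ v)"
  proof (induction u)
    case (Cons z u)
    have "suffix_shift (u @ [x, y] @ v) = suffix_shift (u @ [a, b] @ v)"
      unfolding suffix_shift_append using acoef_suffix_shift[OF w(3)] by simp
    then show ?case using Cons.IH[OF Cons.prems] by simp
  qed simp
  then show "score w < score w'" unfolding w .
  show "length w = length w'" "suffix_shift w = suffix_shift w'" unfolding w using sh by simp_all
qed

text \<open>There is no bound for the measure on all words; each word brings its own bound M, which
  is inherited along the relation.\<close>

lemma wf_bounded_measure:
  fixes f :: "'b \<Rightarrow> int"
  assumes step: "\<And>x y M. \<lbrakk>(y, x) \<in> R; bd M x\<rbrakk> \<Longrightarrow> bd M y \<and> f x < f y"
    and bound: "\<And>x M. bd M x \<Longrightarrow> f x \<le> U M" and total: "\<And>x. \<exists>M. bd M x"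
  shows "wf R"
proof -
  have "x \<in> Wellfounded.acc R" if "bd M x" for x M
    using that
  proof (induction "nat (U M - f x)" arbitrary: x rule: less_induct)
    case less
    show ?case
    proof (rule accI)
      fix y assume "(y, x) \<in> R"
      then have y: "bd M y" "f x < f y" using step less.prems by blast+
      then show "y \<in> Wellfounded.acc R"
        using bound[OF y(1)] by (intro less.hyps) auto
    qed
  qed
  then show ?thesis using total by (meson wf_iff_acc)
qed

fun score_bound :: "int \<Rightarrow> nat \<Rightarrow> int"
  where "score_bound M 0 = 0" | "score_bound M (Suc n) = M + (int p + 1) * score_bound M n"

lemma score_le: "\<forall>z\<in>exponents w. z \<le> M \<Longrightarrow> score w \<le> score_bound M (length w)"
proof (induction w)
  case (Cons x w)
  then have "(int p + 1) * score w \<le> (int p + 1) * score_bound M (length w)"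
    by (intro mult_left_mono) auto
  moreover have "snd x + suffix_shift w \<le> M" using Cons.prems by simp
  moreover have "(0::int) \<le> of_bool (fst x)" by simp
  ultimately show ?case unfolding score.simps score_bound.simps length_Cons by linarith
qed simp

text \<open>Passing to m - 1 absorbs the Bockstein that each letter may subtract.\<close>

lemma score_ge: "\<forall>z\<in>exponents w. m \<le> z \<Longrightarrow> score_bound (m - 1) (length w) \<le> score w"
proof (induction w)
  case (Cons x w)
  then have "(int p + 1) * score_bound (m - 1) (length w) \<le> (int p + 1) * score w"
    by (intro mult_left_mono) auto
  moreover have "m \<le> snd x + suffix_shift w" using Cons.prems by simp
  moreover have "of_bool (fst x) \<le> (1::int)" by simp
  ultimately show ?case unfolding score.simps score_bound.simps length_Cons by linarith
qed simp

text \<open>Rewriting keeps the length and an upper bound for the exponents, hence an upper bound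
  for the growing \<open>score\<close>.\<close>

lemma wf_reduces: "wf {(w', w). reduces w w'}"
proof (rule wf_bounded_measure[where f = score])
  define bd where "bd = (\<lambda>(M, n) w. length w = n \<and> (\<forall>z\<in>exponents w. z \<le> M))"
  show "bd Mn y \<and> score x < score y" if xy: "(y, x) \<in> {(w', w). reduces w w'}" and bd: "bd Mn x" for x y Mn
  proof -
    have "reduces x y" using xy by simp
    note r = reduces_exponents[OF this]
    show ?thesis using r(1,3,4) bd by (cases Mn) (fastforce simp: bd_def intro: order.trans)
  qed
  show "score x \<le> (\<lambda>(M, n). score_bound M n) Mn" if "bd Mn x" for x Mn
    using that score_le by (cases Mn) (auto simp: bd_def)
  show "\<exists>Mn. bd Mn x" for x
    using bdd_above_finite[OF finite_exponents[of x]] by (auto simp: bdd_above_def bd_def)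
qed

text \<open>Rewriting with the dual relations goes against \<open>reduces\<close>. There a lower
  bound for the exponents persists while \<open>score\<close> falls.\<close>

lemma wf_reduces_converse: "wf {(w, w'). reduces w w'}"
proof (rule wf_bounded_measure[where f = "\<lambda>w. - score w"])
  define bd where "bd = (\<lambda>(m, n) w. length w = n \<and> (\<forall>z\<in>exponents w. m \<le> z))"
  show "bd Mn y \<and> - score x < - score y" if xy: "(y, x) \<in> {(w, w'). reduces w w'}" and bd: "bd Mn x" for x y Mn
  proof -
    have "reduces y x" using xy by simp
    note r = reduces_exponents[OF this]
    show ?thesis using r(2,3,4) bd by (cases Mn) (fastforce simp: bd_def intro: order.trans)
  qed
  show "- score x \<le> (\<lambda>(m, n). - score_bound (m - 1) n) Mn" if "bd Mn x" for x Mn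
    using that score_ge by (cases Mn) (auto simp: bd_def)
  show "\<exists>Mn. bd Mn x" for x
    using bdd_below_finite[OF finite_exponents[of x]] by (auto simp: bdd_below_def bd_def)
qed

lemma reduces_context: "reduces w w' \<Longrightarrow> reduces (u @ w @ v) (u @ w' @ v)"
proof -
  assume "reduces w w'"
  then obtain u' x y a b v' where w: "w = u' @ [x, y] @ v'" "w' = u' @ [a, b] @ v'" "acoef x y a b \<noteq> 0"
    by (auto simp: reduces_def)
  then show ?thesis
    unfolding reduces_def
    by (intro exI[of _ "u @ u'"] exI[of _ x] exI[of _ y] exI[of _ a] exI[of _ b] exI[of _ "v' @ v"]) simp
qed

lemma reduces_lists: "reduces w w' \<Longrightarrow> w \<in> lists (dl_gens p) \<longleftrightarrow> w' \<in> lists (dl_gens p)"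
  using acoef_nz(1-4) by (auto simp: reduces_def)

lemma reduces_word_deg: "reduces w w' \<Longrightarrow> word_deg p w = word_deg p w'"
  using acoef_deg by (fastforce simp: reduces_def word_deg_def)

end

section \<open>Normal forms in the Dyer-Lashof algebra\<close>

lemma ev_swap: "ev (\<lambda>u. ev (\<lambda>v. h u v) g) f = ev (\<lambda>v. ev (\<lambda>u. h u v) f) g"
proof -
  have "ev (\<lambda>u. ev (\<lambda>v. h u v) g) f = (\<Sum>u\<in>supp f. \<Sum>v\<in>supp g. coef f u * (coef g v * h u v))"
    by (simp add: ev_def sum_distrib_left)
  also have "\<dots> = (\<Sum>v\<in>supp g. \<Sum>u\<in>supp f. coef f u * (coef g v * h u v))" by (rule sum.swap)
  finally show ?thesis by (simp add: ev_def sum_distrib_left mult.left_commute)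
qed

lemma mem_free_algebra: "f \<in> carrier (free_algebra G) \<longleftrightarrow> supp f \<subseteq> lists G"
  by (simp add: free_algebra_def)

lemma free_algebra_simps [simp]:
  "f \<otimes>\<^bsub>free_algebra G\<^esub> g = word_mult f g" "f \<oplus>\<^bsub>free_algebra G\<^esub> g = f + g"
  "\<zero>\<^bsub>free_algebra G\<^esub> = 0" "\<one>\<^bsub>free_algebra G\<^esub> = sing [] 1"
  by (simp_all add: free_algebra_def)

lemma supp_word_mult_lists: "\<lbrakk>supp f \<subseteq> lists G; supp g \<subseteq> lists G\<rbrakk> \<Longrightarrow> supp (word_mult f g) \<subseteq> lists G"
  using supp_word_mult[of f g] by fastforce

lemma supp_add_subset: "\<lbrakk>supp f \<subseteq> S; supp g \<subseteq> S\<rbrakk> \<Longrightarrow> supp (f + g) \<subseteq> S"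
  using keys_add[of f g] by blast

lemma supp_diff_subset: "\<lbrakk>supp f \<subseteq> S; supp g \<subseteq> S\<rbrakk> \<Longrightarrow> supp (f - g :: 'b \<Rightarrow>\<^sub>0 'k::field) \<subseteq> S"
  using supp_diff[of f g] by blast

lemma supp_uminus [simp]: "supp (- f :: 'b \<Rightarrow>\<^sub>0 'k::field) = supp f"
  by (auto simp: in_keys_iff)

lemma ring_free_algebra: "ring (free_algebra G :: ('g list \<Rightarrow>\<^sub>0 'k::field) ring)"
proof (rule ringI)
  show "abelian_group (free_algebra G :: ('g list \<Rightarrow>\<^sub>0 'k) ring)"
  proof (rule abelian_groupI)
    fix x :: "'g list \<Rightarrow>\<^sub>0 'k" assume "x \<in> carrier (free_algebra G)"
    then show "\<exists>y\<in>carrier (free_algebra G). y \<oplus>\<^bsub>free_algebra G\<^esub> x = \<zero>\<^bsub>free_algebra G\<^esub>"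
      by (intro bexI[of _ "- x"]) (simp_all add: mem_free_algebra)
  qed (simp_all add: mem_free_algebra supp_add_subset ac_simps)
  show "Group.monoid (free_algebra G :: ('g list \<Rightarrow>\<^sub>0 'k) ring)"
    by (rule monoidI) (simp_all add: mem_free_algebra supp_word_mult_lists word_mult_assoc)
qed (simp_all add: word_mult_add_left word_mult_add_right)

context prime_field
begin

abbreviation FA :: "'k dl_free ring" where "FA \<equiv> free_algebra (dl_gens p)"
abbreviation DI :: "'k dl_free set" where "DI \<equiv> dl_ideal p"

interpretation FA: ring FA by (rule ring_free_algebra)

lemma supp_adem_rel: "supp (adem_rel x y) \<subseteq> insert [x, y] {[a, b] | a b. acoef x y a b \<noteq> 0}"
proof
  fix w assume "w \<in> supp (adem_rel x y)"
  then have nz: "coef (adem_rel x y) w \<noteq> 0" by (simp add: in_keys_iff)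
  show "w \<in> insert [x, y] {[a, b] | a b. acoef x y a b \<noteq> 0}"
  proof (cases "w = [x, y]")
    case False
    then have "pair_val (acoef x y) w \<noteq> 0" using nz by (simp add: coef_adem_rel)
    then have "length w = 2" "pair_val (acoef x y) w \<noteq> 0" by (auto intro: ccontr)
    then show ?thesis by (auto simp: length_Suc_conv numeral_2_eq_2)
  qed simp
qed

lemma adem_relations_carrier: "adem_relations p \<subseteq> carrier FA"
proof
  fix r :: "'k dl_free" assume "r \<in> adem_relations p"
  then obtain x y where r: "r = adem_rel x y" "x \<in> dl_gens p" "y \<in> dl_gens p" by (auto simp: adem_relations_eq)
  have "insert [x, y] {[a, b] | a b. acoef x y a b \<noteq> 0} \<subseteq> lists (dl_gens p)"
    using r(2,3) by (auto dest: acoef_nz(3,4))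
  then show "r \<in> carrier FA"
    unfolding mem_free_algebra r(1) by (rule order.trans[OF supp_adem_rel])
qed

lemma ideal_DI: "ideal DI FA"
  unfolding dl_ideal_def by (rule FA.genideal_ideal[OF adem_relations_carrier])

interpretation DI: ideal DI FA by (rule ideal_DI)

lemma DI_zero: "0 \<in> DI" using DI.zero_closed by simp

lemma DI_add: "\<lbrakk>f \<in> DI; g \<in> DI\<rbrakk> \<Longrightarrow> f + g \<in> DI" using DI.a_closed by simp

lemma DI_mult: "\<lbrakk>f \<in> DI; supp g \<subseteq> lists (dl_gens p)\<rbrakk> \<Longrightarrow> word_mult g f \<in> DI \<and> word_mult f g \<in> DI"
  using DI.I_l_closed DI.I_r_closed by (simp add: mem_free_algebra)

lemma DI_scale: "f \<in> DI \<Longrightarrow> pm_scale c f \<in> DI"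
  using DI_mult[of f "sing [] c"] by (simp add: word_mult_const)

lemma DI_uminus: "f \<in> DI \<Longrightarrow> - f \<in> DI" using DI_scale[of f "- 1"] by simp

lemma DI_diff: "\<lbrakk>f \<in> DI; g \<in> DI\<rbrakk> \<Longrightarrow> f - g \<in> DI"
  using DI_add[of f "- g"] DI_uminus[of g] by simp

lemma DI_sum: "(\<And>i. i \<in> S \<Longrightarrow> f i \<in> DI) \<Longrightarrow> sum f S \<in> DI"
  by (induction S rule: infinite_finite_induct) (auto simp: DI_zero DI_add)

lemma adem_rel_DI: "\<lbrakk>x \<in> dl_gens p; y \<in> dl_gens p; \<not> adm x y\<rbrakk> \<Longrightarrow> adem_rel x y \<in> DI"
  using FA.genideal_self[OF adem_relations_carrier] unfolding dl_ideal_def adem_relations_eq by blast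

definition kills_adem :: "(dl_gen list \<Rightarrow> 'k) \<Rightarrow> bool"
  where "kills_adem \<phi> \<longleftrightarrow> (\<forall>u v x y. x \<in> dl_gens p \<longrightarrow> y \<in> dl_gens p \<longrightarrow> \<not> adm x y \<longrightarrow>
    ev (\<lambda>w. \<phi> (u @ w @ v)) (adem_rel x y) = 0)"

text \<open>The elements killed by all these functionals at once form an ideal, because the
  functionals are stable under translation by words on either side. The kernel of a single one need
  not be an ideal.\<close>

lemma kills_adem_DI:
  assumes "f \<in> DI" "kills_adem \<phi>" shows "ev \<phi> f = 0"
proof -
  let ?K = "{f \<in> carrier FA. \<forall>\<phi>. kills_adem \<phi> \<longrightarrow> ev \<phi> f = 0}"
  have ctxt: "kills_adem (\<lambda>w. \<phi> (u @ w))" "kills_adem (\<lambda>w. \<phi> (w @ v))" if "kills_adem \<phi>" for \<phi> u v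
    unfolding kills_adem_def
  proof (safe)
    fix u' v' x y assume xy: "x \<in> dl_gens p" "y \<in> dl_gens p" "\<not> adm x y"
    have "ev (\<lambda>w. \<phi> ((u @ u') @ w @ v')) (adem_rel x y) = 0" "ev (\<lambda>w. \<phi> (u' @ w @ (v' @ v))) (adem_rel x y) = 0"
      using that xy unfolding kills_adem_def by blast+
    then show "ev (\<lambda>w. \<phi> (u @ u' @ w @ v')) (adem_rel x y) = 0" "ev (\<lambda>w. \<phi> ((u' @ w @ v') @ v)) (adem_rel x y) = 0"
      by simp_all
  qed
  have "ideal ?K FA"
  proof (rule idealI)
    show "subgroup ?K (add_monoid FA)"
    proof (rule group.subgroupI)
      show "group (add_monoid FA)" by (rule FA.a_group)
      fix a assume "a \<in> ?K"
      moreover have "inv\<^bsub>add_monoid FA\<^esub> a = - a" if "supp a \<subseteq> lists (dl_gens p)"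
        using FA.minus_equality[of "- a" a] that by (simp add: a_inv_def mem_free_algebra)
      ultimately show "inv\<^bsub>add_monoid FA\<^esub> a \<in> ?K" by (simp add: mem_free_algebra ev_uminus)
    next
      have "0 \<in> ?K" by (simp add: mem_free_algebra)
      then show "?K \<noteq> {}" by blast
    next
      fix a b assume "a \<in> ?K" "b \<in> ?K"
      then show "a \<otimes>\<^bsub>add_monoid FA\<^esub> b \<in> ?K" by (simp add: mem_free_algebra ev_add supp_add_subset)
    qed auto
  next
    fix a x assume a: "a \<in> ?K" and x: "x \<in> carrier FA"
    have "ev \<phi> (word_mult a x) = 0" "ev \<phi> (word_mult x a) = 0" if "kills_adem \<phi>" for \<phi>
    proof -
      show "ev \<phi> (word_mult x a) = 0" using a ctxt(1)[OF that] by (auto simp: ev_word_mult intro: ev_eq_0)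
      have "ev \<phi> (word_mult a x) = ev (\<lambda>v. ev (\<lambda>u. \<phi> (u @ v)) a) x"
        unfolding ev_word_mult by (rule ev_swap)
      then show "ev \<phi> (word_mult a x) = 0" using a ctxt(2)[OF that] by (auto intro: ev_eq_0)
    qed
    then show "x \<otimes>\<^bsub>FA\<^esub> a \<in> ?K" "a \<otimes>\<^bsub>FA\<^esub> x \<in> ?K"
      using a x by (simp_all add: mem_free_algebra supp_word_mult_lists)
  qed (rule ring_free_algebra)
  moreover have "adem_relations p \<subseteq> ?K"
  proof
    fix r :: "'k dl_free" assume r: "r \<in> adem_relations p"
    then obtain x y where xy: "r = adem_rel x y" "x \<in> dl_gens p" "y \<in> dl_gens p" "\<not> adm x y"
      by (auto simp: adem_relations_eq)
    have "ev \<phi> r = 0" if "kills_adem \<phi>" for \<phi>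
    proof -
      have "ev (\<lambda>w. \<phi> ([] @ w @ [])) (adem_rel x y) = 0"
        using that xy(2-4) unfolding kills_adem_def by blast
      then show ?thesis by (simp add: xy(1))
    qed
    then show "r \<in> ?K" using adem_relations_carrier r by blast
  qed
  ultimately have "DI \<subseteq> ?K" unfolding dl_ideal_def by (rule FA.genideal_minimal)
  then show ?thesis using assms by blast
qed

lemma length_supp_adem_rel: "w \<in> supp (adem_rel x y) \<Longrightarrow> length w = 2"
  using supp_adem_rel[of x y] by auto

lemma gen_op_ev: "gen_op x (\<lambda>c J. ev (\<lambda>w. \<Xi> w c J) f) = (\<lambda>c J. ev (\<lambda>w. gen_op x (\<Xi> w) c J) f)"
proof -
  have "milnor n (\<lambda>J. ev (\<lambda>w. \<Theta> w J) f) = (\<lambda>J. ev (\<lambda>w. milnor n (\<Theta> w) J) f)"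
    "steenrod a (\<lambda>J. ev (\<lambda>w. \<Theta> w J) f) = (\<lambda>J. ev (\<lambda>w. steenrod a (\<Theta> w) J) f)" for n a \<Theta>
    by (rule ext, simp add: ev_def milnor_sum milnor_scale steenrod_sum steenrod_scale)+
  then show ?thesis by (cases x) (intro ext, simp)
qed

lemma word_op_ev: "word_op (\<lambda>c J. ev (\<lambda>w. \<Xi> w c J) f) v = (\<lambda>c J. ev (\<lambda>w. word_op (\<Xi> w) v c J) f)"
  by (induction v arbitrary: \<Xi>) (auto simp: gen_op_ev)

text \<open>The relations are homogeneous in the length of words, so a functional given by the
  module may be restricted to one length.\<close>

lemma kills_adem_word_op: "kills_adem (\<lambda>w. if length w = n then word_op \<xi> w c J else 0)"
  unfolding kills_adem_def
proof (intro allI impI)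
  fix u v x y assume xy: "x \<in> dl_gens p" "y \<in> dl_gens p" "\<not> adm x y"
  show "ev (\<lambda>w. if length (u @ w @ v) = n then word_op \<xi> (u @ w @ v) c J else 0) (adem_rel x y) = 0"
  proof (cases "length u + 2 + length v = n")
    case True
    have "ev (\<lambda>w. if length (u @ w @ v) = n then word_op \<xi> (u @ w @ v) c J else 0) (adem_rel x y)
      = ev (\<lambda>w. word_op (word_op (word_op \<xi> u) w) v c J) (adem_rel x y)"
      using True by (intro ev_cong) (auto simp: length_supp_adem_rel word_op_append)
    also have "\<dots> = word_op (\<lambda>c J. ev (\<lambda>w. word_op (word_op \<xi> u) w c J) (adem_rel x y)) v c J"
      unfolding word_op_ev by simp
    also have "\<dots> = word_op (\<lambda>c J. ev (\<lambda>w::unit. 0) 0) v c J"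
      unfolding word_op_adem_rel[OF xy] by simp
    finally show ?thesis unfolding word_op_ev by simp
  next
    case False
    then show ?thesis by (intro ev_eq_0) (auto simp: length_supp_adem_rel)
  qed
qed

lemma DI_coef_short: "\<lbrakk>f \<in> DI; length w < 2\<rbrakk> \<Longrightarrow> coef f w = 0"
proof -
  assume f: "f \<in> DI" and w: "length w < 2"
  have "kills_adem (\<lambda>z. if z = w then 1 else 0)"
    unfolding kills_adem_def using w by (auto intro!: ev_eq_0 dest!: length_supp_adem_rel)
  from kills_adem_DI[OF f this] show ?thesis by (simp add: ev_indicator)
qed

section \<open>Existence and uniqueness of normal forms\<close>

definition adm_words :: "dl_gen list set"
  where "adm_words = {w \<in> lists (dl_gens p). successively adm w}"

text \<open>If \<open>f\<close> were not zero, its part of some length would be detected by a matrix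
  coefficient of the module, but these kill the ideal. This takes the place of a confluence
  check.\<close>

lemma adm_words_DI:
  assumes "f \<in> DI" "supp f \<subseteq> adm_words" shows "f = 0"
proof (rule ccontr)
  assume "f \<noteq> 0"
  then obtain w where w: "w \<in> supp f" by (metis in_keys_iff lookup_zero poly_mapping_eqI)
  define n where "n = length w"
  define S where "S = {v \<in> supp f. length v = n}"
  define fn where "fn = (\<Sum>v\<in>S. sing v (coef f v))"
  have finS: "finite S" by (simp add: S_def)
  have "coef fn w = (\<Sum>v\<in>S. if v = w then coef f v else 0)"
    unfolding fn_def lookup_sum by (rule sum.cong) (auto simp: coef_word)
  then have "coef fn w \<noteq> 0" using w finS by (simp add: S_def n_def in_keys_iff)
  then have "fn \<noteq> 0" by auto
  moreover have "supp fn \<subseteq> S" unfolding fn_def by (rule order.trans[OF supp_sum]) (auto split: if_splits)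
  then have "length v = n \<and> successively adm v" if "v \<in> supp fn" for v
    using that assms(2) by (auto simp: S_def adm_words_def)
  ultimately obtain T c J where "ev (\<lambda>w. word_op (goal_fun T) w c J) fn \<noteq> 0"
    using admissible_independent by blast
  moreover have "ev (\<lambda>w. word_op (goal_fun T) w c J) fn = ev (\<lambda>w. if length w = n then word_op (goal_fun T) w c J else 0) f"
  proof -
    have "ev (\<lambda>w. word_op (goal_fun T) w c J) fn = (\<Sum>v\<in>S. coef f v * word_op (goal_fun T) v c J)"
      unfolding fn_def ev_sum by simp
    also have "\<dots> = (\<Sum>v\<in>supp f. coef f v * (if length v = n then word_op (goal_fun T) v c J else 0))"
      by (rule sum.mono_neutral_cong_left) (auto simp: S_def)
    finally show ?thesis by (simp add: ev_def)
  qed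
  moreover have "ev (\<lambda>w. if length w = n then word_op (goal_fun T) w c J else 0) f = 0"
    by (rule kills_adem_DI[OF assms(1) kills_adem_word_op])
  ultimately show False by simp
qed

lemma not_successively_split:
  "\<not> successively P w \<Longrightarrow> \<exists>u x y v. w = u @ [x, y] @ v \<and> \<not> P x y"
proof (induction w)
  case (Cons z w)
  show ?case
  proof (cases "successively P w")
    case True
    then obtain y v where "w = y # v" "\<not> P z y" using Cons.prems by (cases w) (auto simp: successively_Cons)
    then show ?thesis by (intro exI[of _ "[]"]) auto
  next
    case False
    from Cons.IH[OF this] obtain u x y v where "w = u @ [x, y] @ v \<and> \<not> P x y" by blast
    then show ?thesis by (intro exI[of _ "z # u"]) auto
  qed
qed simp

text \<open>The normal form is confined to words reachable from \<open>w\<close>. This later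
  controls lengths, degrees and the order along which the contraction is defined.\<close>

lemma word_normal_form:
  "w \<in> lists (dl_gens p) \<Longrightarrow> \<exists>g. supp g \<subseteq> {z \<in> adm_words. reduces\<^sup>*\<^sup>* w z} \<and> sing w 1 - g \<in> DI"
proof (induction w rule: wf_induct_rule[OF wf_reduces])
  case (1 w)
  show ?case
  proof (cases "successively adm w")
    case True
    then show ?thesis using 1(2) DI_zero by (intro exI[of _ "sing w 1"]) (auto simp: adm_words_def)
  next
    case False
    then obtain u x y v where w: "w = u @ [x, y] @ v" and xy: "\<not> adm x y"
      using not_successively_split by blast
    then have G: "x \<in> dl_gens p" "y \<in> dl_gens p" "u \<in> lists (dl_gens p)" "v \<in> lists (dl_gens p)" using 1(2) by auto
    define S where "S = {(a, b). acoef x y a b \<noteq> 0}"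
    let ?w = "\<lambda>ab. u @ [fst ab, snd ab] @ v"
    have step: "reduces w (?w ab)" if "ab \<in> S" for ab
    proof -
      have "acoef x y (fst ab) (snd ab) \<noteq> 0" using that by (auto simp: S_def)
      then show ?thesis unfolding reduces_def w by blast
    qed
    have "\<exists>g. supp g \<subseteq> {z \<in> adm_words. reduces\<^sup>*\<^sup>* (?w ab) z} \<and> sing (?w ab) 1 - g \<in> DI" if "ab \<in> S" for ab
    proof (rule 1(1))
      show "(?w ab, w) \<in> {(w', w). reduces w w'}" using step[OF that] by simp
      show "?w ab \<in> lists (dl_gens p)" using reduces_lists[OF step[OF that]] 1(2) by simp
    qed
    then have "\<forall>ab\<in>S. \<exists>g. supp g \<subseteq> {z \<in> adm_words. reduces\<^sup>*\<^sup>* (?w ab) z} \<and> sing (?w ab) 1 - g \<in> DI" by blast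
    from bchoice[OF this] obtain g where
      g: "\<forall>ab\<in>S. supp (g ab) \<subseteq> {z \<in> adm_words. reduces\<^sup>*\<^sup>* (?w ab) z} \<and> sing (?w ab) 1 - g ab \<in> DI" by blast
    let ?g = "\<Sum>ab\<in>S. pm_scale (acoef x y (fst ab) (snd ab)) (g ab)"
    have "supp ?g \<subseteq> (\<Union>ab\<in>S. supp (g ab))"
      by (rule order.trans[OF supp_sum]) (use supp_pm_scale in fastforce)
    also have "\<dots> \<subseteq> {z \<in> adm_words. reduces\<^sup>*\<^sup>* w z}"
      using g step by (blast intro: converse_rtranclp_into_rtranclp)
    finally have "supp ?g \<subseteq> {z \<in> adm_words. reduces\<^sup>*\<^sup>* w z}" .
    moreover have "sing w 1 - ?g = word_mult (word_mult (sing u 1) (adem_rel x y)) (sing v 1)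
        + (\<Sum>ab\<in>S. pm_scale (acoef x y (fst ab) (snd ab)) (sing (?w ab) 1 - g ab))"
    proof (rule ev_eqI)
      fix \<phi>
      show "ev \<phi> (sing w 1 - ?g) = ev \<phi> (word_mult (word_mult (sing u 1) (adem_rel x y)) (sing v 1)
        + (\<Sum>ab\<in>S. pm_scale (acoef x y (fst ab) (snd ab)) (sing (?w ab) 1 - g ab)))"
        by (simp add: ev_diff ev_add ev_word_mult ev_sum ev_scale ev_adem_rel w S_def
            case_prod_unfold right_diff_distrib sum_subtractf)
    qed
    moreover have "word_mult (word_mult (sing u 1) (adem_rel x y)) (sing v 1) \<in> DI"
      using DI_mult adem_rel_DI[OF G(1,2) xy] G(3,4) by simp
    moreover have "(\<Sum>ab\<in>S. pm_scale (acoef x y (fst ab) (snd ab)) (sing (?w ab) 1 - g ab)) \<in> DI"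
      using g by (intro DI_sum DI_scale) auto
    ultimately show ?thesis using DI_add by (intro exI[of _ ?g]) simp
  qed
qed

lemma normal_form_exists:
  assumes "supp f \<subseteq> lists (dl_gens p)"
  shows "\<exists>g. supp g \<subseteq> {z \<in> adm_words. \<exists>w\<in>supp f. reduces\<^sup>*\<^sup>* w z} \<and> f - g \<in> DI"
proof -
  have "\<forall>w\<in>supp f. \<exists>g. supp g \<subseteq> {z \<in> adm_words. reduces\<^sup>*\<^sup>* w z} \<and> sing w 1 - g \<in> DI"
    using word_normal_form assms by blast
  from bchoice[OF this] obtain g where
    g: "\<forall>w\<in>supp f. supp (g w) \<subseteq> {z \<in> adm_words. reduces\<^sup>*\<^sup>* w z} \<and> sing w 1 - g w \<in> DI" by blast
  let ?g = "\<Sum>w\<in>supp f. pm_scale (coef f w) (g w)"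
  have "supp ?g \<subseteq> (\<Union>w\<in>supp f. supp (g w))"
    by (rule order.trans[OF supp_sum]) (use supp_pm_scale in fastforce)
  also have "\<dots> \<subseteq> {z \<in> adm_words. \<exists>w\<in>supp f. reduces\<^sup>*\<^sup>* w z}" using g by blast
  finally have "supp ?g \<subseteq> {z \<in> adm_words. \<exists>w\<in>supp f. reduces\<^sup>*\<^sup>* w z}" .
  moreover have "f - ?g = (\<Sum>w\<in>supp f. pm_scale (coef f w) (sing w 1 - g w))"
    by (rule ev_eqI) (simp add: ev_diff ev_sum ev_scale ev_def[of _ f] right_diff_distrib sum_subtractf)
  moreover have "(\<Sum>w\<in>supp f. pm_scale (coef f w) (sing w 1 - g w)) \<in> DI"
    using g by (intro DI_sum DI_scale) auto
  ultimately show ?thesis by auto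
qed

lemma dl_coset_eq: "dl_coset p f = {g. g - f \<in> DI}"
proof -
  have "dl_coset p f = (\<lambda>h. h + f) ` DI" unfolding a_r_coset_def' by auto
  also have "\<dots> = {g. g - f \<in> DI}" by (auto intro: image_eqI[of _ _ "_ - f"])
  finally show ?thesis .
qed

lemma dl_coset_eq_iff: "dl_coset p f = dl_coset p g \<longleftrightarrow> f - g \<in> DI"
proof
  assume "f - g \<in> DI"
  then have "h - f \<in> DI \<longleftrightarrow> h - g \<in> DI" for h
    using DI_add[of "h - f" "f - g"] DI_diff[of "h - g" "f - g"] by auto
  then show "dl_coset p f = dl_coset p g" by (simp add: dl_coset_eq)
next
  assume "dl_coset p f = dl_coset p g"
  moreover have "f \<in> dl_coset p f" using DI_zero by (simp add: dl_coset_eq)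
  ultimately show "f - g \<in> DI" by (simp add: dl_coset_eq)
qed

definition nf :: "'k dl_free set \<Rightarrow> 'k dl_free"
  where "nf X = (THE g. g \<in> X \<and> supp g \<subseteq> adm_words)"

lemma nf_eqI: "\<lbrakk>f - g \<in> DI; supp g \<subseteq> adm_words\<rbrakk> \<Longrightarrow> nf (dl_coset p f) = g"
  unfolding nf_def
proof (rule the_equality)
  assume fg: "f - g \<in> DI" "supp g \<subseteq> adm_words"
  show "g \<in> dl_coset p f \<and> supp g \<subseteq> adm_words"
    using fg DI_uminus[OF fg(1)] by (simp add: dl_coset_eq)
  fix h assume h: "h \<in> dl_coset p f \<and> supp h \<subseteq> adm_words"
  then have "(h - f) + (f - g) \<in> DI" using fg by (intro DI_add) (auto simp: dl_coset_eq)
  then have "h - g \<in> DI" by simp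
  then show "h = g" using adm_words_DI[of "h - g"] supp_diff_subset[of h adm_words g] h fg(2) by auto
qed

lemma nf_props:
  assumes "supp f \<subseteq> lists (dl_gens p)"
  shows "f - nf (dl_coset p f) \<in> DI" "supp (nf (dl_coset p f)) \<subseteq> adm_words"
    "\<And>z. z \<in> supp (nf (dl_coset p f)) \<Longrightarrow> \<exists>w\<in>supp f. reduces\<^sup>*\<^sup>* w z"
proof -
  obtain g where g: "supp g \<subseteq> {z \<in> adm_words. \<exists>w\<in>supp f. reduces\<^sup>*\<^sup>* w z}" "f - g \<in> DI"
    using normal_form_exists[OF assms] by blast
  then have "nf (dl_coset p f) = g" by (intro nf_eqI) auto
  then show "f - nf (dl_coset p f) \<in> DI" "supp (nf (dl_coset p f)) \<subseteq> adm_words"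
    "\<And>z. z \<in> supp (nf (dl_coset p f)) \<Longrightarrow> \<exists>w\<in>supp f. reduces\<^sup>*\<^sup>* w z" using g by auto
qed

lemma nf_add:
  assumes "supp f \<subseteq> lists (dl_gens p)" "supp g \<subseteq> lists (dl_gens p)"
  shows "nf (dl_coset p (f + g)) = nf (dl_coset p f) + nf (dl_coset p g)"
proof (rule nf_eqI)
  have "f + g - (nf (dl_coset p f) + nf (dl_coset p g)) = (f - nf (dl_coset p f)) + (g - nf (dl_coset p g))" by simp
  then show "f + g - (nf (dl_coset p f) + nf (dl_coset p g)) \<in> DI" using nf_props(1) assms DI_add by metis
  show "supp (nf (dl_coset p f) + nf (dl_coset p g)) \<subseteq> adm_words"
    using nf_props(2) assms by (blast intro: supp_add_subset[THEN subsetD])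
qed

lemma nf_word: "w \<in> adm_words \<Longrightarrow> nf (dl_coset p (sing w 1)) = sing w 1"
  by (rule nf_eqI) (auto simp: DI_zero)

section \<open>The Dyer-Lashof algebra and its augmentation ideal\<close>

abbreviation DL :: "'k dl_free set aug_graded_ring" where "DL \<equiv> dyer_lashof p"

lemma DL_simps:
  "aug_ideal DL = {dl_coset p f | f. f \<in> carrier FA \<and> coef f [] = 0}"
  "homog DL t = {dl_coset p f | f. f \<in> carrier FA \<and> (\<forall>w\<in>supp f. word_deg p w = t)}"
  "carrier DL = carrier (FA Quot DI)"
  "X \<otimes>\<^bsub>DL\<^esub> Y = X \<otimes>\<^bsub>FA Quot DI\<^esub> Y"
  "X \<oplus>\<^bsub>DL\<^esub> Y = X \<oplus>\<^bsub>FA Quot DI\<^esub> Y"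
  by (simp_all add: dyer_lashof_def ring.defs aug_graded_ring.defs)

lemma DL_mult: "\<lbrakk>supp f \<subseteq> lists (dl_gens p); supp g \<subseteq> lists (dl_gens p)\<rbrakk> \<Longrightarrow>
    dl_coset p f \<otimes>\<^bsub>DL\<^esub> dl_coset p g = dl_coset p (word_mult f g)"
  unfolding DL_simps FactRing_def using DI.rcoset_mult_add[of f g] by (simp add: mem_free_algebra)

lemma DL_add: "\<lbrakk>supp f \<subseteq> lists (dl_gens p); supp g \<subseteq> lists (dl_gens p)\<rbrakk> \<Longrightarrow>
    dl_coset p f \<oplus>\<^bsub>DL\<^esub> dl_coset p g = dl_coset p (f + g)"
  unfolding DL_simps FactRing_def using DI.a_rcos_sum[of f g] by (simp add: mem_free_algebra)

definition pos_words :: "dl_gen list set" where "pos_words = lists (dl_gens p) - {[]}"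

lemma aug_iff: "x \<in> aug_ideal DL \<longleftrightarrow> (\<exists>f. x = dl_coset p f \<and> supp f \<subseteq> pos_words)"
proof -
  have "supp f \<subseteq> pos_words \<longleftrightarrow> f \<in> carrier FA \<and> coef f [] = 0" for f :: "'k dl_free"
    unfolding mem_free_algebra pos_words_def by (auto simp: subset_Diff_insert in_keys_iff[of "[]"])
  then show ?thesis unfolding DL_simps by blast
qed

lemma pos_words_lists: "supp f \<subseteq> pos_words \<Longrightarrow> supp f \<subseteq> lists (dl_gens p)"
  by (auto simp: pos_words_def)

lemma supp_word_mult_pos: "\<lbrakk>supp f \<subseteq> pos_words; supp g \<subseteq> pos_words\<rbrakk> \<Longrightarrow> supp (word_mult f g) \<subseteq> pos_words"
  using supp_word_mult[of f g] by (fastforce simp: pos_words_def)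

lemma aug_mult: "\<lbrakk>x \<in> aug_ideal DL; y \<in> aug_ideal DL\<rbrakk> \<Longrightarrow> x \<otimes>\<^bsub>DL\<^esub> y \<in> aug_ideal DL"
  unfolding aug_iff by (metis DL_mult pos_words_lists supp_word_mult_pos)

lemma aug_add: "\<lbrakk>x \<in> aug_ideal DL; y \<in> aug_ideal DL\<rbrakk> \<Longrightarrow> x \<oplus>\<^bsub>DL\<^esub> y \<in> aug_ideal DL"
  unfolding aug_iff by (metis DL_add pos_words_lists supp_add_subset)

lemma aug_mult_assoc: "\<lbrakk>x \<in> aug_ideal DL; y \<in> aug_ideal DL; z \<in> aug_ideal DL\<rbrakk> \<Longrightarrow>
    (x \<otimes>\<^bsub>DL\<^esub> y) \<otimes>\<^bsub>DL\<^esub> z = x \<otimes>\<^bsub>DL\<^esub> (y \<otimes>\<^bsub>DL\<^esub> z)"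
  unfolding aug_iff by (auto simp: DL_mult pos_words_lists supp_word_mult_lists word_mult_assoc)

lemma aug_distrib: "\<lbrakk>x \<in> aug_ideal DL; y \<in> aug_ideal DL; z \<in> aug_ideal DL\<rbrakk> \<Longrightarrow>
    (x \<oplus>\<^bsub>DL\<^esub> y) \<otimes>\<^bsub>DL\<^esub> z = (x \<otimes>\<^bsub>DL\<^esub> z) \<oplus>\<^bsub>DL\<^esub> (y \<otimes>\<^bsub>DL\<^esub> z) \<and>
    z \<otimes>\<^bsub>DL\<^esub> (x \<oplus>\<^bsub>DL\<^esub> y) = (z \<otimes>\<^bsub>DL\<^esub> x) \<oplus>\<^bsub>DL\<^esub> (z \<otimes>\<^bsub>DL\<^esub> y)"
  unfolding aug_iff
  by (auto simp: DL_mult DL_add pos_words_lists supp_word_mult_lists supp_add_subset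
      word_mult_add_left word_mult_add_right)

lemma word_deg_append: "word_deg p (u @ v) = word_deg p u + word_deg p v"
  by (simp add: word_deg_def)

lemma homog_mult: "\<lbrakk>x \<in> homog DL s; y \<in> homog DL t\<rbrakk> \<Longrightarrow> x \<otimes>\<^bsub>DL\<^esub> y \<in> homog DL (s + t)"
proof -
  assume "x \<in> homog DL s" "y \<in> homog DL t"
  then obtain f g where f: "x = dl_coset p f" "supp f \<subseteq> lists (dl_gens p)" "\<forall>w\<in>supp f. word_deg p w = s"
    and g: "y = dl_coset p g" "supp g \<subseteq> lists (dl_gens p)" "\<forall>w\<in>supp g. word_deg p w = t"
    by (auto simp: DL_simps mem_free_algebra)
  have "\<forall>w\<in>supp (word_mult f g). word_deg p w = s + t"
    using supp_word_mult[of f g] f(3) g(3) by (force simp: word_deg_append)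
  then show ?thesis
    using f(1,2) g(1,2) supp_word_mult_lists[OF f(2) g(2)] by (auto simp: DL_simps(2) DL_mult mem_free_algebra)
qed

abbreviation word_elt :: "dl_gen list \<Rightarrow> 'k dl_free set" where "word_elt w \<equiv> dl_coset p (sing w 1)"

lemma word_elt_aug: "w \<in> pos_words \<Longrightarrow> word_elt w \<in> aug_ideal DL"
  unfolding aug_iff by (intro exI[of _ "sing w 1"]) simp

lemma word_elt_homog: "w \<in> pos_words \<Longrightarrow> word_elt w \<in> homog DL (word_deg p w)"
  unfolding DL_simps by (auto simp: mem_free_algebra pos_words_def)

lemma word_elt_mult: "\<lbrakk>u \<in> pos_words; v \<in> pos_words\<rbrakk> \<Longrightarrow> word_elt u \<otimes>\<^bsub>DL\<^esub> word_elt v = word_elt (u @ v)"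
  by (subst DL_mult) (auto simp: pos_words_def)

lemma append_pos_words: "\<lbrakk>u \<in> pos_words; v \<in> pos_words\<rbrakk> \<Longrightarrow> u @ v \<in> pos_words"
  by (auto simp: pos_words_def)

text \<open>Here it matters that \<open>'k\<close> is a prime field: additive maps are linear.\<close>

lemma additive_word_expansion:
  assumes add: "\<And>x y. \<lbrakk>x \<in> aug_ideal DL; y \<in> aug_ideal DL\<rbrakk> \<Longrightarrow> L (x \<oplus>\<^bsub>DL\<^esub> y) = L x + L y"
    and f: "supp f \<subseteq> pos_words"
  shows "L (dl_coset p f) = ev (\<lambda>w. L (word_elt w)) f"
proof -
  have add': "L (dl_coset p (g + h)) = L (dl_coset p g) + L (dl_coset p h)"
    if "supp g \<subseteq> pos_words" "supp h \<subseteq> pos_words" for g h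
    using add[of "dl_coset p g" "dl_coset p h"] that by (auto simp: aug_iff DL_add pos_words_lists)
  have "L (dl_coset p 0) = L (dl_coset p 0) + L (dl_coset p 0)"
    using add'[of 0 0] by (simp only: add_0_left keys_zero empty_subsetI)
  then have zero: "L (dl_coset p 0) = 0" by (simp only: add_cancel_right_right)
  have nat: "L (dl_coset p (sing w (of_nat n))) = of_nat n * L (word_elt w)" if "w \<in> pos_words" for w n
  proof (induction n)
    case (Suc n)
    have "L (dl_coset p (sing w (of_nat (Suc n)))) = L (dl_coset p (sing w 1 + sing w (of_nat n)))"
      by (simp only: single_add[symmetric] of_nat_Suc)
    also have "\<dots> = L (word_elt w) + L (dl_coset p (sing w (of_nat n)))"
      by (rule add') (use that in auto)
    finally show ?case using Suc.IH by (simp add: algebra_simps)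
  qed (simp add: zero)
  have single: "L (dl_coset p (sing w c)) = c * L (word_elt w)" if "w \<in> pos_words" for w c
    using of_nat_surj[of c] nat[OF that] by auto
  show ?thesis using f
  proof (induction f rule: pm_induct)
    case (add w c g)
    then show ?case using add'[of "sing w c" g] single[of w c] by (auto simp: ev_add)
  qed (simp add: zero)
qed

text \<open>The admissible nonempty words form a basis of the augmentation ideal.\<close>

definition basis :: "dl_gen list set" where "basis = adm_words - {[]}"

lemma basis_pos: "w \<in> basis \<Longrightarrow> w \<in> pos_words"
  by (auto simp: basis_def pos_words_def adm_words_def)

lemma reduces_star_props:
  "reduces\<^sup>*\<^sup>* w z \<Longrightarrow> length z = length w \<and> word_deg p z = word_deg p w"
  by (induction rule: rtranclp_induct) (auto simp: reduces_exponents(4) dest: reduces_word_deg reduces_exponents(4))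

lemma nf_pos:
  assumes "supp f \<subseteq> pos_words"
  shows "supp (nf (dl_coset p f)) \<subseteq> basis" "dl_coset p (nf (dl_coset p f)) = dl_coset p f"
proof -
  note n = nf_props[OF pos_words_lists[OF assms]]
  have "z \<noteq> []" if "z \<in> supp (nf (dl_coset p f))" for z
    using n(3)[OF that] assms reduces_star_props by (force simp: pos_words_def)
  then show "supp (nf (dl_coset p f)) \<subseteq> basis" using n(2) by (auto simp: basis_def)
  show "dl_coset p (nf (dl_coset p f)) = dl_coset p f"
    unfolding dl_coset_eq_iff using DI_uminus[OF n(1)] by simp
qed

lemma nf_aug: "x \<in> aug_ideal DL \<Longrightarrow> supp (nf x) \<subseteq> basis \<and> dl_coset p (nf x) = x"
  using nf_pos by (auto simp: aug_iff)

lemma nf_aug_add: "\<lbrakk>x \<in> aug_ideal DL; y \<in> aug_ideal DL\<rbrakk> \<Longrightarrow> nf (x \<oplus>\<^bsub>DL\<^esub> y) = nf x + nf y"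
  by (auto simp: aug_iff DL_add pos_words_lists nf_add)

lemma nf_homog: "\<lbrakk>x \<in> homog DL d; w \<in> supp (nf x)\<rbrakk> \<Longrightarrow> word_deg p w = d"
  using nf_props(3) reduces_star_props by (fastforce simp: DL_simps mem_free_algebra)

lemma additive_expansion:
  assumes "\<And>x y. \<lbrakk>x \<in> aug_ideal DL; y \<in> aug_ideal DL\<rbrakk> \<Longrightarrow> L (x \<oplus>\<^bsub>DL\<^esub> y) = L x + L y"
    and "x \<in> aug_ideal DL"
  shows "L x = ev (\<lambda>w. L (word_elt w)) (nf x)"
  using additive_word_expansion[of L "nf x", OF assms(1)] nf_aug[OF assms(2)] basis_pos by auto

end

section \<open>Cohomology of the bar construction\<close>

locale augmented_graded =
  fixes A :: "('a, 'm) aug_graded_ring_scheme" (structure)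
  assumes aug_closed_mult: "\<lbrakk>x \<in> aug_ideal A; y \<in> aug_ideal A\<rbrakk> \<Longrightarrow> x \<otimes> y \<in> aug_ideal A"
    and aug_closed_add: "\<lbrakk>x \<in> aug_ideal A; y \<in> aug_ideal A\<rbrakk> \<Longrightarrow> x \<oplus> y \<in> aug_ideal A"
    and aug_assoc: "\<lbrakk>x \<in> aug_ideal A; y \<in> aug_ideal A; z \<in> aug_ideal A\<rbrakk> \<Longrightarrow> (x \<otimes> y) \<otimes> z = x \<otimes> (y \<otimes> z)"
    and aug_distl: "\<lbrakk>x \<in> aug_ideal A; y \<in> aug_ideal A; z \<in> aug_ideal A\<rbrakk> \<Longrightarrow> (x \<oplus> y) \<otimes> z = (x \<otimes> z) \<oplus> (y \<otimes> z)"
    and aug_distr: "\<lbrakk>x \<in> aug_ideal A; y \<in> aug_ideal A; z \<in> aug_ideal A\<rbrakk> \<Longrightarrow> z \<otimes> (x \<oplus> y) = (z \<otimes> x) \<oplus> (z \<otimes> y)"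
    and homog_closed_mult: "\<lbrakk>x \<in> homog A s; y \<in> homog A t\<rbrakk> \<Longrightarrow> x \<otimes> y \<in> homog A (s + t)"
begin

definition bar_sgn :: "int \<Rightarrow> 'k::field" where "bar_sgn d = (- 1) powi (1 + d)"

lemma powi_minus_one_add: "(- 1) powi (m + n) = ((- 1) powi m * (- 1) powi n :: 'k::field)"
  by (rule power_int_add) simp

lemma bar_sgn_square [simp]: "bar_sgn d * bar_sgn d = (1::'k::field)" "bar_sgn d * (bar_sgn d * x) = (x::'k)"
  by (simp_all add: bar_sgn_def)

lemma bar_sgn_add: "bar_sgn (d + e) = - (bar_sgn d * bar_sgn e :: 'k::field)"
  by (simp add: bar_sgn_def powi_minus_one_add)

lemma bar_codiff_short [simp]: "bar_codiff A f [] ds = (0::'k::field)" "bar_codiff A f [x] ds = (0::'k)"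
  by (simp_all add: bar_codiff_def)

text \<open>The recursion behind the inductions below: the first entry is merged with the second, or
  the differential acts behind it and passes an element of total degree 1 + d.\<close>

lemma bar_codiff_Cons:
  "bar_codiff A f (x # y # xs) (d # ds)
    = (bar_sgn d :: 'k::field) * (f ((x \<otimes> y) # xs) + bar_codiff A (\<lambda>l. f (x # l)) (y # xs) ds)"
proof -
  have e: "(- 1) powi (int (Suc (Suc i)) + (d + s)) = bar_sgn d * (- 1) powi (int (Suc i) + s)" for i s
  proof -
    have "int (Suc (Suc i)) + (d + s) = (1 + d) + (int (Suc i) + s)" by simp
    then show ?thesis by (simp only: bar_sgn_def powi_minus_one_add mult.assoc)
  qed
  have m: "bar_merge A (Suc i) (x # y # xs) = x # bar_merge A i (y # xs)" for i
    by (simp add: bar_merge_def)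
  have "bar_codiff A f (x # y # xs) (d # ds) = (\<Sum>i<Suc (length xs).
      (- 1) powi (int (Suc i) + sum_list (take (Suc i) (d # ds))) * f (bar_merge A i (x # y # xs)))"
    by (simp add: bar_codiff_def)
  also have "\<dots> = bar_sgn d * f ((x \<otimes> y) # xs) + (\<Sum>i<length xs.
      bar_sgn d * ((- 1) powi (int (Suc i) + sum_list (take (Suc i) ds)) * f (x # bar_merge A i (y # xs))))"
    unfolding sum.lessThan_Suc_shift
    by (intro arg_cong2[where f = "(+)"] sum.cong)
      (simp_all add: m e mult.assoc[symmetric] del: of_nat_Suc, simp_all add: bar_merge_def bar_sgn_def)
  finally show ?thesis by (simp add: bar_codiff_def distrib_left sum_distrib_left)
qed

lemma bar_codiff_add: "bar_codiff A (\<lambda>l. f l + g l) xs ds = bar_codiff A f xs ds + bar_codiff A g xs ds"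
  by (simp add: bar_codiff_def distrib_left sum.distrib)

lemma bar_codiff_scale: "bar_codiff A (\<lambda>l. c * f l) xs ds = c * bar_codiff A f xs ds"
  by (simp add: bar_codiff_def sum_distrib_left mult.left_commute)

lemma bar_codiff_diff: "bar_codiff A (\<lambda>l. f l - g l) xs ds = bar_codiff A f xs ds - bar_codiff A g xs ds"
  by (simp add: bar_codiff_def right_diff_distrib sum_subtractf)

text \<open>The differential squares to zero. Its formula involves the degrees of the entries and
  thus is not a function of the tuple alone; D stands for a function that agrees with it on
  homogeneous tuples.\<close>

lemma bar_codiff_codiff:
  fixes h :: "'a list \<Rightarrow> 'k::field"
  assumes "\<And>ys es. bar_homogeneous A (Suc s) ys es \<Longrightarrow> D ys = bar_codiff A h ys es"
    and "bar_homogeneous A (Suc (Suc s)) xs ds"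
  shows "bar_codiff A D xs ds = 0"
  using assms
proof (induction s arbitrary: h D xs ds)
  case 0
  from 0(2) obtain x y d e where xs: "xs = [x, y]" "ds = [d, e]"
    and h: "x \<in> aug_ideal A \<inter> homog A d" "y \<in> aug_ideal A \<inter> homog A e"
    by (auto simp: bar_homogeneous_def length_Suc_conv list_all2_Cons1)
  have "D [x \<otimes> y] = bar_codiff A h [x \<otimes> y] [d + e]"
    using h by (intro 0(1)) (auto simp: bar_homogeneous_def intro: aug_closed_mult homog_closed_mult)
  then show ?case by (simp add: xs bar_codiff_Cons)
next
  case (Suc s)
  from Suc.prems(2) obtain x y z us d e g gs where xs: "xs = x # y # z # us" "ds = d # e # g # gs"
    by (auto simp: bar_homogeneous_def length_Suc_conv list_all2_Cons1)
  have len: "length us = s" and x: "x \<in> aug_ideal A" "x \<in> homog A d" and y: "y \<in> aug_ideal A" "y \<in> homog A e"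
    and z: "z \<in> aug_ideal A" "z \<in> homog A g" and us: "list_all2 (\<lambda>x d. x \<in> aug_ideal A \<inter> homog A d) us gs"
    using Suc.prems(2) by (auto simp: xs bar_homogeneous_def)
  \<comment> \<open>K collects the terms that merge x with the next entry. The rest D' is the
    differential of \<open>\<lambda>l. h (x # l)\<close>, so the induction hypothesis applies to
    it.\<close>
  define K where "K l = h ((x \<otimes> hd l) # tl l)" for l
  define D' where "D' l = bar_sgn d * D (x # l) - K l" for l
  have Dx: "(\<lambda>l. D (x # l)) = (\<lambda>l. bar_sgn d * (K l + D' l))" by (simp add: D'_def)
  have "bar_codiff A D' (y # z # us) (e # g # gs) = 0"
  proof (rule Suc.IH)
    fix ys es assume ys: "bar_homogeneous A (Suc s) ys es"
    then obtain v vs where v: "ys = v # vs" by (auto simp: bar_homogeneous_def length_Suc_conv)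
    have "D (x # ys) = bar_codiff A h (x # ys) (d # es)"
      using ys x by (intro Suc.prems(1)) (auto simp: bar_homogeneous_def)
    then show "D' ys = bar_codiff A (\<lambda>l. h (x # l)) ys es" by (simp add: D'_def v bar_codiff_Cons K_def)
  qed (use y z us len in \<open>auto simp: bar_homogeneous_def\<close>)
  moreover have "bar_codiff A K (y # z # us) (e # g # gs)
      = bar_sgn e * (h ((x \<otimes> (y \<otimes> z)) # us) + bar_codiff A (\<lambda>l. h ((x \<otimes> y) # l)) (z # us) (g # gs))"
    by (simp add: bar_codiff_Cons K_def)
  moreover have "D ((x \<otimes> y) # z # us) = bar_codiff A h ((x \<otimes> y) # z # us) ((d + e) # g # gs)"
    using x y z us len by (intro Suc.prems(1)) (auto simp: bar_homogeneous_def intro: aug_closed_mult homog_closed_mult)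
  moreover have "(x \<otimes> y) \<otimes> z = x \<otimes> (y \<otimes> z)" using x y z by (intro aug_assoc)
  ultimately show ?case
    by (simp add: xs bar_codiff_Cons[of D] Dx bar_codiff_scale bar_codiff_add)
      (simp add: bar_codiff_Cons[of h] bar_sgn_add algebra_simps)
qed

section \<open>Cup products of cochains\<close>

definition tensor :: "nat \<Rightarrow> ('a list \<Rightarrow> 'k::field) \<Rightarrow> ('a list \<Rightarrow> 'k) \<Rightarrow> 'a list \<Rightarrow> 'k"
  where "tensor s f g xs = f (take s xs) * g (drop s xs)"

text \<open>The Leibniz rule: a merge among the first s + 1 entries concerns f, a merge behind the
  first s entries concerns g, with the sign for passing these s entries.\<close>

lemma bar_codiff_tensor:
  fixes f g :: "'a list \<Rightarrow> 'k::field"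
  assumes "length xs = s + Suc s'" "length ds = length xs"
  shows "bar_codiff A (tensor s f g) xs ds = bar_codiff A f (take (Suc s) xs) (take (Suc s) ds) * g (drop (Suc s) xs)
    + (- 1) powi (int s + sum_list (take s ds)) * f (take s xs) * bar_codiff A g (drop s xs) (drop s ds)"
  using assms
proof (induction s arbitrary: f xs ds)
  case 0
  have "take (Suc 0) xs = [hd xs]" using 0 by (cases xs) auto
  moreover have "tensor 0 f g = (\<lambda>l. f [] * g l)" by (simp add: tensor_def fun_eq_iff)
  ultimately show ?case by (simp add: bar_codiff_scale)
next
  case (Suc s)
  from Suc.prems(1) obtain x y us where xs: "xs = x # y # us" and us: "length us = s + s'"
    by (auto simp: length_Suc_conv)
  from Suc.prems(2) obtain d es where ds: "ds = d # es" and es: "length es = length (y # us)"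
    by (auto simp: length_Suc_conv xs)
  have sg: "(- 1) powi (int (Suc s) + (d + n)) = bar_sgn d * ((- 1) powi (int s + n) :: 'k)" for n
  proof -
    have "int (Suc s) + (d + n) = (1 + d) + (int s + n)" by simp
    then show ?thesis by (simp only: bar_sgn_def powi_minus_one_add mult.assoc)
  qed
  have sg': "(- 1) powi (d + (int (Suc s) + n)) = bar_sgn d * ((- 1) powi (int s + n) :: 'k)" for n
    using sg[of n] by (simp only: add.left_commute)
  have tx: "(\<lambda>l. tensor (Suc s) f g (x # l)) = tensor s (\<lambda>l. f (x # l)) g" by (simp add: tensor_def fun_eq_iff)
  have "bar_codiff A (tensor s (\<lambda>l. f (x # l)) g) (y # us) es =
      bar_codiff A (\<lambda>l. f (x # l)) (take (Suc s) (y # us)) (take (Suc s) es) * g (drop (Suc s) (y # us))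
    + (- 1) powi (int s + sum_list (take s es)) * f (x # take s (y # us)) * bar_codiff A g (drop s (y # us)) (drop s es)"
    by (rule Suc.IH) (use us es in auto)
  then show ?case
    unfolding xs ds bar_codiff_Cons tx by (simp add: bar_codiff_Cons sg sg' tensor_def algebra_simps del: of_nat_Suc)
qed

lemma bar_homogeneous_split:
  assumes "bar_homogeneous A (s + s') xs ds"
  shows "bar_homogeneous A s (take s xs) (take s ds)" "bar_homogeneous A s' (drop s xs) (drop s ds)"
  using assms by (auto simp: bar_homogeneous_def list_all2_takeI list_all2_dropI)

lemma bar_homogeneous_length: "bar_homogeneous A s xs ds \<Longrightarrow> length xs = s \<and> length ds = s"
  by (auto simp: bar_homogeneous_def dest: list_all2_lengthD)

lemma bar_homogeneous_tuple: "bar_homogeneous A s xs ds \<Longrightarrow> xs \<in> bar_tuples A s"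
  by (auto simp: bar_homogeneous_def bar_tuples_def list_all2_conv_all_nth set_conv_nth)

lemma cochainD:
  assumes "f \<in> ext_cochains A s t"
  shows "xs \<notin> bar_tuples A s \<Longrightarrow> f xs = 0"
    and "\<lbrakk>us @ x # vs \<in> bar_tuples A s; us @ y # vs \<in> bar_tuples A s\<rbrakk> \<Longrightarrow>
      f (us @ (x \<oplus> y) # vs) = f (us @ x # vs) + f (us @ y # vs)"
    and "\<lbrakk>bar_homogeneous A s xs ds; sum_list ds \<noteq> t\<rbrakk> \<Longrightarrow> f xs = 0"
  using assms unfolding ext_cochains_def by blast+

lemma cochainI:
  assumes "\<And>xs. xs \<notin> bar_tuples A s \<Longrightarrow> f xs = 0"
    and "\<And>us x y vs. \<lbrakk>us @ x # vs \<in> bar_tuples A s; us @ y # vs \<in> bar_tuples A s\<rbrakk> \<Longrightarrow>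
      f (us @ (x \<oplus> y) # vs) = f (us @ x # vs) + f (us @ y # vs)"
    and "\<And>xs ds. \<lbrakk>bar_homogeneous A s xs ds; sum_list ds \<noteq> t\<rbrakk> \<Longrightarrow> f xs = 0"
  shows "f \<in> ext_cochains A s t"
  using assms unfolding ext_cochains_def by blast

lemma cochain_zero: "(\<lambda>_. 0) \<in> ext_cochains A s t"
  by (rule cochainI) auto

lemma cochain_add: "\<lbrakk>f \<in> ext_cochains A s t; g \<in> ext_cochains A s t\<rbrakk> \<Longrightarrow> (\<lambda>xs. f xs + g xs) \<in> ext_cochains A s t"
  by (rule cochainI) (simp_all add: cochainD)

lemma cochain_scale: "f \<in> ext_cochains A s t \<Longrightarrow> (\<lambda>xs. c * f xs) \<in> ext_cochains A s t"
  by (rule cochainI) (simp_all add: cochainD distrib_left)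

lemma cochain_diff: "\<lbrakk>f \<in> ext_cochains A s t; g \<in> ext_cochains A s t\<rbrakk> \<Longrightarrow> (\<lambda>xs. f xs - g xs) \<in> ext_cochains A s t"
  using cochain_add[of f s t "\<lambda>xs. - 1 * g xs"] cochain_scale[of g s t "- 1"] by simp

lemma tuple_split: "xs \<in> bar_tuples A (s + s') \<longleftrightarrow> take s xs \<in> bar_tuples A s \<and> drop s xs \<in> bar_tuples A s'"
proof -
  have "set xs = set (take s xs) \<union> set (drop s xs)" by (metis append_take_drop_id set_append)
  then show ?thesis by (auto simp: bar_tuples_def)
qed

lemma tensor_cochain:
  fixes f g :: "'a list \<Rightarrow> 'k::field"
  assumes f: "f \<in> ext_cochains A s t" and g: "g \<in> ext_cochains A s' t'"
  shows "tensor s f g \<in> ext_cochains A (s + s') (t + t')"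
proof (rule cochainI)
  fix xs assume "xs \<notin> bar_tuples A (s + s')"
  then show "tensor s f g xs = 0" using cochainD(1)[OF f] cochainD(1)[OF g] by (auto simp: tuple_split tensor_def)
next
  fix us x y vs assume x: "us @ x # vs \<in> bar_tuples A (s + s')" and y: "us @ y # vs \<in> bar_tuples A (s + s')"
  show "tensor s f g (us @ (x \<oplus> y) # vs) = tensor s f g (us @ x # vs) + tensor s f g (us @ y # vs)"
  proof (cases "length us < s")
    case True
    then obtain n where n: "s - length us = Suc n" by (metis Suc_diff_Suc)
    have s: "take s (us @ z # vs) = us @ z # take n vs" "drop s (us @ z # vs) = drop n vs" for z
      using True n by simp_all
    have "us @ x # take n vs \<in> bar_tuples A s" "us @ y # take n vs \<in> bar_tuples A s"
      using x y unfolding tuple_split s by auto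
    from cochainD(2)[OF f this] show ?thesis unfolding tensor_def s by (simp add: distrib_right)
  next
    case False
    have s: "take s (us @ z # vs) = take s us" "drop s (us @ z # vs) = drop s us @ z # vs" for z
      using False by simp_all
    have "drop s us @ x # vs \<in> bar_tuples A s'" "drop s us @ y # vs \<in> bar_tuples A s'"
      using x y unfolding tuple_split s by auto
    from cochainD(2)[OF g this] show ?thesis unfolding tensor_def s by (simp add: distrib_left)
  qed
next
  fix xs ds assume h: "bar_homogeneous A (s + s') xs ds" and ne: "sum_list ds \<noteq> t + t'"
  have "sum_list ds = sum_list (take s ds) + sum_list (drop s ds)" by (metis append_take_drop_id sum_list_append)
  then have "sum_list (take s ds) \<noteq> t \<or> sum_list (drop s ds) \<noteq> t'" using ne by auto
  then show "tensor s f g xs = 0"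
    using cochainD(3)[OF f bar_homogeneous_split(1)[OF h]] cochainD(3)[OF g bar_homogeneous_split(2)[OF h]]
    by (auto simp: tensor_def)
qed

lemma cup_eq: "cup s t s' t' f g = (\<lambda>xs. (- 1) powi ((int s + t) * (int s' + t')) * tensor s f g xs)"
  by (simp add: cup_def tensor_def fun_eq_iff)

lemma cup_cochain: "\<lbrakk>f \<in> ext_cochains A s t; g \<in> ext_cochains A s' t'\<rbrakk> \<Longrightarrow>
    cup s t s' t' f g \<in> ext_cochains A (s + s') (t + t')"
  unfolding cup_eq by (intro cochain_scale tensor_cochain)

lemma cocycle_iff: "f \<in> ext_cocycles A s t \<longleftrightarrow> f \<in> ext_cochains A s t \<and>
    (\<forall>xs ds. bar_homogeneous A (Suc s) xs ds \<longrightarrow> bar_codiff A f xs ds = 0)"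
  by (simp add: ext_cocycles_def)

lemma coboundary_iff: "f \<in> ext_coboundaries A s t \<longleftrightarrow> f \<in> ext_cochains A s t \<and>
    (\<exists>h\<in>ext_cochains A (s - 1) t. \<forall>xs ds. bar_homogeneous A s xs ds \<longrightarrow> f xs = bar_codiff A h xs ds)"
  by (simp add: ext_coboundaries_def)

lemma cocycle_zero: "(\<lambda>_. 0) \<in> ext_cocycles A s t"
  by (simp add: cocycle_iff cochain_zero bar_codiff_def)

lemma cocycle_add: "\<lbrakk>f \<in> ext_cocycles A s t; g \<in> ext_cocycles A s t\<rbrakk> \<Longrightarrow> (\<lambda>xs. f xs + g xs) \<in> ext_cocycles A s t"
  by (simp add: cocycle_iff cochain_add bar_codiff_add)

lemma cocycle_scale: "f \<in> ext_cocycles A s t \<Longrightarrow> (\<lambda>xs. c * f xs) \<in> ext_cocycles A s t"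
  by (simp add: cocycle_iff cochain_scale bar_codiff_scale)

lemma cocycle_diff: "\<lbrakk>f \<in> ext_cocycles A s t; g \<in> ext_cocycles A s t\<rbrakk> \<Longrightarrow> (\<lambda>xs. f xs - g xs) \<in> ext_cocycles A s t"
  by (simp add: cocycle_iff cochain_diff bar_codiff_diff)

lemma coboundary_zero: "(\<lambda>_. 0) \<in> ext_coboundaries A s t"
  unfolding coboundary_iff using cochain_zero by (auto simp: bar_codiff_def intro!: bexI[of _ "\<lambda>_. 0"])

lemma coboundary_add:
  assumes "f \<in> ext_coboundaries A s t" "g \<in> ext_coboundaries A s t"
  shows "(\<lambda>xs. f xs + g xs) \<in> ext_coboundaries A s t"
proof -
  obtain h k where "h \<in> ext_cochains A (s - 1) t" "k \<in> ext_cochains A (s - 1) t"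
    "\<forall>xs ds. bar_homogeneous A s xs ds \<longrightarrow> f xs = bar_codiff A h xs ds"
    "\<forall>xs ds. bar_homogeneous A s xs ds \<longrightarrow> g xs = bar_codiff A k xs ds"
    using assms unfolding coboundary_iff by blast
  then show ?thesis using assms unfolding coboundary_iff
    by (auto intro!: cochain_add bexI[of _ "\<lambda>xs. h xs + k xs"] simp: bar_codiff_add)
qed

lemma coboundary_scale:
  assumes "f \<in> ext_coboundaries A s t" shows "(\<lambda>xs. c * f xs) \<in> ext_coboundaries A s t"
proof -
  obtain h where "h \<in> ext_cochains A (s - 1) t"
    "\<forall>xs ds. bar_homogeneous A s xs ds \<longrightarrow> f xs = bar_codiff A h xs ds"
    using assms unfolding coboundary_iff by blast
  then show ?thesis using assms unfolding coboundary_iff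
    by (auto intro!: cochain_scale bexI[of _ "\<lambda>xs. c * h xs"] simp: bar_codiff_scale)
qed

lemma coboundary_diff: "\<lbrakk>f \<in> ext_coboundaries A s t; g \<in> ext_coboundaries A s t\<rbrakk> \<Longrightarrow>
    (\<lambda>xs. f xs - g xs) \<in> ext_coboundaries A s t"
  using coboundary_add[of f s t "\<lambda>xs. - 1 * g xs"] coboundary_scale[of g s t "- 1"] by simp

text \<open>The sign depends on the degrees of the entries, but f vanishes unless these add up to
  t.\<close>

lemma bar_codiff_tensor_homog:
  fixes f g :: "'a list \<Rightarrow> 'k::field"
  assumes f: "f \<in> ext_cochains A s t" and h: "bar_homogeneous A (s + Suc s') xs ds"
  shows "bar_codiff A (tensor s f g) xs ds = bar_codiff A f (take (Suc s) xs) (take (Suc s) ds) * g (drop (Suc s) xs)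
    + (- 1) powi (int s + t) * f (take s xs) * bar_codiff A g (drop s xs) (drop s ds)"
proof -
  have "sum_list (take s ds) = t \<or> f (take s xs) = 0"
    using cochainD(3)[OF f bar_homogeneous_split(1)[OF h]] by blast
  then show ?thesis
    using bar_codiff_tensor[of xs s s' ds f g] bar_homogeneous_length[OF h] by auto
qed

lemma cup_cocycle:
  assumes f: "f \<in> ext_cocycles A s t" and g: "g \<in> ext_cocycles A s' t'"
  shows "cup s t s' t' f g \<in> ext_cocycles A (s + s') (t + t')"
proof -
  have fc: "f \<in> ext_cochains A s t" and gc: "g \<in> ext_cochains A s' t'" using f g by (simp_all add: cocycle_iff)
  have "bar_codiff A (tensor s f g) xs ds = 0" if h: "bar_homogeneous A (Suc (s + s')) xs ds" for xs ds
  proof -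
    have h': "bar_homogeneous A (s + Suc s') xs ds" "bar_homogeneous A (Suc s + s') xs ds" using h by simp_all
    show ?thesis
      unfolding bar_codiff_tensor_homog[OF fc h'(1)]
      using f g bar_homogeneous_split(2)[OF h'(1)] bar_homogeneous_split(1)[OF h'(2)] by (simp add: cocycle_iff)
  qed
  then show ?thesis using cup_cochain[OF fc gc] by (simp add: cocycle_iff cup_eq bar_codiff_scale)
qed

lemma coboundary_0: "f \<in> ext_coboundaries A 0 t \<Longrightarrow> f = (\<lambda>_. 0)"
proof
  fix xs assume f: "f \<in> ext_coboundaries A 0 t"
  have "f [] = 0" using f unfolding coboundary_iff by (auto simp: bar_homogeneous_def)
  moreover have "f xs = 0" if "xs \<noteq> []"
    using f that cochainD(1)[of f 0 t xs] by (auto simp: coboundary_iff bar_tuples_def)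
  ultimately show "f xs = 0" by (cases "xs = []") auto
qed

lemma cup_coboundary_right:
  assumes f: "f \<in> ext_cocycles A s t" and g: "g \<in> ext_coboundaries A s' t'"
  shows "cup s t s' t' f g \<in> ext_coboundaries A (s + s') (t + t')"
proof (cases s')
  case 0
  then have "cup s t s' t' f g = (\<lambda>_. 0)" using coboundary_0[of g t'] g by (simp add: cup_def fun_eq_iff)
  then show ?thesis using coboundary_zero by simp
next
  case (Suc n)
  have fc: "f \<in> ext_cochains A s t" and gc: "g \<in> ext_cochains A s' t'"
    using f g by (simp_all add: cocycle_iff coboundary_iff)
  obtain h where h: "h \<in> ext_cochains A n t'"
    "\<And>xs ds. bar_homogeneous A s' xs ds \<Longrightarrow> g xs = bar_codiff A h xs ds"
    using g Suc unfolding coboundary_iff by auto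
  \<comment> \<open>The second factor undoes the sign that the Leibniz rule puts in front of the
    differential of \<open>h\<close>.\<close>
  let ?c = "(- 1) powi ((int s + t) * (int s' + t')) * (- 1) powi (int s + t)"
  have "cup s t s' t' f g xs = bar_codiff A (\<lambda>xs. ?c * tensor s f h xs) xs ds"
    if "bar_homogeneous A (s + s') xs ds" for xs ds
  proof -
    have h': "bar_homogeneous A (s + Suc n) xs ds" "bar_homogeneous A (Suc s + n) xs ds" using that Suc by simp_all
    have "bar_codiff A f (take (Suc s) xs) (take (Suc s) ds) = 0"
      using f bar_homogeneous_split(1)[OF h'(2)] by (simp add: cocycle_iff)
    moreover have "g (drop s xs) = bar_codiff A h (drop s xs) (drop s ds)"
      by (rule h(2)) (use bar_homogeneous_split(2)[OF h'(1)] Suc in simp)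
    ultimately show ?thesis
      unfolding bar_codiff_scale bar_codiff_tensor_homog[OF fc h'(1)] cup_eq by (simp add: tensor_def mult.assoc)
  qed
  moreover have "(\<lambda>xs. ?c * tensor s f h xs) \<in> ext_cochains A (s + s' - 1) (t + t')"
    using cochain_scale[OF tensor_cochain[OF fc h(1)]] Suc by simp
  ultimately show ?thesis using cup_cochain[OF fc gc] unfolding coboundary_iff by blast
qed

lemma cup_coboundary_left:
  assumes f: "f \<in> ext_coboundaries A s t" and g: "g \<in> ext_cocycles A s' t'"
  shows "cup s t s' t' f g \<in> ext_coboundaries A (s + s') (t + t')"
proof (cases s)
  case 0
  then have "cup s t s' t' f g = (\<lambda>_. 0)" using coboundary_0[of f t] f by (simp add: cup_def fun_eq_iff)
  then show ?thesis using coboundary_zero by simp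
next
  case (Suc n)
  have fc: "f \<in> ext_cochains A s t" and gc: "g \<in> ext_cochains A s' t'"
    using f g by (simp_all add: cocycle_iff coboundary_iff)
  obtain h where h: "h \<in> ext_cochains A n t"
    "\<And>xs ds. bar_homogeneous A s xs ds \<Longrightarrow> f xs = bar_codiff A h xs ds"
    using f Suc unfolding coboundary_iff by auto
  let ?c = "(- 1) powi ((int s + t) * (int s' + t'))"
  have "cup s t s' t' f g xs = bar_codiff A (\<lambda>xs. ?c * tensor n h g xs) xs ds"
    if "bar_homogeneous A (s + s') xs ds" for xs ds
  proof -
    have h': "bar_homogeneous A (n + Suc s') xs ds" using that Suc by simp
    have "bar_codiff A g (drop n xs) (drop n ds) = 0"
      using g bar_homogeneous_split(2)[OF h'] by (simp add: cocycle_iff)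
    moreover have "f (take s xs) = bar_codiff A h (take s xs) (take s ds)"
      by (rule h(2)) (rule bar_homogeneous_split(1)[OF that])
    ultimately show ?thesis
      unfolding bar_codiff_scale bar_codiff_tensor_homog[OF h(1) h'] cup_eq by (simp add: tensor_def Suc)
  qed
  moreover have "(\<lambda>xs. ?c * tensor n h g xs) \<in> ext_cochains A (s + s' - 1) (t + t')"
    using cochain_scale[OF tensor_cochain[OF h(1) gc]] Suc by simp
  ultimately show ?thesis using cup_cochain[OF fc gc] unfolding coboundary_iff by blast
qed

section \<open>Ext classes and their operations\<close>

lemma ext_class_iff: "g \<in> ext_class A s t f \<longleftrightarrow> g \<in> ext_cocycles A s t \<and> (\<lambda>xs. g xs - f xs) \<in> ext_coboundaries A s t"
  by (simp add: ext_class_def)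

lemma ext_class_self: "f \<in> ext_cocycles A s t \<Longrightarrow> f \<in> ext_class A s t f"
  by (simp add: ext_class_iff coboundary_zero)

lemma ext_class_eqI: "(\<lambda>xs. f xs - g xs) \<in> ext_coboundaries A s t \<Longrightarrow> ext_class A s t f = ext_class A s t g"
proof -
  assume fg: "(\<lambda>xs. f xs - g xs) \<in> ext_coboundaries A s t"
  have "(\<lambda>xs. h xs - f xs) \<in> ext_coboundaries A s t \<longleftrightarrow> (\<lambda>xs. h xs - g xs) \<in> ext_coboundaries A s t" for h
    using coboundary_add[OF _ fg, of "\<lambda>xs. h xs - f xs"] coboundary_diff[OF _ fg, of "\<lambda>xs. h xs - g xs"] by auto
  then show ?thesis by (auto simp: ext_class_iff)
qed

lemma ext_class_eq_iff: "\<lbrakk>f \<in> ext_cocycles A s t; g \<in> ext_cocycles A s t\<rbrakk> \<Longrightarrow>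
    ext_class A s t f = ext_class A s t g \<longleftrightarrow> (\<lambda>xs. f xs - g xs) \<in> ext_coboundaries A s t"
  using ext_class_eqI[of f g s t] ext_class_self[of f s t] by (auto simp: ext_class_iff)

text \<open>Operations on classes are defined as unions over all representatives; such a union is a
  single class once the result does not depend on them.\<close>

lemma Union_const: "\<lbrakk>x \<in> X; \<And>y. y \<in> X \<Longrightarrow> F y = c\<rbrakk> \<Longrightarrow> (\<Union>y\<in>X. F y) = c"
  by auto

lemma ext_badd:
  assumes "f \<in> ext_cocycles A s t" "g \<in> ext_cocycles A s t"
  shows "badd (ext_algebra A) s t (ext_class A s t f) (ext_class A s t g) = ext_class A s t (\<lambda>xs. f xs + g xs)"
proof -
  have "ext_class A s t (\<lambda>xs. f' xs + g' xs) = ext_class A s t (\<lambda>xs. f xs + g xs)"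
    if "f' \<in> ext_class A s t f" "g' \<in> ext_class A s t g" for f' g'
    using that coboundary_add[of "\<lambda>xs. f' xs - f xs" s t "\<lambda>xs. g' xs - g xs"]
    by (intro ext_class_eqI) (simp add: ext_class_iff algebra_simps)
  then show ?thesis
    unfolding ext_algebra_def bigraded_alg.simps
    by (intro Union_const[OF ext_class_self[OF assms(1)]] Union_const[OF ext_class_self[OF assms(2)]])
qed

lemma ext_bscale:
  assumes "f \<in> ext_cocycles A s t"
  shows "bscale (ext_algebra A) s t c (ext_class A s t f) = ext_class A s t (\<lambda>xs. c * f xs)"
proof -
  have "ext_class A s t (\<lambda>xs. c * f' xs) = ext_class A s t (\<lambda>xs. c * f xs)"
    if "f' \<in> ext_class A s t f" for f'
    using that coboundary_scale[of "\<lambda>xs. f' xs - f xs" s t c]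
    by (intro ext_class_eqI) (simp add: ext_class_iff algebra_simps)
  then show ?thesis
    unfolding ext_algebra_def bigraded_alg.simps by (intro Union_const[OF ext_class_self[OF assms]])
qed

lemma ext_bmult:
  assumes f: "f \<in> ext_cocycles A s t" and g: "g \<in> ext_cocycles A s' t'"
  shows "bmult (ext_algebra A) s t s' t' (ext_class A s t f) (ext_class A s' t' g)
    = ext_class A (s + s') (t + t') (cup s t s' t' f g)"
proof -
  have "ext_class A (s + s') (t + t') (cup s t s' t' f' g') = ext_class A (s + s') (t + t') (cup s t s' t' f g)"
    if f': "f' \<in> ext_class A s t f" and g': "g' \<in> ext_class A s' t' g" for f' g'
  proof (rule ext_class_eqI)
    \<comment> \<open>The change of representatives is split as f' g' - f g = (f' - f) g' + f (g' -
      g).\<close>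
    have "cup s t s' t' (\<lambda>xs. f' xs - f xs) g' \<in> ext_coboundaries A (s + s') (t + t')"
      using f' g' by (intro cup_coboundary_left) (simp_all add: ext_class_iff)
    moreover have "cup s t s' t' f (\<lambda>xs. g' xs - g xs) \<in> ext_coboundaries A (s + s') (t + t')"
      using f g' by (intro cup_coboundary_right) (simp_all add: ext_class_iff)
    ultimately have "(\<lambda>xs. cup s t s' t' (\<lambda>xs. f' xs - f xs) g' xs + cup s t s' t' f (\<lambda>xs. g' xs - g xs) xs)
        \<in> ext_coboundaries A (s + s') (t + t')" by (rule coboundary_add)
    then show "(\<lambda>xs. cup s t s' t' f' g' xs - cup s t s' t' f g xs) \<in> ext_coboundaries A (s + s') (t + t')"
      by (simp add: cup_def algebra_simps)
  qed
  then show ?thesis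
    unfolding ext_algebra_def bigraded_alg.simps
    by (intro Union_const[OF ext_class_self[OF f]] Union_const[OF ext_class_self[OF g]])
qed

lemma ext_unit_cocycle: "(\<lambda>xs. if xs = [] then 1 else 0) \<in> ext_cocycles A 0 0"
proof -
  have "(\<lambda>xs. if xs = [] then 1 else 0) \<in> ext_cochains A 0 0"
    by (rule cochainI) (auto simp: bar_tuples_def bar_homogeneous_def)
  then show ?thesis by (auto simp: cocycle_iff bar_homogeneous_def length_Suc_conv)
qed

end

section \<open>Koszulness of the Dyer-Lashof algebra\<close>

abbreviation singles :: "'g list \<Rightarrow> 'g list list" where "singles \<equiv> map (\<lambda>x. [x])"

definition merge_at :: "nat \<Rightarrow> 'g list \<Rightarrow> 'g \<Rightarrow> 'g list"
  where "merge_at i T z = take i T @ z # drop (i + 2) T"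

lemma concat_merge_at:
  assumes "Suc i < length T"
  shows "concat (merge_at i T z) = concat (take i T) @ z @ concat (drop (i + 2) T)"
    "concat T = concat (take i T) @ (T ! i @ T ! Suc i) @ concat (drop (i + 2) T)"
proof -
  have "T = take i T @ T ! i # T ! Suc i # drop (i + 2) T"
    using assms by (metis Cons_nth_drop_Suc Suc_lessD add_2_eq_Suc' append_take_drop_id)
  then show "concat T = concat (take i T) @ (T ! i @ T ! Suc i) @ concat (drop (i + 2) T)"
    by (metis append.assoc concat.simps(2) concat_append)
qed (simp add: merge_at_def)

lemma length_merge_at: "Suc i < length T \<Longrightarrow> length (merge_at i T z) = length T - 1"
  by (simp add: merge_at_def)

lemma set_merge_at: "set (merge_at i T z) \<subseteq> insert z (set T)"
  unfolding merge_at_def by (auto dest: in_set_takeD in_set_dropD)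

text \<open>The inverse of the merge used by the contraction: it matches the lists called
  \<open>uncut\<close> below with those called \<open>cut\<close>.\<close>

fun split_first :: "'g list list \<Rightarrow> 'g list list"
  where
    "split_first [] = []"
  | "split_first ([] # us) = [] # us"
  | "split_first ([x] # us) = [x] # split_first us"
  | "split_first ((x # y # v) # us) = [x] # (y # v) # us"

definition num_singles :: "'g list list \<Rightarrow> nat"
  where "num_singles us = length (takeWhile (\<lambda>w. length w = 1) us)"

lemma split_first_eq: "v \<noteq> [] \<Longrightarrow> split_first (singles \<alpha> @ (x # v) # rest) = singles \<alpha> @ [x] # v # rest"
  by (induction \<alpha>) (auto simp: neq_Nil_conv)

lemma num_singles_eq: "v \<noteq> [] \<Longrightarrow> num_singles (singles \<alpha> @ (x # v) # rest) = length \<alpha>"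
  unfolding num_singles_def by (induction \<alpha>) auto

lemma concat_split_first: "concat (split_first us) = concat us"
  by (induction us rule: split_first.induct) auto

context prime_field
begin

sublocale dl: augmented_graded "dyer_lashof p :: 'k dl_free set aug_graded_ring"
  by unfold_locales (fact aug_mult aug_add aug_mult_assoc aug_distrib[THEN conjunct1]
      aug_distrib[THEN conjunct2] homog_mult)+

abbreviation cochains :: "nat \<Rightarrow> int \<Rightarrow> ('k dl_free set list \<Rightarrow> 'k) set" where "cochains \<equiv> ext_cochains (DL :: 'k dl_free set aug_graded_ring)"
abbreviation tuples where "tuples \<equiv> bar_tuples (DL :: 'k dl_free set aug_graded_ring)"
abbreviation codiff :: "('k dl_free set list \<Rightarrow> 'k) \<Rightarrow> 'k dl_free set list \<Rightarrow> int list \<Rightarrow> 'k" where "codiff \<equiv> bar_codiff (DL :: 'k dl_free set aug_graded_ring)"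
abbreviation homogeneous where "homogeneous \<equiv> bar_homogeneous (DL :: 'k dl_free set aug_graded_ring)"
abbreviation bar_word :: "dl_gen list list \<Rightarrow> 'k dl_free set list" where "bar_word us \<equiv> map word_elt us"
abbreviation degs :: "dl_gen list list \<Rightarrow> int list" where "degs us \<equiv> map (word_deg p) us"

lemma bar_word_homogeneous: "set us \<subseteq> pos_words \<Longrightarrow> homogeneous (length us) (bar_word us) (degs us)"
  by (auto simp: bar_homogeneous_def list_all2_conv_all_nth intro!: word_elt_aug word_elt_homog dest: nth_mem)

lemma bar_word_tuple: "set us \<subseteq> pos_words \<Longrightarrow> bar_word us \<in> tuples (length us)"
  using word_elt_aug by (auto simp: bar_tuples_def)

lemma basis_subset_pos: "basis \<subseteq> pos_words"
  using basis_pos by blast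

section \<open>Cochains and their values on basis words\<close>

definition multiadditive :: "nat \<Rightarrow> ('k dl_free set list \<Rightarrow> 'k) \<Rightarrow> bool"
  where "multiadditive n q \<longleftrightarrow> (\<forall>us x y vs. us @ x # vs \<in> tuples n \<and> us @ y # vs \<in> tuples n \<longrightarrow>
    q (us @ (x \<oplus>\<^bsub>DL\<^esub> y) # vs) = q (us @ x # vs) + q (us @ y # vs))"

lemma cochain_multiadditive: "f \<in> cochains s t \<Longrightarrow> multiadditive s f"
  unfolding multiadditive_def ext_cochains_def by blast

lemma multiadditive_Cons: "\<lbrakk>multiadditive (Suc n) q; x \<in> aug_ideal DL\<rbrakk> \<Longrightarrow> multiadditive n (\<lambda>l. q (x # l))"
  unfolding multiadditive_def bar_tuples_def
proof (intro allI impI)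
  fix us y z vs
  assume q: "\<forall>us x y vs. us @ x # vs \<in> {xs. length xs = Suc n \<and> set xs \<subseteq> aug_ideal DL} \<and>
      us @ y # vs \<in> {xs. length xs = Suc n \<and> set xs \<subseteq> aug_ideal DL} \<longrightarrow>
      q (us @ (x \<oplus>\<^bsub>DL\<^esub> y) # vs) = q (us @ x # vs) + q (us @ y # vs)" and x: "x \<in> aug_ideal DL"
    and yz: "us @ y # vs \<in> {xs. length xs = n \<and> set xs \<subseteq> aug_ideal DL} \<and>
      us @ z # vs \<in> {xs. length xs = n \<and> set xs \<subseteq> aug_ideal DL}"
  from q[rule_format, of "x # us" y vs z] x yz
  show "q (x # us @ (y \<oplus>\<^bsub>DL\<^esub> z) # vs) = q (x # us @ y # vs) + q (x # us @ z # vs)" by simp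
qed

lemma multiadditive_expansion:
  assumes q: "multiadditive n q" and t: "us @ x # vs \<in> tuples n"
  shows "q (us @ x # vs) = ev (\<lambda>w. q (us @ word_elt w # vs)) (nf x)"
proof (rule additive_expansion[where L = "\<lambda>x. q (us @ x # vs)"])
  fix y z assume "y \<in> aug_ideal DL" "z \<in> aug_ideal DL"
  then show "q (us @ (y \<oplus>\<^bsub>DL\<^esub> z) # vs) = q (us @ y # vs) + q (us @ z # vs)"
    using q t unfolding multiadditive_def bar_tuples_def by auto
qed (use t in \<open>auto simp: bar_tuples_def\<close>)

abbreviation occurs_in where "occurs_in us xs \<equiv> list_all2 (\<lambda>u x. u \<in> supp (nf x)) us (xs :: 'k dl_free set list)"

text \<open>The entries are replaced by basis words from left to right. Only words occurring in
  their normal forms are tested, so that the degrees of homogeneous entries carry over.\<close>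

lemma multiadditive_eq_0:
  assumes q: "multiadditive n q" and xs: "xs \<in> tuples n"
    and zero: "\<And>us. occurs_in us xs \<Longrightarrow> q (bar_word us) = 0"
  shows "q xs = 0"
proof -
  have "q (bar_word us @ vs) = 0" if "occurs_in us ys" "ys @ vs = xs" for us ys vs
    using that
  proof (induction vs arbitrary: us ys)
    case Nil
    then show ?case using zero by simp
  next
    case (Cons x vs)
    have ys: "set ys \<subseteq> aug_ideal DL" "x \<in> aug_ideal DL" "set vs \<subseteq> aug_ideal DL"
      and len: "length ys + Suc (length vs) = n"
      using xs Cons.prems(2) by (auto simp: bar_tuples_def)
    have us: "set us \<subseteq> basis"
    proof
      fix u assume "u \<in> set us"
      then obtain i where "i < length us" "u = us ! i" by (metis in_set_conv_nth)
      then have "u \<in> supp (nf (ys ! i))" "ys ! i \<in> set ys"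
        using Cons.prems(1) by (auto simp: list_all2_conv_all_nth)
      then show "u \<in> basis" using nf_aug ys by blast
    qed
    have "bar_word us @ x # vs \<in> tuples n"
      using bar_word_tuple[of us] us basis_subset_pos ys len list_all2_lengthD[OF Cons.prems(1)]
      by (auto simp: bar_tuples_def)
    then have "q (bar_word us @ x # vs) = ev (\<lambda>w. q (bar_word us @ word_elt w # vs)) (nf x)"
      by (rule multiadditive_expansion[OF q])
    also have "\<dots> = 0"
    proof (rule ev_eq_0)
      fix w assume "w \<in> supp (nf x)"
      then have "occurs_in (us @ [w]) (ys @ [x])" using Cons.prems(1) by (simp add: list_all2_appendI)
      from Cons.IH[OF this] Cons.prems(2) show "q (bar_word us @ word_elt w # vs) = 0" by simp
    qed
    finally show ?case .
  qed
  from this[of "[]" "[]" xs] show ?thesis by simp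
qed

lemma occurs_in_basis: "\<lbrakk>occurs_in us xs; set xs \<subseteq> aug_ideal DL\<rbrakk> \<Longrightarrow> set us \<subseteq> basis"
proof
  fix u assume "occurs_in us xs" "set xs \<subseteq> aug_ideal DL" "u \<in> set us"
  then show "u \<in> basis" using nf_aug by (fastforce simp: list_all2_conv_all_nth in_set_conv_nth)
qed

lemma occurs_in_degs: "\<lbrakk>occurs_in us xs; homogeneous s xs ds\<rbrakk> \<Longrightarrow> degs us = ds"
  using nf_homog by (fastforce simp: list_all2_conv_all_nth bar_homogeneous_def intro!: nth_equalityI)

lemma cochain_eq_0:
  assumes f: "f \<in> cochains s t" and zero: "\<And>us. \<lbrakk>length us = s; set us \<subseteq> basis\<rbrakk> \<Longrightarrow> f (bar_word us) = 0"
  shows "f = (\<lambda>_. 0)"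
proof
  fix xs show "f xs = 0"
  proof (cases "xs \<in> tuples s")
    case True
    show ?thesis
    proof (rule multiadditive_eq_0[OF cochain_multiadditive[OF f] True])
      fix us assume "occurs_in us xs"
      then show "f (bar_word us) = 0"
        using occurs_in_basis True by (intro zero) (auto simp: bar_tuples_def dest: list_all2_lengthD)
    qed
  qed (simp add: dl.cochainD(1)[OF f])
qed

fun lin :: "(dl_gen list list \<Rightarrow> 'k) \<Rightarrow> 'k dl_free set list \<Rightarrow> 'k"
  where
    "lin F [] = F []"
  | "lin F (x # xs) = ev (\<lambda>u. lin (\<lambda>us. F (u # us)) xs) (nf x)"

definition cochain_of :: "nat \<Rightarrow> (dl_gen list list \<Rightarrow> 'k) \<Rightarrow> 'k dl_free set list \<Rightarrow> 'k"
  where "cochain_of s F xs = (if xs \<in> tuples s then lin F xs else 0)"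

lemma lin_add:
  "\<lbrakk>x \<in> aug_ideal DL; y \<in> aug_ideal DL\<rbrakk> \<Longrightarrow> lin F (us @ (x \<oplus>\<^bsub>DL\<^esub> y) # vs) = lin F (us @ x # vs) + lin F (us @ y # vs)"
  by (induction us arbitrary: F) (simp_all add: nf_aug_add ev_add ev_fun_add)

lemma lin_eq_0: "(\<And>us. occurs_in us xs \<Longrightarrow> F us = 0) \<Longrightarrow> lin F xs = 0"
proof (induction xs arbitrary: F)
  case (Cons x xs)
  have "lin (\<lambda>us. F (u # us)) xs = 0" if "u \<in> supp (nf x)" for u
    by (rule Cons.IH) (use Cons.prems that in auto)
  then show ?case by (simp add: ev_eq_0)
qed simp

lemma cochain_of_word:
  "\<lbrakk>set us \<subseteq> basis; length us = s\<rbrakk> \<Longrightarrow> cochain_of s F (bar_word us) = F us"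
proof -
  assume us: "set us \<subseteq> basis" "length us = s"
  have "lin F (bar_word us) = F us" using us(1)
    by (induction us arbitrary: F) (auto simp: nf_word basis_def)
  moreover have "set us \<subseteq> pos_words" using us(1) basis_subset_pos by blast
  ultimately show ?thesis using bar_word_tuple[of us] us(2) by (simp add: cochain_of_def)
qed

lemma cochain_of_cochain:
  assumes "\<And>us. \<lbrakk>length us = s; set us \<subseteq> basis; F us \<noteq> 0\<rbrakk> \<Longrightarrow> sum_list (degs us) = t"
  shows "cochain_of s F \<in> cochains s t"
proof (rule dl.cochainI)
  fix us x y vs assume "us @ x # vs \<in> tuples s" "us @ y # vs \<in> tuples s"
  moreover from this have "us @ (x \<oplus>\<^bsub>DL\<^esub> y) # vs \<in> tuples s" using aug_add by (auto simp: bar_tuples_def)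
  ultimately show "cochain_of s F (us @ (x \<oplus>\<^bsub>DL\<^esub> y) # vs) = cochain_of s F (us @ x # vs) + cochain_of s F (us @ y # vs)"
    by (simp add: cochain_of_def lin_add bar_tuples_def)
next
  fix xs ds assume h: "homogeneous s xs ds" "sum_list ds \<noteq> t"
  have "lin F xs = 0"
  proof (rule lin_eq_0)
    fix us assume us: "occurs_in us xs"
    then have "degs us = ds" "set us \<subseteq> basis" "length us = s"
      using occurs_in_degs[OF us h(1)] occurs_in_basis[OF us] dl.bar_homogeneous_tuple[OF h(1)]
      by (auto simp: bar_tuples_def dest: list_all2_lengthD)
    then show "F us = 0" using assms h(2) by blast
  qed
  then show "cochain_of s F xs = 0" by (simp add: cochain_of_def)
qed (simp add: cochain_of_def)

lemma codiff_cong: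
  "\<lbrakk>\<And>l. l \<in> tuples n \<Longrightarrow> f l = g l; xs \<in> tuples (Suc n)\<rbrakk> \<Longrightarrow> codiff f xs ds = codiff g xs ds"
proof -
  assume fg: "\<And>l. l \<in> tuples n \<Longrightarrow> f l = g l" and xs: "xs \<in> tuples (Suc n)"
  have "bar_merge DL i xs \<in> tuples n" if "i < length xs - 1" for i
  proof -
    have "xs ! i \<in> aug_ideal DL" "xs ! Suc i \<in> aug_ideal DL" using xs that by (auto simp: bar_tuples_def)
    then show ?thesis
      using xs that aug_mult[of "xs ! i" "xs ! Suc i"]
      by (auto simp: bar_merge_def bar_tuples_def dest: in_set_takeD in_set_dropD)
  qed
  then show ?thesis unfolding bar_codiff_def using fg by (intro sum.cong) auto
qed

text \<open>Distributivity for the merges that involve the entry in question, additivity of f for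
  all others.\<close>

lemma codiff_multiadditive:
  "\<lbrakk>multiadditive n f; us @ x # vs \<in> tuples (Suc n); us @ y # vs \<in> tuples (Suc n); length ds = Suc n\<rbrakk> \<Longrightarrow>
    codiff f (us @ (x \<oplus>\<^bsub>DL\<^esub> y) # vs) ds = codiff f (us @ x # vs) ds + codiff f (us @ y # vs) ds"
proof (induction us arbitrary: n f ds)
  case Nil
  have aug: "x \<in> aug_ideal DL" "y \<in> aug_ideal DL" "set vs \<subseteq> aug_ideal DL" and len: "length vs = n"
    using Nil.prems by (auto simp: bar_tuples_def)
  show ?case
  proof (cases vs)
    case (Cons z vs')
    obtain d es where ds: "ds = d # es" using Nil.prems(4) by (cases ds) auto
    obtain m where n: "n = Suc m" using len Cons by (cases n) auto
    have z: "z \<in> aug_ideal DL" "set vs' \<subseteq> aug_ideal DL" using aug Cons by auto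
    have "f (((x \<oplus>\<^bsub>DL\<^esub> y) \<otimes>\<^bsub>DL\<^esub> z) # vs') = f ((x \<otimes>\<^bsub>DL\<^esub> z) # vs') + f ((y \<otimes>\<^bsub>DL\<^esub> z) # vs')"
      using Nil.prems(1)[unfolded multiadditive_def, rule_format, of "[]" "x \<otimes>\<^bsub>DL\<^esub> z" vs' "y \<otimes>\<^bsub>DL\<^esub> z"]
        aug z len Cons dl.aug_distl[of x y z] aug_mult by (auto simp: bar_tuples_def)
    moreover have "codiff (\<lambda>l. f ((x \<oplus>\<^bsub>DL\<^esub> y) # l)) (z # vs') es
        = codiff (\<lambda>l. f (x # l) + f (y # l)) (z # vs') es"
    proof (rule codiff_cong)
      fix l assume "l \<in> tuples m"
      then show "f ((x \<oplus>\<^bsub>DL\<^esub> y) # l) = f (x # l) + f (y # l)"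
        using Nil.prems(1)[unfolded multiadditive_def, rule_format, of "[]" x l y] aug n by (auto simp: bar_tuples_def)
    qed (use z len Cons n in \<open>auto simp: bar_tuples_def\<close>)
    ultimately show ?thesis
      by (simp add: Cons ds dl.bar_codiff_Cons dl.bar_codiff_add distrib_left)
  qed simp
next
  case (Cons u us)
  obtain d es where ds: "ds = d # es" "length es = n" using Cons.prems(4) by (cases ds) auto
  have aug: "u \<in> aug_ideal DL" "set us \<subseteq> aug_ideal DL" "x \<in> aug_ideal DL" "y \<in> aug_ideal DL" "set vs \<subseteq> aug_ideal DL"
    and len: "length us + Suc (length vs) = n"
    using Cons.prems by (auto simp: bar_tuples_def)
  obtain m where n: "n = Suc m" using len by (cases n) auto
  have rec: "codiff (\<lambda>l. f (u # l)) (us @ (x \<oplus>\<^bsub>DL\<^esub> y) # vs) es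
      = codiff (\<lambda>l. f (u # l)) (us @ x # vs) es + codiff (\<lambda>l. f (u # l)) (us @ y # vs) es"
  proof (rule Cons.IH)
    show "multiadditive m (\<lambda>l. f (u # l))" using multiadditive_Cons Cons.prems(1) aug(1) n by blast
  qed (use aug len n ds in \<open>auto simp: bar_tuples_def\<close>)
  show ?case
  proof (cases us)
    case Nil
    have "f ((u \<otimes>\<^bsub>DL\<^esub> (x \<oplus>\<^bsub>DL\<^esub> y)) # vs) = f ((u \<otimes>\<^bsub>DL\<^esub> x) # vs) + f ((u \<otimes>\<^bsub>DL\<^esub> y) # vs)"
      using Cons.prems(1)[unfolded multiadditive_def, rule_format, of "[]" "u \<otimes>\<^bsub>DL\<^esub> x" vs "u \<otimes>\<^bsub>DL\<^esub> y"]
        aug len Nil dl.aug_distr[of x y u] aug_mult by (auto simp: bar_tuples_def)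
    then show ?thesis using rec by (simp add: Nil ds dl.bar_codiff_Cons distrib_left)
  next
    case u': (Cons u' us')
    have "f ((u \<otimes>\<^bsub>DL\<^esub> u') # us' @ (x \<oplus>\<^bsub>DL\<^esub> y) # vs)
        = f ((u \<otimes>\<^bsub>DL\<^esub> u') # us' @ x # vs) + f ((u \<otimes>\<^bsub>DL\<^esub> u') # us' @ y # vs)"
      using Cons.prems(1)[unfolded multiadditive_def, rule_format, of "(u \<otimes>\<^bsub>DL\<^esub> u') # us'" x vs y]
        aug len u' aug_mult by (auto simp: bar_tuples_def)
    then show ?thesis using rec by (simp add: u' ds dl.bar_codiff_Cons distrib_left)
  qed
qed

lemma bar_merge_homogeneous:
  assumes "homogeneous (Suc s) xs ds" "i < s"
  shows "homogeneous s (bar_merge DL i xs) (take i ds @ (ds ! i + ds ! Suc i) # drop (i + 2) ds)"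
    "sum_list (take i ds @ (ds ! i + ds ! Suc i) # drop (i + 2) ds) = sum_list ds"
proof -
  have len: "length xs = Suc s" "length ds = Suc s" using dl.bar_homogeneous_length[OF assms(1)] by auto
  have all: "xs ! j \<in> aug_ideal DL \<and> xs ! j \<in> homog DL (ds ! j)" if "j < Suc s" for j
    using assms(1) that len by (auto simp: bar_homogeneous_def list_all2_conv_all_nth)
  have "xs ! i \<otimes>\<^bsub>DL\<^esub> xs ! Suc i \<in> aug_ideal DL \<and> xs ! i \<otimes>\<^bsub>DL\<^esub> xs ! Suc i \<in> homog DL (ds ! i + ds ! Suc i)"
    using all[of i] all[of "Suc i"] assms(2) aug_mult homog_mult by auto
  then show "homogeneous s (bar_merge DL i xs) (take i ds @ (ds ! i + ds ! Suc i) # drop (i + 2) ds)"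
    using assms len unfolding bar_homogeneous_def bar_merge_def
    by (auto intro!: list_all2_appendI list_all2_takeI list_all2_dropI)
  have "ds = take i ds @ ds ! i # ds ! Suc i # drop (i + 2) ds"
    using assms(2) len by (metis Cons_nth_drop_Suc Suc_lessD Suc_mono add_2_eq_Suc' append_take_drop_id)
  then show "sum_list (take i ds @ (ds ! i + ds ! Suc i) # drop (i + 2) ds) = sum_list ds"
    by (metis (no_types, lifting) add.assoc sum_list.Cons sum_list_append)
qed

lemma codiff_degree: "\<lbrakk>h \<in> cochains s t; homogeneous (Suc s) xs ds; sum_list ds \<noteq> t\<rbrakk> \<Longrightarrow> codiff h xs ds = 0"
  unfolding bar_codiff_def
proof (rule sum.neutral, rule ballI)
  fix i assume h: "h \<in> cochains s t" "homogeneous (Suc s) xs ds" "sum_list ds \<noteq> t" and i: "i \<in> {..<length xs - 1}"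
  then have "i < s" using dl.bar_homogeneous_length[OF h(2)] by auto
  then have "h (bar_merge DL i xs) = 0"
    using dl.cochainD(3)[OF h(1)] bar_merge_homogeneous[OF h(2)] h(3) by metis
  then show "(- 1) powi (int (Suc i) + sum_list (take (Suc i) ds)) * h (bar_merge DL i xs) = 0" by simp
qed

text \<open>The differential is only given on homogeneous tuples. Basis words have definite degrees,
  so it can be extended multilinearly from them; on a homogeneous tuple both sides are multiadditive
  and agree on the basis words that occur.\<close>

lemma coboundary_cochain:
  assumes "h \<in> cochains s t"
  shows "\<exists>D\<in>cochains (Suc s) t. \<forall>xs ds. homogeneous (Suc s) xs ds \<longrightarrow> D xs = codiff h xs ds"
proof (intro bexI allI impI)
  let ?F = "\<lambda>us. codiff h (bar_word us) (degs us)"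
  show D: "cochain_of (Suc s) ?F \<in> cochains (Suc s) t"
  proof (rule cochain_of_cochain)
    fix us assume us: "length us = Suc s" "set us \<subseteq> basis" "?F us \<noteq> 0"
    then have "homogeneous (Suc s) (bar_word us) (degs us)"
      using bar_word_homogeneous[of us] basis_subset_pos by auto
    then show "sum_list (degs us) = t" using codiff_degree[OF assms] us(3) by blast
  qed
  fix xs ds assume hom: "homogeneous (Suc s) xs ds"
  have len: "length ds = Suc s" using dl.bar_homogeneous_length[OF hom] by simp
  have "cochain_of (Suc s) ?F xs - codiff h xs ds = 0"
  proof (rule multiadditive_eq_0[where q = "\<lambda>xs. cochain_of (Suc s) ?F xs - codiff h xs ds"])
    show "multiadditive (Suc s) (\<lambda>xs. cochain_of (Suc s) ?F xs - codiff h xs ds)"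
      using cochain_multiadditive[OF D] codiff_multiadditive[OF cochain_multiadditive[OF assms] _ _ len]
      unfolding multiadditive_def by (simp add: algebra_simps)
    show "xs \<in> tuples (Suc s)" by (rule dl.bar_homogeneous_tuple[OF hom])
    fix us assume us: "occurs_in us xs"
    have "set us \<subseteq> basis" "length us = Suc s" "degs us = ds"
      using occurs_in_degs[OF us hom] occurs_in_basis[OF us] dl.bar_homogeneous_tuple[OF hom] us
      by (auto simp: bar_tuples_def dest: list_all2_lengthD)
    then show "cochain_of (Suc s) ?F (bar_word us) - codiff h (bar_word us) ds = 0"
      by (simp add: cochain_of_word)
  qed
  then show "cochain_of (Suc s) ?F xs = codiff h xs ds" by simp
qed

text \<open>
  The bar construction of the associated monomial algebra is a direct sum over all words of complexes
  of subdivisions of the word, where a word has to be cut at each inadmissible pair of neighbours. The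
  first admissible pair gives a contraction by cutting or not cutting there; it is \<open>uncut\<close> or \<open>cut\<close>.
  The contraction extends to the bar construction by recursion along \<^const>\<open>reduces\<close>.
\<close>

abbreviation inadm :: "dl_gen list \<Rightarrow> bool" where "inadm \<equiv> successively (\<lambda>x y. \<not> adm x y)"

definition critical :: "dl_gen list list \<Rightarrow> bool"
  where "critical us \<longleftrightarrow> (\<exists>\<alpha>. us = singles \<alpha> \<and> inadm \<alpha>)"

definition cut :: "dl_gen list list \<Rightarrow> bool"
  where "cut us \<longleftrightarrow> (\<exists>\<alpha> x v rest. us = singles \<alpha> @ [x] # v # rest \<and> inadm (\<alpha> @ [x]) \<and> v \<noteq> [] \<and> adm x (hd v))"

definition uncut :: "dl_gen list list \<Rightarrow> bool"
  where "uncut us \<longleftrightarrow> (\<exists>\<alpha> x v rest. us = singles \<alpha> @ (x # v) # rest \<and> inadm (\<alpha> @ [x]) \<and> v \<noteq> [])"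

lemma cutI: "\<lbrakk>us = singles \<alpha> @ [x] # v # rest; inadm (\<alpha> @ [x]); v \<noteq> []; adm x (hd v)\<rbrakk> \<Longrightarrow> cut us"
  unfolding cut_def by blast

lemma uncutI: "\<lbrakk>us = singles \<alpha> @ (x # v) # rest; inadm (\<alpha> @ [x]); v \<noteq> []\<rbrakk> \<Longrightarrow> uncut us"
  unfolding uncut_def by blast

lemma inadm_snoc: "inadm (\<alpha> @ [x]) \<longleftrightarrow> inadm \<alpha> \<and> (\<alpha> = [] \<or> \<not> adm (last \<alpha>) x)"
  by (auto simp: successively_append_iff)

text \<open>A scan from the left, as long as the entries are single letters that form an
  inadmissible word \<alpha>. It stops at a longer entry (\<open>uncut\<close>) or at an entry whose
  first letter is admissible after \<alpha> (\<open>cut\<close>), or reaches the end.\<close>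

lemma bar_trichotomy: "[] \<notin> set us \<Longrightarrow> critical us \<or> cut us \<or> uncut us"
proof -
  have "critical (singles \<alpha> @ us) \<or> cut (singles \<alpha> @ us) \<or> uncut (singles \<alpha> @ us)" if "[] \<notin> set us" "inadm \<alpha>" for \<alpha> us
    using that
  proof (induction us arbitrary: \<alpha>)
    case Nil
    then show ?case by (auto simp: critical_def)
  next
    case (Cons w us)
    then obtain x v where w: "w = x # v" by (cases w) auto
    show ?case
    proof (cases "inadm (\<alpha> @ [x])")
      case True
      show ?thesis
      proof (cases "v = []")
        case f: False
        then have "uncut (singles \<alpha> @ w # us)" unfolding uncut_def w using True by blast
        then show ?thesis by simp
      next
        case v: True
        show ?thesis using Cons.IH[of "\<alpha> @ [x]"] Cons.prems(1) True by (simp add: w v)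
      qed
    next
      case False
      then have a: "\<alpha> \<noteq> []" "adm (last \<alpha>) x" using Cons.prems(2) by (auto simp: inadm_snoc)
      then have "\<alpha> = butlast \<alpha> @ [last \<alpha>]" by simp
      then have "singles \<alpha> @ w # us = singles (butlast \<alpha>) @ [last \<alpha>] # w # us"
        by (metis append.assoc append_Cons append_Nil list.simps(8) list.simps(9) map_append)
      moreover have "inadm (butlast \<alpha> @ [last \<alpha>])" using Cons.prems(2) a(1) by simp
      ultimately have "cut (singles \<alpha> @ w # us)" unfolding cut_def using a(2) w by fastforce
      then show ?thesis by simp
    qed
  qed
  from this[of us "[]"] show "[] \<notin> set us \<Longrightarrow> critical us \<or> cut us \<or> uncut us" by simp
qed

lemma cut_not_critical: "cut us \<Longrightarrow> \<not> critical us"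
proof
  assume "cut us" "critical us"
  then obtain \<alpha> x v rest \<beta> where us: "us = singles \<alpha> @ [x] # v # rest" "v \<noteq> []" "adm x (hd v)"
    "us = singles \<beta>" "inadm \<beta>" unfolding cut_def critical_def by blast
  have "\<beta> = \<alpha> @ [x] @ v @ concat rest" using arg_cong[OF us(1), of concat] us(4) by simp
  then have "\<beta> = \<alpha> @ [x, hd v] @ tl v @ concat rest" using us(2) by simp
  then show False using us(3,5) by (simp add: successively_append_iff)
qed

text \<open>Otherwise the inadmissible prefix provided by \<open>uncut\<close> is so long that it
  contains the admissible pair at which \<open>cut\<close> cuts.\<close>

lemma cut_not_uncut: "cut us \<Longrightarrow> \<not> uncut us"
proof
  assume "cut us" "uncut us"
  then obtain \<alpha> x v rest \<beta> y w rest' where us: "us = singles \<alpha> @ [x] # v # rest" "v \<noteq> []" "adm x (hd v)"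
    "us = singles \<beta> @ (y # w) # rest'" "inadm (\<beta> @ [y])" "w \<noteq> []" unfolding cut_def uncut_def by blast
  have "length \<beta> = num_singles us" by (simp add: us(4) num_singles_eq[OF us(6)])
  also have "num_singles us = length \<alpha> + 1 + num_singles (v # rest)"
    unfolding us(1) num_singles_def by (induction \<alpha>) auto
  finally have len: "length \<beta> \<ge> length \<alpha> + 1" by simp
  have "\<beta> @ [y] @ w @ concat rest' = \<alpha> @ [x, hd v] @ tl v @ concat rest"
    using arg_cong[OF us(1), of concat] us(2,4) by simp
  then have "take (length \<alpha> + 2) (\<beta> @ [y] @ w @ concat rest') = \<alpha> @ [x, hd v]" by simp
  moreover have "take (length \<alpha> + 2) ((\<beta> @ [y]) @ (w @ concat rest')) = take (length \<alpha> + 2) (\<beta> @ [y])"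
    using len by (subst take_append) simp
  then have "take (length \<alpha> + 2) (\<beta> @ [y] @ w @ concat rest') = take (length \<alpha> + 2) (\<beta> @ [y])"
    by (simp only: append_assoc)
  ultimately have "\<beta> @ [y] = (\<alpha> @ [x, hd v]) @ drop (length \<alpha> + 2) (\<beta> @ [y])"
    by (metis append_take_drop_id)
  then have "inadm ((\<alpha> @ [x, hd v]) @ drop (length \<alpha> + 2) (\<beta> @ [y]))" using us(5) by simp
  then have "inadm (\<alpha> @ [x, hd v])" using successively_append_iff by blast
  then show False using us(3) by (simp add: successively_append_iff)
qed

lemma uncut_split:
  assumes "uncut us"
  obtains \<alpha> x v rest where "us = singles \<alpha> @ (x # v) # rest" "inadm (\<alpha> @ [x])" "v \<noteq> []"
    "split_first us = singles \<alpha> @ [x] # v # rest" "num_singles us = length \<alpha>"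
proof -
  obtain \<alpha> x v rest where u: "us = singles \<alpha> @ (x # v) # rest" "inadm (\<alpha> @ [x])" "v \<noteq> []"
    using assms unfolding uncut_def by blast
  show ?thesis by (rule that[OF u]) (simp_all only: u(1) split_first_eq[OF u(3)] num_singles_eq[OF u(3)])
qed

lemma bar_word_basis: "\<lbrakk>set us \<subseteq> basis; length us = s\<rbrakk> \<Longrightarrow> homogeneous s (bar_word us) (degs us)"
  using bar_word_homogeneous[of us] basis_subset_pos by blast

lemma basis_Cons: "v \<noteq> [] \<Longrightarrow> x # v \<in> basis \<longleftrightarrow> x \<in> dl_gens p \<and> adm x (hd v) \<and> v \<in> basis"
  by (auto simp: basis_def adm_words_def successively_Cons)

lemma basis_single: "[x] \<in> basis \<longleftrightarrow> x \<in> dl_gens p"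
  by (auto simp: basis_def adm_words_def)

lemma split_first_basis: "\<lbrakk>uncut us; set us \<subseteq> basis\<rbrakk> \<Longrightarrow>
    set (split_first us) \<subseteq> basis \<and> cut (split_first us) \<and> length (split_first us) = Suc (length us)"
proof -
  assume uncut: "uncut us" and b: "set us \<subseteq> basis"
  obtain \<alpha> x v rest where us: "us = singles \<alpha> @ (x # v) # rest" "inadm (\<alpha> @ [x])" "v \<noteq> []"
    "split_first us = singles \<alpha> @ [x] # v # rest" "num_singles us = length \<alpha>"
    by (rule uncut_split[OF uncut])
  then have x: "x \<in> dl_gens p" "adm x (hd v)" "v \<in> basis" using b basis_Cons by auto
  have "set (split_first us) \<subseteq> basis" using b x unfolding us(4) by (auto simp: us(1) basis_single)
  moreover have "length (split_first us) = Suc (length us)" unfolding us(4) by (simp add: us(1))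
  ultimately show ?thesis using cutI[OF us(4,2,3) x(2)] by blast
qed

lemma cut_split_first: "\<lbrakk>cut T; set T \<subseteq> basis\<rbrakk> \<Longrightarrow> \<exists>us. uncut us \<and> split_first us = T \<and> set us \<subseteq> basis \<and> Suc (length us) = length T"
proof -
  assume "cut T" and b: "set T \<subseteq> basis"
  then obtain \<alpha> x v rest where T: "T = singles \<alpha> @ [x] # v # rest" "inadm (\<alpha> @ [x])" "v \<noteq> []" "adm x (hd v)"
    unfolding cut_def by blast
  have "x # v \<in> basis" using b T by (simp add: basis_Cons basis_single)
  then have "uncut (singles \<alpha> @ (x # v) # rest) \<and> split_first (singles \<alpha> @ (x # v) # rest) = T \<and>
      set (singles \<alpha> @ (x # v) # rest) \<subseteq> basis \<and> Suc (length (singles \<alpha> @ (x # v) # rest)) = length T"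
    using T b split_first_eq[OF T(3), of \<alpha> x rest] uncutI[OF refl T(2,3)] by simp
  then show ?thesis by blast
qed

section \<open>The order by rewriting and the leading part of the differential\<close>

definition below :: "dl_gen list list \<Rightarrow> dl_gen list list \<Rightarrow> bool"
  where "below us T \<longleftrightarrow> reduces\<^sup>+\<^sup>+ (concat T) (concat us)"

lemma wf_below: "wf {(us, T). below us T}"
proof -
  have "{(us, T). below us T} \<subseteq> inv_image ({(w', w). reduces w w'}\<^sup>+) concat"
  proof clarsimp
    fix us T :: "dl_gen list list" assume "below us T"
    then have "(concat us, concat T) \<in> {(w', w). reduces w w'}\<^sup>+"
      unfolding below_def by (induction rule: tranclp_induct) (auto intro: trancl_into_trancl2)
    then show "(concat us, concat T) \<in> {(w', w). reduces w w'}\<^sup>+" .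
  qed
  then show ?thesis using wf_inv_image[OF wf_trancl[OF wf_reduces]] wf_subset by blast
qed

lemma not_below_same: "concat us = concat T \<Longrightarrow> \<not> below us T"
proof
  assume "concat us = concat T" "below us T"
  then have "below T T" by (simp add: below_def)
  then show False using wf_not_refl[OF wf_below, of T] by blast
qed

definition merge_nf :: "nat \<Rightarrow> dl_gen list list \<Rightarrow> dl_gen list \<Rightarrow>\<^sub>0 'k"
  where "merge_nf i T = nf (word_elt (T ! i @ T ! Suc i))"

definition cut_sgn :: "nat \<Rightarrow> dl_gen list list \<Rightarrow> 'k"
  where "cut_sgn i T = (- 1) powi (int (Suc i) + sum_list (take (Suc i) (degs T)))"

lemma merge_pos: "\<lbrakk>set T \<subseteq> basis; Suc i < length T\<rbrakk> \<Longrightarrow> T ! i @ T ! Suc i \<in> pos_words"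
  by (meson Suc_lessD append_pos_words basis_pos nth_mem subsetD)

lemma merge_nf_supp:
  assumes "set T \<subseteq> basis" "Suc i < length T" "z \<in> supp (merge_nf i T)"
  shows "z \<in> basis" "reduces\<^sup>*\<^sup>* (T ! i @ T ! Suc i) z"
    "set (merge_at i T z) \<subseteq> basis" "length (merge_at i T z) = length T - 1"
    "length (concat (merge_at i T z)) = length (concat T)" "length z = length (T ! i) + length (T ! Suc i)"
proof -
  have pos: "supp (sing (T ! i @ T ! Suc i) (1::'k)) \<subseteq> pos_words" using merge_pos[OF assms(1,2)] by simp
  show z: "z \<in> basis" using nf_pos(1)[OF pos] assms(3) by (auto simp: merge_nf_def)
  show red: "reduces\<^sup>*\<^sup>* (T ! i @ T ! Suc i) z"
    using nf_props(3)[OF pos_words_lists[OF pos], of z] assms(3) by (auto simp: merge_nf_def)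
  show "set (merge_at i T z) \<subseteq> basis" using z set_merge_at[of i T z] assms(1) by blast
  show "length (merge_at i T z) = length T - 1" by (rule length_merge_at[OF assms(2)])
  show len: "length z = length (T ! i) + length (T ! Suc i)" using reduces_star_props[OF red] by simp
  show "length (concat (merge_at i T z)) = length (concat T)"
    unfolding concat_merge_at[OF assms(2)] using len by simp
qed

lemma reduces_star_context: "reduces\<^sup>*\<^sup>* w z \<Longrightarrow> reduces\<^sup>*\<^sup>* (u @ w @ v) (u @ z @ v)"
  by (induction rule: rtranclp_induct) (auto intro: rtranclp.rtrancl_into_rtrancl reduces_context)

text \<open>Merging leaves the underlying word unchanged unless the merged entry is inadmissible and
  has to be rewritten; rewriting never returns to the same word.\<close>

lemma merge_below:
  assumes "set T \<subseteq> basis" "Suc i < length T" "z \<in> supp (merge_nf i T)"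
  shows "below (merge_at i T z) T \<longleftrightarrow> T ! i @ T ! Suc i \<notin> basis"
proof
  assume ni: "T ! i @ T ! Suc i \<notin> basis"
  have "reduces\<^sup>*\<^sup>* (concat T) (concat (merge_at i T z))"
    unfolding concat_merge_at[OF assms(2)] using merge_nf_supp(2)[OF assms] by (rule reduces_star_context)
  moreover have "concat T \<noteq> concat (merge_at i T z)"
    unfolding concat_merge_at[OF assms(2)] using merge_nf_supp(1)[OF assms] ni by auto
  ultimately show "below (merge_at i T z) T" by (auto simp: below_def dest: rtranclpD)
next
  assume b: "below (merge_at i T z) T"
  show "T ! i @ T ! Suc i \<notin> basis"
  proof
    assume "T ! i @ T ! Suc i \<in> basis"
    then have "merge_nf i T = sing (T ! i @ T ! Suc i) 1"
      unfolding merge_nf_def by (intro nf_word) (simp add: basis_def)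
    then have "z = T ! i @ T ! Suc i" using assms(3) by simp
    then show False using b not_below_same[of "merge_at i T z" T] by (simp add: concat_merge_at[OF assms(2)])
  qed
qed

lemma codiff_word:
  assumes h: "h \<in> cochains s t" and T: "set T \<subseteq> basis" "length T = Suc s"
  shows "codiff h (bar_word T) (degs T) = (\<Sum>i<s. cut_sgn i T * ev (\<lambda>z. h (bar_word (merge_at i T z))) (merge_nf i T))"
proof -
  have "h (bar_merge DL i (bar_word T)) = ev (\<lambda>z. h (bar_word (merge_at i T z))) (merge_nf i T)" if i: "i < s" for i
  proof -
    have len: "Suc i < length T" using i T(2) by simp
    then have pos: "T ! i \<in> pos_words" "T ! Suc i \<in> pos_words" using T(1) basis_pos len by (meson Suc_lessD nth_mem subsetD)+
    have bm: "bar_merge DL i (bar_word T) = bar_word (take i T) @ word_elt (T ! i @ T ! Suc i) # bar_word (drop (i + 2) T)"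
      using len word_elt_mult[OF pos] by (simp add: bar_merge_def take_map drop_map)
    moreover have "bar_word (take i T) @ word_elt (T ! i @ T ! Suc i) # bar_word (drop (i + 2) T) \<in> tuples s"
    proof -
      have "set (merge_at i T (T ! i @ T ! Suc i)) \<subseteq> pos_words"
        using set_merge_at[of i T "T ! i @ T ! Suc i"] T(1) basis_subset_pos append_pos_words[OF pos] by blast
      from bar_word_tuple[OF this] show ?thesis using len T(2) by (simp add: merge_at_def)
    qed
    ultimately show ?thesis
      using multiadditive_expansion[OF cochain_multiadditive[OF h]] by (simp add: merge_at_def merge_nf_def)
  qed
  then show ?thesis unfolding bar_codiff_def cut_sgn_def using T(2) by simp
qed

text \<open>The deviation from the differential of the associated monomial algebra, in which
  inadmissible products are zero.\<close>

definition lower_part :: "(dl_gen list list \<Rightarrow> 'k) \<Rightarrow> dl_gen list list \<Rightarrow> 'k"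
  where "lower_part H T = (\<Sum>i<length T - 1. cut_sgn i T *
    ev (\<lambda>z. if below (merge_at i T z) T then H (merge_at i T z) else 0) (merge_nf i T))"

lemma nth_singles_inadm:
  assumes "T = singles \<alpha> @ rest" "inadm \<alpha>" "Suc i < length \<alpha>"
  shows "T ! i @ T ! Suc i \<notin> basis"
proof -
  have "T ! i = [\<alpha> ! i]" "T ! Suc i = [\<alpha> ! Suc i]" using assms by (simp_all add: nth_append)
  moreover have "\<not> adm (\<alpha> ! i) (\<alpha> ! Suc i)" using assms(2,3) by (simp add: successively_conv_nth)
  ultimately show ?thesis by (simp add: basis_def adm_words_def)
qed

text \<open>Let k be the place of the new cut. A merge before k joins an inadmissible pair and so
  lands below; the merge at k restores \<open>us\<close>; a merge after k lands below or keeps the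
  cut at k, and then \<open>h\<close> vanishes.\<close>

lemma codiff_split_first:
  assumes h: "h \<in> cochains s t" and us: "uncut us" "set us \<subseteq> basis" "length us = s"
    and van: "\<And>T. \<lbrakk>cut T; set T \<subseteq> basis; length T = s\<rbrakk> \<Longrightarrow> h (bar_word T) = 0"
  shows "codiff h (bar_word (split_first us)) (degs (split_first us))
    = cut_sgn (num_singles us) (split_first us) * h (bar_word us) + lower_part (\<lambda>us. h (bar_word us)) (split_first us)"
proof -
  obtain \<alpha> x v rest where u: "us = singles \<alpha> @ (x # v) # rest" "inadm (\<alpha> @ [x])" "v \<noteq> []"
    "split_first us = singles \<alpha> @ [x] # v # rest" "num_singles us = length \<alpha>"
    by (rule uncut_split[OF us(1)])
  define T k where "T = split_first us" and "k = length \<alpha>"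
  have T: "T = singles \<alpha> @ [x] # v # rest" unfolding T_def by (rule u(4))
  have Tb: "set T \<subseteq> basis" "length T = Suc s" using split_first_basis[OF us(1,2)] us(3) by (simp_all add: T_def)
  have xv: "x # v \<in> basis" "adm x (hd v)" using us(2) u basis_Cons by auto
  have k: "k < s" using us(3) by (simp add: u(1) k_def)
  have Tk: "T ! k @ T ! Suc k = x # v" "merge_at k T (x # v) = us" by (simp_all add: T k_def u(1) nth_append merge_at_def)
  let ?l = "\<lambda>i z. h (bar_word (merge_at i T z))"
  let ?r = "\<lambda>i z. if below (merge_at i T z) T then h (bar_word (merge_at i T z)) else 0"
  have eqi: "ev (?l i) (merge_nf i T) = ev (?r i) (merge_nf i T)" if i: "i < s" "i \<noteq> k" for i
  proof (rule ev_cong)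
    fix z assume z: "z \<in> supp (merge_nf i T)"
    have len: "Suc i < length T" using i Tb by simp
    note mb = merge_below[OF Tb(1) len z]
    show "?l i z = ?r i z"
    proof (cases "T ! i @ T ! Suc i \<in> basis")
      case True
      have "i > k"
      proof (rule ccontr)
        assume "\<not> i > k"
        then have "Suc i < length (\<alpha> @ [x])" using i(2) by (simp add: k_def)
        moreover have "T = singles (\<alpha> @ [x]) @ v # rest" by (simp add: T)
        ultimately show False using nth_singles_inadm[of T "\<alpha> @ [x]"] u(2) True by blast
      qed
      then obtain j where j: "i = Suc k + j" by (metis less_iff_Suc_add add_Suc)
      have "merge_nf i T = sing (T ! i @ T ! Suc i) 1"
        unfolding merge_nf_def using True by (intro nf_word) (simp add: basis_def)
      then have z': "z = T ! i @ T ! Suc i" using z by simp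
      have "cut (merge_at i T z)"
      proof (cases j)
        case 0
        \<comment> \<open>Here v itself is merged with its successor, which does not change its
          first letter.\<close>
        then have "merge_at i T z = singles \<alpha> @ [x] # (v @ hd rest) # tl rest"
          using len by (cases rest) (simp_all add: merge_at_def z' T j k_def nth_append)
        then show ?thesis by (rule cutI[OF _ u(2)]) (use u(3) xv(2) in simp_all)
      next
        case (Suc n)
        then have "merge_at i T z = singles \<alpha> @ [x] # v # merge_at n rest z"
          by (simp add: merge_at_def T j k_def numeral_eq_Suc)
        then show ?thesis by (rule cutI[OF _ u(2,3) xv(2)])
      qed
      then have "h (bar_word (merge_at i T z)) = 0"
        using merge_nf_supp(3,4)[OF Tb(1) len z] Tb(2) by (intro van) auto
      then show ?thesis by simp
    qed (simp add: mb)
  qed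
  have mk: "merge_nf k T = sing (x # v) 1"
    unfolding merge_nf_def Tk using xv(1) by (intro nf_word) (simp add: basis_def)
  have "\<not> below us T" by (intro not_below_same) (simp add: T_def concat_split_first)
  then have evk: "ev (?l k) (merge_nf k T) = h (bar_word us)" "ev (?r k) (merge_nf k T) = 0"
    unfolding mk by (simp_all add: Tk)
  have "codiff h (bar_word T) (degs T) = (\<Sum>i<s. cut_sgn i T * ev (?l i) (merge_nf i T))"
    by (rule codiff_word[OF h Tb])
  also have "\<dots> = cut_sgn k T * h (bar_word us) + (\<Sum>i\<in>{..<s} - {k}. cut_sgn i T * ev (?l i) (merge_nf i T))"
    using k by (subst sum.remove[of _ k]) (auto simp: evk)
  also have "(\<Sum>i\<in>{..<s} - {k}. cut_sgn i T * ev (?l i) (merge_nf i T)) = (\<Sum>i\<in>{..<s} - {k}. cut_sgn i T * ev (?r i) (merge_nf i T))"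
    by (rule sum.cong) (use eqi in auto)
  also have "\<dots> = (\<Sum>i<s. cut_sgn i T * ev (?r i) (merge_nf i T))"
    using k by (subst (2) sum.remove[of _ k]) (simp_all only: evk, auto)
  finally show ?thesis by (simp add: lower_part_def T_def[symmetric] Tb(2) u(5) k_def)
qed

lemma cut_sgn_square: "cut_sgn i T * (cut_sgn i T * x) = x"
  by (simp add: cut_sgn_def)

lemma cut_sgn_nz: "cut_sgn i T \<noteq> 0"
  using cut_sgn_square[of i T 1] by auto

lemma below_degs: "below us T \<Longrightarrow> sum_list (degs us) = sum_list (degs T)"
proof -
  have "sum_list (degs us) = word_deg p (concat us)" for us
    by (induction us) (simp_all add: word_deg_append, simp add: word_deg_def)
  then show "below us T \<Longrightarrow> sum_list (degs us) = sum_list (degs T)"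
    unfolding below_def using reduces_star_props tranclp_into_rtranclp by metis
qed

text \<open>\<open>codiff_split_first\<close> is solved for the value at \<open>us\<close>. The
  lower part only involves lists below, so this is a recursion along \<open>below\<close>; each cut
  list is \<open>split_first us\<close> for an uncut \<open>us\<close>, so all prescribed values are
  met.\<close>

lemma contraction:
  assumes f: "f \<in> cochains (Suc s) t"
  shows "\<exists>h\<in>cochains s t. (\<forall>T. set T \<subseteq> basis \<longrightarrow> length T = s \<longrightarrow> cut T \<longrightarrow> h (bar_word T) = 0) \<and>
    (\<forall>T. set T \<subseteq> basis \<longrightarrow> length T = Suc s \<longrightarrow> cut T \<longrightarrow> codiff h (bar_word T) (degs T) = f (bar_word T))"
proof -
  define \<Phi> where "\<Phi> H us = (if uncut us then cut_sgn (num_singles us) (split_first us) *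
    (f (bar_word (split_first us)) - lower_part H (split_first us)) else 0)" for H us
  define H where "H = wfrec {(us, T). below us T} \<Phi>"
  \<comment> \<open>\<open>split_first us\<close> has the same underlying word as \<open>us\<close>,
    so its lower part only uses values below \<open>us\<close>, where the restriction made by
    \<open>wfrec\<close> changes nothing.\<close>
  have "lower_part (Wfrec.cut H {(us, T). below us T} us) (split_first us) = lower_part H (split_first us)" for us
    unfolding lower_part_def
    by (intro sum.cong arg_cong2[where f = "(*)"] ev_cong) (simp_all add: Wfrec.cut_def below_def concat_split_first)
  then have H: "H us = \<Phi> H us" for us
    using wfrec[OF wf_below, of \<Phi> us] unfolding H_def[symmetric] \<Phi>_def by simp
  \<comment> \<open>The restriction to degree t makes \<open>h\<close> a cochain. It is compatible
    with the recursion, since rewriting preserves degrees.\<close>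
  define h where "h = cochain_of s (\<lambda>us. if sum_list (degs us) = t then H us else 0)"
  have hc: "h \<in> cochains s t" unfolding h_def by (rule cochain_of_cochain) (auto split: if_splits)
  have hw: "h (bar_word us) = (if sum_list (degs us) = t then H us else 0)" if "set us \<subseteq> basis" "length us = s" for us
    unfolding h_def using that by (simp add: cochain_of_word)
  have van: "h (bar_word T) = 0" if "cut T" "set T \<subseteq> basis" "length T = s" for T
  proof -
    have "H T = 0" by (subst H) (simp only: \<Phi>_def cut_not_uncut[OF that(1)] if_False)
    then show ?thesis using hw[OF that(2,3)] by simp
  qed
  have "codiff h (bar_word T) (degs T) = f (bar_word T)" if T: "set T \<subseteq> basis" "length T = Suc s" "cut T" for T
  proof -
    have hom: "homogeneous (Suc s) (bar_word T) (degs T)"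
      by (rule bar_word_basis[OF T(1,2)])
    show ?thesis
    proof (cases "sum_list (degs T) = t")
      case True
      obtain us where us: "uncut us" "split_first us = T" "set us \<subseteq> basis" "length us = s"
        using cut_split_first[OF T(3,1)] T(2) by auto
      have "sum_list (degs us) = word_deg p (concat us)" for us
        by (induction us) (simp_all add: word_deg_append, simp add: word_deg_def)
      then have du: "sum_list (degs us) = t" using True us(2) by (metis concat_split_first)
      have "lower_part (\<lambda>us. h (bar_word us)) T = lower_part H T"
        unfolding lower_part_def
      proof (intro sum.cong arg_cong2[where f = "(*)"] ev_cong refl)
        fix i z assume i: "i \<in> {..<length T - 1}" and z: "z \<in> supp (merge_nf i T)"
        have len: "Suc i < length T" using i by simp
        show "(if below (merge_at i T z) T then h (bar_word (merge_at i T z)) else 0)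
          = (if below (merge_at i T z) T then H (merge_at i T z) else 0)"
          using below_degs[of "merge_at i T z" T] merge_nf_supp(3,4)[OF T(1) len z] T(2) True by (simp add: hw)
      qed
      moreover have "h (bar_word us) = H us" using hw[OF us(3,4)] du by simp
      moreover have "H us = cut_sgn (num_singles us) T * (f (bar_word T) - lower_part H T)"
        by (subst H) (simp only: \<Phi>_def us(1,2) if_True)
      ultimately show ?thesis
        using codiff_split_first[OF hc us(1,3,4) van] unfolding us(2) by (simp only: cut_sgn_square diff_add_cancel)
    next
      case False
      then show ?thesis using codiff_degree[OF hc hom] dl.cochainD(3)[OF f hom] by simp
    qed
  qed
  then show ?thesis using hc van by blast
qed

text \<open>By well-founded induction the lower part in \<open>codiff_split_first\<close> vanishes.
  Critical lists do not occur in it: they have as many letters as entries, whereas an uncut list has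
  more.\<close>

lemma vanishing:
  assumes g: "g \<in> cochains s t"
    and van: "\<And>T. \<lbrakk>cut T; set T \<subseteq> basis; length T = s\<rbrakk> \<Longrightarrow> g (bar_word T) = 0"
    and van': "\<And>T. \<lbrakk>cut T; set T \<subseteq> basis; length T = Suc s\<rbrakk> \<Longrightarrow> codiff g (bar_word T) (degs T) = 0"
  shows "\<lbrakk>set us \<subseteq> basis; length us = s; \<not> critical us\<rbrakk> \<Longrightarrow> g (bar_word us) = 0"
proof (induction us rule: wf_induct_rule[OF wf_below])
  case (1 us)
  have "[] \<notin> set us" using 1(2) by (auto simp: basis_def)
  then consider "cut us" | "uncut us" using bar_trichotomy 1(4) by blast
  then show ?case
  proof cases
    case 2
    define T where "T = split_first us"
    have T: "set T \<subseteq> basis" "cut T" "length T = Suc s" using split_first_basis[OF 2 1(2)] 1(3) by (auto simp: T_def)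
    obtain \<alpha> x v rest where u: "us = singles \<alpha> @ (x # v) # rest" "v \<noteq> []" using 2 unfolding uncut_def by blast
    have "length (concat ws) \<ge> length ws" if "[] \<notin> set ws" for ws :: "dl_gen list list"
      using that
    proof (induction ws)
      case (Cons w ws)
      then obtain a w' where "w = a # w'" by (cases w) auto
      then show ?case using Cons by simp
    qed simp
    then have "length (concat rest) \<ge> length rest" using \<open>[] \<notin> set us\<close> u by simp
    then have big: "length (concat us) > s" using 1(3) u(2) by (auto simp: u(1) neq_Nil_conv)
    have "lower_part (\<lambda>us. g (bar_word us)) T = 0"
      unfolding lower_part_def
    proof (intro sum.neutral ballI)
      fix i assume i: "i \<in> {..<length T - 1}"
      then have len: "Suc i < length T" by simp
      have "ev (\<lambda>z. if below (merge_at i T z) T then g (bar_word (merge_at i T z)) else 0) (merge_nf i T) = 0"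
      proof (rule ev_eq_0)
        fix z assume z: "z \<in> supp (merge_nf i T)"
        note m = merge_nf_supp[OF T(1) len z]
        have "\<not> critical (merge_at i T z)"
        proof
          assume "critical (merge_at i T z)"
          then have "length (concat (merge_at i T z)) = length (merge_at i T z)" by (auto simp: critical_def)
          then show False using m(4,5) T(3) big by (simp add: T_def concat_split_first)
        qed
        then have "below (merge_at i T z) us \<Longrightarrow> g (bar_word (merge_at i T z)) = 0"
          using m(3,4) T(3) by (intro 1(1)) auto
        then show "(if below (merge_at i T z) T then g (bar_word (merge_at i T z)) else 0) = 0"
          by (simp add: T_def below_def concat_split_first)
      qed
      then show "cut_sgn i T * ev (\<lambda>z. if below (merge_at i T z) T then g (bar_word (merge_at i T z)) else 0) (merge_nf i T) = 0"
        by simp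
    qed
    then have "cut_sgn (num_singles us) T * g (bar_word us) = 0"
      using codiff_split_first[OF g 2 1(2,3) van] van'[OF T(2,1,3)] unfolding T_def by (simp only: add_0_right)
    then show ?thesis using cut_sgn_nz by (simp only: mult_eq_0_iff simp_thms)
  qed (use van 1 in blast)
qed

section \<open>Reduction of cocycles and coboundaries to critical lists\<close>

abbreviation cocycles :: "nat \<Rightarrow> int \<Rightarrow> ('k dl_free set list \<Rightarrow> 'k) set" where "cocycles \<equiv> ext_cocycles DL"
abbreviation coboundaries :: "nat \<Rightarrow> int \<Rightarrow> ('k dl_free set list \<Rightarrow> 'k) set" where "coboundaries \<equiv> ext_coboundaries DL"

text \<open>Subtract the coboundary of the contraction of \<open>f\<close>. The difference is a
  cocycle that vanishes on cut lists, so \<open>vanishing\<close> applies.\<close>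

theorem cocycle_critical:
  assumes f: "f \<in> cocycles s t"
  shows "\<exists>g\<in>cocycles s t. (\<lambda>xs. f xs - g xs) \<in> coboundaries s t \<and>
    (\<forall>us. set us \<subseteq> basis \<longrightarrow> length us = s \<longrightarrow> \<not> critical us \<longrightarrow> g (bar_word us) = 0)"
proof (cases s)
  case 0
  have "critical []" by (simp add: critical_def)
  then show ?thesis using f 0 dl.coboundary_zero by (intro bexI[of _ f]) auto
next
  case (Suc n)
  have fc: "f \<in> cochains (Suc n) t" using f Suc by (simp add: dl.cocycle_iff)
  obtain h where h: "h \<in> cochains n t"
    "\<And>T. \<lbrakk>set T \<subseteq> basis; length T = Suc n; cut T\<rbrakk> \<Longrightarrow> codiff h (bar_word T) (degs T) = f (bar_word T)"
    using contraction[OF fc] by blast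
  obtain D where D: "D \<in> cochains (Suc n) t" "\<And>xs ds. homogeneous (Suc n) xs ds \<Longrightarrow> D xs = codiff h xs ds"
    using coboundary_cochain[OF h(1)] by blast
  define g where "g = (\<lambda>xs. f xs - D xs)"
  have gc: "g \<in> cochains (Suc n) t" unfolding g_def by (rule dl.cochain_diff[OF fc D(1)])
  have dg: "codiff g xs ds = 0" if "homogeneous (Suc (Suc n)) xs ds" for xs ds
    unfolding g_def dl.bar_codiff_diff using dl.bar_codiff_codiff[OF D(2) that] f that Suc
    by (simp add: dl.cocycle_iff)
  have "g (bar_word us) = 0" if us: "set us \<subseteq> basis" "length us = s" "\<not> critical us" for us
  proof (rule vanishing[OF gc _ _ us(1) _ us(3)])
    show "g (bar_word T) = 0" if "cut T" "set T \<subseteq> basis" "length T = Suc n" for T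
      using h(2)[OF that(2,3,1)] D(2)[OF bar_word_basis[OF that(2,3)]] by (simp add: g_def)
    show "codiff g (bar_word T) (degs T) = 0" if "cut T" "set T \<subseteq> basis" "length T = Suc (Suc n)" for T
      by (rule dg[OF bar_word_basis[OF that(2,3)]])
  qed (use us Suc in simp)
  moreover have "g \<in> cocycles s t" using gc dg Suc by (simp add: dl.cocycle_iff)
  moreover have "(\<lambda>xs. f xs - g xs) \<in> coboundaries s t"
    unfolding dl.coboundary_iff using D h(1) Suc by (auto simp: g_def)
  ultimately show ?thesis by blast
qed

text \<open>A primitive can be changed by a coboundary until it vanishes off the critical lists. The
  differential of such a cochain is zero at a critical list, because every merge there creates an
  entry with two letters.\<close>

theorem critical_coboundary_zero:
  assumes f: "f \<in> coboundaries s t"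
    and crit: "\<And>us. \<lbrakk>set us \<subseteq> basis; length us = s; \<not> critical us\<rbrakk> \<Longrightarrow> f (bar_word us) = 0"
  shows "f = (\<lambda>_. 0)"
proof (cases s)
  case 0
  then show ?thesis using dl.coboundary_0 f by blast
next
  case (Suc m)
  have fc: "f \<in> cochains s t" using f by (simp add: dl.coboundary_iff)
  obtain h where h: "h \<in> cochains m t" "\<And>xs ds. homogeneous s xs ds \<Longrightarrow> f xs = codiff h xs ds"
    using f Suc by (auto simp: dl.coboundary_iff)
  have fT: "f (bar_word T) = codiff h (bar_word T) (degs T)" if "set T \<subseteq> basis" "length T = s" for T
    by (rule h(2)[OF bar_word_basis[OF that]])
  show ?thesis
  proof (cases m)
    case 0
    have "f (bar_word us) = 0" if us: "length us = s" "set us \<subseteq> basis" for us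
    proof -
      obtain u where "us = [u]" using us(1) Suc 0 by (auto simp: length_Suc_conv)
      then show ?thesis using fT[OF us(2,1)] by simp
    qed
    then show ?thesis by (intro cochain_eq_0[OF fc])
  next
    case m: (Suc n)
    have hc: "h \<in> cochains (Suc n) t" using h(1) m by simp
    obtain k where k: "k \<in> cochains n t"
      "\<And>T. \<lbrakk>set T \<subseteq> basis; length T = Suc n; cut T\<rbrakk> \<Longrightarrow> codiff k (bar_word T) (degs T) = h (bar_word T)"
      using contraction[OF hc] by blast
    obtain D where D: "D \<in> cochains (Suc n) t" "\<And>xs ds. homogeneous (Suc n) xs ds \<Longrightarrow> D xs = codiff k xs ds"
      using coboundary_cochain[OF k(1)] by blast
    define g where "g = (\<lambda>xs. h xs - D xs)"
    have gc: "g \<in> cochains (Suc n) t" unfolding g_def by (rule dl.cochain_diff[OF hc D(1)])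
    have dg: "codiff g (bar_word T) (degs T) = f (bar_word T)" if "set T \<subseteq> basis" "length T = Suc (Suc n)" for T
      unfolding g_def dl.bar_codiff_diff
      using dl.bar_codiff_codiff[OF D(2) bar_word_basis[OF that]] fT[OF that(1)] that(2) Suc m by simp
    have g0: "g (bar_word us) = 0" if us: "set us \<subseteq> basis" "length us = Suc n" "\<not> critical us" for us
    proof (rule vanishing[OF gc _ _ us])
      show "g (bar_word T) = 0" if "cut T" "set T \<subseteq> basis" "length T = Suc n" for T
        using k(2)[OF that(2,3,1)] D(2)[OF bar_word_basis[OF that(2,3)]] by (simp add: g_def)
      show "codiff g (bar_word T) (degs T) = 0" if "cut T" "set T \<subseteq> basis" "length T = Suc (Suc n)" for T
        using dg crit that cut_not_critical Suc m by simp
    qed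
    have "f (bar_word us) = 0" if us: "length us = s" "set us \<subseteq> basis" for us
    proof (cases "critical us")
      case True
      have len: "length us = Suc (Suc n)" using us Suc m by simp
      have "codiff g (bar_word us) (degs us) = 0"
        unfolding codiff_word[OF gc us(2) len]
      proof (intro sum.neutral ballI)
        fix i assume "i \<in> {..<Suc n}"
        then have i: "Suc i < length us" using len by simp
        have "ev (\<lambda>z. g (bar_word (merge_at i us z))) (merge_nf i us) = 0"
        proof (rule ev_eq_0)
          fix z assume z: "z \<in> supp (merge_nf i us)"
          note mz = merge_nf_supp[OF us(2) i z]
          have "length w = 1" if "w \<in> set us" for w using that True by (auto simp: critical_def)
          then have "length (us ! i) = 1" "length (us ! Suc i) = 1" using i by auto
          then have "length z = 2" using mz(6) by simp
          moreover have "z \<in> set (merge_at i us z)" by (simp add: merge_at_def)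
          ultimately have "\<not> critical (merge_at i us z)" by (auto simp: critical_def)
          then show "g (bar_word (merge_at i us z)) = 0" using mz(3,4) len by (intro g0) auto
        qed
        then show "cut_sgn i us * ev (\<lambda>z. g (bar_word (merge_at i us z))) (merge_nf i us) = 0" by simp
      qed
      then show ?thesis using dg[OF us(2) len] by simp
    qed (use crit us in blast)
    then show ?thesis by (intro cochain_eq_0[OF fc])
  qed
qed

end

section \<open>The Koszul dual\<close>

context prime_field
begin

text \<open>
  Up to these signs, which come from the sign conventions for the bar differential and the cup
  product, the quadratic dual relations are the orthogonal complement of the Adem relations.
\<close>

definition theta :: "dl_gen \<Rightarrow> dl_gen \<Rightarrow> 'k"
  where "theta x y = sgn_k ((1 + dl_deg p x) * dl_deg p y)"

definition dual_rel :: "dl_gen \<Rightarrow> dl_gen \<Rightarrow> 'k dl_free"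
  where "dual_rel a b = sing [a, b] 1 + pair_sum (\<lambda>x y. theta a b * theta x y * acoef x y a b)"

lemma sgn_k_square [simp]: "sgn_k n * sgn_k n = 1" "sgn_k n * (sgn_k n * x) = x"
  by (simp_all add: sgn_k_def)

lemma sgn_k_nz [simp]: "sgn_k n \<noteq> 0"
  by (simp add: sgn_k_def)

lemma theta_nz [simp]: "theta x y \<noteq> 0"
  by (simp add: theta_def)

text \<open>Given indices of the resulting pair confine the right index of its source from both
  sides. So a dual relation is a finite sum, in spite of the infinite dimension of the graded
  pieces.\<close>

lemma finite_acoef_dual: "finite {(x, y). acoef x y a b \<noteq> 0}"
proof (rule finite_subset)
  show "{(x, y). acoef x y a b \<noteq> 0} \<subseteq> (\<lambda>(e, e', s). ((e, snd a + snd b - s), (e', s))) `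
      (UNIV \<times> UNIV \<times> {snd a + suffix_shift [b]..snd b})"
  proof clarify
    fix e u e' s assume nz: "acoef (e, u) (e', s) a b \<noteq> 0"
    have "snd a + suffix_shift [b] \<le> s" using acoef_exponents(3)[OF nz] by simp
    moreover have "s \<le> snd b" using acoef_nz(9)[OF nz] by (simp add: of_bool_def split: if_splits)
    moreover have "u = snd a + snd b - s" using acoef_nz(7)[OF nz] by simp
    ultimately show "((e, u), (e', s)) \<in> (\<lambda>(e, e', s). ((e, snd a + snd b - s), (e', s))) `
      (UNIV \<times> UNIV \<times> {snd a + suffix_shift [b]..snd b})" by (intro image_eqI[of _ _ "(e, e', s)"]) auto
  qed
qed auto

lemma coef_dual_rel:
  "coef (dual_rel a b) w = (if w = [a, b] then 1 else 0) + pair_val (\<lambda>x y. theta a b * theta x y * acoef x y a b) w"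
proof -
  have "{(x, y). theta a b * theta x y * acoef x y a b \<noteq> 0} = {(x, y). acoef x y a b \<noteq> 0}" by auto
  then show ?thesis unfolding dual_rel_def using finite_acoef_dual by (simp add: lookup_add coef_word coef_pair_sum)
qed

lemma supp_dual_rel: "w \<in> supp (dual_rel a b) \<Longrightarrow> w = [a, b] \<or> (\<exists>x y. w = [x, y] \<and> acoef x y a b \<noteq> 0)"
proof -
  assume "w \<in> supp (dual_rel a b)"
  then have "w = [a, b] \<or> pair_val (\<lambda>x y. theta a b * theta x y * acoef x y a b) w \<noteq> 0"
    by (auto simp: in_keys_iff coef_dual_rel split: if_splits)
  moreover have "length w = 2" if "pair_val F w \<noteq> 0" for F :: "dl_gen \<Rightarrow> dl_gen \<Rightarrow> 'k"
    using that by (auto intro: ccontr)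
  ultimately show ?thesis by (fastforce simp: length_Suc_conv numeral_2_eq_2)
qed

section \<open>The quadratic dual algebra\<close>

definition graded_words :: "nat \<Rightarrow> int \<Rightarrow> dl_gen list set"
  where "graded_words s t = {w \<in> lists (dl_gens p). length w = s \<and> word_deg p w = t}"

lemma graded_words_append: "\<lbrakk>u \<in> graded_words s t; v \<in> graded_words s' t'\<rbrakk> \<Longrightarrow> u @ v \<in> graded_words (s + s') (t + t')"
  by (auto simp: graded_words_def word_deg_append)

lemma supp_word_mult_graded: "\<lbrakk>supp f \<subseteq> graded_words s t; supp g \<subseteq> graded_words s' t'\<rbrakk> \<Longrightarrow>
    supp (word_mult f g) \<subseteq> graded_words (s + s') (t + t')"
  using supp_word_mult[of f g] graded_words_append by blast

lemma supp_dual_rel_graded: "\<lbrakk>a \<in> dl_gens p; b \<in> dl_gens p\<rbrakk> \<Longrightarrow>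
    supp (dual_rel a b) \<subseteq> graded_words 2 (dl_deg p a + dl_deg p b)"
proof
  fix w assume ab: "a \<in> dl_gens p" "b \<in> dl_gens p" and w: "w \<in> supp (dual_rel a b)"
  then show "w \<in> graded_words 2 (dl_deg p a + dl_deg p b)"
    using supp_dual_rel[OF w] by (auto simp: graded_words_def word_deg_def acoef_deg dest: acoef_nz)
qed

text \<open>The quadratic dual algebra is the quotient by these spaces.\<close>

definition dual_ideal_gens :: "nat \<Rightarrow> int \<Rightarrow> 'k dl_free set"
  where "dual_ideal_gens s t = {word_mult (word_mult (sing u 1) (dual_rel a b)) (sing v 1) | u v a b.
    a \<in> dl_gens p \<and> b \<in> dl_gens p \<and> adm a b \<and> u @ [a, b] @ v \<in> graded_words s t}"

definition dual_ideal :: "nat \<Rightarrow> int \<Rightarrow> 'k dl_free set"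
  where "dual_ideal s t = pm.span (dual_ideal_gens s t)"

lemma dual_ideal_closed: "0 \<in> dual_ideal s t" "\<lbrakk>f \<in> dual_ideal s t; g \<in> dual_ideal s t\<rbrakk> \<Longrightarrow> f + g \<in> dual_ideal s t"
  "\<lbrakk>f \<in> dual_ideal s t; g \<in> dual_ideal s t\<rbrakk> \<Longrightarrow> f - g \<in> dual_ideal s t" "f \<in> dual_ideal s t \<Longrightarrow> pm_scale c f \<in> dual_ideal s t"
  "f \<in> dual_ideal s t \<Longrightarrow> - f \<in> dual_ideal s t"
  unfolding dual_ideal_def by (rule pm.span_zero pm.span_add pm.span_diff pm.span_scale pm.span_neg; assumption)+

lemma dual_ideal_sum: "(\<And>i. i \<in> S \<Longrightarrow> f i \<in> dual_ideal s t) \<Longrightarrow> sum f S \<in> dual_ideal s t"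
  unfolding dual_ideal_def by (rule pm.span_sum)

text \<open>An admissible pair is replaced by the inadmissible pairs from which it arises; this
  inverse rewriting terminates by \<open>wf_reduces_converse\<close>.\<close>

lemma dual_normal_form:
  "w \<in> graded_words s t \<Longrightarrow> \<exists>g. supp g \<subseteq> {z \<in> graded_words s t. inadm z} \<and> sing w 1 - g \<in> dual_ideal s t"
proof (induction w rule: wf_induct_rule[OF wf_reduces_converse])
  case (1 w)
  show ?case
  proof (cases "inadm w")
    case True
    then show ?thesis using 1(2) dual_ideal_closed(1) by (intro exI[of _ "sing w 1"]) auto
  next
    case False
    then obtain u a b v where w: "w = u @ [a, b] @ v" and ab: "adm a b"
      using not_successively_split[of "\<lambda>x y. \<not> adm x y"] by blast
    define c where "c x y = theta a b * theta x y * acoef x y a b" for x y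
    define S where "S = {(x, y). c x y \<noteq> 0}"
    let ?w = "\<lambda>xy. u @ [fst xy, snd xy] @ v"
    have step: "reduces (?w xy) w" if "xy \<in> S" for xy
    proof -
      have "acoef (fst xy) (snd xy) a b \<noteq> 0" using that by (auto simp: S_def c_def)
      then show ?thesis unfolding reduces_def w by blast
    qed
    have "\<exists>g. supp g \<subseteq> {z \<in> graded_words s t. inadm z} \<and> sing (?w xy) 1 - g \<in> dual_ideal s t" if "xy \<in> S" for xy
    proof (rule 1(1))
      show "(?w xy, w) \<in> {(w, w'). reduces w w'}" using step[OF that] by simp
      show "?w xy \<in> graded_words s t"
        using reduces_lists[OF step[OF that]] reduces_word_deg[OF step[OF that]] reduces_exponents(4)[OF step[OF that]] 1(2)
        by (simp add: graded_words_def)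
    qed
    then have "\<forall>xy\<in>S. \<exists>g. supp g \<subseteq> {z \<in> graded_words s t. inadm z} \<and> sing (?w xy) 1 - g \<in> dual_ideal s t" by blast
    from bchoice[OF this] obtain g where
      g: "\<forall>xy\<in>S. supp (g xy) \<subseteq> {z \<in> graded_words s t. inadm z} \<and> sing (?w xy) 1 - g xy \<in> dual_ideal s t" by blast
    let ?g = "- (\<Sum>xy\<in>S. pm_scale (c (fst xy) (snd xy)) (g xy))"
    have "supp ?g \<subseteq> (\<Union>xy\<in>S. supp (pm_scale (c (fst xy) (snd xy)) (g xy)))"
      unfolding supp_uminus by (rule supp_sum)
    also have "\<dots> \<subseteq> (\<Union>xy\<in>S. supp (g xy))" by (intro UN_mono order.refl supp_pm_scale)
    also have "\<dots> \<subseteq> {z \<in> graded_words s t. inadm z}" using g by blast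
    finally have "supp ?g \<subseteq> {z \<in> graded_words s t. inadm z}" .
    moreover have "sing w 1 - ?g = word_mult (word_mult (sing u 1) (dual_rel a b)) (sing v 1)
        - (\<Sum>xy\<in>S. pm_scale (c (fst xy) (snd xy)) (sing (?w xy) 1 - g xy))"
    proof (rule ev_eqI)
      fix \<phi>
      show "ev \<phi> (sing w 1 - ?g) = ev \<phi> (word_mult (word_mult (sing u 1) (dual_rel a b)) (sing v 1)
        - (\<Sum>xy\<in>S. pm_scale (c (fst xy) (snd xy)) (sing (?w xy) 1 - g xy)))"
        unfolding dual_rel_def c_def[symmetric]
        by (simp add: ev_diff ev_add ev_uminus ev_word_mult ev_sum ev_scale ev_pair_sum w S_def
            case_prod_unfold right_diff_distrib sum_subtractf)
    qed
    moreover have "word_mult (word_mult (sing u 1) (dual_rel a b)) (sing v 1) \<in> dual_ideal s t"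
    proof -
      have "a \<in> dl_gens p" "b \<in> dl_gens p" using 1(2) by (auto simp: w graded_words_def)
      then show ?thesis
        using 1(2) ab unfolding dual_ideal_def dual_ideal_gens_def w by (intro pm.span_base) blast
    qed
    moreover have "(\<Sum>xy\<in>S. pm_scale (c (fst xy) (snd xy)) (sing (?w xy) 1 - g xy)) \<in> dual_ideal s t"
      using g by (intro dual_ideal_sum dual_ideal_closed(4)) auto
    ultimately show ?thesis using dual_ideal_closed(3) by (intro exI[of _ ?g]) simp
  qed
qed

lemma dual_normal_form_pm:
  assumes "supp x \<subseteq> graded_words s t"
  shows "\<exists>g. supp g \<subseteq> {z \<in> graded_words s t. inadm z} \<and> x - g \<in> dual_ideal s t"
  using assms
proof (induction x rule: pm_induct)
  case zero
  then show ?case using dual_ideal_closed(1) by (intro exI[of _ 0]) simp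
next
  case (add w c x)
  obtain g where g: "supp g \<subseteq> {z \<in> graded_words s t. inadm z}" "x - g \<in> dual_ideal s t" using add.IH by blast
  obtain h where h: "supp h \<subseteq> {z \<in> graded_words s t. inadm z}" "sing w 1 - h \<in> dual_ideal s t"
    using dual_normal_form[OF add.hyps(1)] by blast
  have "sing w c + x - (pm_scale c h + g) = pm_scale c (sing w 1 - h) + (x - g)"
    unfolding pm_scale_diff using sing_eq_scale[of w c] by simp
  moreover have "pm_scale c (sing w 1 - h) + (x - g) \<in> dual_ideal s t"
    by (intro dual_ideal_closed(2,4) g h)
  moreover have "supp (pm_scale c h + g) \<subseteq> {z \<in> graded_words s t. inadm z}"
    using supp_pm_scale[of c h] g(1) h(1) by (intro supp_add_subset) auto
  ultimately show ?case by (intro exI[of _ "pm_scale c h + g"] conjI) (simp_all only:)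
qed

section \<open>Dual classes and their products\<close>

lemma nf_nz_aug:
  "x \<in> aug_ideal DL \<Longrightarrow> dl_dual p g [x] = coef (nf x) [g]"
proof -
  assume x: "x \<in> aug_ideal DL"
  have *: "f \<in> x \<longleftrightarrow> f - nf x \<in> DI" for f using nf_aug[OF x] dl_coset_eq[of "nf x"] by blast
  then have "nf x \<in> x" using DI_zero by simp
  then have "(SOME f. f \<in> x) \<in> x" by (rule someI)
  then have "coef ((SOME f. f \<in> x) - nf x) [g] = 0" using * by (intro DI_coef_short) auto
  then show ?thesis using x by (simp add: dl_dual_def bar_tuples_def lookup_minus)
qed

text \<open>A product of two elements of the augmentation ideal only involves words of length at
  least two, as rewriting preserves the length.\<close>

lemma dl_dual_cocycle: "dl_dual p g \<in> cocycles 1 (dl_deg p g)"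
proof -
  have aug: "x \<in> aug_ideal DL" if "[x] \<in> tuples 1" for x using that by (simp add: bar_tuples_def)
  have "dl_dual p g \<in> cochains 1 (dl_deg p g)"
  proof (rule dl.cochainI)
    fix us x y vs assume xy: "us @ x # vs \<in> tuples 1" "us @ y # vs \<in> tuples 1"
    then have "us = []" "vs = []" by (auto simp: bar_tuples_def)
    then show "dl_dual p g (us @ (x \<oplus>\<^bsub>DL\<^esub> y) # vs) = dl_dual p g (us @ x # vs) + dl_dual p g (us @ y # vs)"
      using xy aug[of x] aug[of y] by (simp add: nf_nz_aug aug_add nf_aug_add lookup_add)
  next
    fix xs ds assume h: "homogeneous 1 xs ds" "sum_list ds \<noteq> dl_deg p g"
    then obtain x d where xd: "xs = [x]" "ds = [d]" by (auto simp: bar_homogeneous_def length_Suc_conv list_all2_Cons1)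
    then have x: "x \<in> aug_ideal DL" "x \<in> homog DL d" using h(1) by (auto simp: bar_homogeneous_def)
    have "[g] \<notin> supp (nf x)" using nf_homog[OF x(2), of "[g]"] h(2) xd by (auto simp: word_deg_def)
    then show "dl_dual p g xs = 0" using x xd by (simp add: nf_nz_aug in_keys_iff)
  qed (simp add: dl_dual_def)
  moreover have "codiff (dl_dual p g) xs ds = 0" if hom: "homogeneous (Suc 1) xs ds" for xs ds
  proof -
    obtain x y d e where xs: "xs = [x, y]" "ds = [d, e]" and xy: "x \<in> aug_ideal DL" "y \<in> aug_ideal DL"
      using hom by (auto simp: bar_homogeneous_def length_Suc_conv list_all2_Cons1)
    have pos: "supp (nf x) \<subseteq> pos_words" "supp (nf y) \<subseteq> pos_words"
      using nf_aug xy basis_subset_pos by blast+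
    let ?f = "word_mult (nf x) (nf y)"
    have fp: "supp ?f \<subseteq> pos_words" by (rule supp_word_mult_pos[OF pos])
    have prod: "x \<otimes>\<^bsub>DL\<^esub> y = dl_coset p ?f"
      using nf_aug xy DL_mult[OF pos_words_lists[OF pos(1)] pos_words_lists[OF pos(2)]] by simp
    have "[g] \<notin> supp (nf (dl_coset p ?f))"
    proof
      assume "[g] \<in> supp (nf (dl_coset p ?f))"
      then obtain w where w: "w \<in> supp ?f" "reduces\<^sup>*\<^sup>* w [g]" using nf_props(3)[OF pos_words_lists[OF fp]] by blast
      obtain u v where "w = u @ v" "u \<in> pos_words" "v \<in> pos_words" using supp_word_mult[of "nf x" "nf y"] w(1) pos by blast
      then have "length w \<ge> 2" by (cases u; cases v) (auto simp: pos_words_def)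
      then show False using reduces_star_props[OF w(2)] by simp
    qed
    then have "dl_dual p g [x \<otimes>\<^bsub>DL\<^esub> y] = 0"
      using nf_nz_aug[of "x \<otimes>\<^bsub>DL\<^esub> y" g] aug_mult[OF xy] unfolding prod by (simp add: in_keys_iff)
    then show ?thesis by (simp add: xs dl.bar_codiff_Cons)
  qed
  ultimately show ?thesis by (simp add: dl.cocycle_iff)
qed

fun dual_word :: "dl_gen list \<Rightarrow> 'k dl_free set list \<Rightarrow> 'k"
  where
    "dual_word [] = (\<lambda>xs. if xs = [] then 1 else 0)"
  | "dual_word (g # w) = cup 1 (dl_deg p g) (length w) (word_deg p w) (dl_dual p g) (dual_word w)"

lemma word_deg_simps [simp]: "word_deg p [] = 0" "word_deg p (g # w) = dl_deg p g + word_deg p w"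
  by (simp_all add: word_deg_def)

lemma dual_word_cocycle: "dual_word w \<in> cocycles (length w) (word_deg p w)"
proof (induction w)
  case (Cons g w)
  then show ?case using dl.cup_cocycle[OF dl_dual_cocycle[of g] Cons.IH] by simp
qed (simp add: dl.ext_unit_cocycle)

lemma cup_assoc:
  "cup (s + s') (t + t') s'' t'' (cup s t s' t' f g) h = cup s t (s' + s'') (t' + t'') f (cup s' t' s'' t'' g (h :: 'b list \<Rightarrow> 'k))"
proof
  fix xs
  have "(- 1) powi ((int (s + s') + (t + t')) * (int s'' + t'')) * (- 1) powi ((int s + t) * (int s' + t'))
      = ((- 1) powi ((int s + t) * (int (s' + s'') + (t' + t''))) * (- 1) powi ((int s' + t') * (int s'' + t'')) :: 'k)"
    by (simp add: dl.powi_minus_one_add[symmetric] algebra_simps)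
  then show "cup (s + s') (t + t') s'' t'' (cup s t s' t' f g) h xs = cup s t (s' + s'') (t' + t'') f (cup s' t' s'' t'' g h) xs"
    by (simp add: cup_def min_def drop_take add.commute mult.assoc[symmetric])
qed

lemma dual_word_append:
  "dual_word (u @ v) = cup (length u) (word_deg p u) (length v) (word_deg p v) (dual_word u) (dual_word v)"
proof (induction u)
  case Nil
  then show ?case by (simp add: cup_def)
next
  case (Cons g u)
  then show ?case
    using cup_assoc[of 1 "length u" "dl_deg p g" "word_deg p u" "length v" "word_deg p v" "dl_dual p g" "dual_word u" "dual_word v"]
    by (simp add: word_deg_append)
qed

lemma dual_word_single: "dual_word [g] = dl_dual p g"
proof
  fix xs show "dual_word [g] xs = dl_dual p g xs"
    by (cases xs; cases "tl xs") (auto simp: cup_def dl_dual_def bar_tuples_def)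
qed

text \<open>The Koszul signs accumulated by the iterated cup product
  \<open>dual_word\<close>.\<close>

fun word_sgn :: "dl_gen list \<Rightarrow> 'k"
  where
    "word_sgn [] = 1"
  | "word_sgn (g # w) = sgn_k ((1 + dl_deg p g) * (int (length w) + word_deg p w)) * word_sgn w"

lemma word_sgn_square [simp]: "word_sgn w * (word_sgn w * x) = x"
proof (induction w arbitrary: x)
  case (Cons g w)
  have "word_sgn (g # w) * (word_sgn (g # w) * x)
      = sgn_k ((1 + dl_deg p g) * (int (length w) + word_deg p w)) * (sgn_k ((1 + dl_deg p g) * (int (length w) + word_deg p w))
        * (word_sgn w * (word_sgn w * x)))" by (simp only: word_sgn.simps ac_simps)
  then show ?case by (simp only: Cons.IH sgn_k_square)
qed simp

lemma word_sgn_nz [simp]: "word_sgn w \<noteq> 0"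
  using word_sgn_square[of w 1] by auto

lemma dual_word_bar_word:
  "\<lbrakk>set us \<subseteq> basis; length us = length w\<rbrakk> \<Longrightarrow> dual_word w (bar_word us) = (if us = singles w then word_sgn w else 0)"
proof (induction w arbitrary: us)
  case (Cons g w)
  then obtain u vs where us: "us = u # vs" by (cases us) auto
  have u: "u \<in> basis" using Cons.prems us by simp
  then have "dl_dual p g [word_elt u] = (if u = [g] then 1 else 0)"
    using nf_nz_aug[OF word_elt_aug[OF basis_pos[OF u]]] nf_word[of u] by (simp add: basis_def coef_word eq_commute)
  moreover have "dual_word w (bar_word vs) = (if vs = singles w then word_sgn w else 0)"
    by (rule Cons.IH) (use Cons.prems us in auto)
  ultimately show ?case by (simp add: us cup_def sgn_k_def)
qed simp

definition dual_of :: "'k dl_free \<Rightarrow> 'k dl_free set list \<Rightarrow> 'k"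
  where "dual_of x xs = ev (\<lambda>w. dual_word w xs) x"

lemma dual_of_simps: "dual_of 0 = (\<lambda>_. 0)" "dual_of (x + y) = (\<lambda>xs. dual_of x xs + dual_of y xs)"
  "dual_of (x - y) = (\<lambda>xs. dual_of x xs - dual_of y xs)"
  "dual_of (pm_scale c x) = (\<lambda>xs. c * dual_of x xs)" "dual_of (sing w c) = (\<lambda>xs. c * dual_word w xs)"
  by (simp_all add: dual_of_def fun_eq_iff ev_add ev_diff ev_scale)

lemma dual_of_cocycle: "supp x \<subseteq> graded_words s t \<Longrightarrow> dual_of x \<in> cocycles s t"
proof (induction x rule: pm_induct)
  case zero
  then show ?case by (simp add: dual_of_simps dl.cocycle_zero)
next
  case (add w c x)
  then have "dual_word w \<in> cocycles s t" using dual_word_cocycle[of w] by (auto simp: graded_words_def)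
  then show ?case using add.IH by (simp add: dual_of_simps dl.cocycle_add dl.cocycle_scale)
qed

lemma dual_of_word_mult:
  assumes "supp x \<subseteq> graded_words s t" "supp y \<subseteq> graded_words s' t'"
  shows "dual_of (word_mult x y) = cup s t s' t' (dual_of x) (dual_of y)"
proof
  fix xs
  let ?c = "(- 1) powi ((int s + t) * (int s' + t'))"
  have "dual_of (word_mult x y) xs = ev (\<lambda>u. ev (\<lambda>v. dual_word (u @ v) xs) y) x"
    by (simp add: dual_of_def ev_word_mult)
  also have "\<dots> = ev (\<lambda>u. ev (\<lambda>v. (?c * dual_word u (take s xs)) * dual_word v (drop s xs)) y) x"
    using assms by (intro ev_cong) (auto simp: dual_word_append cup_def graded_words_def mult.assoc)
  also have "\<dots> = ev (\<lambda>u. (?c * dual_of y (drop s xs)) * dual_word u (take s xs)) x"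
  proof (rule ev_cong)
    show "ev (\<lambda>v. (?c * dual_word u (take s xs)) * dual_word v (drop s xs)) y
        = (?c * dual_of y (drop s xs)) * dual_word u (take s xs)" for u
      unfolding ev_fun_scale dual_of_def by (simp add: mult_ac)
  qed
  also have "\<dots> = cup s t s' t' (dual_of x) (dual_of y) xs"
    unfolding ev_fun_scale by (simp add: dual_of_def cup_def mult_ac)
  finally show "dual_of (word_mult x y) xs = cup s t s' t' (dual_of x) (dual_of y) xs" .
qed

lemma dual_of_bar_word:
  assumes "supp x \<subseteq> graded_words s t" "set us \<subseteq> basis" "length us = s"
  shows "dual_of x (bar_word us) = (if us = singles (concat us) then word_sgn (concat us) * coef x (concat us) else 0)"
proof -
  have "dual_of x (bar_word us) = ev (\<lambda>w. if us = singles w then word_sgn w else 0) x"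
    unfolding dual_of_def using assms by (intro ev_cong dual_word_bar_word) (auto simp: graded_words_def)
  also have "\<dots> = (if us = singles (concat us) then word_sgn (concat us) * coef x (concat us) else 0)"
  proof (cases "us = singles (concat us)")
    case True
    have "us = singles w \<longleftrightarrow> w = concat us" for w using True by auto
    then have "ev (\<lambda>w. if us = singles w then word_sgn w else 0) x
        = ev (\<lambda>w. word_sgn (concat us) * (if w = concat us then 1 else 0)) x" by (intro ev_cong) auto
    then show ?thesis unfolding if_P[OF True] by (simp only: ev_fun_scale ev_indicator)
  next
    case False
    then have "us \<noteq> singles w" for w by auto
    then show ?thesis using False by (simp add: ev_eq_0)
  qed
  finally show ?thesis .
qed

lemma nf_pair:
  assumes "x \<in> dl_gens p" "y \<in> dl_gens p"
  shows "coef (nf (word_elt [x, y])) w = (if adm x y then (if w = [x, y] then 1 else 0) else pair_val (acoef x y) w)"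
proof (cases "adm x y")
  case True
  then have "[x, y] \<in> adm_words" using assms by (auto simp: adm_words_def)
  then show ?thesis using True by (simp add: nf_word coef_word)
next
  case False
  have "nf (word_elt [x, y]) = pair_sum (acoef x y)"
  proof (rule nf_eqI)
    show "sing [x, y] 1 - pair_sum (acoef x y) \<in> DI" using adem_rel_DI[OF assms False] by (simp add: adem_rel_def)
    show "supp (pair_sum (acoef x y)) \<subseteq> adm_words"
    proof
      fix w assume "w \<in> supp (pair_sum (acoef x y))"
      then have nz: "pair_val (acoef x y) w \<noteq> 0" by (simp add: in_keys_iff coef_pair_sum[OF finite_acoef])
      then have "length w = 2" by (auto intro: ccontr)
      then obtain a b where w: "w = [a, b]" by (auto simp: length_Suc_conv numeral_2_eq_2)
      then have "acoef x y a b \<noteq> 0" using nz by simp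
      from acoef_nz(3,4,6)[OF this] show "w \<in> adm_words" by (simp add: w adm_words_def)
    qed
  qed
  then show ?thesis using False by (simp add: coef_pair_sum[OF finite_acoef])
qed

text \<open>The primitive is \<open>theta a b\<close> times the cochain of length one dual to the
  admissible word \<open>[a, b]\<close>. On a pair of letters its coboundary reads off the
  coefficient of \<open>[a, b]\<close> in their product, which is an Adem coefficient if the pair is
  inadmissible.\<close>

lemma dual_of_dual_rel:
  assumes ab: "a \<in> dl_gens p" "b \<in> dl_gens p" "adm a b"
  shows "dual_of (dual_rel a b) \<in> coboundaries 2 (dl_deg p a + dl_deg p b)"
proof -
  let ?t = "dl_deg p a + dl_deg p b"
  define h where "h = cochain_of 1 (\<lambda>us. if us = [[a, b]] then theta a b else 0)"
  have h: "h \<in> cochains 1 ?t"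
    unfolding h_def by (rule cochain_of_cochain) (auto split: if_splits)
  have hw: "h (bar_word [z]) = (if z = [a, b] then theta a b else 0)" if "z \<in> basis" for z
    unfolding h_def using that by (subst cochain_of_word) auto
  obtain D where D: "D \<in> cochains (Suc 1) ?t" "\<And>xs ds. homogeneous (Suc 1) xs ds \<Longrightarrow> D xs = codiff h xs ds"
    using coboundary_cochain[OF h] by blast
  have supp: "supp (dual_rel a b) \<subseteq> graded_words 2 ?t" by (rule supp_dual_rel_graded[OF ab(1,2)])
  have dc: "dual_of (dual_rel a b) \<in> cochains (Suc 1) ?t"
    using dual_of_cocycle[OF supp] by (simp add: dl.cocycle_iff numeral_2_eq_2)
  have "(\<lambda>xs. dual_of (dual_rel a b) xs - D xs) = (\<lambda>_. 0)"
  proof (rule cochain_eq_0[OF dl.cochain_diff[OF dc D(1)]])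
    fix us assume us: "length us = Suc 1" "set us \<subseteq> basis"
    then obtain u v where uv: "us = [u, v]" by (auto simp: length_Suc_conv)
    have uvb: "u \<in> basis" "v \<in> basis" using us uv by auto
    have hom: "homogeneous (Suc 1) (bar_word us) (degs us)" by (rule bar_word_basis[OF us(2,1)])
    have "D (bar_word us) = cut_sgn 0 us * ev (\<lambda>z. h (bar_word (merge_at 0 us z))) (merge_nf 0 us)"
      unfolding D(2)[OF hom] codiff_word[OF h us(2,1)] by simp
    also have "ev (\<lambda>z. h (bar_word (merge_at 0 us z))) (merge_nf 0 us)
        = ev (\<lambda>z. theta a b * (if z = [a, b] then 1 else 0)) (nf (word_elt (u @ v)))"
      unfolding merge_nf_def uv nth_Cons_0 nth_Cons_Suc
    proof (rule ev_cong)
      fix z assume "z \<in> supp (nf (word_elt (u @ v)))"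
      then have "z \<in> basis" using nf_pos(1)[of "sing (u @ v) 1"] append_pos_words basis_pos uvb by auto
      then show "h (bar_word (merge_at 0 [u, v] z)) = theta a b * (if z = [a, b] then 1 else 0)"
        using hw by (simp add: merge_at_def)
    qed
    also have "\<dots> = theta a b * coef (nf (word_elt (u @ v))) [a, b]" by (simp only: ev_fun_scale ev_indicator)
    finally have Dus: "D (bar_word us) = cut_sgn 0 us * (theta a b * coef (nf (word_elt (u @ v))) [a, b])" .
    have "dual_of (dual_rel a b) (bar_word us) = D (bar_word us)"
    proof (cases "length u = 1 \<and> length v = 1")
      case True
      then obtain x y where xy: "u = [x]" "v = [y]" by (auto simp: length_Suc_conv)
      have G: "x \<in> dl_gens p" "y \<in> dl_gens p" using uvb xy basis_single by auto
      \<comment> \<open>The cup product contributes (1 + |x|)(1 + |y|) to the exponent of the sign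
        and \<open>theta\<close> contributes (1 + |x|)|y|. The sum has the parity of 1 + |x|, as in
        the bar differential; this is the origin of \<open>theta\<close>.\<close>
      have sg: "cut_sgn 0 us = word_sgn [x, y] * theta x y"
      proof -
        have "word_sgn [x, y] * theta x y = sgn_k ((1 + dl_deg p x) * (1 + dl_deg p y) + (1 + dl_deg p x) * dl_deg p y)"
          by (simp add: theta_def sgn_k_add)
        also have "\<dots> = sgn_k (1 + dl_deg p x)"
          by (rule sgn_k_cong) (simp add: algebra_simps)
        finally show ?thesis by (simp add: cut_sgn_def uv xy sgn_k_def)
      qed
      have "dual_of (dual_rel a b) (bar_word us) = word_sgn [x, y] * coef (dual_rel a b) [x, y]"
        using dual_of_bar_word[OF supp us(2)] us(1) by (simp add: uv xy numeral_2_eq_2)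
      moreover have "acoef x y a b = 0" if "adm x y" using acoef_nz(5)[of x y a b] that by blast
      ultimately show ?thesis
        unfolding Dus sg using nf_pair[OF G, of "[a, b]"] ab(3)
        by (auto simp: coef_dual_rel xy theta_def mult_ac)
    next
      case False
      have "u \<noteq> []" "v \<noteq> []" using uvb by (auto simp: basis_def)
      then have big: "length (u @ v) > 2" using False by (cases u; cases v) (auto simp: Suc_lessI)
      have "\<forall>z\<in>set us. length z = 1" if "us = singles w" for w using that by auto
      then have "us \<noteq> singles (concat us)" using False uv by (metis list.set_intros(1,2))
      then have "dual_of (dual_rel a b) (bar_word us) = 0"
        using dual_of_bar_word[OF supp us(2)] us(1) by (simp add: numeral_2_eq_2)
      moreover have "[a, b] \<notin> supp (nf (word_elt (u @ v)))"
      proof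
        assume "[a, b] \<in> supp (nf (word_elt (u @ v)))"
        then have "reduces\<^sup>*\<^sup>* (u @ v) [a, b]"
          using nf_props(3)[of "sing (u @ v) 1" "[a, b]"] append_pos_words[OF basis_pos[OF uvb(1)] basis_pos[OF uvb(2)]]
          by (auto simp: pos_words_def)
        from reduces_star_props[OF this] big show False by simp
      qed
      ultimately show ?thesis unfolding Dus by (simp add: in_keys_iff)
    qed
    then show "dual_of (dual_rel a b) (bar_word us) - D (bar_word us) = 0" by simp
  qed
  then have "dual_of (dual_rel a b) = D" by (simp add: fun_eq_iff)
  then show ?thesis unfolding dl.coboundary_iff using D h by (auto simp: numeral_2_eq_2)
qed

lemma dual_of_dual_ideal:
  assumes "x \<in> dual_ideal s t"
  shows "supp x \<subseteq> graded_words s t \<and> dual_of x \<in> coboundaries s t"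
  using assms unfolding dual_ideal_def
proof (induction rule: pm.span_induct)
  case base
  show ?case
    by (rule pm.subspaceI)
      (auto simp: dual_of_simps dl.coboundary_zero dl.coboundary_add dl.coboundary_scale
        dest!: subsetD[OF keys_add] subsetD[OF supp_pm_scale])
next
  case (step x)
  then obtain u v a b where x: "x = word_mult (word_mult (sing u 1) (dual_rel a b)) (sing v 1)"
    and ab: "a \<in> dl_gens p" "b \<in> dl_gens p" "adm a b" and w: "u @ [a, b] @ v \<in> graded_words s t"
    by (auto simp: dual_ideal_gens_def)
  define su tu sv tv where "su = length u" and "tu = word_deg p u" and "sv = length v" and "tv = word_deg p v"
  have u: "supp (sing u (1::'k)) \<subseteq> graded_words su tu" "supp (sing v (1::'k)) \<subseteq> graded_words sv tv"
    using w by (auto simp: graded_words_def su_def tu_def sv_def tv_def)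
  have st: "s = su + 2 + sv" "t = tu + (dl_deg p a + dl_deg p b) + tv"
    using w by (auto simp: graded_words_def word_deg_append su_def tu_def sv_def tv_def)
  note r = supp_dual_rel_graded[OF ab(1,2)]
  note ur = supp_word_mult_graded[OF u(1) r]
  have "dual_of (word_mult (sing u 1) (dual_rel a b)) \<in> coboundaries (su + 2) (tu + (dl_deg p a + dl_deg p b))"
    unfolding dual_of_word_mult[OF u(1) r]
    by (rule dl.cup_coboundary_right[OF dual_of_cocycle[OF u(1)] dual_of_dual_rel[OF ab]])
  then have "dual_of x \<in> coboundaries s t"
    unfolding x dual_of_word_mult[OF ur u(2)] st by (rule dl.cup_coboundary_left[OF _ dual_of_cocycle[OF u(2)]])
  then show ?case using supp_word_mult_graded[OF ur u(2)] by (simp add: x st)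
qed

text \<open>Modulo the dual ideal only inadmissible words remain. Their dual cochains vanish off the
  critical lists, so \<open>critical_coboundary_zero\<close> makes all coefficients zero.\<close>

theorem dual_of_kernel:
  assumes x: "supp x \<subseteq> graded_words s t"
  shows "dual_of x \<in> coboundaries s t \<longleftrightarrow> x \<in> dual_ideal s t"
proof
  assume cob: "dual_of x \<in> coboundaries s t"
  obtain g where g: "supp g \<subseteq> {z \<in> graded_words s t. inadm z}" "x - g \<in> dual_ideal s t"
    using dual_normal_form_pm[OF x] by blast
  have gs: "supp g \<subseteq> graded_words s t" using g(1) by blast
  have "dual_of g = (\<lambda>xs. dual_of x xs - dual_of (x - g) xs)" by (simp add: dual_of_simps)
  then have "dual_of g \<in> coboundaries s t"
    using dl.coboundary_diff[OF cob] dual_of_dual_ideal[OF g(2)] by simp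
  then have zero: "dual_of g = (\<lambda>_. 0)"
  proof (rule critical_coboundary_zero)
    fix us assume us: "set us \<subseteq> basis" "length us = s" "\<not> critical us"
    have "coef g (concat us) = 0" if "us = singles (concat us)"
    proof (rule ccontr)
      assume "coef g (concat us) \<noteq> 0"
      then have "inadm (concat us)" using g(1) by (auto simp: in_keys_iff[symmetric])
      then show False using us(3) that unfolding critical_def by blast
    qed
    then show "dual_of g (bar_word us) = 0" using dual_of_bar_word[OF gs us(1,2)] by simp
  qed
  have "coef g w = 0" for w
  proof (cases "w \<in> supp g")
    case True
    then have w: "w \<in> graded_words s t" using gs by blast
    then have "set (singles w) \<subseteq> basis" "length (singles w) = s" by (auto simp: graded_words_def basis_single)
    from dual_of_bar_word[OF gs this] show ?thesis using zero by simp
  qed (simp add: in_keys_iff)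
  then have "g = 0" by (intro poly_mapping_eqI) simp
  then show "x \<in> dual_ideal s t" using g(2) by simp
qed (use dual_of_dual_ideal in blast)

section \<open>The subalgebra of Ext generated by the dual classes\<close>

abbreviation ext :: "nat \<Rightarrow> int \<Rightarrow> ('k dl_free set list \<Rightarrow> 'k) \<Rightarrow> ('k dl_free set list \<Rightarrow> 'k) set"
  where "ext \<equiv> ext_class DL"

lemma koszul_dual_simps:
  "bzero (koszul_dual p) = (\<lambda>s t. ext s t (\<lambda>_. 0))" "badd (koszul_dual p) = badd (ext_algebra DL)"
  "bscale (koszul_dual p) = bscale (ext_algebra DL)" "bone (koszul_dual p) = ext 0 0 (\<lambda>xs. if xs = [] then 1 else 0)"
  "bmult (koszul_dual p) = bmult (ext_algebra DL)"
  "bcomp (koszul_dual p) s t = {X. generated_by (ext_algebra DL) (\<lambda>s t. {dl_dual_class p g | g. g \<in> dl_gens p \<and> s = 1 \<and> dl_deg p g = t}) s t X}"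
  by (simp_all add: koszul_dual_def generated_subalgebra_def ext_algebra_def)

lemma koszul_dual_comp:
  "bcomp (koszul_dual p) s t = (\<lambda>x. ext s t (dual_of x)) ` {x. supp x \<subseteq> graded_words s t}"
proof (intro equalityI subsetI)
  fix X :: "('k dl_free set list \<Rightarrow> 'k) set" assume "X \<in> bcomp (koszul_dual p) s t"
  then have "generated_by (ext_algebra DL) (\<lambda>s t. {dl_dual_class p g | g. g \<in> dl_gens p \<and> s = 1 \<and> dl_deg p g = t}) s t X"
    by (simp add: koszul_dual_simps)
  then show "X \<in> (\<lambda>x. ext s t (dual_of x)) ` {x. supp x \<subseteq> graded_words s t}"
  proof (induction rule: generated_by.induct)
    case (gen_base X s t)
    then obtain g where g: "X = dl_dual_class p g" "g \<in> dl_gens p" "s = 1" "dl_deg p g = t" by blast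
    then show ?case
      by (intro image_eqI[of _ _ "sing [g] 1"])
        (auto simp: dual_of_simps dual_word_single dl_dual_class_def graded_words_def simp del: dual_word.simps)
  next
    case (gen_zero s t)
    then show ?case by (intro image_eqI[of _ _ 0]) (auto simp: dual_of_simps ext_algebra_def)
  next
    case gen_one
    then show ?case by (intro image_eqI[of _ _ "sing [] 1"]) (auto simp: dual_of_simps ext_algebra_def graded_words_def)
  next
    case (gen_add s t X Y)
    then obtain x y where xy: "supp x \<subseteq> graded_words s t" "supp y \<subseteq> graded_words s t"
      "X = ext s t (dual_of x)" "Y = ext s t (dual_of y)" by blast
    then show ?case
      by (intro image_eqI[of _ _ "x + y"]) (simp_all add: dl.ext_badd dual_of_cocycle dual_of_simps supp_add_subset)
  next
    case (gen_scale s t X c)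
    then obtain x where x: "supp x \<subseteq> graded_words s t" "X = ext s t (dual_of x)" by blast
    then show ?case
      using supp_pm_scale[of c x]
      by (intro image_eqI[of _ _ "pm_scale c x"]) (auto simp: dl.ext_bscale dual_of_cocycle dual_of_simps)
  next
    case (gen_mult s t X s' t' Y)
    then obtain x y where xy: "supp x \<subseteq> graded_words s t" "supp y \<subseteq> graded_words s' t'"
      "X = ext s t (dual_of x)" "Y = ext s' t' (dual_of y)" by blast
    then show ?case
      by (intro image_eqI[of _ _ "word_mult x y"])
        (simp_all add: dl.ext_bmult dual_of_cocycle dual_of_word_mult supp_word_mult_graded)
  qed
next
  let ?S = "\<lambda>s t. {dl_dual_class p g | g. g \<in> dl_gens p \<and> s = 1 \<and> dl_deg p g = t}"
  fix X assume "X \<in> (\<lambda>x. ext s t (dual_of x)) ` {x. supp x \<subseteq> graded_words s t}"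
  then obtain x where x: "supp x \<subseteq> graded_words s t" and X: "X = ext s t (dual_of x)" by blast
  have word: "generated_by (ext_algebra DL) ?S (length w) (word_deg p w) (ext (length w) (word_deg p w) (dual_word w))"
    if "w \<in> lists (dl_gens p)" for w
    using that
  proof (induction w)
    case Nil
    have "generated_by (ext_algebra DL) ?S 0 0 (bone (ext_algebra DL))" by (rule generated_by.gen_one)
    then show ?case by (simp add: ext_algebra_def)
  next
    case (Cons g w)
    have "generated_by (ext_algebra DL) ?S 1 (dl_deg p g) (ext 1 (dl_deg p g) (dl_dual p g))"
      using Cons.hyps unfolding dl_dual_class_def by (intro generated_by.gen_base) blast
    from generated_by.gen_mult[OF this Cons.IH]
    show ?case by (simp add: dl.ext_bmult[OF dl_dual_cocycle dual_word_cocycle, unfolded One_nat_def])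
  qed
  have "generated_by (ext_algebra DL) ?S s t (ext s t (dual_of x))" using x
  proof (induction x rule: pm_induct)
    case zero
    have "generated_by (ext_algebra DL) ?S s t (bzero (ext_algebra DL) s t)" by (rule generated_by.gen_zero)
    then show ?case by (simp add: ext_algebra_def dual_of_simps)
  next
    case (add w c g)
    then have w: "w \<in> lists (dl_gens p)" "length w = s" "word_deg p w = t" by (auto simp: graded_words_def)
    have wc: "dual_word w \<in> cocycles s t" using dual_word_cocycle[of w] w by simp
    have "generated_by (ext_algebra DL) ?S s t (badd (ext_algebra DL) s t (bscale (ext_algebra DL) s t c (ext s t (dual_word w))) (ext s t (dual_of g)))"
      using word[OF w(1)] w add.IH by (intro generated_by.gen_add generated_by.gen_scale) auto
    then show ?case
      by (simp add: dl.ext_bscale[OF wc] dl.ext_badd[OF dl.cocycle_scale[OF wc] dual_of_cocycle[OF add.hyps(2)]] dual_of_simps)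
  qed
  then show "X \<in> bcomp (koszul_dual p) s t" by (simp add: koszul_dual_simps X)
qed

text \<open>A cocycle concentrated on critical lists is given by its values at inadmissible words.
  Finitely many tuples see only finitely many of them, and dropping the others leaves a finite
  combination of words. The coboundary that was split off is added again at the end.\<close>

theorem koszul_dual_dense:
  assumes f: "f \<in> cocycles s t" and F: "finite F"
  shows "\<exists>g\<in>cocycles s t. ext s t g \<in> bcomp (koszul_dual p) s t \<and> (\<forall>xs\<in>F. g xs = f xs)"
proof -
  obtain g where g: "g \<in> cocycles s t" "(\<lambda>xs. f xs - g xs) \<in> coboundaries s t"
    "\<And>us. \<lbrakk>set us \<subseteq> basis; length us = s; \<not> critical us\<rbrakk> \<Longrightarrow> g (bar_word us) = 0"
    using cocycle_critical[OF f] by blast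
  have gc: "g \<in> cochains s t" using g(1) by (simp add: dl.cocycle_iff)
  \<comment> \<open>The letters that can occur: entries of critical lists have one letter, so the
    first letters of the words in the normal forms suffice.\<close>
  define L where "L = hd ` (\<Union>xs\<in>F. \<Union>x\<in>set xs. supp (nf x))"
  define Z where "Z = {w. set w \<subseteq> L \<and> length w = s} \<inter> graded_words s t \<inter> {w. inadm w}"
  have "finite L" unfolding L_def using F by auto
  then have finZ: "finite Z" unfolding Z_def by (intro finite_Int disjI1 finite_lists_length_eq)
  define x where "x = (\<Sum>w\<in>Z. sing w (word_sgn w * g (bar_word (singles w))))"
  have xZ: "supp x \<subseteq> Z" unfolding x_def by (rule order.trans[OF supp_sum]) (auto split: if_splits)
  have xs: "supp x \<subseteq> graded_words s t" using xZ by (auto simp: Z_def)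
  have coef_x: "coef x w = (if w \<in> Z then word_sgn w * g (bar_word (singles w)) else 0)" for w
  proof -
    have "coef x w = (\<Sum>v\<in>Z. if v = w then word_sgn v * g (bar_word (singles v)) else 0)"
      unfolding x_def lookup_sum by (rule sum.cong) (auto simp: coef_word)
    then show ?thesis using finZ by simp
  qed
  define q where "q = (\<lambda>xs. g xs - dual_of x xs)"
  have qc: "q \<in> cochains s t"
    unfolding q_def using dual_of_cocycle[OF xs] by (intro dl.cochain_diff[OF gc]) (simp add: dl.cocycle_iff)
  have "q ys = 0" if ys: "ys \<in> F" for ys
  proof (cases "ys \<in> tuples s")
    case True
    show ?thesis
    proof (rule multiadditive_eq_0[OF cochain_multiadditive[OF qc] True])
      fix us assume us: "occurs_in us ys"
      have ub: "set us \<subseteq> basis" "length us = s"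
        using occurs_in_basis[OF us] True list_all2_lengthD[OF us] by (auto simp: bar_tuples_def)
      have hd: "hd u \<in> L" if u: "u \<in> set us" for u
      proof -
        obtain i where "i < length us" "u = us ! i" using u by (metis in_set_conv_nth)
        then have "u \<in> supp (nf (ys ! i))" "ys ! i \<in> set ys"
          using us by (auto simp: list_all2_conv_all_nth)
        then show ?thesis using ys by (auto simp: L_def)
      qed
      show "q (bar_word us) = 0"
      proof (cases "critical us")
        case False
        have "coef x (concat us) = 0" if "us = singles (concat us)"
          using False that unfolding coef_x Z_def critical_def by auto
        then show ?thesis using g(3)[OF ub False] dual_of_bar_word[OF xs ub] by (simp add: q_def)
      next
        case True
        then obtain w where w: "us = singles w" "inadm w" by (auto simp: critical_def)
        have "set w \<subseteq> L" using hd[of "[_]"] by (fastforce simp: w)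
        moreover have "w \<in> lists (dl_gens p)" using ub(1) by (auto simp: w basis_single)
        ultimately have "w \<in> Z \<longleftrightarrow> word_deg p w = t" using ub(2) w by (auto simp: Z_def graded_words_def)
        moreover have "g (bar_word us) = 0" if "word_deg p w \<noteq> t"
        proof -
          have "sum_list (degs us) = word_deg p w" unfolding w(1) by (induction w) simp_all
          then show ?thesis using dl.cochainD(3)[OF gc bar_word_basis[OF ub]] that by simp
        qed
        ultimately show ?thesis using dual_of_bar_word[OF xs ub] by (auto simp: q_def coef_x w(1))
      qed
    qed
  qed (simp add: dl.cochainD(1)[OF qc])
  then have agree: "dual_of x ys = g ys" if "ys \<in> F" for ys using that by (simp add: q_def)
  define k where "k = (\<lambda>ys. dual_of x ys + (f ys - g ys))"
  have "k \<in> cocycles s t" unfolding k_def by (intro dl.cocycle_add dl.cocycle_diff dual_of_cocycle f g xs)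
  moreover have "ext s t k = ext s t (dual_of x)"
    by (rule dl.ext_class_eqI) (simp add: k_def g(2))
  then have "ext s t k \<in> bcomp (koszul_dual p) s t" unfolding koszul_dual_comp using xs by blast
  moreover have "k ys = f ys" if "ys \<in> F" for ys using agree[OF that] by (simp add: k_def)
  ultimately show ?thesis by blast
qed

end

section \<open>The ringoid and its stabilisation\<close>

text \<open>Both algebras of the theorem are images of spaces of linear combinations of words; the
  axioms are inherited once the operations are computed on representatives.\<close>

lemma bigraded_algebra_presented:
  fixes A :: "('k::field, 'a) bigraded_alg" and \<pi> :: "nat \<Rightarrow> int \<Rightarrow> ('g list \<Rightarrow>\<^sub>0 'k) \<Rightarrow> 'a"
  assumes comp: "\<And>s t. bcomp A s t = \<pi> s t ` {x. supp x \<subseteq> W s t}"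
    and zero: "\<And>s t. bzero A s t = \<pi> s t 0"
    and add: "\<And>s t x y. \<lbrakk>supp x \<subseteq> W s t; supp y \<subseteq> W s t\<rbrakk> \<Longrightarrow> badd A s t (\<pi> s t x) (\<pi> s t y) = \<pi> s t (x + y)"
    and scale: "\<And>s t x c. supp x \<subseteq> W s t \<Longrightarrow> bscale A s t c (\<pi> s t x) = \<pi> s t (pm_scale c x)"
    and one: "bone A = \<pi> 0 0 (sing [] 1)" "[] \<in> W 0 0"
    and mult: "\<And>s t s' t' x y. \<lbrakk>supp x \<subseteq> W s t; supp y \<subseteq> W s' t'\<rbrakk> \<Longrightarrow>
      bmult A s t s' t' (\<pi> s t x) (\<pi> s' t' y) = \<pi> (s + s') (t + t') (word_mult x y)"
    and W: "\<And>s t s' t' u v. \<lbrakk>u \<in> W s t; v \<in> W s' t'\<rbrakk> \<Longrightarrow> u @ v \<in> W (s + s') (t + t')"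
  shows "bigraded_algebra A"
proof -
  have sW: "supp (word_mult x y) \<subseteq> W (s + s') (t + t')" if "supp x \<subseteq> W s t" "supp y \<subseteq> W s' t'"
    for x y :: "'g list \<Rightarrow>\<^sub>0 'k" and s s' t t'
    using supp_word_mult[of x y] that W by blast
  have sS: "supp (pm_scale c x) \<subseteq> W s t" if "supp x \<subseteq> W s t" for x :: "'g list \<Rightarrow>\<^sub>0 'k" and c s t
    using supp_pm_scale[of c x] that by blast
  have s1: "supp (sing [] (1::'k)) \<subseteq> W 0 0" using one(2) by simp
  note rules = zero add scale one(1) mult sW sS s1 supp_add_subset
  show ?thesis
  proof (unfold_locales, goal_cases)
    case (14 x s t y s' t' z s'' t'')
    then obtain f g h where "x = \<pi> s t f" "y = \<pi> s' t' g" "z = \<pi> s'' t'' h"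
      "supp f \<subseteq> W s t" "supp g \<subseteq> W s' t'" "supp h \<subseteq> W s'' t''" unfolding comp by blast
    then show ?case by (simp add: rules word_mult_assoc add.assoc)
  next
    case (15 x s t)
    then obtain f where f: "x = \<pi> s t f" "supp f \<subseteq> W s t" unfolding comp by blast
    then show ?case using mult[OF s1 f(2)] by (simp add: one(1))
  next
    case (16 x s t)
    then obtain f where f: "x = \<pi> s t f" "supp f \<subseteq> W s t" unfolding comp by blast
    then show ?case using mult[OF f(2) s1] by (simp add: one(1))
  qed (unfold comp, auto simp: rules one(2) pm_scale_add pm_scale_add_left ac_simps
      word_mult_add_left word_mult_add_right word_mult_scale_left word_mult_scale_right intro!: imageI)
qed

context prime_field
begin

section \<open>Words that are defined on an object\<close>

definition gen_ok :: "int \<Rightarrow> dl_gen \<Rightarrow> bool"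
  where "gen_ok j g \<longleftrightarrow> (if p = 2 then snd g \<ge> - j else 2 * snd g > - j)"

fun path_ok :: "int \<Rightarrow> dl_gen list \<Rightarrow> bool"
  where
    "path_ok j [] \<longleftrightarrow> True"
  | "path_ok j (g # w) \<longleftrightarrow> path_ok j w \<and> g \<in> dl_gens p \<and> gen_ok (j - word_deg p w) g"

text \<open>The word determines all intermediate objects, and the first coordinate only counts
  letters. So being a path from a given object is a condition on j and the word.\<close>

lemma ru_path_iff:
  "s \<le> 0 \<Longrightarrow> ru_path p (s, j) w y \<longleftrightarrow> y = (s - int (length w), j - word_deg p w) \<and> path_ok j w"
proof (induction w arbitrary: y)
  case (Cons g w)
  then show ?case by (auto simp: ru_gen_def ru_target_def gen_ok_def)
qed auto

lemma path_ok_mono: "\<lbrakk>path_ok j w; j \<le> j'\<rbrakk> \<Longrightarrow> path_ok j' w"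
  by (induction w) (auto simp: gen_ok_def split: if_splits)

lemma path_ok_append: "path_ok j (u @ v) \<longleftrightarrow> path_ok j v \<and> path_ok (j - word_deg p v) u"
  by (induction u) (auto simp: word_deg_append algebra_simps)

lemma path_ok_eventually: "w \<in> lists (dl_gens p) \<Longrightarrow> \<exists>J. \<forall>j\<ge>J. path_ok j w"
proof (induction w)
  case (Cons g w)
  then obtain J where "\<forall>j\<ge>J. path_ok j w" "g \<in> dl_gens p" by auto
  then show ?case
    by (intro exI[of _ "max J (word_deg p w + 2 * \<bar>snd g\<bar> + 1)"]) (auto simp: gen_ok_def)
qed simp

lemma eventually_ball_finite:
  fixes P :: "'b \<Rightarrow> int \<Rightarrow> bool"
  assumes "finite S" "\<And>x. x \<in> S \<Longrightarrow> \<exists>J. \<forall>j\<ge>J. P x j"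
  shows "\<exists>J. \<forall>j\<ge>J. \<forall>x\<in>S. P x j"
  using assms
proof (induction S rule: finite_induct)
  case (insert x S)
  obtain J where "\<forall>j\<ge>J. P x j" using insert.prems by blast
  moreover obtain J' where "\<forall>j\<ge>J'. \<forall>x\<in>S. P x j" using insert.IH insert.prems by blast
  ultimately show ?case by (intro exI[of _ "max J J'"]) auto
qed simp

section \<open>The relations of the ringoid as quadratic dual relations\<close>

definition rel_ok :: "int \<Rightarrow> dl_gen \<Rightarrow> dl_gen \<Rightarrow> bool"
  where "rel_ok j a b \<longleftrightarrow> (if p = 2 then snd b \<ge> - j \<and> snd a \<ge> snd b - j
    else 2 * snd b > - j \<and> 2 * snd a > 2 * (int p - 1) * snd b - j - of_bool (fst b))"

lemma rel_ok_mono: "\<lbrakk>rel_ok j a b; j \<le> j'\<rbrakk> \<Longrightarrow> rel_ok j' a b"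
  by (auto simp: rel_ok_def split: if_splits)

lemma rel_ok_eventually: "\<exists>J. \<forall>j\<ge>J. rel_ok j a b"
  by (rule exI[of _ "2 * \<bar>snd b\<bar> + 2 * \<bar>snd a\<bar> + \<bar>2 * (int p - 1) * snd b\<bar> + 2"]) (auto simp: rel_ok_def)

lemma theta_p2: "p = 2 \<Longrightarrow> theta x y = 1"
  unfolding theta_def by (rule sgn_k_p2)

lemma theta_odd: "p \<noteq> 2 \<Longrightarrow> theta x y = (if \<not> fst x \<and> fst y then - 1 else 1)"
proof -
  assume p: "p \<noteq> 2"
  have "even (dl_deg p g) \<longleftrightarrow> \<not> fst g" for g by (simp add: dl_deg_def p)
  then have "even ((1 + dl_deg p x) * dl_deg p y) \<longleftrightarrow> fst x \<or> \<not> fst y" by auto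
  then show ?thesis unfolding theta_def by (cases "even ((1 + dl_deg p x) * dl_deg p y)") auto
qed

lemma pm_eq_pair_addI:
  assumes "\<And>w. coef f w = (if w = [x, y] then 1 else 0) + pair_val F w"
    and "\<And>w. coef g w = (if w = [x, y] then 1 else 0) + pair_val H w"
    and "\<And>e u e' i. F (e, u) (e', i) = H (e, u) (e', i)"
  shows "f = (g :: 'k dl_free)"
proof -
  have "F a b = H a b" for a b by (cases a; cases b) (simp add: assms(3))
  then have "F = H" by (intro ext)
  then show ?thesis using assms(1,2) by (intro poly_mapping_eqI) simp
qed

lemma sgn_k_shift: "sgn_k (2 * b + (a - c)) = (- 1) powi (a - c)"
proof -
  have "sgn_k (2 * b + (a - c)) = sgn_k (a - c)" by (rule sgn_k_cong) simp
  then show ?thesis by (simp add: sgn_k_def)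
qed

text \<open>Symmetry of binomial coefficients: the two lower indices add up to the upper one. The
  left sides come from the Adem relations, the right sides from the ringoid.\<close>

lemma ru_binom:
  assumes "u + c = a + b"
  shows "ibinom ((int p - 1) * (b - c) - 1) (int p * b - u) = ibinom ((int p - 1) * (b - c) - 1) (a - int p * c - 1)"
    "ibinom ((int p - 1) * (b - c) - 1) (int p * b - u - 1) = ibinom ((int p - 1) * (b - c) - 1) (a - int p * c)"
    "ibinom ((int p - 1) * (b - c)) (int p * b - u) = ibinom ((int p - 1) * (b - c)) (a - int p * c)"
proof -
  have u: "u = a + b - c" using assms by simp
  show "ibinom ((int p - 1) * (b - c) - 1) (int p * b - u) = ibinom ((int p - 1) * (b - c) - 1) (a - int p * c - 1)"
    by (subst ibinom_sym) (simp add: u algebra_simps)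
  show "ibinom ((int p - 1) * (b - c) - 1) (int p * b - u - 1) = ibinom ((int p - 1) * (b - c) - 1) (a - int p * c)"
    by (subst ibinom_sym) (simp add: u algebra_simps)
  show "ibinom ((int p - 1) * (b - c)) (int p * b - u) = ibinom ((int p - 1) * (b - c)) (a - int p * c)"
    by (subst ibinom_sym) (simp add: u algebra_simps)
qed

text \<open>
  The binomial coefficients in the relations of the ringoid vanish on the indices excluded by the
  conditions that depend on the source \<open>j\<close>. So the relations do not depend on \<open>j\<close>.
\<close>

lemma ru_rel_2_eq: "\<lbrakk>p = 2; a \<le> 2 * b\<rbrakk> \<Longrightarrow> ru_rel_2 a b = dual_rel (False, a) (False, b)"
proof (rule pm_eq_pair_addI[OF _ coef_dual_rel])
  assume *: "p = 2" "a \<le> 2 * b"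
  let ?S = "{c. a + b - c > 2 * c \<and> c \<ge> a - b}"
  have fin: "finite ?S" by (rule finite_subset[of _ "{a - b..\<bar>a + b\<bar>}"]) auto
  let ?F = "\<lambda>x y. if fst x = False \<and> fst y = False \<and> snd x + snd y = a + b \<and> snd y \<in> ?S
        then B (b - snd y - 1) (a - 2 * snd y - 1) else 0"
  have "pair_val (\<lambda>x y. - ?F x y) w = - pair_val ?F w" for w by (auto simp: pair_val_def split: list.splits)
  then show "coef (ru_rel_2 a b) w = (if w = [(False, a), (False, b)] then 1 else 0) + pair_val (\<lambda>x y. - ?F x y) w" for w
    unfolding ru_rel_2_def lookup_minus coef_quad_sum[OF fin] coef_word by simp
  fix e u e' c
  have neg: "- z = z" for z :: 'k
  proof -
    have "- 1 * z = 1 * z" by (simp only: minus_one_p[OF *(1)])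
    then show ?thesis by simp
  qed
  have "ibinom (b - c - 1) (a - 2 * c - 1) = 0" if "\<not> c \<ge> a - b" using that by (intro ibinom_eq_0) auto
  moreover have "ibinom (b - c - 1) (2 * b - u) = ibinom (b - c - 1) (a - 2 * c - 1)" if "u + c = a + b"
    using ru_binom(1)[OF that] unfolding *(1) by (simp add: algebra_simps)
  ultimately show "- ?F (e, u) (e', c) = theta (False, a) (False, b) * theta (e, u) (e', c) * acoef (e, u) (e', c) (False, a) (False, b)"
    unfolding neg theta_p2[OF *(1)] acoef_def sgn_k_p2[OF *(1)] adm_def Let_def mem_dl_gens using * by auto
qed

lemma finite_ru_indices:
  "finite {c. a + b - c > int p * c \<and> 2 * c > - j}" "finite {c. a + b - c \<ge> int p * c \<and> 2 * c > - j}"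
proof -
  have sub: "{c. a + b - c \<ge> int p * c \<and> 2 * c > - j} \<subseteq> {- \<bar>j\<bar>..\<bar>a + b\<bar>}"
  proof
    fix c assume c: "c \<in> {c. a + b - c \<ge> int p * c \<and> 2 * c > - j}"
    have "c \<le> \<bar>a + b\<bar>"
    proof (cases "c \<le> 0")
      case False
      then have "1 * c \<le> int p * c" using p_ge_2 by (intro mult_right_mono) auto
      then show ?thesis using c unfolding mem_Collect_eq by linarith
    qed auto
    then show "c \<in> {- \<bar>j\<bar>..\<bar>a + b\<bar>}" using c by auto
  qed
  then show "finite {c. a + b - c \<ge> int p * c \<and> 2 * c > - j}" by (rule finite_subset) simp
  show "finite {c. a + b - c > int p * c \<and> 2 * c > - j}" by (rule finite_subset[OF _ finite_subset[OF sub]]) auto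
qed

text \<open>If 2 c <= -j, the condition on a makes the lower index exceed the upper one.\<close>

lemma ru_binom_zero:
  "\<lbrakk>2 * a > 2 * (int p - 1) * b - j; \<not> 2 * c > - j\<rbrakk> \<Longrightarrow> ibinom ((int p - 1) * (b - c) - 1) (a - int p * c - 1) = 0"
  "\<lbrakk>2 * a > 2 * (int p - 1) * b - j; \<not> 2 * c > - j\<rbrakk> \<Longrightarrow> ibinom ((int p - 1) * (b - c)) (a - int p * c) = 0"
  "\<lbrakk>2 * a > 2 * (int p - 1) * b - j - 1; \<not> 2 * c > - j\<rbrakk> \<Longrightarrow> ibinom ((int p - 1) * (b - c) - 1) (a - int p * c) = 0"
  by (rule ibinom_eq_0, simp add: algebra_simps)+

lemma ru_binom_zero':
  "a + b - c > int p * c \<or> ibinom ((int p - 1) * (b - c) - 1) (a - int p * c - 1) = 0"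
  "a + b - c \<ge> int p * c \<or> ibinom ((int p - 1) * (b - c)) (a - int p * c) = 0"
  "a + b - c \<ge> int p * c \<or> ibinom ((int p - 1) * (b - c) - 1) (a - int p * c) = 0"
proof -
  define N where "N = (int p - 1) * (b - c)"
  have "N < 0" if "b < c" unfolding N_def using p_ge_2 that by (intro mult_pos_neg) auto
  then have "N < 0 \<or> c < b \<or> (c = b \<and> N = 0)" unfolding N_def by force
  then show "a + b - c > int p * c \<or> ibinom ((int p - 1) * (b - c) - 1) (a - int p * c - 1) = 0"
    "a + b - c \<ge> int p * c \<or> ibinom ((int p - 1) * (b - c)) (a - int p * c) = 0"
    "a + b - c \<ge> int p * c \<or> ibinom ((int p - 1) * (b - c) - 1) (a - int p * c) = 0"
    unfolding N_def[symmetric] by (auto simp: ibinom_def)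
qed

lemma ru_rel_odd_QQ_eq:
  "\<lbrakk>p \<noteq> 2; a \<le> int p * b; 2 * a > 2 * (int p - 1) * b - j\<rbrakk> \<Longrightarrow>
    ru_rel_odd_QQ p j a b = dual_rel (False, a) (False, b)"
proof (rule pm_eq_pair_addI[OF _ coef_dual_rel])
  assume *: "p \<noteq> 2" "a \<le> int p * b" "2 * a > 2 * (int p - 1) * b - j"
  let ?S = "{c. a + b - c > int p * c \<and> 2 * c > - j}"
  let ?F = "\<lambda>x y. if fst x = False \<and> fst y = False \<and> snd x + snd y = a + b \<and> snd y \<in> ?S
        then (- 1) powi (a - snd y) * B ((int p - 1) * (b - snd y) - 1) (a - int p * snd y - 1) else 0"
  show "coef (ru_rel_odd_QQ p j a b) w = (if w = [(False, a), (False, b)] then 1 else 0) + pair_val ?F w" for w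
    unfolding ru_rel_odd_QQ_def lookup_add coef_quad_sum[OF finite_ru_indices(1)] coef_word by simp
  fix e u e' c
  show "?F (e, u) (e', c) = theta (False, a) (False, b) * theta (e, u) (e', c) * acoef (e, u) (e', c) (False, a) (False, b)"
  proof (cases "u + c = a + b")
    case True
    then have u: "u = a + b - c" by simp
    show ?thesis
      unfolding acoef_def theta_odd[OF *(1)] mem_dl_gens adm_def Let_def fst_conv snd_conv ru_binom(1)[OF True]
      using * ru_binom_zero(1)[OF *(3), of c] ru_binom_zero'(1)[of c a b] True by (auto simp: u sgn_k_shift)
  qed (auto simp: acoef_def)
qed

lemma ru_rel_odd_bQQ_eq:
  "\<lbrakk>p \<noteq> 2; a \<le> int p * b; 2 * a > 2 * (int p - 1) * b - j\<rbrakk> \<Longrightarrow>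
    ru_rel_odd_bQQ p j a b = dual_rel (True, a) (False, b)"
proof (rule pm_eq_pair_addI[OF _ coef_dual_rel])
  assume *: "p \<noteq> 2" "a \<le> int p * b" "2 * a > 2 * (int p - 1) * b - j"
  let ?S = "{c. a + b - c > int p * c \<and> 2 * c > - j}" and ?S' = "{c. a + b - c \<ge> int p * c \<and> 2 * c > - j}"
  let ?F = "\<lambda>x y. if fst x = True \<and> fst y = False \<and> snd x + snd y = a + b \<and> snd y \<in> ?S
        then (- 1) powi (a - snd y) * B ((int p - 1) * (b - snd y) - 1) (a - int p * snd y - 1) else 0"
  let ?H = "\<lambda>x y. if fst x = False \<and> fst y = True \<and> snd x + snd y = a + b \<and> snd y \<in> ?S'
        then (- 1) powi (a - snd y) * B ((int p - 1) * (b - snd y)) (a - int p * snd y) else 0"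
  have "pair_val (\<lambda>x y. ?F x y - ?H x y) w = pair_val ?F w - pair_val ?H w" for w
    by (auto simp: pair_val_def split: list.splits)
  then show "coef (ru_rel_odd_bQQ p j a b) w = (if w = [(True, a), (False, b)] then 1 else 0) + pair_val (\<lambda>x y. ?F x y - ?H x y) w" for w
    unfolding ru_rel_odd_bQQ_def lookup_add lookup_minus coef_quad_sum[OF finite_ru_indices(1)]
      coef_quad_sum[OF finite_ru_indices(2)] coef_word by simp
  fix e u e' c
  show "?F (e, u) (e', c) - ?H (e, u) (e', c) = theta (True, a) (False, b) * theta (e, u) (e', c) * acoef (e, u) (e', c) (True, a) (False, b)"
  proof (cases "u + c = a + b")
    case True
    then have u: "u = a + b - c" by simp
    show ?thesis
      unfolding acoef_def theta_odd[OF *(1)] mem_dl_gens adm_def Let_def fst_conv snd_conv ru_binom[OF True]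
      using * ru_binom_zero(1,2)[OF *(3), of c] ru_binom_zero'(1,2)[of c a b] True by (cases e; cases e') (auto simp: u sgn_k_shift)
  qed (auto simp: acoef_def)
qed

lemma ru_rel_odd_QbQ_eq:
  "\<lbrakk>p \<noteq> 2; a < int p * b; 2 * a > 2 * (int p - 1) * b - j - 1\<rbrakk> \<Longrightarrow>
    ru_rel_odd_QbQ p j d a b = dual_rel (d, a) (True, b)"
proof (rule pm_eq_pair_addI[OF _ coef_dual_rel])
  assume *: "p \<noteq> 2" "a < int p * b" "2 * a > 2 * (int p - 1) * b - j - 1"
  let ?S = "{c. a + b - c \<ge> int p * c \<and> 2 * c > - j}"
  let ?F = "\<lambda>x y. if fst x = d \<and> fst y = True \<and> snd x + snd y = a + b \<and> snd y \<in> ?S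
        then (- 1) powi (a - snd y) * B ((int p - 1) * (b - snd y) - 1) (a - int p * snd y) else 0"
  have "pair_val (\<lambda>x y. - ?F x y) w = - pair_val ?F w" for w by (auto simp: pair_val_def split: list.splits)
  then show "coef (ru_rel_odd_QbQ p j d a b) w = (if w = [(d, a), (True, b)] then 1 else 0) + pair_val (\<lambda>x y. - ?F x y) w" for w
    unfolding ru_rel_odd_QbQ_def lookup_minus coef_quad_sum[OF finite_ru_indices(2)] coef_word by simp
  fix e u e' c
  show "- ?F (e, u) (e', c) = theta (d, a) (True, b) * theta (e, u) (e', c) * acoef (e, u) (e', c) (d, a) (True, b)"
  proof (cases "u + c = a + b")
    case True
    then have u: "u = a + b - c" by simp
    show ?thesis
      unfolding acoef_def theta_odd[OF *(1)] mem_dl_gens adm_def Let_def fst_conv snd_conv ru_binom[OF True]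
      using * ru_binom_zero(3)[OF *(3), of c] ru_binom_zero'(3)[of c a b] True by (cases e; cases e'; cases d) (auto simp: u sgn_k_shift)
  qed (auto simp: acoef_def)
qed

lemma ru_relations_eq:
  "ru_relations p j = {dual_rel a b | a b. a \<in> dl_gens p \<and> b \<in> dl_gens p \<and> adm a b \<and> rel_ok j a b}" (is "_ = ?R")
proof (cases "p = 2")
  case True
  have "ru_relations p j = {ru_rel_2 a b | a b. a \<le> 2 * b \<and> b \<ge> - j \<and> a \<ge> b - j}"
    by (simp add: ru_relations_def True)
  also have "\<dots> = {dual_rel (False, a) (False, b) | a b. a \<le> 2 * b \<and> b \<ge> - j \<and> a \<ge> b - j}"
    by (intro Collect_cong ex_cong1) (auto simp: ru_rel_2_eq[OF True])
  also have "\<dots> = ?R"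
  proof (intro equalityI subsetI)
    fix z assume "z \<in> ?R"
    then obtain a b where ab: "z = dual_rel a b" "a \<in> dl_gens p" "b \<in> dl_gens p" "adm a b" "rel_ok j a b" by blast
    have f: "\<not> fst a" "\<not> fst b" using True ab(2,3) unfolding mem_dl_gens by blast+
    then have "a = (False, snd a)" "b = (False, snd b)" by (simp_all add: prod_eq_iff)
    then have "z = dual_rel (False, snd a) (False, snd b)" using ab(1) by metis
    moreover have "snd a \<le> 2 * snd b \<and> snd b \<ge> - j \<and> snd a \<ge> snd b - j"
      using ab(4,5) f True unfolding adm_def rel_ok_def by simp
    ultimately show "z \<in> {dual_rel (False, a) (False, b) | a b. a \<le> 2 * b \<and> b \<ge> - j \<and> a \<ge> b - j}" by blast
  next
    fix z assume "z \<in> {dual_rel (False, a) (False, b) | a b. a \<le> 2 * b \<and> b \<ge> - j \<and> a \<ge> b - j}"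
    then obtain a b where ab: "z = dual_rel (False, a) (False, b)" "a \<le> 2 * b \<and> b \<ge> - j \<and> a \<ge> b - j" by blast
    have "(False, a) \<in> dl_gens p" "(False, b) \<in> dl_gens p" "adm (False, a) (False, b)" "rel_ok j (False, a) (False, b)"
      using ab(2) unfolding adm_def rel_ok_def dl_gens_def by (auto simp: True)
    then show "z \<in> ?R" using ab(1) by blast
  qed
  finally show ?thesis .
next
  case False
  let ?c = "\<lambda>a b. a \<le> int p * b \<and> 2 * b > - j \<and> 2 * a > 2 * (int p - 1) * b - j"
  let ?d = "\<lambda>a b. a < int p * b \<and> 2 * b > - j \<and> 2 * a > 2 * (int p - 1) * b - j - 1"
  have 1: "ru_relations p j = {ru_rel_odd_QQ p j a b | a b. ?c a b} \<union> {ru_rel_odd_bQQ p j a b | a b. ?c a b}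
      \<union> {ru_rel_odd_QbQ p j e a b | e a b. ?d a b}"
    by (simp add: ru_relations_def False)
  have 2: "{ru_rel_odd_QQ p j a b | a b. ?c a b} = {dual_rel (False, a) (False, b) | a b. ?c a b}"
    by (intro Collect_cong ex_cong1) (auto simp: ru_rel_odd_QQ_eq[OF False])
  have 3: "{ru_rel_odd_bQQ p j a b | a b. ?c a b} = {dual_rel (True, a) (False, b) | a b. ?c a b}"
    by (intro Collect_cong ex_cong1) (auto simp: ru_rel_odd_bQQ_eq[OF False])
  have 4: "{ru_rel_odd_QbQ p j e a b | e a b. ?d a b} = {dual_rel (e, a) (True, b) | e a b. ?d a b}"
    by (intro Collect_cong ex_cong1) (auto simp: ru_rel_odd_QbQ_eq[OF False])
  have c: "adm (e, a) (False, b) \<and> rel_ok j (e, a) (False, b) \<longleftrightarrow> ?c a b" for e a b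
    by (auto simp: adm_def rel_ok_def False)
  have d: "adm (e, a) (True, b) \<and> rel_ok j (e, a) (True, b) \<longleftrightarrow> ?d a b" for e a b
    by (auto simp: adm_def rel_ok_def False)
  have G: "x \<in> dl_gens p" for x using False by (simp add: mem_dl_gens)
  show ?thesis
  proof (unfold 1 2 3 4, intro equalityI subsetI)
    fix z assume "z \<in> ?R"
    then obtain e a e' b where z: "z = dual_rel (e, a) (e', b)" "adm (e, a) (e', b)" "rel_ok j (e, a) (e', b)" by auto
    show "z \<in> {dual_rel (False, a) (False, b) | a b. ?c a b} \<union> {dual_rel (True, a) (False, b) | a b. ?c a b}
      \<union> {dual_rel (e, a) (True, b) | e a b. ?d a b}"
    proof (cases e')
      case True
      then have "?d a b" "z = dual_rel (e, a) (True, b)" using z d[of e a b] by simp_all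
      then show ?thesis by blast
    next
      case f: False
      then have "?c a b" "z = dual_rel (e, a) (False, b)" using z c[of e a b] by simp_all
      then show ?thesis by (cases e; simp only: ; blast)
    qed
  next
    fix z assume "z \<in> {dual_rel (False, a) (False, b) | a b. ?c a b} \<union> {dual_rel (True, a) (False, b) | a b. ?c a b}
      \<union> {dual_rel (e, a) (True, b) | e a b. ?d a b}"
    then consider e a b where "z = dual_rel (e, a) (False, b)" "?c a b" | e a b where "z = dual_rel (e, a) (True, b)" "?d a b"
      by blast
    then show "z \<in> ?R"
    proof cases
      case 1
      then have "z = dual_rel (e, a) (False, b) \<and> adm (e, a) (False, b) \<and> rel_ok j (e, a) (False, b)" using c[of e a b] by simp
      then show ?thesis using G by blast
    next
      case 2
      then have "z = dual_rel (e, a) (True, b) \<and> adm (e, a) (True, b) \<and> rel_ok j (e, a) (True, b)" using d[of e a b] by simp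
      then show ?thesis using G by blast
    qed
  qed
qed

section \<open>The ideal of relations on an object and its growth with j\<close>

definition ringoid_gens :: "int \<Rightarrow> nat \<Rightarrow> int \<Rightarrow> 'k dl_free set"
  where "ringoid_gens j n t = {word_mult (word_mult (sing u 1) (dual_rel a b)) (sing v 1) | u v a b.
    a \<in> dl_gens p \<and> b \<in> dl_gens p \<and> adm a b \<and> u @ [a, b] @ v \<in> graded_words n t \<and>
    path_ok j v \<and> rel_ok (j - word_deg p v) a b \<and> (\<forall>w\<in>supp (dual_rel a b). path_ok j (w @ v)) \<and>
    path_ok (j - word_deg p v - word_deg p [a, b]) u}"

definition ringoid_ideal :: "int \<Rightarrow> nat \<Rightarrow> int \<Rightarrow> 'k dl_free set"
  where "ringoid_ideal j n t = pm.span (ringoid_gens j n t)"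

lemma path_ok_lists: "path_ok j w \<Longrightarrow> w \<in> lists (dl_gens p)"
  by (induction w) auto

text \<open>The leading word has coefficient 1. So a relation is not zero and determines the object
  in which it ends, as used in \<open>ru_ideal_eq\<close>.\<close>

lemma dual_rel_lead:
  assumes "adm a b"
  shows "[a, b] \<in> supp (dual_rel a b)"
proof -
  have "acoef a b a b = 0" using acoef_nz(5)[of a b a b] assms by blast
  then show ?thesis by (simp add: in_keys_iff coef_dual_rel)
qed

lemma ru_ideal_eq:
  assumes s: "s \<le> 0"
  shows "ru_ideal p (s, j) (s - int n, j - t) = ringoid_ideal j n t"
proof -
  have "{word_mult (word_mult (sing u 1) r) (sing v 1) | u r v z z'. ru_path p (s, j) v z \<and>
      r \<in> ru_relations p (snd z) \<inter> ru_free p z z' \<and> ru_path p z' u (s - int n, j - t)} = ringoid_gens j n t" (is "?L = _")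
  proof (intro equalityI subsetI)
    fix x :: "'k dl_free" assume "x \<in> ?L"
    then obtain u r v z z' where x: "x = word_mult (word_mult (sing u 1) r) (sing v 1)" and v: "ru_path p (s, j) v z"
      and r: "r \<in> ru_relations p (snd z)" "r \<in> ru_free p z z'" and u: "ru_path p z' u (s - int n, j - t)" by blast
    have z: "z = (s - int (length v), j - word_deg p v)" "path_ok j v" using v s by (simp_all add: ru_path_iff)
    obtain a b where ab: "r = dual_rel a b" "a \<in> dl_gens p" "b \<in> dl_gens p" "adm a b" "rel_ok (j - word_deg p v) a b"
      using r(1) unfolding ru_relations_eq z(1) snd_conv by blast
    have zs: "s - int (length v) \<le> 0" using s by simp
    have w: "z' = (s - int (length v) - int (length w), j - word_deg p v - word_deg p w) \<and> path_ok (j - word_deg p v) w"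
      if "w \<in> supp r" for w
      using r(2) that unfolding ru_free_def z(1) by (simp add: ru_path_iff[OF zs])
    then have z': "z' = (s - int (length v) - 2, j - word_deg p v - word_deg p [a, b])"
      using dual_rel_lead[OF ab(4)] w[of "[a, b]"] unfolding ab(1) by simp
    have "s - int (length v) - 2 \<le> 0" using s by simp
    from u[unfolded z' ru_path_iff[OF this]]
    have u': "path_ok (j - word_deg p v - word_deg p [a, b]) u" "int n = int (length v) + 2 + int (length u)"
      "t = word_deg p v + word_deg p [a, b] + word_deg p u" by auto
    have "u @ [a, b] @ v \<in> graded_words n t"
      using path_ok_lists[OF u'(1)] path_ok_lists[OF z(2)] ab(2,3) u'(2,3) by (auto simp: graded_words_def word_deg_append)
    moreover have "\<forall>w\<in>supp (dual_rel a b). path_ok j (w @ v)" using w z(2) by (auto simp: path_ok_append ab(1))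
    ultimately show "x \<in> ringoid_gens j n t" unfolding ringoid_gens_def x ab(1) using ab z(2) u'(1) by blast
  next
    fix x assume "x \<in> ringoid_gens j n t"
    then obtain u v a b where x: "x = word_mult (word_mult (sing u 1) (dual_rel a b)) (sing v 1)"
      and ab: "a \<in> dl_gens p" "b \<in> dl_gens p" "adm a b" and g: "u @ [a, b] @ v \<in> graded_words n t"
      and ok: "path_ok j v" "rel_ok (j - word_deg p v) a b" "\<forall>w\<in>supp (dual_rel a b). path_ok j (w @ v)"
        "path_ok (j - word_deg p v - word_deg p [a, b]) u" unfolding ringoid_gens_def by blast
    define z where "z = (s - int (length v), j - word_deg p v)"
    define z' where "z' = (s - int (length v) - 2, j - word_deg p v - word_deg p [a, b])"
    have v: "ru_path p (s, j) v z" using s ok(1) by (simp add: ru_path_iff z_def)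
    have "dual_rel a b \<in> ru_relations p (snd z)" unfolding ru_relations_eq z_def snd_conv using ab ok(2) by blast
    moreover have "dual_rel a b \<in> ru_free p z z'"
      unfolding ru_free_def z_def z'_def mem_Collect_eq
    proof
      fix w assume w: "w \<in> supp (dual_rel a b)"
      then have "w \<in> graded_words 2 (dl_deg p a + dl_deg p b)" using supp_dual_rel_graded[OF ab(1,2)] by blast
      then show "ru_path p (s - int (length v), j - word_deg p v) w (s - int (length v) - 2, j - word_deg p v - word_deg p [a, b])"
        using s ok(3) w by (subst ru_path_iff) (auto simp: graded_words_def path_ok_append)
    qed
    moreover have "ru_path p z' u (s - int n, j - t)"
      using s ok(4) g by (auto simp: z'_def ru_path_iff graded_words_def word_deg_append)
    ultimately show "x \<in> ?L" unfolding x using v by blast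
  qed
  then show ?thesis by (simp add: ru_ideal_def ringoid_ideal_def)
qed

text \<open>All conditions are lower bounds for j. This makes the suspension well defined on
  classes.\<close>

lemma ringoid_ideal_mono:
  assumes "j \<le> j'"
  shows "ringoid_ideal j n t \<subseteq> ringoid_ideal j' n t"
  unfolding ringoid_ideal_def
proof (rule pm.span_mono, rule subsetI)
  fix x assume "x \<in> ringoid_gens j n t"
  then obtain u v a b where x: "x = word_mult (word_mult (sing u 1) (dual_rel a b)) (sing v 1)"
    and ab: "a \<in> dl_gens p" "b \<in> dl_gens p" "adm a b" "u @ [a, b] @ v \<in> graded_words n t"
    and ok: "path_ok j v" "rel_ok (j - word_deg p v) a b" "\<forall>w\<in>supp (dual_rel a b). path_ok j (w @ v)"
      "path_ok (j - word_deg p v - word_deg p [a, b]) u" unfolding ringoid_gens_def by blast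
  have "path_ok j' v" "\<forall>w\<in>supp (dual_rel a b). path_ok j' (w @ v)" using ok(1,3) path_ok_mono[OF _ assms] by blast+
  moreover have "rel_ok (j' - word_deg p v) a b" using assms by (intro rel_ok_mono[OF ok(2)]) simp
  moreover have "path_ok (j' - word_deg p v - word_deg p [a, b]) u" using assms by (intro path_ok_mono[OF ok(4)]) simp
  ultimately show "x \<in> ringoid_gens j' n t" unfolding ringoid_gens_def using x ab by blast
qed

lemma ringoid_ideal_subset: "ringoid_ideal j n t \<subseteq> dual_ideal n t"
  unfolding ringoid_ideal_def dual_ideal_def by (rule pm.span_mono) (unfold ringoid_gens_def dual_ideal_gens_def, blast)

lemma ringoid_ideal_closed:
  "0 \<in> ringoid_ideal j n t" "\<lbrakk>f \<in> ringoid_ideal j n t; g \<in> ringoid_ideal j n t\<rbrakk> \<Longrightarrow> f + g \<in> ringoid_ideal j n t"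
  "\<lbrakk>f \<in> ringoid_ideal j n t; g \<in> ringoid_ideal j n t\<rbrakk> \<Longrightarrow> f - g \<in> ringoid_ideal j n t"
  "f \<in> ringoid_ideal j n t \<Longrightarrow> pm_scale c f \<in> ringoid_ideal j n t"
  unfolding ringoid_ideal_def by (rule pm.span_zero pm.span_add pm.span_diff pm.span_scale; assumption)+

text \<open>An element of the dual ideal is a finite combination of relations between words, and
  each of these is defined for all large j. With \<open>ringoid_ideal_subset\<close>, the dual ideal
  is the union of the ideals for the single j.\<close>

lemma ringoid_ideal_eventually:
  assumes "x \<in> dual_ideal n t"
  shows "\<exists>J. \<forall>j\<ge>J. x \<in> ringoid_ideal j n t"
  using assms unfolding dual_ideal_def
proof (induction rule: pm.span_induct)
  case base
  show ?case
  proof (rule pm.subspaceI, simp_all only: mem_Collect_eq)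
    show "\<exists>J. \<forall>j\<ge>J. 0 \<in> ringoid_ideal j n t" by (simp add: ringoid_ideal_closed)
  next
    fix x y :: "'k dl_free"
    assume "\<exists>J. \<forall>j\<ge>J. x \<in> ringoid_ideal j n t" "\<exists>J. \<forall>j\<ge>J. y \<in> ringoid_ideal j n t"
    then obtain J J' where "\<forall>j\<ge>J. x \<in> ringoid_ideal j n t" "\<forall>j\<ge>J'. y \<in> ringoid_ideal j n t" by blast
    then show "\<exists>J. \<forall>j\<ge>J. x + y \<in> ringoid_ideal j n t" by (intro exI[of _ "max J J'"]) (simp add: ringoid_ideal_closed)
  next
    fix c and x :: "'k dl_free" assume "\<exists>J. \<forall>j\<ge>J. x \<in> ringoid_ideal j n t"
    then show "\<exists>J. \<forall>j\<ge>J. pm_scale c x \<in> ringoid_ideal j n t" by (blast intro: ringoid_ideal_closed)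
  qed
next
  case (step x)
  then obtain u v a b where x: "x = word_mult (word_mult (sing u 1) (dual_rel a b)) (sing v 1)"
    and ab: "a \<in> dl_gens p" "b \<in> dl_gens p" "adm a b" and g: "u @ [a, b] @ v \<in> graded_words n t"
    unfolding dual_ideal_gens_def by blast
  have uv: "u \<in> lists (dl_gens p)" "v \<in> lists (dl_gens p)" using g by (auto simp: graded_words_def)
  obtain J1 where J1: "\<forall>j\<ge>J1. path_ok j v" using path_ok_eventually[OF uv(2)] by blast
  obtain J2 where J2: "\<forall>j\<ge>J2. path_ok j u" using path_ok_eventually[OF uv(1)] by blast
  obtain J3 where J3: "\<forall>j\<ge>J3. rel_ok j a b" using rel_ok_eventually by blast
  have "\<exists>J. \<forall>j\<ge>J. \<forall>w\<in>supp (dual_rel a b). path_ok j (w @ v)"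
  proof (rule eventually_ball_finite)
    fix w assume "w \<in> supp (dual_rel a b)"
    then have "w @ v \<in> lists (dl_gens p)" using supp_dual_rel_graded[OF ab(1,2)] uv(2) by (auto simp: graded_words_def)
    then show "\<exists>J. \<forall>j\<ge>J. path_ok j (w @ v)" by (rule path_ok_eventually)
  qed simp
  then obtain J4 where J4: "\<forall>j\<ge>J4. \<forall>w\<in>supp (dual_rel a b). path_ok j (w @ v)" by blast
  let ?J = "max (max J1 J4) (max (J2 + word_deg p v + word_deg p [a, b]) (J3 + word_deg p v))"
  have "x \<in> ringoid_gens j n t" if "j \<ge> ?J" for j
  proof -
    have "path_ok j v" "rel_ok (j - word_deg p v) a b" "\<forall>w\<in>supp (dual_rel a b). path_ok j (w @ v)"
      "path_ok (j - word_deg p v - word_deg p [a, b]) u" using that J1 J2 J3 J4 by simp_all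
    then show ?thesis unfolding ringoid_gens_def using x ab g by blast
  qed
  then show ?case unfolding ringoid_ideal_def by (blast intro: pm.span_base)
qed

definition path_words :: "int \<Rightarrow> nat \<Rightarrow> int \<Rightarrow> dl_gen list set"
  where "path_words j n t = {w \<in> graded_words n t. path_ok j w}"

lemma path_words_subset: "path_words j n t \<subseteq> graded_words n t"
  by (auto simp: path_words_def)

lemma path_words_mono: "j \<le> j' \<Longrightarrow> path_words j n t \<subseteq> path_words j' n t"
  by (auto simp: path_words_def path_ok_mono)

lemma path_words_eventually:
  assumes "supp x \<subseteq> graded_words n t"
  shows "\<exists>J. \<forall>j\<ge>J. supp x \<subseteq> path_words j n t"
proof -
  have "\<exists>J. \<forall>j\<ge>J. \<forall>w\<in>supp x. path_ok j w"
    using assms by (intro eventually_ball_finite path_ok_eventually) (auto simp: graded_words_def)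
  then show ?thesis using assms unfolding path_words_def by blast
qed

text \<open>Hence every representative of a class of defined words consists of defined words again,
  which is needed to compose arbitrary representatives.\<close>

lemma ringoid_ideal_supp:
  assumes "x \<in> ringoid_ideal j n t"
  shows "supp x \<subseteq> path_words j n t"
  using assms unfolding ringoid_ideal_def
proof (induction rule: pm.span_induct)
  case base
  show ?case
    by (rule pm.subspaceI) (auto dest!: subsetD[OF keys_add] subsetD[OF supp_pm_scale])
next
  case (step x)
  then obtain u v a b where x: "x = word_mult (word_mult (sing u 1) (dual_rel a b)) (sing v 1)"
    and ab: "a \<in> dl_gens p" "b \<in> dl_gens p" "adm a b" and g: "u @ [a, b] @ v \<in> graded_words n t"
    and ok: "path_ok j v" "rel_ok (j - word_deg p v) a b" "\<forall>w\<in>supp (dual_rel a b). path_ok j (w @ v)"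
        "path_ok (j - word_deg p v - word_deg p [a, b]) u" unfolding ringoid_gens_def by blast
  show ?case
  proof
    fix z assume "z \<in> supp x"
    then obtain w where z: "z = u @ w @ v" and w: "w \<in> supp (dual_rel a b)"
      unfolding x using supp_word_mult[of "word_mult (sing u 1) (dual_rel a b)" "sing v 1"]
        supp_word_mult[of "sing u 1" "dual_rel a b"] by fastforce
    have w2: "w \<in> graded_words 2 (dl_deg p a + dl_deg p b)" using w supp_dual_rel_graded[OF ab(1,2)] by blast
    then have "path_ok j z" unfolding z path_ok_append[of j u] using ok(3,4) w
      by (simp add: word_deg_append graded_words_def word_deg_simps algebra_simps)
    moreover have "z \<in> graded_words n t" using g w2 by (auto simp: z graded_words_def word_deg_append word_deg_simps)
    ultimately show "z \<in> path_words j n t" by (simp add: path_words_def)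
  qed
qed

lemma word_mult_span:
  assumes x: "x \<in> pm.span S" and S: "\<And>y w. \<lbrakk>y \<in> S; w \<in> W\<rbrakk> \<Longrightarrow> word_mult (sing w 1) y \<in> pm.span T"
    and f: "supp f \<subseteq> W"
  shows "word_mult f x \<in> pm.span T"
proof -
  have *: "word_mult (sing w 1) x \<in> pm.span T" if "w \<in> W" for w
    using x
  proof (induction rule: pm.span_induct)
    case base
    show ?case
      by (rule pm.subspaceI) (auto simp: word_mult_add_right word_mult_scale_right pm.span_zero intro: pm.span_add pm.span_scale)
  qed (rule S[OF _ that])
  show ?thesis using f
  proof (induction f rule: pm_induct)
    case (add w c g)
    have "word_mult (sing w c + g) x = pm_scale c (word_mult (sing w 1) x) + word_mult g x"
      by (simp add: word_mult_add_left sing_eq_scale[of w c] word_mult_scale_left)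
    then show ?case using * add by (simp add: pm.span_add pm.span_scale)
  qed (simp add: pm.span_zero)
qed

lemma word_mult_span_right:
  assumes x: "x \<in> pm.span S" and S: "\<And>y w. \<lbrakk>y \<in> S; w \<in> W\<rbrakk> \<Longrightarrow> word_mult y (sing w 1) \<in> pm.span T"
    and f: "supp f \<subseteq> W"
  shows "word_mult x f \<in> pm.span T"
proof -
  have *: "word_mult x (sing w 1) \<in> pm.span T" if "w \<in> W" for w
    using x
  proof (induction rule: pm.span_induct)
    case base
    show ?case
      by (rule pm.subspaceI) (auto simp: word_mult_add_left word_mult_scale_left pm.span_zero intro: pm.span_add pm.span_scale)
  qed (rule S[OF _ that])
  show ?thesis using f
  proof (induction f rule: pm_induct)
    case (add w c g)
    have "word_mult x (sing w c + g) = pm_scale c (word_mult x (sing w 1)) + word_mult x g"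
      by (simp add: word_mult_add_right sing_eq_scale[of w c] word_mult_scale_right)
    then show ?case using * add by (simp add: pm.span_add pm.span_scale)
  qed (simp add: pm.span_zero)
qed

text \<open>The words of \<open>f\<close> act after words of degree t, so they have to be defined on
  j - t.\<close>

lemma ringoid_ideal_mult_left:
  assumes "x \<in> ringoid_ideal j n t" "supp f \<subseteq> path_words (j - t) n' t'"
  shows "word_mult f x \<in> ringoid_ideal j (n' + n) (t' + t)"
  unfolding ringoid_ideal_def
proof (rule word_mult_span[OF assms(1)[unfolded ringoid_ideal_def] _ assms(2)])
  fix x w assume "x \<in> ringoid_gens j n t" and w: "w \<in> path_words (j - t) n' t'"
  then obtain u v a b where x: "x = word_mult (word_mult (sing u 1) (dual_rel a b)) (sing v 1)"
    and ab: "a \<in> dl_gens p" "b \<in> dl_gens p" "adm a b" and g: "u @ [a, b] @ v \<in> graded_words n t"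
    and ok: "path_ok j v" "rel_ok (j - word_deg p v) a b" "\<forall>w\<in>supp (dual_rel a b). path_ok j (w @ v)"
      "path_ok (j - word_deg p v - word_deg p [a, b]) u" unfolding ringoid_gens_def by blast
  have t: "t = word_deg p u + word_deg p [a, b] + word_deg p v"
    using g unfolding graded_words_def mem_Collect_eq word_deg_append by linarith
  have "word_mult (sing w 1) x = word_mult (word_mult (sing (w @ u) 1) (dual_rel a b)) (sing v 1)"
    by (simp add: x word_mult_assoc[symmetric])
  moreover have "(w @ u) @ [a, b] @ v \<in> graded_words (n' + n) (t' + t)"
    using graded_words_append[OF _ g, of w n' t'] w by (simp add: path_words_def)
  moreover have "path_ok (j - word_deg p v - word_deg p [a, b]) (w @ u)"
    using w ok(4) by (simp add: path_ok_append path_words_def t algebra_simps)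
  ultimately have "word_mult (sing w 1) x \<in> ringoid_gens j (n' + n) (t' + t)"
    unfolding ringoid_gens_def using ab ok(1,2,3) by blast
  then show "word_mult (sing w 1) x \<in> pm.span (ringoid_gens j (n' + n) (t' + t))" by (rule pm.span_base)
qed

lemma ringoid_ideal_mult_right:
  assumes "x \<in> ringoid_ideal (j - t') n t" "supp f \<subseteq> path_words j n' t'"
  shows "word_mult x f \<in> ringoid_ideal j (n + n') (t + t')"
  unfolding ringoid_ideal_def
proof (rule word_mult_span_right[OF assms(1)[unfolded ringoid_ideal_def] _ assms(2)])
  fix x w assume "x \<in> ringoid_gens (j - t') n t" and w: "w \<in> path_words j n' t'"
  then obtain u v a b where x: "x = word_mult (word_mult (sing u 1) (dual_rel a b)) (sing v 1)"
    and ab: "a \<in> dl_gens p" "b \<in> dl_gens p" "adm a b" and g: "u @ [a, b] @ v \<in> graded_words n t"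
    and ok: "path_ok (j - t') v" "rel_ok (j - t' - word_deg p v) a b"
      "\<forall>w\<in>supp (dual_rel a b). path_ok (j - t') (w @ v)"
      "path_ok (j - t' - word_deg p v - word_deg p [a, b]) u" unfolding ringoid_gens_def by blast
  have w': "word_deg p w = t'" "path_ok j w" using w by (simp_all add: path_words_def graded_words_def)
  have "word_mult x (sing w 1) = word_mult (word_mult (sing u 1) (dual_rel a b)) (sing (v @ w) 1)"
    by (simp add: x word_mult_assoc)
  moreover have "u @ [a, b] @ (v @ w) \<in> graded_words (n + n') (t + t')"
    using graded_words_append[OF g, of w n' t'] w by (simp add: path_words_def)
  moreover have "path_ok j (v @ w)" using ok(1) w' by (simp add: path_ok_append)
  moreover have deg: "j - word_deg p (v @ w) = j - t' - word_deg p v" using w' by (simp add: word_deg_append)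
  moreover have "\<forall>z\<in>supp (dual_rel a b). path_ok j (z @ (v @ w))"
    using ok(3) w' path_ok_append[of j _ w] by (metis append_assoc)
  ultimately have "word_mult x (sing w 1) \<in> ringoid_gens j (n + n') (t + t')"
    unfolding ringoid_gens_def using ab ok(2,4) unfolding deg[symmetric] by blast
  then show "word_mult x (sing w 1) \<in> pm.span (ringoid_gens j (n + n') (t + t'))" by (rule pm.span_base)
qed

text \<open>Deduced from the ringoid, for j so large that everything involved is defined.\<close>

lemma dual_ideal_mult_left:
  assumes "x \<in> dual_ideal n t" "supp f \<subseteq> graded_words n' t'"
  shows "word_mult f x \<in> dual_ideal (n' + n) (t' + t)"
proof -
  obtain J where J: "\<forall>j\<ge>J. x \<in> ringoid_ideal j n t" using ringoid_ideal_eventually[OF assms(1)] by blast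
  obtain J' where J': "\<forall>j\<ge>J'. supp f \<subseteq> path_words j n' t'" using path_words_eventually[OF assms(2)] by blast
  let ?j = "max J (J' + t)"
  have "x \<in> ringoid_ideal ?j n t" "supp f \<subseteq> path_words (?j - t) n' t'" using J J' by auto
  then show ?thesis using ringoid_ideal_mult_left ringoid_ideal_subset by blast
qed

lemma dual_ideal_mult_right:
  assumes "x \<in> dual_ideal n t" "supp f \<subseteq> graded_words n' t'"
  shows "word_mult x f \<in> dual_ideal (n + n') (t + t')"
proof -
  obtain J where J: "\<forall>j\<ge>J. x \<in> ringoid_ideal j n t" using ringoid_ideal_eventually[OF assms(1)] by blast
  obtain J' where J': "\<forall>j\<ge>J'. supp f \<subseteq> path_words j n' t'" using path_words_eventually[OF assms(2)] by blast
  let ?j = "max (J + t') J'"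
  have "x \<in> ringoid_ideal (?j - t') n t" "supp f \<subseteq> path_words ?j n' t'" using J J' by auto
  then show ?thesis using ringoid_ideal_mult_right ringoid_ideal_subset by blast
qed

text \<open>Operations are indexed by their weight and degree shift, which determine the bidegree of the words.\<close>

abbreviation shift_deg :: "nat \<Rightarrow> int \<Rightarrow> int"
  where "shift_deg v d \<equiv> - d - int v"

section \<open>Stable operations and their algebra structure\<close>

definition op_class :: "int \<Rightarrow> nat \<Rightarrow> int \<Rightarrow> 'k dl_free \<Rightarrow> 'k dl_free set"
  where "op_class j v d f = {g. g - f \<in> ringoid_ideal j v (shift_deg v d)}"

abbreviation op_words :: "int \<Rightarrow> nat \<Rightarrow> int \<Rightarrow> dl_gen list set"
  where "op_words j v d \<equiv> path_words j v (shift_deg v d)"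

lemma op_class_self: "f \<in> op_class j v d f"
  by (simp add: op_class_def ringoid_ideal_closed)

lemma op_class_eq: "op_class j v d f = op_class j v d g \<longleftrightarrow> f - g \<in> ringoid_ideal j v (shift_deg v d)"
proof
  assume "op_class j v d f = op_class j v d g"
  then show "f - g \<in> ringoid_ideal j v (shift_deg v d)" using op_class_self[of f j v d] by (auto simp: op_class_def)
next
  assume *: "f - g \<in> ringoid_ideal j v (shift_deg v d)"
  have "h - f \<in> ringoid_ideal j v (shift_deg v d) \<longleftrightarrow> h - g \<in> ringoid_ideal j v (shift_deg v d)" for h
    using ringoid_ideal_closed(2)[OF _ *, of "h - f"] ringoid_ideal_closed(3)[OF _ *, of "h - g"] by auto
  then show "op_class j v d f = op_class j v d g" by (simp add: op_class_def)
qed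

lemma op_class_mem: "g \<in> op_class j v d f \<longleftrightarrow> g - f \<in> ringoid_ideal j v (shift_deg v d)"
  by (simp add: op_class_def)

lemma op_class_eqI: "g \<in> op_class j v d f \<Longrightarrow> j \<le> j' \<Longrightarrow> op_class j' v d g = op_class j' v d f"
  using ringoid_ideal_mono[of j j'] by (auto simp: op_class_eq op_class_mem)

lemma op_class_supp: "\<lbrakk>g \<in> op_class j v d f; supp f \<subseteq> op_words j v d\<rbrakk> \<Longrightarrow> supp g \<subseteq> op_words j v d"
  using ringoid_ideal_supp[of "g - f"] supp_add_subset[of "g - f" _ f] by (simp add: op_class_mem)

text \<open>The first coordinate s does not enter the relations, so a class only depends on j, the
  weight and the shift.\<close>

lemma ru_class_eq: "s \<le> 0 \<Longrightarrow> ru_class p (s, j) (s - int v, j + d + int v) f = op_class j v d f"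
  using ru_ideal_eq[of s j v "shift_deg v d"] by (simp add: ru_class_def op_class_def algebra_simps)

lemma ru_class_pow: "ru_class p (0, j) (pow_target (j + d) v) f = op_class j v d f"
  using ru_class_eq[of 0 j v d f] by simp

lemma ru_free_pow: "ru_free p (0, j) (pow_target (j + d) v) = {f. supp f \<subseteq> op_words j v d}"
  unfolding ru_free_def ru_path_iff[OF order.refl] path_words_def graded_words_def using path_ok_lists by fastforce

lemma power_ring_eq: "power_ring p (j + d) j v = op_class j v d ` {f. supp f \<subseteq> op_words j v d}"
  unfolding power_ring_def ru_hom_def ru_free_pow by (simp add: ru_class_pow)

lemma suspension_op_class: "suspension p v d j (op_class j v d f) = op_class (j + 1) v d f"
proof -
  have "(\<Union>g\<in>op_class j v d f. op_class (j + 1) v d g) = op_class (j + 1) v d f"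
    by (intro dl.Union_const[OF op_class_self] op_class_eqI) (assumption, linarith)
  then show ?thesis unfolding suspension_def same_word_def ru_class_pow .
qed

lemma suspension_iter_op_class: "suspension_iter p v d j m (op_class j v d f) = op_class (j + int m) v d f"
  by (induction m) (simp_all add: suspension_op_class ac_simps)

text \<open>A closed form of the stable class that refers to no chosen degree of the
  representative.\<close>

definition stab :: "nat \<Rightarrow> int \<Rightarrow> 'k dl_free \<Rightarrow> 'k stable_op"
  where "stab v d f = {(k, op_class k v d g) | k g. supp g \<subseteq> op_words k v d \<and> f - g \<in> dual_ideal v (shift_deg v d)}"

text \<open>Representatives agree after suspensions iff their difference lies in the ideal for some
  j, which means that it lies in the dual ideal.\<close>

lemma stable_class_eq: "stable_class p v d j (op_class j v d f) = stab v d f"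
proof (intro equalityI subsetI)
  fix z assume "z \<in> stable_class p v d j (op_class j v d f)"
  then obtain k g m n where z: "z = (k, op_class k v d g)" "supp g \<subseteq> op_words k v d" and mn: "j + int m = k + int n"
    "suspension_iter p v d j m (op_class j v d f) = suspension_iter p v d k n (op_class k v d g)"
    unfolding stable_class_def power_ring_eq by blast
  have "f - g \<in> ringoid_ideal (j + int m) v (shift_deg v d)" using mn(2) unfolding suspension_iter_op_class mn(1)[symmetric] op_class_eq .
  then show "z \<in> stab v d f" using z ringoid_ideal_subset unfolding stab_def by blast
next
  fix z assume "z \<in> stab v d f"
  then obtain k g where z: "z = (k, op_class k v d g)" "supp g \<subseteq> op_words k v d"
    and fg: "f - g \<in> dual_ideal v (shift_deg v d)" unfolding stab_def by blast
  obtain J where J: "\<forall>j\<ge>J. f - g \<in> ringoid_ideal j v (shift_deg v d)" using ringoid_ideal_eventually[OF fg] by blast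
  define N where "N = max J (max j k)"
  have "N \<ge> j" "N \<ge> k" and NJ: "N \<ge> J" unfolding N_def by linarith+
  then have N: "j + int (nat (N - j)) = N" "k + int (nat (N - k)) = N" by simp_all
  have "op_class N v d f = op_class N v d g" using J NJ by (simp add: op_class_eq)
  then have "suspension_iter p v d j (nat (N - j)) (op_class j v d f) = suspension_iter p v d k (nat (N - k)) (op_class k v d g)"
    unfolding suspension_iter_op_class N(1,2) .
  moreover have "j + int (nat (N - j)) = k + int (nat (N - k))" using N(1,2) by simp
  ultimately show "z \<in> stable_class p v d j (op_class j v d f)"
    unfolding stable_class_def z(1) power_ring_eq using z(2) by blast
qed

lemma stab_eqI: "f - g \<in> dual_ideal v (shift_deg v d) \<Longrightarrow> stab v d f = stab v d g"
proof -
  assume *: "f - g \<in> dual_ideal v (shift_deg v d)"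
  have "f - h \<in> dual_ideal v (shift_deg v d) \<longleftrightarrow> g - h \<in> dual_ideal v (shift_deg v d)" for h
    using dual_ideal_closed(2)[OF *, of "g - h"] dual_ideal_closed(3)[OF _ *, of "f - h"] by auto
  then show ?thesis by (simp add: stab_def)
qed

lemma stab_mem: "\<lbrakk>supp f \<subseteq> op_words j v d\<rbrakk> \<Longrightarrow> (j, op_class j v d f) \<in> stab v d f"
  using dual_ideal_closed(1) unfolding stab_def by force

lemma stab_eventually: "supp f \<subseteq> graded_words v (shift_deg v d) \<Longrightarrow> \<exists>J. \<forall>j\<ge>J. (j, op_class j v d f) \<in> stab v d f"
  using path_words_eventually stab_mem by meson

lemma stab_eq_iff:
  assumes "supp f \<subseteq> graded_words v (shift_deg v d)"
  shows "stab v d f = stab v d g \<longleftrightarrow> f - g \<in> dual_ideal v (shift_deg v d)"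
proof
  assume eq: "stab v d f = stab v d g"
  obtain j where "(j, op_class j v d f) \<in> stab v d g" using stab_eventually[OF assms] unfolding eq by blast
  then obtain h where h: "op_class j v d f = op_class j v d h" "g - h \<in> dual_ideal v (shift_deg v d)"
    unfolding stab_def by blast
  then have "f - h \<in> dual_ideal v (shift_deg v d)" using ringoid_ideal_subset by (auto simp: op_class_eq)
  then show "f - g \<in> dual_ideal v (shift_deg v d)" using dual_ideal_closed(3)[OF _ h(2), of "f - h"] by simp
qed (rule stab_eqI)

lemma Union_singleton: "\<lbrakk>x \<in> S; \<And>y. y \<in> S \<Longrightarrow> y = A\<rbrakk> \<Longrightarrow> \<Union>S = A"
  by auto

lemma stable_bcomp: "bcomp (stable_power_algebra p) v d = stab v d ` {f. supp f \<subseteq> graded_words v (shift_deg v d)}"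
proof (intro equalityI subsetI)
  fix z :: "'k stable_op" assume "z \<in> bcomp (stable_power_algebra p) v d"
  then obtain j f where "z = stable_class p v d j (op_class j v d f)" and f: "supp f \<subseteq> op_words j v d"
    unfolding stable_power_algebra_def bigraded_alg.simps power_ring_eq by blast
  then have "z = stab v d f" by (simp only: stable_class_eq)
  then show "z \<in> stab v d ` {f. supp f \<subseteq> graded_words v (shift_deg v d)}" using f path_words_subset by blast
next
  fix z assume "z \<in> stab v d ` {f. supp f \<subseteq> graded_words v (shift_deg v d)}"
  then obtain f where z: "z = stab v d f" and f: "supp f \<subseteq> graded_words v (shift_deg v d)" by blast
  obtain j where "\<forall>k\<ge>j. supp f \<subseteq> op_words k v d" using path_words_eventually[OF f] ..
  then have "supp f \<subseteq> op_words j v d" by simp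
  then have "op_class j v d f \<in> power_ring p (j + d) j v" unfolding power_ring_eq by blast
  moreover have "z = stable_class p v d j (op_class j v d f)" by (simp only: z stable_class_eq)
  ultimately show "z \<in> bcomp (stable_power_algebra p) v d"
    unfolding stable_power_algebra_def bigraded_alg.simps mem_Collect_eq by (intro exI conjI)
qed

lemma stable_bzero: "bzero (stable_power_algebra p) v d = stab v d 0"
  using ru_class_pow[of 0 v d 0] by (simp add: stable_power_algebra_def stable_class_eq)

lemma stable_bone: "bone (stable_power_algebra p) = stab 0 0 (sing [] 1)"
  using ru_class_pow[of 0 0 0 "sing [] 1"] by (simp add: stable_power_algebra_def stable_class_eq)

lemma ru_add_op_class:
  "ru_add p (0, j) (pow_target (j + d) v) (op_class j v d f) (op_class j v d g) = op_class j v d (f + g)"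
  unfolding ru_add_def ru_class_pow
proof (intro dl.Union_const[OF op_class_self])
  fix f' g' assume "f' \<in> op_class j v d f" "g' \<in> op_class j v d g"
  then show "op_class j v d (f' + g') = op_class j v d (f + g)"
    using ringoid_ideal_closed(2)[of "f' - f" j v "shift_deg v d" "g' - g"]
    by (simp add: op_class_eq op_class_mem algebra_simps)
qed

lemma ru_scale_op_class:
  "ru_scale p (0, j) (pow_target (j + d) v) c (op_class j v d f) = op_class j v d (pm_scale c f)"
  unfolding ru_scale_def ru_class_pow
proof (intro dl.Union_const[OF op_class_self])
  fix f' assume "f' \<in> op_class j v d f"
  then show "op_class j v d (pm_scale c f') = op_class j v d (pm_scale c f)"
    using ringoid_ideal_closed(4)[of "f' - f" j v "shift_deg v d" c]
    by (simp add: op_class_eq op_class_mem pm_scale_diff)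
qed

text \<open>The right factor ends in (-w, k + e + w), so the composition of the power ring suspends
  the left factor w times before juxtaposing.\<close>

lemma same_word_op_class:
  "same_word p (pow_target (k + e) w) (- int v - int w, k + e + d + int v + int w) (op_class (k + e) v d f)
    = op_class (k + e + int w) v d f"
proof -
  have "ru_class p (pow_target (k + e) w) (- int v - int w, k + e + d + int v + int w) g = op_class (k + e + int w) v d g" (is "ru_class p _ (?s, ?j) g = _") for g
  proof -
    have "?s = - int w - int v" "?j = k + e + int w + d + int v" by simp_all
    then show ?thesis using ru_class_eq[of "- int w" "k + e + int w" v d g] by (simp only:)
  qed
  moreover have "(\<Union>g\<in>op_class (k + e) v d f. op_class (k + e + int w) v d g) = op_class (k + e + int w) v d f"
    by (intro dl.Union_const[OF op_class_self] op_class_eqI) (assumption, linarith)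
  ultimately show ?thesis unfolding same_word_def by simp
qed

lemma power_comp_op_class:
  assumes f: "supp f \<subseteq> op_words (k + e) v d" and g: "supp g \<subseteq> op_words k w e"
  shows "power_comp p (k + e + d) v (k + e) w k (op_class (k + e) v d f) (op_class k w e g)
    = op_class k (v + w) (d + e) (word_mult f g)"
proof -
  have target: "pow_target (k + e + d) (v + w) = pow_target (k + (d + e)) (v + w)" by simp
  show ?thesis
    unfolding power_comp_def same_word_op_class ru_comp_def target ru_class_pow
  proof (intro dl.Union_const[OF op_class_self])
    fix f' g' assume f': "f' \<in> op_class (k + e + int w) v d f" and g': "g' \<in> op_class k w e g"
    have j: "k - shift_deg w e = k + e + int w" by simp
    have s: "shift_deg v d + shift_deg w e = shift_deg (v + w) (d + e)" by simp
    \<comment> \<open>Again f' g' - f g = (f' - f) g' + f (g' - g), now with ideals of the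
      ringoid.\<close>
    have "word_mult (f' - f) g' \<in> ringoid_ideal k (v + w) (shift_deg v d + shift_deg w e)"
      using f' op_class_supp[OF g' g] by (intro ringoid_ideal_mult_right) (simp_all add: j op_class_mem)
    moreover have "word_mult f (g' - g) \<in> ringoid_ideal k (v + w) (shift_deg v d + shift_deg w e)"
      using g' f path_words_mono[of "k + e" "k + e + int w"]
      by (intro ringoid_ideal_mult_left) (auto simp: j op_class_mem)
    ultimately have "word_mult (f' - f) g' + word_mult f (g' - g) \<in> ringoid_ideal k (v + w) (shift_deg v d + shift_deg w e)"
      by (rule ringoid_ideal_closed(2))
    then show "op_class k (v + w) (d + e) (word_mult f' g') = op_class k (v + w) (d + e) (word_mult f g)"
      unfolding op_class_eq s[symmetric] by (simp add: word_mult_diff_left word_mult_diff_right)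
  qed
qed

lemma stab_elim:
  assumes "(k, X) \<in> stab v d f"
  obtains g where "X = op_class k v d g" "supp g \<subseteq> op_words k v d" "f - g \<in> dual_ideal v (shift_deg v d)"
  using assms unfolding stab_def by blast

lemma stable_badd:
  assumes f: "supp f \<subseteq> graded_words v (shift_deg v d)" and g: "supp g \<subseteq> graded_words v (shift_deg v d)"
  shows "badd (stable_power_algebra p) v d (stab v d f) (stab v d g) = stab v d (f + g)"
proof -
  obtain J J' where "\<forall>j\<ge>J. (j, op_class j v d f) \<in> stab v d f" "\<forall>j\<ge>J'. (j, op_class j v d g) \<in> stab v d g"
    using stab_eventually[OF f] stab_eventually[OF g] by blast
  then have m: "(max J J', op_class (max J J') v d f) \<in> stab v d f" "(max J J', op_class (max J J') v d g) \<in> stab v d g" by simp_all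
  have "stable_class p v d j (ru_add p (0, j) (pow_target (j + d) v) X Y) = stab v d (f + g)"
    if X: "(j, X) \<in> stab v d f" and Y: "(j, Y) \<in> stab v d g" for j X Y
  proof -
    obtain f' where f': "X = op_class j v d f'" "f - f' \<in> dual_ideal v (shift_deg v d)" using stab_elim[OF X] .
    obtain g' where g': "Y = op_class j v d g'" "g - g' \<in> dual_ideal v (shift_deg v d)" using stab_elim[OF Y] .
    have "f + g - (f' + g') \<in> dual_ideal v (shift_deg v d)"
      using dual_ideal_closed(2)[OF f'(2) g'(2)] by (simp add: algebra_simps)
    then show ?thesis unfolding f'(1) g'(1) ru_add_op_class stable_class_eq by (rule stab_eqI[symmetric])
  qed
  then show ?thesis unfolding stable_power_algebra_def bigraded_alg.simps
    using m by (intro Union_singleton) blast+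
qed

lemma stable_bscale:
  assumes f: "supp f \<subseteq> graded_words v (shift_deg v d)"
  shows "bscale (stable_power_algebra p) v d c (stab v d f) = stab v d (pm_scale c f)"
proof -
  obtain j where m: "(j, op_class j v d f) \<in> stab v d f" using stab_eventually[OF f] by blast
  have "stable_class p v d j (ru_scale p (0, j) (pow_target (j + d) v) c X) = stab v d (pm_scale c f)"
    if X: "(j, X) \<in> stab v d f" for j X
  proof -
    obtain f' where f': "X = op_class j v d f'" "f - f' \<in> dual_ideal v (shift_deg v d)" using stab_elim[OF X] .
    have "pm_scale c f - pm_scale c f' \<in> dual_ideal v (shift_deg v d)"
      using dual_ideal_closed(4)[OF f'(2), of c] by (simp add: pm_scale_diff)
    then show ?thesis unfolding f'(1) ru_scale_op_class stable_class_eq by (rule stab_eqI[symmetric])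
  qed
  then show ?thesis unfolding stable_power_algebra_def bigraded_alg.simps
    using m by (intro Union_singleton) blast+
qed

lemma stable_bmult:
  assumes f: "supp f \<subseteq> graded_words v (shift_deg v d)" and g: "supp g \<subseteq> graded_words w (shift_deg w e)"
  shows "bmult (stable_power_algebra p) v d w e (stab v d f) (stab w e g) = stab (v + w) (d + e) (word_mult f g)"
proof -
  obtain J J' where "\<forall>j\<ge>J. (j, op_class j v d f) \<in> stab v d f" "\<forall>j\<ge>J'. (j, op_class j w e g) \<in> stab w e g"
    using stab_eventually[OF f] stab_eventually[OF g] by blast
  \<comment> \<open>The source k has to be at least J' for the right factor, and k + e at least J
    for the left one.\<close>
  then have m: "(max (J - e) J' + e, op_class (max (J - e) J' + e) v d f) \<in> stab v d f"
    "(max (J - e) J', op_class (max (J - e) J') w e g) \<in> stab w e g" by simp_all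
  have "stable_class p (v + w) (d + e) k (power_comp p (k + e + d) v (k + e) w k X Y) = stab (v + w) (d + e) (word_mult f g)"
    if X: "(k + e, X) \<in> stab v d f" and Y: "(k, Y) \<in> stab w e g" for k X Y
  proof -
    obtain f' where f': "X = op_class (k + e) v d f'" "supp f' \<subseteq> op_words (k + e) v d" "f - f' \<in> dual_ideal v (shift_deg v d)"
      using stab_elim[OF X] .
    obtain g' where g': "Y = op_class k w e g'" "supp g' \<subseteq> op_words k w e" "g - g' \<in> dual_ideal w (shift_deg w e)"
      using stab_elim[OF Y] .
    have s: "shift_deg v d + shift_deg w e = shift_deg (v + w) (d + e)" by simp
    have f's: "supp f' \<subseteq> graded_words v (shift_deg v d)" using f'(2) path_words_subset by blast
    have "word_mult (f - f') g + word_mult f' (g - g') \<in> dual_ideal (v + w) (shift_deg v d + shift_deg w e)"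
      using dual_ideal_mult_right[OF f'(3) g] dual_ideal_mult_left[OF g'(3) f's] by (rule dual_ideal_closed(2))
    then have "word_mult f g - word_mult f' g' \<in> dual_ideal (v + w) (shift_deg (v + w) (d + e))"
      unfolding s by (simp add: word_mult_diff_left word_mult_diff_right)
    then show ?thesis
      unfolding f'(1) g'(1) power_comp_op_class[OF f'(2) g'(2)] stable_class_eq by (rule stab_eqI[symmetric])
  qed
  then show ?thesis unfolding stable_power_algebra_def bigraded_alg.simps
    using m by (intro Union_singleton) blast+
qed

lemma bigraded_stable: "bigraded_algebra (stable_power_algebra p :: ('k, 'k stable_op) bigraded_alg)"
proof (rule bigraded_algebra_presented[where \<pi> = stab and W = "\<lambda>v d. graded_words v (shift_deg v d)"])
  fix v d w e u z assume "u \<in> graded_words v (shift_deg v d)" "z \<in> graded_words w (shift_deg w e)"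
  then have "u @ z \<in> graded_words (v + w) (shift_deg v d + shift_deg w e)" by (rule graded_words_append)
  moreover have "shift_deg v d + shift_deg w e = shift_deg (v + w) (d + e)" by simp
  ultimately show "u @ z \<in> graded_words (v + w) (shift_deg (v + w) (d + e))" by simp
qed (auto simp: stable_bcomp stable_bzero stable_bone stable_badd stable_bscale stable_bmult graded_words_def)

section \<open>The comparison isomorphism\<close>

lemma koszul_dual_add: "\<lbrakk>supp x \<subseteq> graded_words s t; supp y \<subseteq> graded_words s t\<rbrakk> \<Longrightarrow>
    badd (koszul_dual p) s t (ext s t (dual_of x)) (ext s t (dual_of y)) = ext s t (dual_of (x + y))"
  by (simp add: koszul_dual_simps dl.ext_badd dual_of_cocycle dual_of_simps)

lemma koszul_dual_scale: "supp x \<subseteq> graded_words s t \<Longrightarrow>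
    bscale (koszul_dual p) s t c (ext s t (dual_of x)) = ext s t (dual_of (pm_scale c x))"
  by (simp add: koszul_dual_simps dl.ext_bscale dual_of_cocycle dual_of_simps)

lemma koszul_dual_one: "bone (koszul_dual p) = ext 0 0 (dual_of (sing [] 1))"
proof -
  have "dual_of (sing [] 1) = (\<lambda>xs. if xs = [] then 1 else 0)" by (auto simp: dual_of_simps)
  then show ?thesis by (simp only: koszul_dual_simps)
qed

lemma koszul_dual_mult: "\<lbrakk>supp x \<subseteq> graded_words s t; supp y \<subseteq> graded_words s' t'\<rbrakk> \<Longrightarrow>
    bmult (koszul_dual p) s t s' t' (ext s t (dual_of x)) (ext s' t' (dual_of y)) = ext (s + s') (t + t') (dual_of (word_mult x y))"
  by (simp add: koszul_dual_simps dl.ext_bmult dual_of_cocycle dual_of_word_mult)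

lemma bigraded_koszul_dual: "bigraded_algebra (koszul_dual p :: ('k, ('k dl_free set list \<Rightarrow> 'k) set) bigraded_alg)"
proof (rule bigraded_algebra_presented[where \<pi> = "\<lambda>s t x. ext s t (dual_of x)" and W = graded_words])
  show "bzero (koszul_dual p) s t = ext s t (dual_of 0)" for s t by (simp add: koszul_dual_simps dual_of_simps)
qed (auto simp: koszul_dual_comp koszul_dual_add koszul_dual_scale koszul_dual_one koszul_dual_mult graded_words_def word_deg_append)

text \<open>Independence of the chosen representative is part of
  \<open>comparison_stab\<close>.\<close>

definition comparison :: "nat \<Rightarrow> int \<Rightarrow> 'k stable_op \<Rightarrow> ('k dl_free set list \<Rightarrow> 'k) set"
  where "comparison v d X = ext v (shift_deg v d)
    (dual_of (SOME x. supp x \<subseteq> graded_words v (shift_deg v d) \<and> X = stab v d x))"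

lemma ext_dual_of_eq_iff: "\<lbrakk>supp x \<subseteq> graded_words s t; supp y \<subseteq> graded_words s t\<rbrakk> \<Longrightarrow>
    ext s t (dual_of x) = ext s t (dual_of y) \<longleftrightarrow> x - y \<in> dual_ideal s t"
  using dual_of_kernel[of "x - y" s t] supp_diff_subset[of x "graded_words s t" y]
  by (simp add: dl.ext_class_eq_iff dual_of_cocycle dual_of_simps)

lemma comparison_stab:
  assumes "supp x \<subseteq> graded_words v (shift_deg v d)"
  shows "comparison v d (stab v d x) = ext v (shift_deg v d) (dual_of x)"
proof -
  define y where "y = (SOME y. supp y \<subseteq> graded_words v (shift_deg v d) \<and> stab v d x = stab v d y)"
  have "supp y \<subseteq> graded_words v (shift_deg v d) \<and> stab v d x = stab v d y"
    unfolding y_def by (rule someI[of _ x]) (simp add: assms)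
  then have "ext v (shift_deg v d) (dual_of x) = ext v (shift_deg v d) (dual_of y)"
    using assms stab_eq_iff[OF assms, of y] by (simp add: ext_dual_of_eq_iff)
  then show ?thesis by (simp add: comparison_def y_def)
qed

text \<open>The regrading comes from the targets in the power ring: a word of length v that leads
  from (0, j) to (-v, j + d + v) has degree -d - v.\<close>

lemma comparison_iso:
  "bigraded_algebra_iso (\<lambda>v d. - d - int v) (stable_power_algebra p) (koszul_dual p) comparison"
proof -
  let ?W = "\<lambda>v d. {x. supp x \<subseteq> graded_words v (shift_deg v d)}"
  have bij1: "bij (\<lambda>d. - d - int v)" for v
    by (rule bij_betw_byWitness[where f' = "\<lambda>d. - d - int v"]) auto
  have bij2: "bij_betw (comparison v d) (bcomp (stable_power_algebra p) v d) (bcomp (koszul_dual p) v (shift_deg v d))" for v d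
    unfolding stable_bcomp koszul_dual_comp
  proof (rule bij_betw_imageI)
    \<comment> \<open>Equality of stable classes and equality of Ext classes are the same condition:
      the difference of representatives lies in \<open>dual_ideal\<close>.\<close>
    show "inj_on (comparison v d) (stab v d ` ?W v d)"
      by (rule inj_onI) (elim imageE, simp add: comparison_stab ext_dual_of_eq_iff stab_eq_iff)
    show "comparison v d ` stab v d ` ?W v d = (\<lambda>x. ext v (shift_deg v d) (dual_of x)) ` ?W v d"
      unfolding image_image by (rule image_cong) (simp_all add: comparison_stab)
  qed
  have add: "comparison v d (badd (stable_power_algebra p) v d X Y)
      = badd (koszul_dual p) v (shift_deg v d) (comparison v d X) (comparison v d Y)"
    if "X \<in> bcomp (stable_power_algebra p) v d" "Y \<in> bcomp (stable_power_algebra p) v d" for v d X Y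
    using that unfolding stable_bcomp
    by (auto simp: stable_badd koszul_dual_add comparison_stab supp_add_subset)
  have scale: "comparison v d (bscale (stable_power_algebra p) v d c X)
      = bscale (koszul_dual p) v (shift_deg v d) c (comparison v d X)"
    if "X \<in> bcomp (stable_power_algebra p) v d" for v d c X
    using that unfolding stable_bcomp
    by (auto simp: stable_bscale koszul_dual_scale comparison_stab order.trans[OF supp_pm_scale])
  have one: "comparison 0 0 (bone (stable_power_algebra p)) = bone (koszul_dual p)"
    using comparison_stab[of "sing [] 1" 0 0] by (simp add: stable_bone koszul_dual_one graded_words_def)
  have mult: "comparison (v + w) (d + e) (bmult (stable_power_algebra p) v d w e X Y)
      = bmult (koszul_dual p) v (shift_deg v d) w (shift_deg w e) (comparison v d X) (comparison w e Y)"
    if "X \<in> bcomp (stable_power_algebra p) v d" "Y \<in> bcomp (stable_power_algebra p) w e" for v d w e X Y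
  proof -
    obtain x y where xy: "X = stab v d x" "supp x \<subseteq> graded_words v (shift_deg v d)"
      "Y = stab w e y" "supp y \<subseteq> graded_words w (shift_deg w e)" using \<open>X \<in> _\<close> \<open>Y \<in> _\<close> unfolding stable_bcomp by blast
    have s: "shift_deg v d + shift_deg w e = shift_deg (v + w) (d + e)" by simp
    show ?thesis
      using supp_word_mult_graded[OF xy(2,4)] xy
      unfolding s by (simp only: stable_bmult comparison_stab koszul_dual_mult s)
  qed
  show ?thesis
    unfolding bigraded_algebra_iso_def
    using bigraded_stable bigraded_koszul_dual bij1 bij2 add scale one mult by auto
qed

lemma comparison_gen:
  assumes "g \<in> dl_gens p"
  shows "comparison 1 (- dl_deg p g - 1) (stable_gen p g) = dl_dual_class p g"
proof -
  define d where "d = - dl_deg p g - 1"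
  have "stable_gen p g = stab 1 d (sing [g] 1)"
    unfolding stable_gen_def Let_def d_def[symmetric] ru_class_pow stable_class_eq ..
  moreover have "comparison 1 d (stab 1 d (sing [g] 1)) = ext 1 (shift_deg 1 d) (dual_of (sing [g] 1))"
    using assms by (intro comparison_stab) (simp add: graded_words_def d_def word_deg_simps)
  moreover have "dual_of (sing [g] 1) = dl_dual p g" by (simp add: dual_of_simps dual_word_single del: dual_word.simps)
  ultimately show ?thesis by (simp add: dl_dual_class_def d_def)
qed

end

text \<open>The second conjunct says that the generated subalgebra is dense in Ext for pointwise
  convergence of cocycles, which ties the Koszul dual to the full Ext groups.\<close>

theorem corollary6p9:
  fixes p :: nat
  assumes "prime p" and "CARD('k::field) = p"
  shows "(\<exists>\<Phi>. bigraded_algebra_iso (\<lambda>v d. - d - int v)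
             (stable_power_algebra p :: ('k, 'k stable_op) bigraded_alg) (koszul_dual p) \<Phi> \<and>
           (\<forall>g\<in>dl_gens p. \<Phi> 1 (- dl_deg p g - 1) (stable_gen p g) = dl_dual_class p g)) \<and>
    (\<forall>s t. \<forall>f \<in> ext_cocycles (dyer_lashof p) s t. \<forall>F. finite F \<longrightarrow>
       (\<exists>g \<in> ext_cocycles (dyer_lashof p) s t.
          ext_class (dyer_lashof p) s t g \<in> bcomp (koszul_dual p :: ('k, _) bigraded_alg) s t \<and>
          (\<forall>xs\<in>F. g xs = f xs)))"
proof -
  interpret prime_field p "TYPE('k)" by unfold_locales (use assms in auto)
  show ?thesis using comparison_iso comparison_gen koszul_dual_dense by blast
qed

end
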